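(* For all $\epsilon\in(0,1]$, $\delta\in(0,1/2]$, $\alpha\in(0,1/2]$, there exists an $\alpha$-accurate $(\epsilon,\delta)$-differentially private sampler for the class $\mathcal{D}^{\mathsf{N}}=\{\mathsf{N}(\mu,\Sigma)\mid\mu\in\mathbb{R}^d,\ \Sigma\in\mathbb{R}^{d\times d}\}$ of all $d$-dimensional Gaussians (with $\mu,\Sigma$ unknown and no further assumption) with sample complexity $$O\left(\frac{d^2}{\epsilon}\,\mathrm{polylog}\left(\frac{d}{\alpha\epsilon\delta}\right)\right).$$
   Context: $\mathsf{N}(\mu,\Sigma)$ is the Gaussian with mean $\mu$ and covariance $\Sigma$ (density proportional to $\exp(-\frac12(x-\mu)^T\Sigma^{-1}(x-\mu))$, so $\Sigma$ is positive definite). A sampler with sample complexity $n$ for a class $\mathcal{D}$ is an algorithm $\mathcal{A}$ that receives $n$ i.i.d. samples $\mathbf{X}\sim D^n$ from an unknown $D\in\mathcal{D}$ and outputs one element of the domain; with $Q_{\mathcal{A},D}$ the distribution of $\mathcal{A}(\mathbf{X})$, it is $\alpha$-accurate if $d_{\mathrm{tv}}(D,Q_{\mathcal{A},D})\le\alpha$ for all $D\in\mathcal{D}$. Datasets are neighbors if they have the same size and differ in one element. $\mathcal{M}$ is $(\epsilon,\delta)$-DP if for all neighbors $Y,Y'$ and all output sets $S$, $\Pr[\mathcal{M}(Y)\in S]\le e^\epsilon\Pr[\mathcal{M}(Y')\in S]+\delta$. $\mathrm{polylog}(x)$ is a quantity bounded by a polynomial in $\log x$. *)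

theory Defs
  imports
    "HOL-Probability.Probability"
    "HOL-Computational_Algebra.Polynomial"
    "Jordan_Normal_Form.Gauss_Jordan_Elimination"
    "Jordan_Normal_Form.Determinant"
begin

section \<open>Private samplers\<close>

text \<open>
  A dataset of size \<open>n\<close> over a measurable domain \<open>X\<close> is an ordered \<open>n\<close>-tuple, i.e. a point of
  \<open>PiM {..<n} (\<lambda>_. X)\<close>. A randomized algorithm which outputs one element of \<open>X\<close> is a Markov kernel
  from datasets to \<open>X\<close>.
\<close>

abbreviation datasets :: "'a measure \<Rightarrow> nat \<Rightarrow> (nat \<Rightarrow> 'a) measure" where
  "datasets X n \<equiv> PiM {..<n} (\<lambda>_. X)"

definition sampler :: "'a measure \<Rightarrow> nat \<Rightarrow> ((nat \<Rightarrow> 'a) \<Rightarrow> 'a measure) \<Rightarrow> bool" where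
  "sampler X n A \<longleftrightarrow> A \<in> datasets X n \<rightarrow>\<^sub>M prob_algebra X"

definition neighbors :: "nat \<Rightarrow> (nat \<Rightarrow> 'a) \<Rightarrow> (nat \<Rightarrow> 'a) \<Rightarrow> bool" where
  "neighbors n Y Y' \<longleftrightarrow> card {i \<in> {..<n}. Y i \<noteq> Y' i} = 1"

definition differentially_private ::
  "real \<Rightarrow> real \<Rightarrow> 'a measure \<Rightarrow> nat \<Rightarrow> ((nat \<Rightarrow> 'a) \<Rightarrow> 'a measure) \<Rightarrow> bool" where
  "differentially_private \<epsilon> \<delta> X n A \<longleftrightarrow>
     (\<forall>Y \<in> space (datasets X n). \<forall>Y' \<in> space (datasets X n). neighbors n Y Y' \<longrightarrow>
        (\<forall>S \<in> sets X. measure (A Y) S \<le> exp \<epsilon> * measure (A Y') S + \<delta>))"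

definition tv_dist :: "'a measure \<Rightarrow> 'a measure \<Rightarrow> real" where
  "tv_dist P Q = (SUP S \<in> sets P. \<bar>measure P S - measure Q S\<bar>)"

text \<open>
  The law of the output when the input is \<open>n\<close> i.i.d. samples from \<open>D\<close>, over the randomness of both
  the samples and the algorithm.
\<close>

definition output_dist :: "nat \<Rightarrow> ((nat \<Rightarrow> 'a) \<Rightarrow> 'a measure) \<Rightarrow> 'a measure \<Rightarrow> 'a measure" where
  "output_dist n A D = Giry_Monad.bind (PiM {..<n} (\<lambda>_. D)) A"

definition accurate ::
  "real \<Rightarrow> 'a measure set \<Rightarrow> nat \<Rightarrow> ((nat \<Rightarrow> 'a) \<Rightarrow> 'a measure) \<Rightarrow> bool" where
  "accurate \<alpha> \<D> n A \<longleftrightarrow> (\<forall>D \<in> \<D>. tv_dist D (output_dist n A D) \<le> \<alpha>)"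

section \<open>Gaussians on \<open>\<real>\<^sup>d\<close>\<close>

text \<open>
  As the dimension \<open>d\<close> has to be quantified inside statements, it is a natural number and not a
  type: points of \<open>\<real>\<^sup>d\<close> are functions in the extensional product over \<open>{..<d}\<close>, carrying Lebesgue
  measure on the Borel sets. Means and covariances are vectors and matrices with explicit
  dimension; \<open>Matrix.vec d x\<close> turns a point into a vector.
\<close>

definition lborel_dim :: "nat \<Rightarrow> (nat \<Rightarrow> real) measure" where
  "lborel_dim d = PiM {..<d} (\<lambda>_. lborel)"

definition positive_definite :: "nat \<Rightarrow> real mat \<Rightarrow> bool" where
  "positive_definite d \<Sigma> \<longleftrightarrow> \<Sigma> \<in> carrier_mat d d \<and> transpose_mat \<Sigma> = \<Sigma> \<and>
     (\<forall>v \<in> carrier_vec d. v \<noteq> 0\<^sub>v d \<longrightarrow> scalar_prod v (\<Sigma> *\<^sub>v v) > 0)"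

text \<open>
  The unnormalised density. The option-valued \<open>mat_inverse\<close> is \<open>Some\<close> of the two-sided inverse
  for every positive definite \<open>\<Sigma>\<close>, as shown below.
\<close>

definition gaussian_weight ::
  "nat \<Rightarrow> real Matrix.vec \<Rightarrow> real mat \<Rightarrow> (nat \<Rightarrow> real) \<Rightarrow> real" where
  "gaussian_weight d \<mu> \<Sigma> x =
     (let v = Matrix.vec d x - \<mu> in exp (- (scalar_prod v (the (mat_inverse \<Sigma>) *\<^sub>v v)) / 2))"

definition gaussian :: "nat \<Rightarrow> real Matrix.vec \<Rightarrow> real mat \<Rightarrow> (nat \<Rightarrow> real) measure" where
  "gaussian d \<mu> \<Sigma> = density (lborel_dim d)
     (\<lambda>x. ennreal (gaussian_weight d \<mu> \<Sigma> x / (\<integral>y. gaussian_weight d \<mu> \<Sigma> y \<partial>lborel_dim d)))"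

definition gaussians :: "nat \<Rightarrow> (nat \<Rightarrow> real) measure set" where
  "gaussians d = {gaussian d \<mu> \<Sigma> | \<mu> \<Sigma>. \<mu> \<in> carrier_vec d \<and> positive_definite d \<Sigma>}"

lemma positive_definite_mat_inverse:
  assumes "positive_definite d \<Sigma>"
  obtains B where "mat_inverse \<Sigma> = Some B" "B \<in> carrier_mat d d"
    "\<Sigma> * B = 1\<^sub>m d" "B * \<Sigma> = 1\<^sub>m d"
proof -
  have S: "\<Sigma> \<in> carrier_mat d d"
    using assms by (simp add: positive_definite_def)
  have "Determinant.det \<Sigma> \<noteq> 0"
  proof
    assume "Determinant.det \<Sigma> = 0"
    then obtain v where v: "v \<in> carrier_vec d" "v \<noteq> 0\<^sub>v d" "\<Sigma> *\<^sub>v v = 0\<^sub>v d"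
      using det_0_iff_vec_prod_zero_field[OF S] by auto
    then have "scalar_prod v (\<Sigma> *\<^sub>v v) = 0"
      by simp
    with v assms show False
      by (force simp: positive_definite_def)
  qed
  then have "\<Sigma> \<in> Units (ring_mat TYPE(real) d ())"
    using det_non_zero_imp_unit[OF S] by simp
  then have "mat_inverse \<Sigma> \<noteq> None"
    using mat_inverse(1)[OF S, where b = "()"] by auto
  then obtain B where "mat_inverse \<Sigma> = Some B"
    by auto
  with mat_inverse(2)[OF S this] that show thesis
    by blast
qed

end

theory Submission
  imports Defs
begin

text \<open>
  A Gaussian sample can be produced from Gaussian data without estimating the parameters. Take a
  block of \<open>2 b\<close> points with \<open>b = d + 2 c\<close> of order \<open>d\<^sup>2\<close> up to logarithms, let \<open>V\<close> be its mean and
  \<open>Z\<^sub>i = (X\<^sub>i - X\<^sub>b\<^sub>+\<^sub>i) / sqrt 2\<close>, draw a standard Gaussian \<open>h\<close> and output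
  \<open>V + sqrt (1 - 1 / (2 b)) \<Sum>\<^sub>i (h\<^sub>i / |h|) Z\<^sub>i\<close>. This is a combination of the data whose coefficients \<open>a\<close>
  satisfy \<open>\<Sum> a = \<Sum> a\<^sup>2 = 1\<close>, so over random data the output has exactly the right law.

  Conversely, for fixed typical data the output law is within a constant factor (and a small additive
  error) of a fixed Gaussian. By affine equivariance it suffices to see this for standard Gaussian
  data. The uniform point \<open>h / |h|\<close> of the sphere is projected to a vector with density proportional to
  \<open>(1 - w\<^sup>T S\<^sup>-\<^sup>1 w)\<^sup>c\<^sup>-\<^sup>1\<close>, \<open>S = Z\<^sup>T Z\<close>, and as \<open>S\<close> is close to \<open>b\<close> times the identity this is
  comparable to \<open>exp (- |w|\<^sup>2 / 2)\<close> outside a set of small mass. The quadratic form is controlled at a typical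
  \<open>w\<close> only, not uniformly; therefore \<open>d\<^sup>2\<close> points are enough.

  So the output laws of \<open>k\<close> blocks are pairwise compatible up to a constant factor \<open>K\<close>. For privacy,
  weight each block by the excess over \<open>1/2\<close> of the fraction of blocks compatible with it, and sample from the
  weighted mean of the laws. Two blocks of positive weight share a compatible block, hence no law in the mean
  exceeds the mean itself by more than a factor \<open>K\<^sup>2\<close>, and changing one block changes the mean by a factor
  \<open>1 + O(K\<^sup>2 / k)\<close>. A sigmoid of the total weight switches smoothly to a constant output when few blocks agree.
  Thus \<open>k\<close> of order \<open>1 / \<epsilon>\<close> up to logarithms suffices.
\<close>

section \<open>Gaussian product measures\<close>

text \<open>Why d^2: the deviation E of the empirical covariance enters through w^T E w at points
  with |w|^2 of order d. A bound uniform in w needs operator norm about 1 / d, which takes about d^3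
  points. For w independent of the data the form is only about |w|^2 / sqrt b, bounded once b is of
  order d^2. But the output of a block depends on the block. So exceptional points are first
  measured under the fixed Gaussian, where w is independent of the data and Fubini applies; carrying
  the weight exp (w^T E w / 2) along then pays for the passage back to the law of the block
  (\<open>excess_mass\<close>). Only E \<ge> - I / 2 is asked for uniformly, and entrywise estimates
  give it.

  b - d is even so that the density of the projected sphere has an integral exponent. The Jacobian
  and the normalising constant of that density are never evaluated: total mass fixes or bounds them.

  Typical data satisfy the comparison on all measurable sets, although the algorithm tests only
  countably many. That allows the passage from general to standard Gaussian data, since an affine
  map need not preserve the test family.\<close>

lemma indep_vars_PiM_components:
  assumes M: "\<And>k. k \<in> K \<Longrightarrow> prob_space (M k)"
  shows "prob_space.indep_vars (PiM K M) M (\<lambda>i \<omega>. \<omega> i) K"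
proof -
  interpret prob_space "PiM K M" using M by (rule prob_space_PiM)
  show ?thesis
  proof (cases "K = {}")
    case True then show ?thesis unfolding indep_vars_def indep_sets_def by auto
  next
    case False
    have "distr (PiM K M) (PiM K M) (\<lambda>x. \<lambda>i\<in>K. x i) = distr (PiM K M) (PiM K M) (\<lambda>x. x)"
      by (intro distr_cong) (auto simp: space_PiM PiE_restrict restrict_PiE_iff PiE_iff extensional_restrict)
    also have "\<dots> = PiM K M" by (rule distr_id)
    also have "\<dots> = PiM K (\<lambda>i. distr (PiM K M) (M i) (\<lambda>x. x i))"
      using M by (intro PiM_cong) (auto simp: distr_PiM_component)
    finally show ?thesis
      by (subst indep_vars_iff_distr_eq_PiM'[OF False]) auto
  qed
qed

text \<open>Functions of disjoint groups of coordinates are independent, so their joint law factors.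
  It serves to regroup indices: rows against columns of a random matrix, and the pairing of point i
  with point b + i.\<close>

lemma distr_PiM_groups:
  assumes M: "\<And>k. k \<in> K \<Longrightarrow> prob_space (M k)"
    and G: "\<And>j. j \<in> J \<Longrightarrow> G j \<subseteq> K" "disjoint_family_on G J"
    and f: "\<And>j. j \<in> J \<Longrightarrow> f j \<in> PiM (G j) M \<rightarrow>\<^sub>M N j"
  shows "distr (PiM K M) (PiM J N) (\<lambda>\<omega>. \<lambda>j\<in>J. f j (restrict \<omega> (G j))) =
    PiM J (\<lambda>j. distr (PiM (G j) M) (N j) (f j))"
proof (cases "J = {}")
  case True
  then show ?thesis
  proof -
    interpret prob_space "PiM K M" using M by (rule prob_space_PiM)
    have "distr (PiM K M) (PiM {} N) (\<lambda>\<omega>. \<lambda>j\<in>{}. f j (restrict \<omega> (G j))) = PiM {} (\<lambda>j. distr (PiM (G j) M) (N j) (f j))"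
      proof (rule measure_eqI)
      fix A assume "A \<in> sets (distr (PiM K M) (PiM {} N) (\<lambda>\<omega>. \<lambda>j\<in>{}. f j (restrict \<omega> (G j))))"
      then have "A = {} \<or> A = {\<lambda>_. undefined}" by (auto simp: sets_PiM_empty)
      then show "emeasure (distr (PiM K M) (PiM {} N) (\<lambda>\<omega>. \<lambda>j\<in>{}. f j (restrict \<omega> (G j)))) A =
        emeasure (PiM {} (\<lambda>j. distr (PiM (G j) M) (N j) (f j))) A"
        by (auto simp: emeasure_distr sets_PiM_empty PiM_empty emeasure_space_1 restrict_def measurable_count_space_eq2)
    qed (simp add: sets_PiM_empty)
    then show ?thesis using True by simp
  qed
next
  case False
  interpret prob_space "PiM K M" using M by (rule prob_space_PiM)
  have ind: "indep_vars M (\<lambda>i \<omega>. \<omega> i) K"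
    using M by (intro indep_vars_PiM_components)
  have 1: "indep_vars (\<lambda>j. PiM (G j) M) (\<lambda>j \<omega>. restrict (\<lambda>i. \<omega> i) (G j)) J"
    by (rule indep_vars_restrict[OF ind G])
  have 2: "indep_vars N (\<lambda>j \<omega>. f j (restrict \<omega> (G j))) J"
    using indep_vars_compose[OF 1 f] by (simp add: comp_def)
  have rv: "\<And>j. j \<in> J \<Longrightarrow> (\<lambda>\<omega>. f j (restrict \<omega> (G j))) \<in> PiM K M \<rightarrow>\<^sub>M N j"
    using 2 by (simp add: indep_vars_def2)
  have m: "j \<in> J \<Longrightarrow> (\<lambda>\<omega>. restrict \<omega> (G j)) \<in> PiM K M \<rightarrow>\<^sub>M PiM (G j) M" for j
    using G(1) by (intro measurable_restrict_subset)
  have "distr (PiM K M) (PiM J N) (\<lambda>\<omega>. \<lambda>j\<in>J. f j (restrict \<omega> (G j))) =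
     PiM J (\<lambda>j. distr (PiM K M) (N j) (\<lambda>\<omega>. f j (restrict \<omega> (G j))))"
    using 2 indep_vars_iff_distr_eq_PiM'[OF False rv] by simp
  also have "\<dots> = PiM J (\<lambda>j. distr (PiM (G j) M) (N j) (f j))"
  proof (rule PiM_cong[OF refl])
    fix j assume j: "j \<in> J"
    have "distr (PiM (G j) M) (N j) (f j) = distr (distr (PiM K M) (PiM (G j) M) (\<lambda>\<omega>. restrict \<omega> (G j))) (N j) (f j)"
      using distr_PiM_reindex[of K M "\<lambda>x. x" "G j"] M G(1)[OF j] by (auto simp: subset_iff)
    also have "\<dots> = distr (PiM K M) (N j) (\<lambda>\<omega>. f j (restrict \<omega> (G j)))"
      using distr_distr[OF f[OF j] m[OF j]] by (simp add: comp_def)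
    finally show "distr (PiM K M) (N j) (\<lambda>\<omega>. f j (restrict \<omega> (G j))) = distr (PiM (G j) M) (N j) (f j)" by simp
  qed
  finally show ?thesis .
qed

lemma prob_space_std_normal [simp, intro]: "prob_space std_normal_distribution"
  by (rule prob_space_normal_density) simp

text \<open>The right side is an image of the standard law and not a normal density, so that the
  case of all coefficients zero, which has no density, is included. Zero coefficients are discarded
  first for the same reason.\<close>

lemma distr_linear_comb_std_normal:
  assumes I: "finite I"
  shows "distr (PiM I (\<lambda>_. std_normal_distribution)) borel (\<lambda>x. \<Sum>i\<in>I. a i * x i) =
    distr std_normal_distribution borel (\<lambda>x. sqrt (\<Sum>i\<in>I. (a i)\<^sup>2) * x)"
proof -
  interpret P: prob_space "PiM I (\<lambda>_. std_normal_distribution)" by (intro prob_space_PiM) simp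
  interpret N: prob_space std_normal_distribution by simp
  define J where "J = {i\<in>I. a i \<noteq> 0}"
  have J: "finite J" "J \<subseteq> I" using I by (auto simp: J_def)
  have s1: "(\<Sum>i\<in>I. a i * x i) = (\<Sum>i\<in>J. a i * x i)" for x
    using I by (intro sum.mono_neutral_right) (auto simp: J_def)
  have s2: "(\<Sum>i\<in>I. (a i)\<^sup>2) = (\<Sum>i\<in>J. (a i)\<^sup>2)"
    using I by (intro sum.mono_neutral_right) (auto simp: J_def)
  show ?thesis
  proof (cases "J = {}")
    case True
    show ?thesis unfolding s1 s2 True
      by (intro measure_eqI) (auto simp: emeasure_distr P.emeasure_space_1 N.emeasure_space_1 split: split_indicator)
  next
    case False
    have ind: "P.indep_vars (\<lambda>_. borel) (\<lambda>i \<omega>. \<omega> i) I"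
      using indep_vars_PiM_components[of I "\<lambda>_. std_normal_distribution"]
      by (simp add: P.indep_vars_def2)
    have ind': "P.indep_vars (\<lambda>_. borel) (\<lambda>i \<omega>. a i * \<omega> i) J"
      using P.indep_vars_compose2[OF P.indep_vars_subset[OF ind J(2)], of "\<lambda>i x. a i * x" "\<lambda>_. borel"] by simp
    have dn: "distributed (PiM I (\<lambda>_. std_normal_distribution)) lborel (\<lambda>\<omega>. a i * \<omega> i) (normal_density 0 (\<bar>a i\<bar>))" if i: "i \<in> J" for i
    proof -
      have "distr (PiM I (\<lambda>_. std_normal_distribution)) lborel (\<lambda>\<omega>. \<omega> i) = distr (PiM I (\<lambda>_. std_normal_distribution)) std_normal_distribution (\<lambda>\<omega>. \<omega> i)"
        by (intro distr_cong) auto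
      also have "\<dots> = std_normal_distribution" using i J by (intro distr_PiM_component) auto
      finally have "distributed (PiM I (\<lambda>_. std_normal_distribution)) lborel (\<lambda>\<omega>. \<omega> i) (normal_density 0 1)"
        using i J by (auto simp: distributed_def)
      from P.normal_density_affine[OF this, of "a i" 0] i show ?thesis by (simp add: J_def)
    qed
    have "distributed (PiM I (\<lambda>_. std_normal_distribution)) lborel (\<lambda>\<omega>. \<Sum>i\<in>J. a i * \<omega> i) (normal_density (\<Sum>i\<in>J. 0) (sqrt (\<Sum>i\<in>J. \<bar>a i\<bar>\<^sup>2)))"
      by (rule P.sum_indep_normal[OF J(1) False ind' _ dn]) (auto simp: J_def)
    then have 1: "distributed (PiM I (\<lambda>_. std_normal_distribution)) lborel (\<lambda>\<omega>. \<Sum>i\<in>J. a i * \<omega> i) (normal_density 0 (sqrt (\<Sum>i\<in>J. (a i)\<^sup>2)))"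
      by simp
    have pos: "sqrt (\<Sum>i\<in>J. (a i)\<^sup>2) > 0"
      using False J by (auto simp: J_def intro!: sum_pos)
    have "distributed std_normal_distribution lborel (\<lambda>x. x) (normal_density 0 1)"
      by (auto simp: distributed_def intro!: measure_eqI simp: emeasure_distr)
    from N.normal_density_affine[OF this, of "sqrt (\<Sum>i\<in>J. (a i)\<^sup>2)" 0] pos
    have 2: "distributed std_normal_distribution lborel (\<lambda>x. sqrt (\<Sum>i\<in>J. (a i)\<^sup>2) * x) (normal_density 0 (sqrt (\<Sum>i\<in>J. (a i)\<^sup>2)))"
      by simp
    have b: "distr M borel f = distr M lborel f" for M :: "'z measure" and f :: "'z \<Rightarrow> real"
      by (intro distr_cong) auto
    show ?thesis unfolding s1 s2 b
      using distributed_distr_eq_density[OF 1] distributed_distr_eq_density[OF 2] by simp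
  qed
qed

text \<open>Tilting the standard density by exp (t x^2) gives s times the centred normal density of
  variance s^2 = 1 / (1 - 2 t), which integrates to 1.\<close>

lemma nn_integral_exp_square_std_normal:
  assumes t: "t < 1/2"
  shows "(\<integral>\<^sup>+x. ennreal (exp (t * x\<^sup>2)) \<partial>std_normal_distribution) = ennreal (1 / sqrt (1 - 2*t))"
proof -
  define s where "s = 1 / sqrt (1 - 2*t)"
  have s: "s > 0" using t by (simp add: s_def)
  have s2: "s\<^sup>2 = 1 / (1 - 2*t)" using t by (simp add: s_def power_divide)
  have eq: "exp (t * x\<^sup>2) * std_normal_density x = s * normal_density 0 s x" for x
  proof -
    have "- x\<^sup>2 / (2 * s\<^sup>2) = t * x\<^sup>2 + - x\<^sup>2 / 2" using t by (simp add: s2 field_simps)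
    moreover have "sqrt (2 * pi * s\<^sup>2) = s * sqrt (2 * pi)" using s by (simp add: real_sqrt_mult)
    ultimately show ?thesis using s
      by (simp add: normal_density_def mult_exp_exp)
  qed
  have "(\<integral>\<^sup>+x. ennreal (exp (t * x\<^sup>2)) \<partial>std_normal_distribution) = (\<integral>\<^sup>+x. ennreal s * ennreal (normal_density 0 s x) \<partial>lborel)"
    by (subst nn_integral_density) (auto simp: ennreal_mult'[symmetric] eq[symmetric] mult_ac s less_imp_le intro!: nn_integral_cong)
  also have "\<dots> = ennreal s * (\<integral>\<^sup>+x. ennreal (normal_density 0 s x) \<partial>lborel)"
    by (rule nn_integral_cmult) simp
  also have "(\<integral>\<^sup>+x. ennreal (normal_density 0 s x) \<partial>lborel) = 1"
  proof -
    interpret prob_space "density lborel (normal_density 0 s)" by (rule prob_space_normal_density[OF s])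
    show ?thesis using emeasure_space_1 by (simp add: emeasure_density)
  qed
  finally show ?thesis by (simp add: s_def)
qed

lemma measurable_component2:
  assumes "i \<in> I" "j \<in> J"
  shows "(\<lambda>x. x i j) \<in> PiM I (\<lambda>_. PiM J N) \<rightarrow>\<^sub>M N j"
  using measurable_compose[OF measurable_component_singleton[OF assms(1), of "\<lambda>_. PiM J N"] measurable_component_singleton[OF assms(2)]] .

lemma distr_PiM_swap:
  assumes M: "prob_space M" and I: "finite I"
  shows "distr (PiM (I \<times> J) (\<lambda>_. M)) (PiM I (\<lambda>_. PiM J (\<lambda>_. M))) (\<lambda>\<omega>. \<lambda>i\<in>I. \<lambda>j\<in>J. \<omega> (i, j)) = PiM I (\<lambda>_. PiM J (\<lambda>_. M))"
    (is ?A)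
    and "distr (PiM (I \<times> J) (\<lambda>_. M)) (PiM J (\<lambda>_. PiM I (\<lambda>_. M))) (\<lambda>\<omega>. \<lambda>j\<in>J. \<lambda>i\<in>I. \<omega> (i, j)) = PiM J (\<lambda>_. PiM I (\<lambda>_. M))"
    (is ?B)
proof -
  have *: "distr (PiM (I \<times> J) (\<lambda>_. M)) (PiM I (\<lambda>_. PiM J (\<lambda>_. M))) (\<lambda>\<omega>. \<lambda>i\<in>I. \<lambda>j\<in>J. restrict \<omega> ({i} \<times> J) (i, j)) =
    PiM I (\<lambda>i. distr (PiM ({i} \<times> J) (\<lambda>_. M)) (PiM J (\<lambda>_. M)) (\<lambda>\<omega>. \<lambda>j\<in>J. \<omega> (i, j)))"
    using M by (intro distr_PiM_groups[where N = "\<lambda>_. PiM J (\<lambda>_. M)"]) (auto simp: disjoint_family_on_def simp del: restrict_apply intro!: measurable_restrict measurable_component_singleton)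
  have r: "distr (PiM ({i} \<times> J) (\<lambda>_. M)) (PiM J (\<lambda>_. M)) (\<lambda>\<omega>. \<lambda>j\<in>J. \<omega> (i, j)) = PiM J (\<lambda>_. M)" for i
    using M by (intro distr_PiM_reindex) (auto simp: inj_on_def)
  have e: "(\<lambda>\<omega>. \<lambda>i\<in>I. \<lambda>j\<in>J. restrict \<omega> ({i} \<times> J) (i, j)) = (\<lambda>\<omega>. \<lambda>i\<in>I. \<lambda>j\<in>J. \<omega> (i, j))"
    by (auto simp: fun_eq_iff restrict_def)
  show ?A using * unfolding r e .
  have *: "distr (PiM (I \<times> J) (\<lambda>_. M)) (PiM J (\<lambda>_. PiM I (\<lambda>_. M))) (\<lambda>\<omega>. \<lambda>j\<in>J. \<lambda>i\<in>I. restrict \<omega> (I \<times> {j}) (i, j)) =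
    PiM J (\<lambda>j. distr (PiM (I \<times> {j}) (\<lambda>_. M)) (PiM I (\<lambda>_. M)) (\<lambda>\<omega>. \<lambda>i\<in>I. \<omega> (i, j)))"
    using M by (intro distr_PiM_groups[where N = "\<lambda>_. PiM I (\<lambda>_. M)"]) (auto simp: disjoint_family_on_def simp del: restrict_apply intro!: measurable_restrict measurable_component_singleton)
  have r: "distr (PiM (I \<times> {j}) (\<lambda>_. M)) (PiM I (\<lambda>_. M)) (\<lambda>\<omega>. \<lambda>i\<in>I. \<omega> (i, j)) = PiM I (\<lambda>_. M)" for j
    using M by (intro distr_PiM_reindex) (auto simp: inj_on_def)
  have e: "(\<lambda>\<omega>. \<lambda>j\<in>J. \<lambda>i\<in>I. restrict \<omega> (I \<times> {j}) (i, j)) = (\<lambda>\<omega>. \<lambda>j\<in>J. \<lambda>i\<in>I. \<omega> (i, j))"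
    by (auto simp: fun_eq_iff restrict_def)
  show ?B using * unfolding r e .
qed

abbreviation stdg :: "'i set \<Rightarrow> ('i \<Rightarrow> real) measure" where
  "stdg I \<equiv> PiM I (\<lambda>_. std_normal_distribution)"

lemma prob_space_stdg [simp, intro]: "prob_space (stdg I)"
  by (intro prob_space_PiM) simp

text \<open>Rotation invariance of the Gaussian. Read by columns instead of rows, the random matrix
  yields independent coordinates, and each coordinate is a scalar combination of variance \<Sum> a^2
  = 1.\<close>

lemma unit_comb_stdg:
  fixes a :: "'i \<Rightarrow> real" and J :: "'j set"
  assumes I: "finite I" and a: "(\<Sum>i\<in>I. (a i)\<^sup>2) = 1"
  shows "distr (PiM I (\<lambda>_. stdg J)) (stdg J) (\<lambda>X. \<lambda>j\<in>J. \<Sum>i\<in>I. a i * X i j) = stdg J"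
proof -
  define P where "P = stdg (I \<times> J)"
  have s1: "distr (stdg I) std_normal_distribution (\<lambda>x. \<Sum>i\<in>I. a i * x i) = std_normal_distribution"
  proof -
    have "distr (stdg I) std_normal_distribution (\<lambda>x. \<Sum>i\<in>I. a i * x i) = distr (stdg I) borel (\<lambda>x. \<Sum>i\<in>I. a i * x i)"
      by (intro distr_cong) auto
    also have "\<dots> = distr std_normal_distribution borel (\<lambda>x. x)"
      using distr_linear_comb_std_normal[OF I, of a] a by simp
    also have "\<dots> = std_normal_distribution" by (intro distr_id2) simp
    finally show ?thesis .
  qed
  have m1: "(\<lambda>\<omega>. \<lambda>i\<in>I. \<lambda>j\<in>J. \<omega> (i, j)) \<in> P \<rightarrow>\<^sub>M PiM I (\<lambda>_. stdg J)"
    unfolding P_def by (intro measurable_restrict measurable_component_singleton) auto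
  have m1': "(\<lambda>\<omega>. \<lambda>j\<in>J. \<lambda>i\<in>I. \<omega> (i, j)) \<in> P \<rightarrow>\<^sub>M PiM J (\<lambda>_. stdg I)"
    unfolding P_def by (intro measurable_restrict measurable_component_singleton) auto
  have mc: "(\<lambda>X. X i j) \<in> borel_measurable (PiM K (\<lambda>_. stdg L))" if "i \<in> K" "j \<in> L" for i j and K :: "'k set" and L :: "'l set"
    using measurable_component2[OF that, of "\<lambda>_. std_normal_distribution"] by simp
  have m2: "(\<lambda>X. \<lambda>j\<in>J. \<Sum>i\<in>I. a i * X i j) \<in> PiM I (\<lambda>_. stdg J) \<rightarrow>\<^sub>M stdg J"
    by (rule measurable_restrict) (simp add: mc borel_measurable_sum borel_measurable_times)
  have m2': "(\<lambda>X. \<lambda>j\<in>J. \<Sum>i\<in>I. a i * X j i) \<in> PiM J (\<lambda>_. stdg I) \<rightarrow>\<^sub>M stdg J"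
    by (rule measurable_restrict) (simp add: mc borel_measurable_sum borel_measurable_times)
  have "distr (PiM I (\<lambda>_. stdg J)) (stdg J) (\<lambda>X. \<lambda>j\<in>J. \<Sum>i\<in>I. a i * X i j) =
    distr (distr P (PiM I (\<lambda>_. stdg J)) (\<lambda>\<omega>. \<lambda>i\<in>I. \<lambda>j\<in>J. \<omega> (i, j))) (stdg J) (\<lambda>X. \<lambda>j\<in>J. \<Sum>i\<in>I. a i * X i j)"
    unfolding P_def by (subst distr_PiM_swap(1)[OF _ I]) auto
  also have "\<dots> = distr P (stdg J) (\<lambda>\<omega>. \<lambda>j\<in>J. \<Sum>i\<in>I. a i * \<omega> (i, j))"
    by (subst distr_distr[OF m2 m1]) (auto simp: comp_def intro!: distr_cong restrict_ext sum.cong)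
  also have "\<dots> = distr (distr P (PiM J (\<lambda>_. stdg I)) (\<lambda>\<omega>. \<lambda>j\<in>J. \<lambda>i\<in>I. \<omega> (i, j))) (stdg J) (\<lambda>X. \<lambda>j\<in>J. \<Sum>i\<in>I. a i * X j i)"
    by (subst distr_distr[OF m2' m1']) (auto simp: comp_def intro!: distr_cong restrict_ext sum.cong)
  also have "\<dots> = distr (PiM J (\<lambda>_. stdg I)) (stdg J) (\<lambda>X. \<lambda>j\<in>J. \<Sum>i\<in>I. a i * X j i)"
    unfolding P_def by (subst distr_PiM_swap(2)[OF _ I]) auto
  also have "\<dots> = distr (PiM J (\<lambda>_. stdg I)) (stdg J) (\<lambda>X. \<lambda>j\<in>J. (\<lambda>x. \<Sum>i\<in>I. a i * x i) (restrict X {j} j))"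
    by simp
  also have "\<dots> = PiM J (\<lambda>j. distr (PiM {j} (\<lambda>_. stdg I)) std_normal_distribution (\<lambda>X. \<Sum>i\<in>I. a i * X j i))"
    by (rule distr_PiM_groups[where N = "\<lambda>_. std_normal_distribution" and f = "\<lambda>j X. \<Sum>i\<in>I. a i * X j i"])
       (auto simp: disjoint_family_on_def intro!: borel_measurable_sum borel_measurable_times mc)
  also have "\<dots> = PiM J (\<lambda>j. distr (distr (PiM {j} (\<lambda>_. stdg I)) (stdg I) (\<lambda>X. X j)) std_normal_distribution (\<lambda>x. \<Sum>i\<in>I. a i * x i))"
    by (intro PiM_cong refl, subst distr_distr) (auto simp: comp_def)
  also have "\<dots> = stdg J"
    by (subst distr_PiM_component) (auto simp: s1)
  finally show ?thesis .
qed

section \<open>Translation-invariant measures\<close>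

abbreviation leb :: "'i set \<Rightarrow> ('i \<Rightarrow> real) measure" where
  "leb I \<equiv> PiM I (\<lambda>_. lborel)"

interpretation leb: product_sigma_finite "\<lambda>_. lborel :: real measure"
  by standard

lemma sigma_finite_leb: "finite I \<Longrightarrow> sigma_finite_measure (leb I)"
  by (rule leb.sigma_finite)

lemma leb_distr_coordinatewise:
  assumes I: "finite I" and f: "\<And>i. i \<in> I \<Longrightarrow> f i \<in> borel \<rightarrow>\<^sub>M borel"
    and d: "\<And>i. i \<in> I \<Longrightarrow> distr lborel borel (f i) = lborel"
  shows "distr (leb I) (leb I) (\<lambda>x. \<lambda>i\<in>I. f i (x i)) = leb I"
proof (rule leb.PiM_eqI[OF I])
  note f[measurable]
  have m[measurable]: "(\<lambda>x. \<lambda>i\<in>I. f i (x i)) \<in> leb I \<rightarrow>\<^sub>M leb I"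
    using f by (intro measurable_restrict measurable_compose[OF measurable_component_singleton]) auto
  fix A :: "'a \<Rightarrow> real set" assume A: "\<And>i. i \<in> I \<Longrightarrow> A i \<in> sets lborel"
  have "emeasure (distr (leb I) (leb I) (\<lambda>x. \<lambda>i\<in>I. f i (x i))) (Pi\<^sub>E I A) =
    emeasure (leb I) ((\<lambda>x. \<lambda>i\<in>I. f i (x i)) -` (Pi\<^sub>E I A) \<inter> space (leb I))"
    using A I by (intro emeasure_distr m) (auto intro!: sets_PiM_I_finite)
  also have "(\<lambda>x. \<lambda>i\<in>I. f i (x i)) -` (Pi\<^sub>E I A) \<inter> space (leb I) = Pi\<^sub>E I (\<lambda>i. f i -` A i)"
    by (auto simp: space_PiM PiE_iff)
  also have "emeasure (leb I) \<dots> = (\<Prod>i\<in>I. emeasure lborel (f i -` A i))"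
    using A measurable_sets[OF f] I by (intro leb.emeasure_PiM) auto
  also have "\<dots> = (\<Prod>i\<in>I. emeasure lborel (A i))"
  proof (rule prod.cong[OF refl])
    fix i assume i: "i \<in> I"
    have "emeasure (distr lborel borel (f i)) (A i) = emeasure lborel (f i -` A i)"
      using f[OF i] A[OF i] by (subst emeasure_distr) auto
    then show "emeasure lborel (f i -` A i) = emeasure lborel (A i)" by (simp add: d[OF i])
  qed
  finally show "emeasure (distr (leb I) (leb I) (\<lambda>x. \<lambda>i\<in>I. f i (x i))) (Pi\<^sub>E I A) = (\<Prod>i\<in>I. emeasure lborel (A i))" .
qed simp

lemma leb_translate:
  assumes I: "finite I" and [measurable]: "f \<in> borel_measurable (leb I)"
  shows "(\<integral>\<^sup>+x. f (\<lambda>i\<in>I. x i + t i) \<partial>leb I) = (\<integral>\<^sup>+x. f x \<partial>leb I)"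
proof -
  have m: "(\<lambda>x. \<lambda>i\<in>I. x i + t i) \<in> leb I \<rightarrow>\<^sub>M leb I"
    by measurable
  have "distr (leb I) (leb I) (\<lambda>x. \<lambda>i\<in>I. x i + t i) = leb I"
  proof (intro leb_distr_coordinatewise[OF I])
    show "distr lborel borel (\<lambda>a. a + t i) = lborel" for i
    proof -
      have "(\<lambda>a. a + t i) = (+) (t i)" by (auto simp: fun_eq_iff)
      then show ?thesis by (simp add: lborel_distr_plus)
    qed
  qed simp
  then have "(\<integral>\<^sup>+x. f x \<partial>leb I) = (\<integral>\<^sup>+x. f x \<partial>distr (leb I) (leb I) (\<lambda>x. \<lambda>i\<in>I. x i + t i))" by simp
  also have "\<dots> = (\<integral>\<^sup>+x. f (\<lambda>i\<in>I. x i + t i) \<partial>leb I)"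
    by (rule nn_integral_distr[OF m]) simp
  finally show ?thesis ..
qed

lemma leb_reflect:
  assumes I: "finite I" and [measurable]: "f \<in> borel_measurable (leb I)"
  shows "(\<integral>\<^sup>+x. f (\<lambda>i\<in>I. t i - x i) \<partial>leb I) = (\<integral>\<^sup>+x. f x \<partial>leb I)"
proof -
  have m: "(\<lambda>x. \<lambda>i\<in>I. - x i) \<in> leb I \<rightarrow>\<^sub>M leb I"
    by measurable
  have "distr (leb I) (leb I) (\<lambda>x. \<lambda>i\<in>I. - x i) = leb I"
    by (intro leb_distr_coordinatewise[OF I]) (auto simp: lborel_distr_uminus)
  then have "(\<integral>\<^sup>+x. f (\<lambda>i\<in>I. x i + t i) \<partial>leb I) = (\<integral>\<^sup>+x. f (\<lambda>i\<in>I. x i + t i) \<partial>distr (leb I) (leb I) (\<lambda>x. \<lambda>i\<in>I. - x i))" by simp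
  also have "\<dots> = (\<integral>\<^sup>+x. f (\<lambda>i\<in>I. (\<lambda>i\<in>I. - x i) i + t i) \<partial>leb I)"
    by (rule nn_integral_distr[OF m]) measurable
  also have "\<dots> = (\<integral>\<^sup>+x. f (\<lambda>i\<in>I. t i - x i) \<partial>leb I)"
    by (intro nn_integral_cong arg_cong[where f=f]) (auto simp: restrict_def)
  finally show ?thesis using leb_translate[OF assms] by simp
qed

lemma leb_scale:
  assumes I: "finite I" and [measurable]: "f \<in> borel_measurable (leb I)" and s: "s > 0"
  shows "(\<integral>\<^sup>+x. f x \<partial>leb I) = ennreal (s ^ card I) * (\<integral>\<^sup>+x. f (\<lambda>i\<in>I. s * x i) \<partial>leb I)"
proof -
  have m: "(\<lambda>x. \<lambda>i\<in>I. s * x i) \<in> leb I \<rightarrow>\<^sub>M leb I"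
    by measurable
  have "scale_measure (ennreal (s ^ card I)) (distr (leb I) (leb I) (\<lambda>x. \<lambda>i\<in>I. s * x i)) = leb I"
  proof (rule leb.PiM_eqI[OF I])
    fix A :: "'a \<Rightarrow> real set" assume A: "\<And>i. i \<in> I \<Longrightarrow> A i \<in> sets lborel"
    have "emeasure (distr (leb I) (leb I) (\<lambda>x. \<lambda>i\<in>I. s * x i)) (Pi\<^sub>E I A) =
      emeasure (leb I) ((\<lambda>x. \<lambda>i\<in>I. s * x i) -` (Pi\<^sub>E I A) \<inter> space (leb I))"
      using A I by (intro emeasure_distr m) (auto intro!: sets_PiM_I_finite)
    also have "(\<lambda>x. \<lambda>i\<in>I. s * x i) -` (Pi\<^sub>E I A) \<inter> space (leb I) = Pi\<^sub>E I (\<lambda>i. (*) s -` A i)"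
      by (auto simp: space_PiM PiE_iff)
    also have "emeasure (leb I) \<dots> = (\<Prod>i\<in>I. emeasure lborel ((*) s -` A i))"
      using A I by (intro leb.emeasure_PiM) (auto intro!: measurable_sets_borel[of _ borel])
    finally have *: "emeasure (distr (leb I) (leb I) (\<lambda>x. \<lambda>i\<in>I. s * x i)) (Pi\<^sub>E I A) =
       (\<Prod>i\<in>I. emeasure lborel ((*) s -` A i))" .
    have **: "ennreal s * emeasure lborel ((*) s -` A i) = emeasure lborel (A i)" if i: "i \<in> I" for i
    proof -
      have "emeasure lborel (A i) = (\<integral>\<^sup>+x. indicator (A i) x \<partial>lborel)"
        using A[OF i] by simp
      also have "\<dots> = ennreal \<bar>s\<bar> * (\<integral>\<^sup>+x. indicator (A i) (0 + s * x) \<partial>lborel)"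
        using A[OF i] s by (intro nn_integral_real_affine) auto
      also have "(\<integral>\<^sup>+x. indicator (A i) (0 + s * x) \<partial>lborel) = (\<integral>\<^sup>+x. indicator ((*) s -` A i) x \<partial>lborel)"
        by (intro nn_integral_cong) (auto split: split_indicator)
      also have "\<dots> = emeasure lborel ((*) s -` A i)"
        using A[OF i] by (intro nn_integral_indicator) (auto intro!: measurable_sets_borel[of _ borel])
      finally show ?thesis using s by simp
    qed
    have "(\<Prod>i\<in>I. emeasure lborel (A i)) = (\<Prod>i\<in>I. ennreal s * emeasure lborel ((*) s -` A i))"
      by (simp add: ** cong: prod.cong)
    also have "\<dots> = ennreal (s ^ card I) * (\<Prod>i\<in>I. emeasure lborel ((*) s -` A i))"
      using s by (simp only: prod.distrib prod_constant ennreal_power less_imp_le)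
    finally show "emeasure (scale_measure (ennreal (s ^ card I)) (distr (leb I) (leb I) (\<lambda>x. \<lambda>i\<in>I. s * x i))) (Pi\<^sub>E I A) =
        (\<Prod>i\<in>I. emeasure lborel (A i))"
      by (simp add: *)
  qed simp
  then have "(\<integral>\<^sup>+x. f x \<partial>leb I) = (\<integral>\<^sup>+x. f x \<partial>scale_measure (ennreal (s ^ card I)) (distr (leb I) (leb I) (\<lambda>x. \<lambda>i\<in>I. s * x i)))"
    by simp
  also have "\<dots> = ennreal (s ^ card I) * (\<integral>\<^sup>+x. f (\<lambda>i\<in>I. s * x i) \<partial>leb I)"
    by (subst nn_integral_scale_measure) (auto simp: nn_integral_distr[OF m])
  finally show ?thesis .
qed

text \<open>Uniqueness of translation-invariant measures: both sides of \<open>\<nu>(A) \<lambda>(B) = \<nu>(B) \<lambda>(A)\<close> are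
  \<open>\<integral>\<integral> 1\<^sub>A(T x) 1\<^sub>B(y + T x)\<close>. It replaces the Jacobian determinant by an unspecified constant.\<close>

lemma leb_additive_bij:
  fixes T U :: "('i \<Rightarrow> real) \<Rightarrow> 'i \<Rightarrow> real"
  assumes I: "finite I" and T[measurable]: "T \<in> leb I \<rightarrow>\<^sub>M leb I" and U[measurable]: "U \<in> leb I \<rightarrow>\<^sub>M leb I"
    and TU: "\<And>x. x \<in> space (leb I) \<Longrightarrow> T (U x) = x" and UT: "\<And>x. x \<in> space (leb I) \<Longrightarrow> U (T x) = x"
    and add: "\<And>x y. x \<in> space (leb I) \<Longrightarrow> y \<in> space (leb I) \<Longrightarrow> T (\<lambda>i\<in>I. x i + y i) = (\<lambda>i\<in>I. T x i + T y i)"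
  obtains c :: real where "c > 0" "\<And>f. f \<in> borel_measurable (leb I) \<Longrightarrow> (\<integral>\<^sup>+x. f (T x) \<partial>leb I) = ennreal c * (\<integral>\<^sup>+x. f x \<partial>leb I)"
proof -
  interpret sigma_finite_measure "leb I" by (rule sigma_finite_leb[OF I])
  interpret P: pair_sigma_finite "leb I" "leb I" ..
  define nu where "nu A = (\<integral>\<^sup>+x. indicator A (T x) \<partial>leb I)" for A :: "('i \<Rightarrow> real) set"
  have Tsp: "T x \<in> space (leb I)" if "x \<in> space (leb I)" for x using measurable_space[OF T that] .
  have Usp: "U x \<in> space (leb I)" if "x \<in> space (leb I)" for x using measurable_space[OF U that] .
  have Tc0: "i \<in> I \<Longrightarrow> (\<lambda>x. T x i) \<in> leb I \<rightarrow>\<^sub>M lborel" for i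
    by (rule measurable_compose[OF T measurable_component_singleton])
  from measurable_compose[OF measurable_fst this]
  have Tc: "i \<in> I \<Longrightarrow> (\<lambda>x. T (fst x) i) \<in> leb I \<Otimes>\<^sub>M leb I \<rightarrow>\<^sub>M lborel" for i by blast
  have pl[measurable]: "(\<lambda>(x, y). \<lambda>i\<in>I. y i + T x i) \<in> leb I \<Otimes>\<^sub>M leb I \<rightarrow>\<^sub>M leb I"
    unfolding split_def using Tc by (intro measurable_restrict) auto
  have mi[measurable]: "(\<lambda>(x, y). \<lambda>i\<in>I. T x i - y i) \<in> leb I \<Otimes>\<^sub>M leb I \<rightarrow>\<^sub>M leb I"
    unfolding split_def using Tc by (intro measurable_restrict) auto
  have key: "nu A * emeasure (leb I) B = nu B * emeasure (leb I) A"
    if A[measurable]: "A \<in> sets (leb I)" and B[measurable]: "B \<in> sets (leb I)" for A B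
  proof -
    have "nu A * emeasure (leb I) B = (\<integral>\<^sup>+x. indicator A (T x) * (\<integral>\<^sup>+y. indicator B y \<partial>leb I) \<partial>leb I)"
      unfolding nu_def by (subst nn_integral_multc) auto
    also have "\<dots> = (\<integral>\<^sup>+x. indicator A (T x) * (\<integral>\<^sup>+y. indicator B (\<lambda>i\<in>I. y i + T x i) \<partial>leb I) \<partial>leb I)"
      using leb_translate[OF I, of "indicator B"] by simp
    also have "\<dots> = (\<integral>\<^sup>+x. (\<integral>\<^sup>+y. indicator A (T x) * indicator B (\<lambda>i\<in>I. y i + T x i) \<partial>leb I) \<partial>leb I)"
      by (intro nn_integral_cong nn_integral_cmult[symmetric] measurable_compose[OF measurable_compose[OF measurable_Pair1' pl]])
        (auto)
    also have "\<dots> = (\<integral>\<^sup>+y. (\<integral>\<^sup>+x. indicator A (T x) * indicator B (\<lambda>i\<in>I. y i + T x i) \<partial>leb I) \<partial>leb I)"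
      by (rule P.Fubini'[symmetric]) measurable
    also have "\<dots> = (\<integral>\<^sup>+y. (\<integral>\<^sup>+x. indicator A (\<lambda>i\<in>I. T x i - y i) * indicator B (T x) \<partial>leb I) \<partial>leb I)"
    proof (rule nn_integral_cong)
      fix y assume y: "y \<in> space (leb I)"
      \<comment> \<open>Translating x by the preimage of -y turns \<open>T x\<close> into
        \<open>T x - y\<close> and \<open>y + T x\<close> into \<open>T x\<close>; afterwards y
        occurs only in the factor with A and can be integrated out by reflection.\<close>
      define z where "z = U (\<lambda>i\<in>I. - y i)"
      have ny: "(\<lambda>i\<in>I. - y i) \<in> space (leb I)" by (auto simp: space_PiM)
      have z: "z \<in> space (leb I)" unfolding z_def using Usp ny by auto
      have Tz: "T z = (\<lambda>i\<in>I. - y i)" unfolding z_def by (rule TU[OF ny])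
      have [measurable]: "(\<lambda>x. \<lambda>i\<in>I. y i + T x i) \<in> leb I \<rightarrow>\<^sub>M leb I"
        using Tc0 by (intro measurable_restrict) auto
      have "(\<integral>\<^sup>+x. indicator A (T x) * indicator B (\<lambda>i\<in>I. y i + T x i) \<partial>leb I) =
        (\<integral>\<^sup>+x. indicator A (T (\<lambda>i\<in>I. x i + z i)) * indicator B (\<lambda>i\<in>I. y i + T (\<lambda>i\<in>I. x i + z i) i) \<partial>leb I)"
        by (rule leb_translate[OF I, symmetric]) measurable
      also have "\<dots> = (\<integral>\<^sup>+x. indicator A (\<lambda>i\<in>I. T x i - y i) * indicator B (T x) \<partial>leb I)"
      proof (rule nn_integral_cong)
        fix x assume x: "x \<in> space (leb I)"
        have 1: "T (\<lambda>i\<in>I. x i + z i) = (\<lambda>i\<in>I. T x i - y i)"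
          using add[OF x z] Tz by (auto simp: restrict_def fun_eq_iff)
        have 2: "(\<lambda>i\<in>I. y i + (\<lambda>i\<in>I. T x i - y i) i) = T x"
          using Tsp[OF x] by (auto simp: space_PiM PiE_iff extensional_def)
        show "indicator A (T (\<lambda>i\<in>I. x i + z i)) * indicator B (\<lambda>i\<in>I. y i + T (\<lambda>i\<in>I. x i + z i) i) =
          (indicator A (\<lambda>i\<in>I. T x i - y i) * indicator B (T x) :: ennreal)"
          unfolding 1 2 ..
      qed
      finally show "(\<integral>\<^sup>+x. indicator A (T x) * indicator B (\<lambda>i\<in>I. y i + T x i) \<partial>leb I) =
        (\<integral>\<^sup>+x. indicator A (\<lambda>i\<in>I. T x i - y i) * indicator B (T x) \<partial>leb I)" .
    qed
    also have "\<dots> = (\<integral>\<^sup>+x. (\<integral>\<^sup>+y. indicator A (\<lambda>i\<in>I. T x i - y i) * indicator B (T x) \<partial>leb I) \<partial>leb I)"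
      by (rule P.Fubini') measurable
    also have "\<dots> = (\<integral>\<^sup>+x. (\<integral>\<^sup>+y. indicator A (\<lambda>i\<in>I. T x i - y i) \<partial>leb I) * indicator B (T x) \<partial>leb I)"
      by (intro nn_integral_cong nn_integral_multc measurable_compose[OF measurable_compose[OF measurable_Pair1' mi]]) auto
    also have "\<dots> = (\<integral>\<^sup>+x. emeasure (leb I) A * indicator B (T x) \<partial>leb I)"
      using leb_reflect[OF I, of "indicator A"] by simp
    also have "\<dots> = nu B * emeasure (leb I) A"
      unfolding nu_def by (subst nn_integral_cmult) (auto simp: mult.commute)
    finally show ?thesis .
  qed
  define Q where "Q = Pi\<^sub>E I (\<lambda>_. {0..1::real})"
  have Q[measurable]: "Q \<in> sets (leb I)" using I by (auto simp: Q_def intro!: sets_PiM_I_finite)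
  have Q1: "emeasure (leb I) Q = 1" unfolding Q_def using I by (subst leb.emeasure_PiM) auto
  have nuA: "nu A = nu Q * emeasure (leb I) A" if "A \<in> sets (leb I)" for A
    using key[OF that Q] Q1 by simp
  \<comment> \<open>This is the image of the unit cube under T, so its \<open>nu\<close> is 1.
    Together with the proportionality this shows that the factor \<open>nu Q\<close> is neither 0
    nor infinite.\<close>
  define TQ where "TQ = U -` Q \<inter> space (leb I)"
  have TQ: "TQ \<in> sets (leb I)" unfolding TQ_def by measurable
  have "nu TQ = (\<integral>\<^sup>+x. indicator Q x \<partial>leb I)"
    unfolding nu_def by (intro nn_integral_cong) (auto simp: TQ_def UT Tsp split: split_indicator)
  then have "nu Q * emeasure (leb I) TQ = 1" using nuA[OF TQ] Q1 by simp
  then have nz: "nu Q \<noteq> 0" and nt: "nu Q \<noteq> \<top>"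
    by (auto simp: ennreal_top_mult split: if_splits)
  define c where "c = enn2real (nu Q)"
  have c: "ennreal c = nu Q" "c > 0"
    using nz nt by (auto simp: c_def enn2real_positive_iff top.not_eq_extremum zero_less_iff_neq_zero)
  have eq: "distr (leb I) (leb I) T = scale_measure (ennreal c) (leb I)"
  proof (rule measure_eqI)
    fix A assume "A \<in> sets (distr (leb I) (leb I) T)"
    then have A[measurable]: "A \<in> sets (leb I)" by simp
    have "emeasure (distr (leb I) (leb I) T) A = (\<integral>\<^sup>+x. indicator A x \<partial>distr (leb I) (leb I) T)" by simp
    also have "\<dots> = nu A" unfolding nu_def by (rule nn_integral_distr[OF T]) simp
    finally show "emeasure (distr (leb I) (leb I) T) A = emeasure (scale_measure (ennreal c) (leb I)) A"
      using nuA[OF A] c by simp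
  qed simp
  have "(\<integral>\<^sup>+x. f (T x) \<partial>leb I) = ennreal c * (\<integral>\<^sup>+x. f x \<partial>leb I)" if f: "f \<in> borel_measurable (leb I)" for f
  proof -
    have "(\<integral>\<^sup>+x. f (T x) \<partial>leb I) = (\<integral>\<^sup>+x. f x \<partial>distr (leb I) (leb I) T)"
      using nn_integral_distr[OF T] f by simp
    also have "\<dots> = ennreal c * (\<integral>\<^sup>+x. f x \<partial>leb I)"
      unfolding eq using f by (rule nn_integral_scale_measure)
    finally show ?thesis .
  qed
  then show thesis using c(2) that by blast
qed

text \<open>Polar coordinates without a sphere: scaling by sqrt s carries N \<le> 1 to N \<le> s, so
  this sublevel set has volume V s^c and the law of N has density V c s^(c-1) on s > 0. The lower
  bound on N places the sublevel sets inside cubes, which makes V finite.\<close>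

lemma leb_homogeneous:
  fixes N :: "('i \<Rightarrow> real) \<Rightarrow> real"
  assumes I: "finite I" and c: "card I = 2 * c" "c \<ge> 1" and N[measurable]: "N \<in> borel_measurable (leb I)"
    and hom: "\<And>x s. x \<in> space (leb I) \<Longrightarrow> s > 0 \<Longrightarrow> N (\<lambda>i\<in>I. s * x i) = s\<^sup>2 * N x"
    and lb: "\<And>x. x \<in> space (leb I) \<Longrightarrow> N x \<ge> (\<Sum>i\<in>I. (x i)\<^sup>2)"
  obtains C :: real where "C \<ge> 0" "\<And>G. G \<in> borel_measurable borel \<Longrightarrow>
    (\<integral>\<^sup>+x. G (N x) \<partial>leb I) = ennreal C * (\<integral>\<^sup>+s. G s * ennreal (s ^ (c - 1)) * indicator {0<..} s \<partial>lborel)"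
proof -
  define Q where "Q r = Pi\<^sub>E I (\<lambda>_. {-r..r::real})" for r
  have Qm: "Q r \<in> sets (leb I)" for r using I by (auto simp: Q_def intro!: sets_PiM_I_finite)
  have Q: "emeasure (leb I) (Q r) = (\<Prod>i\<in>I. ennreal (2 * r))" if "r \<ge> 0" for r
    unfolding Q_def using I that by (subst leb.emeasure_PiM) auto
  define B where "B r = {x \<in> space (leb I). N x \<le> r}" for r
  have Bm[measurable]: "B r \<in> sets (leb I)" for r unfolding B_def by measurable
  have BQ: "B (r\<^sup>2) \<subseteq> Q r" if r: "r \<ge> 0" for r
  proof
    fix x assume "x \<in> B (r\<^sup>2)"
    then have x: "x \<in> space (leb I)" "N x \<le> r\<^sup>2" by (auto simp: B_def)
    have "(x i)\<^sup>2 \<le> r\<^sup>2" if "i \<in> I" for i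
      using member_le_sum[of i I "\<lambda>i. (x i)\<^sup>2"] that I lb[OF x(1)] x(2) by auto
    then have "\<bar>x i\<bar> \<le> r" if "i \<in> I" for i using that r by (metis abs_le_square_iff abs_of_nonneg)
    then show "x \<in> Q r" using x(1) by (fastforce simp: Q_def space_PiM PiE_iff)
  qed
  define V where "V = measure (leb I) (B 1)"
  have "emeasure (leb I) (B 1) \<le> emeasure (leb I) (Q 1)"
    using BQ[of 1] Qm by (intro emeasure_mono) auto
  also have "\<dots> < \<infinity>" using Q[of 1] by (simp add: power_less_top_ennreal)
  finally have V: "emeasure (leb I) (B 1) = ennreal V" unfolding V_def
    by (intro emeasure_eq_ennreal_measure) auto
  have V0: "V \<ge> 0" by (simp add: V_def)
  have Bs: "emeasure (leb I) (B s) = ennreal (V * s ^ c)" if s: "s > 0" for s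
  proof -
    have "emeasure (leb I) (B s) = (\<integral>\<^sup>+x. indicator (B s) x \<partial>leb I)" by simp
    also have "\<dots> = ennreal (sqrt s ^ card I) * (\<integral>\<^sup>+x. indicator (B s) (\<lambda>i\<in>I. sqrt s * x i) \<partial>leb I)"
      using s by (intro leb_scale[OF I]) auto
    also have "(\<integral>\<^sup>+x. indicator (B s) (\<lambda>i\<in>I. sqrt s * x i) \<partial>leb I) = (\<integral>\<^sup>+x. indicator (B 1) x \<partial>leb I)"
    proof (rule nn_integral_cong)
      fix x assume x: "x \<in> space (leb I)"
      have "(\<lambda>i\<in>I. sqrt s * x i) \<in> space (leb I)" by (auto simp: space_PiM)
      then have "(\<lambda>i\<in>I. sqrt s * x i) \<in> B s \<longleftrightarrow> x \<in> B 1"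
        using hom[OF x, of "sqrt s"] s x by (auto simp: B_def)
      then show "indicator (B s) (\<lambda>i\<in>I. sqrt s * x i) = (indicator (B 1) x :: ennreal)"
        by (auto split: split_indicator)
    qed
    also have "sqrt s ^ card I = s ^ c" using s by (simp add: c power_mult)
    finally show ?thesis using V V0 s by (simp add: ennreal_mult'[symmetric] mult.commute)
  qed
  have B0: "emeasure (leb I) (B s) = 0" if s: "s \<le> 0" for s
  proof -
    have "B s \<subseteq> B (0\<^sup>2)" using s by (auto simp: B_def)
    also have "\<dots> \<subseteq> Q 0" by (rule BQ) simp
    finally have "emeasure (leb I) (B s) \<le> emeasure (leb I) (Q 0)" using Qm by (intro emeasure_mono) auto
    also have "\<dots> = 0" using Q[of 0] I c by (auto simp: card_gt_0_iff)
    finally show ?thesis by simp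
  qed
  \<comment> \<open>The derivative of s \<mapsto> V s^c on the positive half line. Half lines
    generate the Borel sets, so agreement of the distribution functions identifies the law of
    N.\<close>
  define D where "D = density lborel (\<lambda>s. ennreal (V * c * s ^ (c - 1)) * indicator {0<..} s)"
  have Dm: "(\<lambda>s. ennreal (V * c * s ^ (c - 1)) * indicator {0<..} s) \<in> borel_measurable lborel" by measurable
  have Ds: "emeasure D {..s} = (if s > 0 then ennreal (V * s ^ c) else 0)" for s
  proof -
    have "emeasure D {..s} = (\<integral>\<^sup>+t. ennreal (V * c * t ^ (c - 1)) * indicator {0<..} t * indicator {..s} t \<partial>lborel)"
      unfolding D_def by (rule emeasure_density) (auto intro: Dm)
    also have "\<dots> = (\<integral>\<^sup>+t. ennreal (V * c * t ^ (c - 1)) * indicator {0..s} t \<partial>lborel)"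
    proof (rule nn_integral_cong_AE)
      have "AE t in lborel. t \<noteq> (0::real)" by (rule AE_lborel_singleton)
      then show "AE t in lborel. ennreal (V * c * t ^ (c - 1)) * indicator {0<..} t * indicator {..s} t =
        ennreal (V * c * t ^ (c - 1)) * indicator {0..s} t"
        by eventually_elim (auto split: split_indicator)
    qed
    also have "\<dots> = (if s > 0 then ennreal (V * s ^ c) else 0)"
    proof (cases "s > 0")
      case True
      have "(\<integral>\<^sup>+t. ennreal (V * c * t ^ (c - 1)) * indicator {0..s} t \<partial>lborel) = ennreal (V * s ^ c - V * 0 ^ c)"
        using V0 True by (intro nn_integral_FTC_Icc) (auto intro!: derivative_eq_intros)
      then show ?thesis using True c by (auto simp: power_0_left)
    next
      case False
      have "(\<integral>\<^sup>+t. ennreal (V * c * t ^ (c - 1)) * indicator {0..s} t \<partial>lborel) = (\<integral>\<^sup>+t. 0 \<partial>(lborel::real measure))"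
      proof (rule nn_integral_cong_AE)
        have "AE t in lborel. t \<noteq> (0::real)" by (rule AE_lborel_singleton)
        then show "AE t in lborel. ennreal (V * c * t ^ (c - 1)) * indicator {0..s} t = 0"
        proof eventually_elim
          case (elim t)
          then show ?case using False by (auto split: split_indicator)
        qed
      qed
      then show ?thesis using False by simp
    qed
    finally show ?thesis .
  qed
  have eq: "distr (leb I) borel N = D"
  proof (rule measure_eqI_generator_eq[where E = "range (\<lambda>s::real. {..s})" and \<Omega> = UNIV and A = "\<lambda>n. {..real n}"])
    show "Int_stable (range (\<lambda>s::real. {..s}))" by (auto simp: Int_stable_def min_def)
    show "sets (distr (leb I) borel N) = sigma_sets UNIV (range (\<lambda>s::real. {..s}))"
      by (simp add: borel_eq_atMost)
    show "sets D = sigma_sets UNIV (range (\<lambda>s::real. {..s}))"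
      by (simp add: D_def borel_eq_atMost)
    show "(\<Union>n. {..real n}) = UNIV" using real_arch_simple by auto
    have dB: "emeasure (distr (leb I) borel N) {..s} = emeasure (leb I) (B s)" for s
      by (subst emeasure_distr) (auto simp: B_def vimage_def intro!: arg_cong2[where f=emeasure])
    show "emeasure (distr (leb I) borel N) X = emeasure D X" if "X \<in> range (\<lambda>s::real. {..s})" for X
      using that dB Ds Bs B0 by auto
    show "emeasure (distr (leb I) borel N) {..real n} \<noteq> \<infinity>" for n
      using dB Bs[of "real n"] B0[of "real n"] by (cases "n = 0") auto
  qed auto
  show thesis
  proof (rule that[of "V * c"])
    show "V * c \<ge> 0" using V0 by simp
    fix G :: "real \<Rightarrow> ennreal" assume G[measurable]: "G \<in> borel_measurable borel"
    have "(\<integral>\<^sup>+x. G (N x) \<partial>leb I) = (\<integral>\<^sup>+s. G s \<partial>distr (leb I) borel N)"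
      by (subst nn_integral_distr) auto
    also have "\<dots> = (\<integral>\<^sup>+s. ennreal (V * c * s ^ (c - 1)) * indicator {0<..} s * G s \<partial>lborel)"
      unfolding eq D_def by (rule nn_integral_density) auto
    also have "\<dots> = (\<integral>\<^sup>+s. ennreal (V * c) * (G s * ennreal (s ^ (c - 1)) * indicator {0<..} s) \<partial>lborel)"
      using V0 by (intro nn_integral_cong) (auto simp: ennreal_mult' mult_ac split: split_indicator)
    also have "\<dots> = ennreal (V * c) * (\<integral>\<^sup>+s. G s * ennreal (s ^ (c - 1)) * indicator {0<..} s \<partial>lborel)"
      by (rule nn_integral_cmult) measurable
    finally show "(\<integral>\<^sup>+x. G (N x) \<partial>leb I) = ennreal (V * c) * (\<integral>\<^sup>+s. G s * ennreal (s ^ (c - 1)) * indicator {0<..} s \<partial>lborel)" .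
  qed
qed

section \<open>Gaussian laws as affine images\<close>

text \<open>A trivial kernel gives a nonzero determinant and hence an inverse. The result is handed
  back as functions of two indices, so that later computations are plain sums without carrier
  conditions.\<close>

lemma two_sided_inverse_exists:
  fixes F :: "nat \<Rightarrow> nat \<Rightarrow> real"
  assumes inj: "\<And>v. (\<And>i. i < n \<Longrightarrow> (\<Sum>j<n. F i j * v j) = 0) \<Longrightarrow> (\<And>j. j < n \<Longrightarrow> v j = 0)"
  obtains G where "\<And>i k. i < n \<Longrightarrow> k < n \<Longrightarrow> (\<Sum>j<n. F i j * G j k) = (if i = k then 1 else 0)"
    "\<And>i k. i < n \<Longrightarrow> k < n \<Longrightarrow> (\<Sum>j<n. G i j * F j k) = (if i = k then 1 else 0)"
proof -
  define A where "A = Matrix.mat n n (\<lambda>(i, j). F i j)"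
  have A: "A \<in> carrier_mat n n" by (simp add: A_def)
  have "Determinant.det A \<noteq> 0"
  proof
    assume "Determinant.det A = 0"
    then obtain v where v: "v \<in> carrier_vec n" "v \<noteq> 0\<^sub>v n" "A *\<^sub>v v = 0\<^sub>v n"
      using det_0_iff_vec_prod_zero_field[OF A] by auto
    have "(\<Sum>j<n. F i j * vec_index v j) = 0" if i: "i < n" for i
    proof -
      have "vec_index (A *\<^sub>v v) i = (\<Sum>j<n. F i j * vec_index v j)"
        using i v(1) by (simp add: A_def scalar_prod_def atLeast0LessThan)
      then show ?thesis using v(3) i by simp
    qed
    from inj[of "vec_index v", OF this] have "v = 0\<^sub>v n"
      using v(1) by (intro eq_vecI) auto
    with v(2) show False ..
  qed
  then have "A \<in> Units (ring_mat TYPE(real) n ())"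
    using det_non_zero_imp_unit[OF A] by simp
  then have "mat_inverse A \<noteq> None"
    using mat_inverse(1)[OF A, where b = "()"] by auto
  then obtain B where "mat_inverse A = Some B" by auto
  from mat_inverse(2)[OF A this] have B: "A * B = 1\<^sub>m n" "B * A = 1\<^sub>m n" "B \<in> carrier_mat n n" by auto
  have 1: "(\<Sum>j<n. F i j * B $$ (j, k)) = (if i = k then 1 else 0)" if "i < n" "k < n" for i k
  proof -
    have "(A * B) $$ (i, k) = (\<Sum>j<n. F i j * B $$ (j, k))"
      using that B(3) by (simp add: A_def scalar_prod_def atLeast0LessThan)
    then show ?thesis using B(1) that by simp
  qed
  have 2: "(\<Sum>j<n. B $$ (i, j) * F j k) = (if i = k then 1 else 0)" if "i < n" "k < n" for i k
  proof -
    have "(B * A) $$ (i, k) = (\<Sum>j<n. B $$ (i, j) * F j k)"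
      using that B(3) by (simp add: A_def scalar_prod_def atLeast0LessThan)
    then show ?thesis using B(2) that by simp
  qed
  show thesis using that[of "\<lambda>i j. B $$ (i, j)", OF 1 2] by blast
qed

lemma sum_mult_delta_left:
  fixes f :: "nat \<Rightarrow> real"
  assumes "i < n" shows "(\<Sum>k<n. (if i = k then 1 else 0) * f k) = f i"
  using assms by (simp add: if_distrib[of "\<lambda>x. x * _"] cong: if_cong)

lemma linear_inverse_apply:
  fixes F G :: "nat \<Rightarrow> nat \<Rightarrow> real"
  assumes FG: "\<And>i k. i < n \<Longrightarrow> k < n \<Longrightarrow> (\<Sum>j<n. F i j * G j k) = (if i = k then 1 else 0)" and i: "i < n"
  shows "(\<Sum>j<n. F i j * (\<Sum>k<n. G j k * x k)) = x i"
proof -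
  have "(\<Sum>j<n. F i j * (\<Sum>k<n. G j k * x k)) = (\<Sum>j<n. \<Sum>k<n. F i j * G j k * x k)"
    by (simp add: sum_distrib_left mult.assoc)
  also have "\<dots> = (\<Sum>k<n. \<Sum>j<n. F i j * G j k * x k)" by (rule sum.swap)
  also have "\<dots> = (\<Sum>k<n. (\<Sum>j<n. F i j * G j k) * x k)" by (simp add: sum_distrib_right)
  also have "\<dots> = (\<Sum>k<n. (if i = k then 1 else 0) * x k)" by (intro sum.cong refl) (simp add: FG i)
  also have "\<dots> = x i" by (rule sum_mult_delta_left[OF i])
  finally show ?thesis .
qed

text \<open>Cholesky factorisation by induction on the index set: splitting off \<open>s\<close>
  leaves the Schur complement \<open>B'\<close>, which is again symmetric and positive
  definite.\<close>

lemma symmetric_root_exists: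
  fixes B :: "'i \<Rightarrow> 'i \<Rightarrow> real"
  assumes "finite S" and "\<And>i j. i \<in> S \<Longrightarrow> j \<in> S \<Longrightarrow> B i j = B j i"
    and "\<And>v. (\<exists>i\<in>S. v i \<noteq> 0) \<Longrightarrow> (\<Sum>i\<in>S. \<Sum>j\<in>S. B i j * v i * v j) > 0"
  shows "\<exists>c. \<forall>i\<in>S. \<forall>j\<in>S. B i j = (\<Sum>k\<in>S. c i k * c j k)"
  using assms
proof (induction S arbitrary: B rule: finite_induct)
  case empty
  then show ?case by simp
next
  case (insert s S)
  note sym = insert.prems(1) and pd = insert.prems(2)
  define b where "b = B s s"
  have split: "(\<Sum>i\<in>insert s S. \<Sum>j\<in>insert s S. B i j * v i * v j) =
    b * (v s)\<^sup>2 + 2 * v s * (\<Sum>j\<in>S. B j s * v j) + (\<Sum>i\<in>S. \<Sum>j\<in>S. B i j * v i * v j)" for v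
  proof -
    have "(\<Sum>j\<in>S. B s j * v s * v j) = v s * (\<Sum>j\<in>S. B j s * v j)"
      unfolding sum_distrib_left using sym by (intro sum.cong) auto
    moreover have "(\<Sum>i\<in>S. B i s * v i * v s) = v s * (\<Sum>j\<in>S. B j s * v j)"
      unfolding sum_distrib_left by (intro sum.cong) auto
    ultimately show ?thesis
      using insert.hyps by (simp add: sum.distrib b_def power2_eq_square)
  qed
  have b: "b > 0"
    using pd[of "\<lambda>i. if i = s then 1 else 0"] split[of "\<lambda>i. if i = s then 1 else 0"] insert.hyps
    by (auto simp: if_distrib[of "\<lambda>x. _ * x"] if_distrib[of "\<lambda>x. x * _"] sum.delta cong: if_cong split: if_splits)
  define B' where "B' i j = B i j - B i s * B j s / b" for i j
  have "\<exists>c. \<forall>i\<in>S. \<forall>j\<in>S. B' i j = (\<Sum>k\<in>S. c i k * c j k)"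
  proof (rule insert.IH)
    show "B' i j = B' j i" if "i \<in> S" "j \<in> S" for i j
      using sym that by (simp add: B'_def)
    fix v :: "'i \<Rightarrow> real" assume "\<exists>i\<in>S. v i \<noteq> 0"
    then obtain i where i: "i \<in> S" "v i \<noteq> 0" by auto
    define q where "q = (\<Sum>j\<in>S. B j s * v j)"
    \<comment> \<open>The value -q / b minimises the form over the coordinate s, and the minimum is
      the form of the Schur complement at v.\<close>
    define v' where "v' = v(s := - q / b)"
    have v'S: "j \<in> S \<Longrightarrow> v' j = v j" for j using insert.hyps by (auto simp: v'_def)
    have "0 < (\<Sum>i\<in>insert s S. \<Sum>j\<in>insert s S. B i j * v' i * v' j)"
      using i v'S by (intro pd bexI[of _ i]) auto
    also have "\<dots> = b * (q / b)\<^sup>2 - 2 * (q / b) * q + (\<Sum>i\<in>S. \<Sum>j\<in>S. B i j * v i * v j)"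
      unfolding split by (simp add: v'S q_def[symmetric]) (simp add: v'_def)
    also have "b * (q / b)\<^sup>2 - 2 * (q / b) * q = - (q * q / b)"
      using b by (simp add: power2_eq_square field_simps)
    also have "q * q / b = (\<Sum>i\<in>S. \<Sum>j\<in>S. (B i s * B j s / b) * v i * v j)"
      unfolding q_def sum_product sum_divide_distrib by (intro sum.cong refl) simp
    also have "- \<dots> + (\<Sum>i\<in>S. \<Sum>j\<in>S. B i j * v i * v j) = (\<Sum>i\<in>S. \<Sum>j\<in>S. B' i j * v i * v j)"
      by (simp add: B'_def algebra_simps sum_subtractf)
    finally show "(\<Sum>i\<in>S. \<Sum>j\<in>S. B' i j * v i * v j) > 0" .
  qed
  then obtain c' where c': "\<And>i j. i \<in> S \<Longrightarrow> j \<in> S \<Longrightarrow> B' i j = (\<Sum>k\<in>S. c' i k * c' j k)" by blast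
  \<comment> \<open>Column s carries the rank one part that was subtracted; row s vanishes off that
    column, and the remaining square is the factor given by induction.\<close>
  define c where "c i k = (if k = s then B i s / sqrt b else if i = s then 0 else c' i k)" for i k
  have cs: "c i s = B i s / sqrt b" for i by (simp add: c_def)
  have eq: "(\<Sum>k\<in>insert s S. c i k * c j k) = B i s * B j s / b + (\<Sum>k\<in>S. c i k * c j k)" for i j
    using insert.hyps b by (simp add: cs)
  have z: "(\<Sum>k\<in>S. c i k * c j k) = 0" if "i = s \<or> j = s" for i j
    using that insert.hyps by (intro sum.neutral) (auto simp: c_def)
  have nz: "(\<Sum>k\<in>S. c i k * c j k) = B' i j" if "i \<in> S" "j \<in> S" for i j
    unfolding c'[OF that] using that insert.hyps by (intro sum.cong) (auto simp: c_def)
  show ?case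
  proof (intro exI[of _ c] ballI)
    fix i j assume ij: "i \<in> insert s S" "j \<in> insert s S"
    consider "i = s" | "j = s" | "i \<in> S" "j \<in> S" using ij by auto
    then show "B i j = (\<Sum>k\<in>insert s S. c i k * c j k)"
    proof cases
      case 1 then show ?thesis unfolding eq using z[of i j] b sym[OF ij] by (simp add: b_def)
    next
      case 2 then show ?thesis unfolding eq using z[of i j] b by (simp add: b_def)
    next
      case 3 then show ?thesis unfolding eq nz[OF 3] by (simp add: B'_def)
    qed
  qed
qed

lemma stdg_density:
  assumes I: "finite I"
  shows "stdg I = density (leb I) (\<lambda>x. ennreal ((1 / sqrt (2 * pi)) ^ card I * exp (- (\<Sum>i\<in>I. (x i)\<^sup>2) / 2)))"
proof -
  interpret N: product_sigma_finite "\<lambda>_. std_normal_distribution"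
    unfolding product_sigma_finite_def by (intro allI prob_space_imp_sigma_finite) simp
  have eq: "ennreal ((1 / sqrt (2 * pi)) ^ card I * exp (- (\<Sum>i\<in>I. (x i)\<^sup>2) / 2)) = (\<Prod>i\<in>I. ennreal (std_normal_density (x i)))" for x :: "'a \<Rightarrow> real"
  proof -
    have "(\<Prod>i\<in>I. std_normal_density (x i)) = (1 / sqrt (2 * pi)) ^ card I * (\<Prod>i\<in>I. exp (- (x i)\<^sup>2 / 2))"
      unfolding std_normal_density_def prod.distrib by simp
    also have "(\<Prod>i\<in>I. exp (- (x i)\<^sup>2 / 2)) = exp (- (\<Sum>i\<in>I. (x i)\<^sup>2) / 2)"
      using I by (simp add: exp_sum[symmetric] sum_negf sum_divide_distrib)
    finally show ?thesis by (simp add: prod_ennreal)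
  qed
  have m: "(\<lambda>x. \<Prod>i\<in>I. ennreal (std_normal_density (x i))) \<in> borel_measurable (leb I)"
    by (intro borel_measurable_prod_ennreal) simp
  have "density (leb I) (\<lambda>x. \<Prod>i\<in>I. ennreal (std_normal_density (x i))) = stdg I"
  proof (rule N.PiM_eqI[OF I])
    show "sets (density (leb I) (\<lambda>x. \<Prod>i\<in>I. ennreal (std_normal_density (x i)))) = sets (stdg I)"
      by (auto intro!: sets_PiM_cong)
    fix A :: "'a \<Rightarrow> real set" assume A: "\<And>i. i \<in> I \<Longrightarrow> A i \<in> sets std_normal_distribution"
    have "emeasure (density (leb I) (\<lambda>x. \<Prod>i\<in>I. ennreal (std_normal_density (x i)))) (Pi\<^sub>E I A) =
      (\<integral>\<^sup>+x. (\<Prod>i\<in>I. ennreal (std_normal_density (x i))) * indicator (Pi\<^sub>E I A) x \<partial>leb I)"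
      using A I by (intro emeasure_density m) (auto intro!: sets_PiM_I_finite)
    also have "\<dots> = (\<integral>\<^sup>+x. (\<Prod>i\<in>I. ennreal (std_normal_density (x i)) * indicator (A i) (x i)) \<partial>leb I)"
    proof (rule nn_integral_cong)
      fix x assume x: "x \<in> space (leb I)"
      have "(indicator (Pi\<^sub>E I A) x :: ennreal) = (\<Prod>i\<in>I. indicator (A i) (x i))"
        using x I by (auto simp: indicator_def space_PiM PiE_iff prod_zero_iff intro!: prod.neutral[symmetric])
      then show "(\<Prod>i\<in>I. ennreal (std_normal_density (x i))) * indicator (Pi\<^sub>E I A) x =
        (\<Prod>i\<in>I. ennreal (std_normal_density (x i)) * indicator (A i) (x i))"
        by (simp add: prod.distrib)
    qed
    also have "\<dots> = (\<Prod>i\<in>I. \<integral>\<^sup>+y. ennreal (std_normal_density y) * indicator (A i) y \<partial>lborel)"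
      using A I by (intro leb.product_nn_integral_prod) auto
    also have "\<dots> = (\<Prod>i\<in>I. emeasure std_normal_distribution (A i))"
      using A by (intro prod.cong refl) (auto simp: emeasure_density)
    finally show "emeasure (density (leb I) (\<lambda>x. \<Prod>i\<in>I. ennreal (std_normal_density (x i)))) (Pi\<^sub>E I A) =
      (\<Prod>i\<in>I. emeasure std_normal_distribution (A i))" .
  qed
  then show ?thesis unfolding eq by simp
qed

definition affine_map :: "nat \<Rightarrow> (nat \<Rightarrow> real) \<Rightarrow> (nat \<Rightarrow> nat \<Rightarrow> real) \<Rightarrow> (nat \<Rightarrow> real) \<Rightarrow> (nat \<Rightarrow> real)" where
  "affine_map d m a x = (\<lambda>i\<in>{..<d}. m i + (\<Sum>k<d. a i k * x k))"

lemma affine_map_measurable [measurable]: "affine_map d m a \<in> leb {..<d} \<rightarrow>\<^sub>M leb {..<d}"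
  unfolding affine_map_def by (intro measurable_restrict) measurable

text \<open>Here c is 1 / |det a|. It depends neither on f nor on the translation m, which is all
  that is needed for it to cancel when a density is normalised.\<close>

lemma leb_linear_bij:
  fixes a h :: "nat \<Rightarrow> nat \<Rightarrow> real"
  assumes ah: "\<And>i k. i < d \<Longrightarrow> k < d \<Longrightarrow> (\<Sum>j<d. a i j * h j k) = (if i = k then 1 else 0)"
    and ha: "\<And>i k. i < d \<Longrightarrow> k < d \<Longrightarrow> (\<Sum>j<d. h i j * a j k) = (if i = k then 1 else 0)"
  obtains c :: real where "c > 0" "\<And>f m. f \<in> borel_measurable (leb {..<d}) \<Longrightarrow>
    (\<integral>\<^sup>+x. f (affine_map d m a x) \<partial>leb {..<d}) = ennreal c * (\<integral>\<^sup>+x. f x \<partial>leb {..<d})"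
proof -
  let ?T = "affine_map d (\<lambda>_. 0) a" and ?U = "affine_map d (\<lambda>_. 0) h"
  have TU: "?T (?U x) = x" if "x \<in> space (leb {..<d})" for x
  proof
    fix i show "?T (?U x) i = x i"
      using that linear_inverse_apply[OF ah, of i x] by (cases "i < d") (auto simp: affine_map_def space_PiM PiE_iff extensional_def)
  qed
  have UT: "?U (?T x) = x" if "x \<in> space (leb {..<d})" for x
  proof
    fix i show "?U (?T x) i = x i"
      using that linear_inverse_apply[OF ha, of i x] by (cases "i < d") (auto simp: affine_map_def space_PiM PiE_iff extensional_def)
  qed
  have add: "?T (\<lambda>i\<in>{..<d}. x i + y i) = (\<lambda>i\<in>{..<d}. ?T x i + ?T y i)" for x y
    by (auto simp: affine_map_def fun_eq_iff algebra_simps sum.distrib)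
  obtain c :: real where c: "c > 0" "\<And>f. f \<in> borel_measurable (leb {..<d}) \<Longrightarrow>
      (\<integral>\<^sup>+x. f (?T x) \<partial>leb {..<d}) = ennreal c * (\<integral>\<^sup>+x. f x \<partial>leb {..<d})"
    using leb_additive_bij[of "{..<d}" ?T ?U, OF _ affine_map_measurable affine_map_measurable TU UT add] by blast
  have "(\<integral>\<^sup>+x. f (affine_map d m a x) \<partial>leb {..<d}) = ennreal c * (\<integral>\<^sup>+x. f x \<partial>leb {..<d})"
    if f[measurable]: "f \<in> borel_measurable (leb {..<d})" for f m
  proof -
    have [measurable]: "(\<lambda>x. \<lambda>i\<in>{..<d}. x i + m i) \<in> leb {..<d} \<rightarrow>\<^sub>M leb {..<d}"
      by measurable
    have "(\<integral>\<^sup>+x. f (affine_map d m a x) \<partial>leb {..<d}) = (\<integral>\<^sup>+x. f (\<lambda>i\<in>{..<d}. ?T x i + m i) \<partial>leb {..<d})"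
      by (intro nn_integral_cong arg_cong[where f=f]) (auto simp: affine_map_def fun_eq_iff)
    also have "\<dots> = ennreal c * (\<integral>\<^sup>+x. f (\<lambda>i\<in>{..<d}. x i + m i) \<partial>leb {..<d})"
      by (rule c(2)) measurable
    also have "(\<integral>\<^sup>+x. f (\<lambda>i\<in>{..<d}. x i + m i) \<partial>leb {..<d}) = (\<integral>\<^sup>+x. f x \<partial>leb {..<d})"
      by (rule leb_translate) auto
    finally show ?thesis .
  qed
  with c(1) show thesis using that by blast
qed

lemma lborel_dim_eq: "lborel_dim d = leb {..<d}"
  by (simp add: lborel_dim_def)

text \<open>With \<Sigma> = a a^T and h the inverse of a, the inverse covariance is h^T h, so the
  unnormalised density at \<mu> + a x is exp (-|x|^2 / 2). Hence the image of the standard Gaussian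
  has a density proportional to the required one.\<close>

lemma gaussian_eq_distr:
  assumes mu: "\<mu> \<in> carrier_vec d" and pd: "positive_definite d \<Sigma>"
  obtains a where "gaussian d \<mu> \<Sigma> = distr (stdg {..<d}) (lborel_dim d) (affine_map d (vec_index \<mu>) a)"
proof -
  obtain B where B: "mat_inverse \<Sigma> = Some B" "B \<in> carrier_mat d d" "\<Sigma> * B = 1\<^sub>m d" "B * \<Sigma> = 1\<^sub>m d"
    using positive_definite_mat_inverse[OF pd] .
  have S: "\<Sigma> \<in> carrier_mat d d" "transpose_mat \<Sigma> = \<Sigma>"
    using pd by (auto simp: positive_definite_def)
  have quad: "scalar_prod v (\<Sigma> *\<^sub>v v) = (\<Sum>i<d. \<Sum>j<d. \<Sigma> $$ (i, j) * vec_index v i * vec_index v j)" if "v \<in> carrier_vec d" for v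
    using S(1) that by (simp add: scalar_prod_def atLeast0LessThan sum_distrib_left mult_ac)
  have pos: "(\<Sum>i\<in>{..<d}. \<Sum>j\<in>{..<d}. \<Sigma> $$ (i, j) * v i * v j) > 0" if "\<exists>i\<in>{..<d}. v i \<noteq> 0" for v
  proof -
    from that obtain i where i: "i < d" "v i \<noteq> 0" by auto
    have "Matrix.vec d v \<noteq> 0\<^sub>v d"
      using i by (metis index_vec index_zero_vec(1))
    then have "scalar_prod (Matrix.vec d v) (\<Sigma> *\<^sub>v Matrix.vec d v) > 0"
      using pd by (auto simp: positive_definite_def)
    then show ?thesis by (subst (asm) quad) auto
  qed
  have "\<exists>a. \<forall>i\<in>{..<d}. \<forall>j\<in>{..<d}. \<Sigma> $$ (i, j) = (\<Sum>k\<in>{..<d}. a i k * a j k)"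
  proof (rule symmetric_root_exists)
    show "\<Sigma> $$ (i, j) = \<Sigma> $$ (j, i)" if "i \<in> {..<d}" "j \<in> {..<d}" for i j
      using S that by (metis carrier_matD index_transpose_mat(1) lessThan_iff)
  qed (use pos in auto)
  then obtain a where a: "\<And>i j. i < d \<Longrightarrow> j < d \<Longrightarrow> \<Sigma> $$ (i, j) = (\<Sum>k<d. a i k * a j k)" by blast
  obtain G where G: "\<And>i k. i < d \<Longrightarrow> k < d \<Longrightarrow> (\<Sum>j<d. a j i * G j k) = (if i = k then 1 else 0)"
    "\<And>i k. i < d \<Longrightarrow> k < d \<Longrightarrow> (\<Sum>j<d. G i j * a k j) = (if i = k then 1 else 0)"
  proof (rule two_sided_inverse_exists[of d "\<lambda>i j. a j i"])
    fix v :: "nat \<Rightarrow> real" and j assume v: "\<And>i. i < d \<Longrightarrow> (\<Sum>j<d. a j i * v j) = 0" and j: "j < d"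
    \<comment> \<open>The form of \<Sigma> at v is |a^T v|^2, so a vector in the kernel of a^T
      vanishes by definiteness.\<close>
    have "(\<Sum>i<d. \<Sum>j<d. \<Sigma> $$ (i, j) * v i * v j) = (\<Sum>i<d. \<Sum>j<d. \<Sum>k<d. (a i k * v i) * (a j k * v j))"
      by (intro sum.cong refl) (simp add: a sum_distrib_left sum_distrib_right mult_ac)
    also have "\<dots> = (\<Sum>i<d. \<Sum>k<d. \<Sum>j<d. (a i k * v i) * (a j k * v j))"
      by (intro sum.cong refl sum.swap)
    also have "\<dots> = (\<Sum>k<d. \<Sum>i<d. \<Sum>j<d. (a i k * v i) * (a j k * v j))" by (rule sum.swap)
    also have "\<dots> = (\<Sum>k<d. (\<Sum>i<d. a i k * v i) * (\<Sum>j<d. a j k * v j))" by (simp add: sum_product)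
    also have "\<dots> = 0" using v by (intro sum.neutral) auto
    finally show "v j = 0" using pos[of v] j by (metis lessThan_iff less_irrefl)
  qed blast
  define h where "h i j = G j i" for i j
  have ha: "(\<Sum>j<d. h i j * a j k) = (if i = k then 1 else 0)" if "i < d" "k < d" for i k
    using G(1)[OF that(2,1)] by (simp add: h_def mult.commute)
  have ah: "(\<Sum>j<d. a i j * h j k) = (if i = k then 1 else 0)" if "i < d" "k < d" for i k
    using G(2)[OF that(2,1)] by (simp add: h_def mult.commute)
  define A where "A = Matrix.mat d d (\<lambda>(i, j). a i j)"
  define H where "H = Matrix.mat d d (\<lambda>(i, j). h i j)"
  have A: "A \<in> carrier_mat d d" and H: "H \<in> carrier_mat d d" by (auto simp: A_def H_def)
  have AH: "A * H = 1\<^sub>m d" by (rule eq_matI) (auto simp: A_def H_def scalar_prod_def atLeast0LessThan ah)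
  have HA: "H * A = 1\<^sub>m d" by (rule eq_matI) (auto simp: A_def H_def scalar_prod_def atLeast0LessThan ha)
  have SA: "\<Sigma> = A * transpose_mat A"
    using S by (intro eq_matI) (auto simp: A_def scalar_prod_def atLeast0LessThan a)
  have "\<Sigma> * (transpose_mat H * H) = A * (transpose_mat A * transpose_mat H) * H"
    unfolding SA using A H by (simp add: assoc_mult_mat[of _ d d _ d _ d])
  also have "transpose_mat A * transpose_mat H = 1\<^sub>m d"
    using transpose_mult[OF H A] HA by simp
  finally have "\<Sigma> * (transpose_mat H * H) = 1\<^sub>m d" using A H AH by simp
  then have "B * (\<Sigma> * (transpose_mat H * H)) = B" using B by simp
  then have BH: "B = transpose_mat H * H"
    using B S H assoc_mult_mat[of B d d \<Sigma> d "transpose_mat H * H" d] by simp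
  have w: "gaussian_weight d \<mu> \<Sigma> (affine_map d (vec_index \<mu>) a x) = exp (- (\<Sum>i<d. (x i)\<^sup>2) / 2)" for x
  proof -
    define v where "v = Matrix.vec d (affine_map d (vec_index \<mu>) a x) - \<mu>"
    have v: "v \<in> carrier_vec d" using mu by (simp add: v_def)
    have vi: "vec_index v i = (\<Sum>k<d. a i k * x k)" if "i < d" for i
      using that mu by (simp add: v_def affine_map_def)
    have Hv: "vec_index (H *\<^sub>v v) i = x i" if i: "i < d" for i
    proof -
      have "vec_index (H *\<^sub>v v) i = (\<Sum>j<d. h i j * vec_index v j)"
        using i v by (simp add: H_def scalar_prod_def atLeast0LessThan)
      also have "\<dots> = (\<Sum>j<d. h i j * (\<Sum>k<d. a j k * x k))" by (intro sum.cong refl) (simp add: vi)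
      also have "\<dots> = x i" by (rule linear_inverse_apply[OF ha i])
      finally show ?thesis .
    qed
    have "scalar_prod v (B *\<^sub>v v) = scalar_prod v (transpose_mat H *\<^sub>v (H *\<^sub>v v))"
      unfolding BH using H v by (simp add: assoc_mult_mat_vec[of _ d d _ d])
    also have "\<dots> = scalar_prod (transpose_mat H *\<^sub>v (H *\<^sub>v v)) v"
      using H v by (intro comm_scalar_prod[of _ d]) auto
    also have "\<dots> = scalar_prod (H *\<^sub>v v) (H *\<^sub>v v)"
      using transpose_vec_mult_scalar[OF H v, of "H *\<^sub>v v"] H v by auto
    also have "\<dots> = (\<Sum>i<d. (x i)\<^sup>2)"
      using H v by (simp add: scalar_prod_def atLeast0LessThan Hv[simplified] power2_eq_square del: index_mult_mat_vec)
    finally show ?thesis by (simp add: gaussian_weight_def Let_def B(1) v_def[symmetric])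
  qed
  define W where "W = gaussian_weight d \<mu> \<Sigma>"
  have Wm[measurable]: "W \<in> borel_measurable (leb {..<d})"
  proof -
    have "W = (\<lambda>x. exp (- (\<Sum>i<d. (x i - vec_index \<mu> i) * (\<Sum>j<d. B $$ (i, j) * (x j - vec_index \<mu> j))) / 2))"
      using B mu by (auto simp: fun_eq_iff W_def gaussian_weight_def Let_def scalar_prod_def atLeast0LessThan)
    then show ?thesis by simp
  qed
  define c0 where "c0 = (1 / sqrt (2 * pi)) ^ d"
  have c0: "c0 > 0" by (simp add: c0_def)
  obtain c :: real where c: "c > 0" "\<And>f m. f \<in> borel_measurable (leb {..<d}) \<Longrightarrow>
    (\<integral>\<^sup>+x. f (affine_map d m a x) \<partial>leb {..<d}) = ennreal c * (\<integral>\<^sup>+x. f x \<partial>leb {..<d})"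
    using leb_linear_bij[OF ah ha] by blast
  let ?T = "affine_map d (vec_index \<mu>) a"
  have Tm[measurable]: "?T \<in> stdg {..<d} \<rightarrow>\<^sub>M lborel_dim d"
    using affine_map_measurable by (simp add: lborel_dim_eq cong: measurable_cong_sets)
  have em: "emeasure (distr (stdg {..<d}) (lborel_dim d) ?T) E = (\<integral>\<^sup>+y. ennreal (c * c0 * W y) * indicator E y \<partial>leb {..<d})"
    if E: "E \<in> sets (lborel_dim d)" for E
  proof -
    have E'[measurable]: "E \<in> sets (leb {..<d})" using E by (simp add: lborel_dim_eq)
    have "emeasure (distr (stdg {..<d}) (lborel_dim d) ?T) E = (\<integral>\<^sup>+x. indicator E x \<partial>distr (stdg {..<d}) (lborel_dim d) ?T)"
      using E by simp
    also have "\<dots> = (\<integral>\<^sup>+x. indicator E (?T x) \<partial>stdg {..<d})"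
      using E by (intro nn_integral_distr) auto
    also have "\<dots> = (\<integral>\<^sup>+x. ennreal (c0 * exp (- (\<Sum>i<d. (x i)\<^sup>2) / 2)) * indicator E (?T x) \<partial>leb {..<d})"
      unfolding stdg_density[OF finite_lessThan] c0_def by (subst nn_integral_density) auto
    also have "\<dots> = (\<integral>\<^sup>+x. (\<lambda>y. ennreal (c0 * W y) * indicator E y) (?T x) \<partial>leb {..<d})"
      unfolding W_def by (simp add: w)
    also have "\<dots> = ennreal c * (\<integral>\<^sup>+y. ennreal (c0 * W y) * indicator E y \<partial>leb {..<d})"
      by (rule c(2)) measurable
    also have "\<dots> = (\<integral>\<^sup>+y. ennreal c * (ennreal (c0 * W y) * indicator E y) \<partial>leb {..<d})"
      by (rule nn_integral_cmult[symmetric]) measurable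
    also have "\<dots> = (\<integral>\<^sup>+y. ennreal (c * c0 * W y) * indicator E y \<partial>leb {..<d})"
      using c(1) by (intro nn_integral_cong) (simp add: ennreal_mult' mult.assoc)
    finally show ?thesis .
  qed
  have W0: "W x > 0" for x by (simp add: W_def gaussian_weight_def Let_def)
  interpret D: prob_space "distr (stdg {..<d}) (lborel_dim d) ?T"
    by (rule prob_space.prob_space_distr) auto
  \<comment> \<open>The image is a probability measure. This evaluates the integral in the
    denominator of the definition without computing a determinant.\<close>
  have "1 = (\<integral>\<^sup>+y. ennreal (c * c0) * ennreal (W y) \<partial>leb {..<d})"
    using D.emeasure_space_1 em[of "space (lborel_dim d)"] c(1) c0
    by (simp add: lborel_dim_eq ennreal_mult' cong: nn_integral_cong)
  also have "\<dots> = ennreal (c * c0) * (\<integral>\<^sup>+y. ennreal (W y) \<partial>leb {..<d})"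
    by (rule nn_integral_cmult) measurable
  finally have tot: "ennreal (c * c0) * (\<integral>\<^sup>+y. ennreal (W y) \<partial>leb {..<d}) = 1" ..
  have "(\<integral>\<^sup>+y. ennreal (W y) \<partial>leb {..<d}) = ennreal (1 / (c * c0)) * (ennreal (c * c0) * (\<integral>\<^sup>+y. ennreal (W y) \<partial>leb {..<d}))"
    using c(1) c0 by (simp add: mult.assoc[symmetric] ennreal_mult'[symmetric])
  also have "\<dots> = ennreal (1 / (c * c0))" by (simp add: tot)
  finally have "(\<integral>y. W y \<partial>leb {..<d}) = 1 / (c * c0)"
    using W0 c(1) c0 by (subst integral_eq_nn_integral) (auto simp: less_imp_le)
  then have dens: "W x / (\<integral>y. W y \<partial>lborel_dim d) = c * c0 * W x" for x by (simp add: lborel_dim_eq)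
  have "gaussian d \<mu> \<Sigma> = distr (stdg {..<d}) (lborel_dim d) ?T"
  proof (rule measure_eqI)
    fix E assume "E \<in> sets (gaussian d \<mu> \<Sigma>)"
    then have E: "E \<in> sets (lborel_dim d)" by (simp add: gaussian_def)
    have "emeasure (gaussian d \<mu> \<Sigma>) E = (\<integral>\<^sup>+y. ennreal (c * c0 * W y) * indicator E y \<partial>leb {..<d})"
      unfolding gaussian_def W_def[symmetric] dens using E by (subst emeasure_density) (auto simp: lborel_dim_eq)
    then show "emeasure (gaussian d \<mu> \<Sigma>) E = emeasure (distr (stdg {..<d}) (lborel_dim d) ?T) E"
      using em[OF E] by simp
  qed (simp add: gaussian_def)
  then show thesis by (rule that)
qed

section \<open>Projections of the sphere\<close>

definition qf :: "(nat \<Rightarrow> nat \<Rightarrow> real) \<Rightarrow> nat \<Rightarrow> (nat \<Rightarrow> real) \<Rightarrow> real" where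
  "qf H d v = (\<Sum>j<d. v j * (\<Sum>k<d. H j k * v k))"

lemma qf_measurable [measurable]: "qf H d \<in> borel_measurable (leb {..<d})"
  unfolding qf_def by measurable

lemma qf_scale: "qf H d (\<lambda>j\<in>{..<d}. s * v j) = s\<^sup>2 * qf H d v"
  by (simp add: qf_def sum_distrib_left power2_eq_square mult_ac)

context
  fixes Z :: "nat \<Rightarrow> nat \<Rightarrow> real" and Si :: "nat \<Rightarrow> nat \<Rightarrow> real" and d c b :: nat
  assumes c: "c \<ge> 1" and b: "b = d + 2 * c"
    and Si: "\<And>j l. j < d \<Longrightarrow> l < d \<Longrightarrow> (\<Sum>k<d. (\<Sum>i<b. Z i j * Z i k) * Si k l) = (if j = l then 1 else 0)"
    and lead: "\<And>v. (\<And>j. j < d \<Longrightarrow> (\<Sum>i<d. Z i j * v i) = 0) \<Longrightarrow> (\<And>i. i < d \<Longrightarrow> v i = 0)"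
begin

text \<open>\<open>hs v\<close> = Z S^-1 v, with S = Z^T Z, is the shortest h whose combination Z^T
  h is v. It lies in the column space of Z and is therefore orthogonal to every k with Z^T k = 0;
  the last claim is Pythagoras.\<close>

lemma min_norm_decomposition:
  fixes hs and v :: "nat \<Rightarrow> real"
  defines "hs \<equiv> \<lambda>v i. \<Sum>j<d. Z i j * (\<Sum>k<d. Si j k * v k)"
  shows "j < d \<Longrightarrow> (\<Sum>i<b. hs v i * Z i j) = v j"
    and "(\<Sum>i<b. (hs v i)\<^sup>2) = qf Si d v"
    and "(\<And>j. j < d \<Longrightarrow> (\<Sum>i<b. k i * Z i j) = 0) \<Longrightarrow> (\<Sum>i<b. (hs v i + k i)\<^sup>2) = qf Si d v + (\<Sum>i<b. (k i)\<^sup>2)"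
proof -
  define y where "y j = (\<Sum>k<d. Si j k * v k)" for j
  have hsy: "hs v i = (\<Sum>j<d. Z i j * y j)" for i by (simp add: hs_def y_def)
  have sw: "(\<Sum>i<b. hs v i * k i) = (\<Sum>j<d. y j * (\<Sum>i<b. k i * Z i j))" for k
  proof -
    have "(\<Sum>i<b. hs v i * k i) = (\<Sum>i<b. \<Sum>j<d. y j * (k i * Z i j))"
      unfolding hsy sum_distrib_right by (intro sum.cong refl) (simp add: mult_ac)
    also have "\<dots> = (\<Sum>j<d. \<Sum>i<b. y j * (k i * Z i j))" by (rule sum.swap)
    finally show ?thesis by (simp add: sum_distrib_left)
  qed
  have 1: "(\<Sum>i<b. hs v i * Z i j) = v j" if j: "j < d" for j
  proof -
    have "(\<Sum>i<b. hs v i * Z i j) = (\<Sum>l<d. (\<Sum>i<b. Z i j * Z i l) * y l)"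
      unfolding sw by (simp add: mult.commute)
    also have "\<dots> = v j"
      unfolding y_def by (rule linear_inverse_apply[where F = "\<lambda>j l. \<Sum>i<b. Z i j * Z i l", OF Si j])
    finally show ?thesis .
  qed
  then show "j < d \<Longrightarrow> (\<Sum>i<b. hs v i * Z i j) = v j" .
  have "(\<Sum>i<b. (hs v i)\<^sup>2) = (\<Sum>j<d. y j * (\<Sum>i<b. hs v i * Z i j))"
    using sw[of "hs v"] by (simp add: power2_eq_square)
  also have "\<dots> = (\<Sum>j<d. y j * v j)" by (intro sum.cong refl) (simp add: 1)
  finally show 2: "(\<Sum>i<b. (hs v i)\<^sup>2) = qf Si d v" by (simp add: qf_def y_def mult.commute)
  assume k: "\<And>j. j < d \<Longrightarrow> (\<Sum>i<b. k i * Z i j) = 0"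
  have "(\<Sum>i<b. hs v i * k i) = 0" unfolding sw using k by (intro sum.neutral) auto
  then have "(\<Sum>i<b. 2 * hs v i * k i) = 0" by (simp add: mult.assoc sum_distrib_left[symmetric])
  then show "(\<Sum>i<b. (hs v i + k i)\<^sup>2) = qf Si d v + (\<Sum>i<b. (k i)\<^sup>2)"
    by (simp add: power2_sum sum.distrib 2)
qed

lemma qf_nonneg: "qf Si d v \<ge> 0"
  unfolding min_norm_decomposition(2)[symmetric] by (intro sum_nonneg) simp

text \<open>The joint image of Lebesgue measure under v = Z^T h and |h|^2. Over each v the fibre is
  an affine space of dimension 2 c on which |h|^2 is the constant v^T S^-1 v plus a homogeneous
  quadratic form, and \<open>leb_homogeneous\<close> applies to the form.\<close>

lemma nn_integral_image_and_norm:
  obtains C :: real where "C \<ge> 0" "\<And>\<Phi>. case_prod \<Phi> \<in> borel_measurable (leb {..<d} \<Otimes>\<^sub>M borel) \<Longrightarrow>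
    (\<integral>\<^sup>+h. \<Phi> (\<lambda>j\<in>{..<d}. \<Sum>i<b. h i * Z i j) (\<Sum>i<b. (h i)\<^sup>2) \<partial>leb {..<b}) =
    ennreal C * (\<integral>\<^sup>+v. (\<integral>\<^sup>+s. \<Phi> v (qf Si d v + s) * ennreal (s ^ (c - 1)) * indicator {0<..} s \<partial>lborel) \<partial>leb {..<d})"
proof -
  \<comment> \<open>The first d rows compute Z^T h, the others copy the trailing coordinates of h.
    Invertibility of this change of coordinates is the nonsingularity of the first d points.\<close>
  define F where "F i l = (if i < d then Z l i else if l = i then 1 else 0)" for i l
  have F1: "(\<Sum>l<b. F i l * h l) = (\<Sum>l<b. h l * Z l i)" if "i < d" for i h
    using that by (simp add: F_def mult.commute)
  have F2: "(\<Sum>l<b. F i l * h l) = h i" if "\<not> i < d" "i < b" for i h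
    using that by (simp add: F_def if_distrib[of "\<lambda>x. x * _"] cong: if_cong)
  have inj: "v j = 0" if z: "\<And>i. i < b \<Longrightarrow> (\<Sum>l<b. F i l * v l) = 0" and j: "j < b" for v j
  proof -
    have v2: "v i = 0" if "\<not> i < d" "i < b" for i using F2[OF that, of v] z that by simp
    have "(\<Sum>i<d. Z i j * v i) = 0" if j: "j < d" for j
    proof -
      have "(\<Sum>i<d. Z i j * v i) = (\<Sum>i<b. v i * Z i j)"
        using v2 b by (intro sum.mono_neutral_cong_left) auto
      also have "\<dots> = 0" using z[of j] F1[OF j, of v] j b by simp
      finally show ?thesis .
    qed
    from lead[of v, OF this] v2 j show ?thesis by (cases "j < d") auto
  qed
  obtain G where FG: "\<And>i k. i < b \<Longrightarrow> k < b \<Longrightarrow> (\<Sum>j<b. F i j * G j k) = (if i = k then 1 else 0)"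
    and GF: "\<And>i k. i < b \<Longrightarrow> k < b \<Longrightarrow> (\<Sum>j<b. G i j * F j k) = (if i = k then 1 else 0)"
  proof (rule two_sided_inverse_exists[of b F])
    fix v :: "nat \<Rightarrow> real" and j assume "\<And>i. i < b \<Longrightarrow> (\<Sum>l<b. F i l * v l) = 0" "j < b"
    then show "v j = 0" by (rule inj)
  qed blast
  define Ga where "Ga x i = (\<Sum>j<b. G i j * x j)" for x i
  have FGa: "(\<Sum>l<b. F i l * Ga x l) = x i" if "i < b" for x i
    unfolding Ga_def by (rule linear_inverse_apply[OF FG that])
  have GaF: "Ga x i = h i" if x: "\<And>i. i < b \<Longrightarrow> x i = (\<Sum>l<b. F i l * h l)" and i: "i < b" for x h i
  proof -
    have "Ga x i = (\<Sum>j<b. G i j * (\<Sum>l<b. F j l * h l))" unfolding Ga_def by (intro sum.cong refl) (simp add: x)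
    also have "\<dots> = h i" by (rule linear_inverse_apply[OF GF i])
    finally show ?thesis .
  qed
  define J where "J = {d..<b}"
  have dJ: "{..<d} \<union> J = {..<b}" "{..<d} \<inter> J = {}" "finite J" "card J = 2 * c"
    using b by (auto simp: J_def)
  \<comment> \<open>|h|^2 for the h with trailing coordinates z and combination zero, that is, the
    form on the fibre over v = 0.\<close>
  define N where "N z = (\<Sum>i<b. (Ga (merge {..<d} J (\<lambda>_. 0, z)) i)\<^sup>2)" for z :: "nat \<Rightarrow> real"
  have Gam: "Ga (merge {..<d} J (v, z)) i = (\<Sum>j<d. G i j * v j) + (\<Sum>j\<in>J. G i j * z j)" for v z i
  proof -
    have "Ga (merge {..<d} J (v, z)) i = (\<Sum>j\<in>{..<d} \<union> J. G i j * merge {..<d} J (v, z) j)"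
      by (simp add: Ga_def dJ(1))
    also have "\<dots> = (\<Sum>j<d. G i j * merge {..<d} J (v, z) j) + (\<Sum>j\<in>J. G i j * merge {..<d} J (v, z) j)"
      using dJ by (intro sum.union_disjoint) auto
    also have "\<dots> = (\<Sum>j<d. G i j * v j) + (\<Sum>j\<in>J. G i j * z j)"
      using dJ(2) by (intro arg_cong2[where f="(+)"] sum.cong refl) auto
    finally show ?thesis .
  qed
  define ell where "ell v = (\<lambda>i. \<Sum>j<d. Z i j * (\<Sum>k<d. Si j k * v k))" for v
  \<comment> \<open>Subtracting the shortest solution \<open>ell v\<close> from h leaves an element
    of the fibre over 0 whose trailing coordinates are shifted by \<open>ell v\<close>. Translation
    invariance removes the shift when z is integrated.\<close>
  have dec: "(\<Sum>i<b. (Ga (merge {..<d} J (v, z)) i)\<^sup>2) = qf Si d v + N (\<lambda>i\<in>J. z i + (- ell v i))" for v z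
  proof -
    define k where "k i = Ga (merge {..<d} J (v, z)) i - ell v i" for i
    have kZ: "(\<Sum>i<b. k i * Z i j) = 0" if j: "j < d" for j
    proof -
      have "(\<Sum>i<b. Ga (merge {..<d} J (v, z)) i * Z i j) = v j"
        using FGa[of j "merge {..<d} J (v, z)"] F1[OF j] j b dJ(2) by simp
      moreover have "(\<Sum>i<b. ell v i * Z i j) = v j"
        unfolding ell_def by (rule min_norm_decomposition(1)[OF j])
      ultimately show ?thesis by (simp add: k_def left_diff_distrib sum_subtractf)
    qed
    have "(\<Sum>i<b. (ell v i + k i)\<^sup>2) = qf Si d v + (\<Sum>i<b. (k i)\<^sup>2)"
      unfolding ell_def by (rule min_norm_decomposition(3)[OF kZ])
    moreover have Gk: "Ga (merge {..<d} J (\<lambda>_. 0, \<lambda>i\<in>J. z i + (- ell v i))) i = k i" if i: "i < b" for i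
    proof (rule GaF[OF _ i])
      fix i assume i: "i < b"
      show "merge {..<d} J (\<lambda>_. 0, \<lambda>i\<in>J. z i + (- ell v i)) i = (\<Sum>l<b. F i l * k l)"
      proof (cases "i < d")
        case True
        then show ?thesis using F1[OF True, of k] kZ[OF True] dJ(2) by simp
      next
        case False
        then have iJ: "i \<in> J" using i by (auto simp: J_def)
        have "Ga (merge {..<d} J (v, z)) i = z i"
          using FGa[OF i, of "merge {..<d} J (v, z)"] F2[OF False i] iJ dJ(2) by (simp add: False)
        then show ?thesis using F2[OF False i, of k] iJ False dJ(2) by (simp add: k_def)
      qed
    qed
    moreover have "N (\<lambda>i\<in>J. z i + (- ell v i)) = (\<Sum>i<b. (k i)\<^sup>2)"
      unfolding N_def by (intro sum.cong refl arg_cong[where f="\<lambda>x. x\<^sup>2"]) (rule Gk, simp)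
    moreover have "(\<Sum>i<b. (Ga (merge {..<d} J (v, z)) i)\<^sup>2) = (\<Sum>i<b. (ell v i + k i)\<^sup>2)"
      by (intro sum.cong refl) (simp add: k_def)
    ultimately show ?thesis by simp
  qed
  have Nm[measurable]: "N \<in> borel_measurable (leb J)"
    unfolding N_def[abs_def] Gam
    by (intro borel_measurable_sum borel_measurable_power borel_measurable_add borel_measurable_times borel_measurable_const) simp_all
  have Nhom: "N (\<lambda>i\<in>J. s * x i) = s\<^sup>2 * N x" for s x
    unfolding N_def Gam sum_distrib_left power_mult_distrib[symmetric]
    by (intro sum.cong refl arg_cong[where f="\<lambda>x. x\<^sup>2"]) (simp add: sum_distrib_left mult_ac)
  \<comment> \<open>The trailing coordinates of h are those of x itself, so |h|^2 is at least the
    sum of their squares.\<close>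
  have Nlb: "(\<Sum>i\<in>J. (x i)\<^sup>2) \<le> N x" for x
  proof -
    have "(\<Sum>i\<in>J. (x i)\<^sup>2) = (\<Sum>i\<in>J. (Ga (merge {..<d} J (\<lambda>_. 0, x)) i)\<^sup>2)"
    proof (rule sum.cong[OF refl])
      fix i assume i: "i \<in> J"
      then have "i < b" "\<not> i < d" by (auto simp: J_def)
      then have "Ga (merge {..<d} J (\<lambda>_. 0, x)) i = x i"
        using FGa[of i "merge {..<d} J (\<lambda>_. 0, x)"] F2[of i] i dJ(2) by simp
      then show "(x i)\<^sup>2 = (Ga (merge {..<d} J (\<lambda>_. 0, x)) i)\<^sup>2" by simp
    qed
    also have "\<dots> \<le> N x" unfolding N_def by (intro sum_mono2) (auto simp: J_def)
    finally show ?thesis .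
  qed
  obtain C1 where C1: "C1 \<ge> 0" "\<And>G. G \<in> borel_measurable borel \<Longrightarrow>
    (\<integral>\<^sup>+x. G (N x) \<partial>leb J) = ennreal C1 * (\<integral>\<^sup>+s. G s * ennreal (s ^ (c - 1)) * indicator {0<..} s \<partial>lborel)"
    using leb_homogeneous[OF dJ(3,4) c Nm Nhom Nlb] by blast
  obtain C2 :: real where C2: "C2 > 0" "\<And>f m. f \<in> borel_measurable (leb {..<b}) \<Longrightarrow>
    (\<integral>\<^sup>+x. f (affine_map b m F x) \<partial>leb {..<b}) = ennreal C2 * (\<integral>\<^sup>+x. f x \<partial>leb {..<b})"
    using leb_linear_bij[OF FG GF] by blast
  show thesis
  proof (rule that[of "C2 * C1"])
    show "C2 * C1 \<ge> 0" using C1 C2 by simp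
    fix \<Phi> :: "(nat \<Rightarrow> real) \<Rightarrow> real \<Rightarrow> ennreal"
    assume Phi[measurable]: "case_prod \<Phi> \<in> borel_measurable (leb {..<d} \<Otimes>\<^sub>M borel)"
    have Phi2: "(\<lambda>x. \<Phi> (f x) (g x)) \<in> borel_measurable M"
      if "f \<in> M \<rightarrow>\<^sub>M leb {..<d}" "g \<in> borel_measurable M" for f g and M :: "'z measure"
      using measurable_compose[OF measurable_Pair[OF that] Phi] by simp
    define \<Psi> where "\<Psi> x = \<Phi> (restrict x {..<d}) (\<Sum>i<b. (Ga x i)\<^sup>2)" for x
    have rm: "(\<lambda>x. restrict x {..<d}) \<in> leb {..<b} \<rightarrow>\<^sub>M leb {..<d}"
      using b by (intro measurable_restrict_subset) auto
    have \<Psi>m: "\<Psi> \<in> borel_measurable (leb {..<b})"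
      unfolding \<Psi>_def[abs_def] Ga_def
      by (intro Phi2 rm borel_measurable_sum borel_measurable_power borel_measurable_times borel_measurable_const) simp_all
    have "(\<integral>\<^sup>+h. \<Phi> (\<lambda>j\<in>{..<d}. \<Sum>i<b. h i * Z i j) (\<Sum>i<b. (h i)\<^sup>2) \<partial>leb {..<b}) =
      (\<integral>\<^sup>+h. \<Psi> (affine_map b (\<lambda>_. 0) F h) \<partial>leb {..<b})"
    proof (intro nn_integral_cong)
      fix h :: "nat \<Rightarrow> real"
      have 1: "restrict (affine_map b (\<lambda>_. 0) F h) {..<d} = (\<lambda>j\<in>{..<d}. \<Sum>i<b. h i * Z i j)"
        using b F1 by (auto simp: affine_map_def fun_eq_iff)
      have "Ga (affine_map b (\<lambda>_. 0) F h) i = h i" if "i < b" for i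
        by (rule GaF[OF _ that]) (simp add: affine_map_def)
      then show "\<Phi> (\<lambda>j\<in>{..<d}. \<Sum>i<b. h i * Z i j) (\<Sum>i<b. (h i)\<^sup>2) = \<Psi> (affine_map b (\<lambda>_. 0) F h)"
        unfolding \<Psi>_def 1 by simp
    qed
    also have "\<dots> = ennreal C2 * (\<integral>\<^sup>+x. \<Psi> x \<partial>leb {..<b})" by (rule C2(2)[OF \<Psi>m])
    also have "(\<integral>\<^sup>+x. \<Psi> x \<partial>leb {..<b}) = (\<integral>\<^sup>+v. (\<integral>\<^sup>+z. \<Psi> (merge {..<d} J (v, z)) \<partial>leb J) \<partial>leb {..<d})"
      using \<Psi>m dJ leb.product_nn_integral_fold[of "{..<d}" J \<Psi>] by simp
    also have "\<dots> = (\<integral>\<^sup>+v. ennreal C1 * (\<integral>\<^sup>+s. \<Phi> v (qf Si d v + s) * ennreal (s ^ (c - 1)) * indicator {0<..} s \<partial>lborel) \<partial>leb {..<d})"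
    proof (rule nn_integral_cong)
      fix v assume v: "v \<in> space (leb {..<d})"
      have rv: "restrict (merge {..<d} J (v, z)) {..<d} = v" for z
        using v dJ(2) by (auto simp: space_PiM PiE_iff extensional_def fun_eq_iff)
      have pm: "(\<lambda>s. \<Phi> v (qf Si d v + s)) \<in> borel_measurable borel"
        using v by (intro Phi2) auto
      have "(\<integral>\<^sup>+z. \<Psi> (merge {..<d} J (v, z)) \<partial>leb J) = (\<integral>\<^sup>+z. \<Phi> v (qf Si d v + N (\<lambda>i\<in>J. z i + (- ell v i))) \<partial>leb J)"
        unfolding \<Psi>_def rv dec ..
      also have "\<dots> = (\<integral>\<^sup>+z. \<Phi> v (qf Si d v + N z) \<partial>leb J)"
        using measurable_compose[OF Nm pm] by (rule leb_translate[OF dJ(3)])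
      also have "\<dots> = ennreal C1 * (\<integral>\<^sup>+s. \<Phi> v (qf Si d v + s) * ennreal (s ^ (c - 1)) * indicator {0<..} s \<partial>lborel)"
        by (rule C1(2)[OF pm])
      finally show "(\<integral>\<^sup>+z. \<Psi> (merge {..<d} J (v, z)) \<partial>leb J) = ennreal C1 * (\<integral>\<^sup>+s. \<Phi> v (qf Si d v + s) * ennreal (s ^ (c - 1)) * indicator {0<..} s \<partial>lborel)" .
    qed
    also have "\<dots> = ennreal C1 * (\<integral>\<^sup>+v. (\<integral>\<^sup>+s. \<Phi> v (qf Si d v + s) * ennreal (s ^ (c - 1)) * indicator {0<..} s \<partial>lborel) \<partial>leb {..<d})"
    proof (rule nn_integral_cmult)
      have [measurable]: "(\<lambda>x. \<Phi> (fst x) (qf Si d (fst x) + snd x)) \<in> borel_measurable (leb {..<d} \<Otimes>\<^sub>M lborel)"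
        by (intro Phi2) auto
      show "(\<lambda>v. (\<integral>\<^sup>+s. \<Phi> v (qf Si d v + s) * ennreal (s ^ (c - 1)) * indicator {0<..} s \<partial>lborel)) \<in> borel_measurable (leb {..<d})"
        by (intro lborel.borel_measurable_nn_integral) (simp add: split_def)
    qed
    also have "ennreal C2 * (ennreal C1 * (\<integral>\<^sup>+v. (\<integral>\<^sup>+s. \<Phi> v (qf Si d v + s) * ennreal (s ^ (c - 1)) * indicator {0<..} s \<partial>lborel) \<partial>leb {..<d})) =
      ennreal (C2 * C1) * (\<integral>\<^sup>+v. (\<integral>\<^sup>+s. \<Phi> v (qf Si d v + s) * ennreal (s ^ (c - 1)) * indicator {0<..} s \<partial>lborel) \<partial>leb {..<d})"
      unfolding ennreal_mult'[OF less_imp_le[OF C2(1)]] mult.assoc ..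
    finally show "(\<integral>\<^sup>+h. \<Phi> (\<lambda>j\<in>{..<d}. \<Sum>i<b. h i * Z i j) (\<Sum>i<b. (h i)\<^sup>2) \<partial>leb {..<b}) =
      ennreal (C2 * C1) * (\<integral>\<^sup>+v. (\<integral>\<^sup>+s. \<Phi> v (qf Si d v + s) * ennreal (s ^ (c - 1)) * indicator {0<..} s \<partial>lborel) \<partial>leb {..<d})" .
  qed
qed

text \<open>In the variables t = |h|^2 and w = v / sqrt t the integrand separates, since t - v^T
  S^-1 v = t (1 - w^T S^-1 w) and the Gaussian weight is a function of t. K stays implicit here;
  \<open>density_compare\<close> later recovers its size from total mass.\<close>

lemma sphere_projection_density:
  obtains K :: ennreal where "\<And>f. f \<in> borel_measurable (leb {..<d}) \<Longrightarrow>
    (\<integral>\<^sup>+h. f (\<lambda>j\<in>{..<d}. (\<Sum>i<b. h i * Z i j) / sqrt (\<Sum>i<b. (h i)\<^sup>2)) \<partial>stdg {..<b}) =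
    K * (\<integral>\<^sup>+w. f w * (ennreal ((1 - qf Si d w) ^ (c - 1)) * indicator {..<1} (qf Si d w)) \<partial>leb {..<d})"
proof -
  obtain C where C: "C \<ge> 0" "\<And>\<Phi>. case_prod \<Phi> \<in> borel_measurable (leb {..<d} \<Otimes>\<^sub>M borel) \<Longrightarrow>
    (\<integral>\<^sup>+h. \<Phi> (\<lambda>j\<in>{..<d}. \<Sum>i<b. h i * Z i j) (\<Sum>i<b. (h i)\<^sup>2) \<partial>leb {..<b}) =
    ennreal C * (\<integral>\<^sup>+v. (\<integral>\<^sup>+s. \<Phi> v (qf Si d v + s) * ennreal (s ^ (c - 1)) * indicator {0<..} s \<partial>lborel) \<partial>leb {..<d})"
    using nn_integral_image_and_norm by blast
  interpret L: sigma_finite_measure "leb {..<d}" by (rule sigma_finite_leb) simp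
  interpret P: pair_sigma_finite "leb {..<d}" "lborel :: real measure" ..
  define c0 where "c0 = (1 / sqrt (2 * pi)) ^ b"
  have c0: "c0 > 0" by (simp add: c0_def)
  \<comment> \<open>The whole t-dependence: sqrt t ^ d from the substitution v = sqrt t w, the
    Gaussian weight, and t^(c-1) from the factorisation of the power.\<close>
  define D where "D = (\<integral>\<^sup>+t. ennreal (sqrt t ^ d * (c0 * exp (- t / 2)) * t ^ (c - 1)) * indicator {0<..} t \<partial>(lborel::real measure))"
  show thesis
  proof (rule that[of "ennreal C * D"])
    fix f :: "(nat \<Rightarrow> real) \<Rightarrow> ennreal" assume f[measurable]: "f \<in> borel_measurable (leb {..<d})"
    define u where "u w = ennreal ((1 - qf Si d w) ^ (c - 1)) * indicator {..<1} (qf Si d w)" for w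
    have um[measurable]: "u \<in> borel_measurable (leb {..<d})" unfolding u_def by measurable
    define \<Phi> where "\<Phi> v t = f (\<lambda>j\<in>{..<d}. v j / sqrt t) * ennreal (c0 * exp (- t / 2))" for v t
    have "(\<lambda>x. \<lambda>j\<in>{..<d}. fst x j / sqrt (snd x)) \<in> leb {..<d} \<Otimes>\<^sub>M borel \<rightarrow>\<^sub>M leb {..<d}"
    proof (rule measurable_restrict)
      fix j assume "j \<in> {..<d}"
      then have a: "(\<lambda>x. fst x j) \<in> borel_measurable (leb {..<d} \<Otimes>\<^sub>M borel)"
        using measurable_compose[OF measurable_fst measurable_component_singleton] by fastforce
      have s: "(\<lambda>x. sqrt (snd x)) \<in> borel_measurable (leb {..<d} \<Otimes>\<^sub>M borel)" by measurable
      show "(\<lambda>x. fst x j / sqrt (snd x)) \<in> leb {..<d} \<Otimes>\<^sub>M borel \<rightarrow>\<^sub>M lborel"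
        using borel_measurable_divide[OF a s] by simp
    qed
    from measurable_compose[OF this f]
    have [measurable]: "(\<lambda>x. f (\<lambda>j\<in>{..<d}. fst x j / sqrt (snd x))) \<in> borel_measurable (leb {..<d} \<Otimes>\<^sub>M borel)" .
    have \<Phi>m[measurable]: "case_prod \<Phi> \<in> borel_measurable (leb {..<d} \<Otimes>\<^sub>M borel)"
      unfolding \<Phi>_def split_def by measurable
    have sv: "(\<lambda>x. \<Phi> (fst x) (snd x)) \<in> borel_measurable (leb {..<d} \<Otimes>\<^sub>M lborel)"
      using \<Phi>m by (simp add: split_def cong: measurable_cong_sets)
    define g where "g v t = \<Phi> v t * ennreal ((t - qf Si d v) ^ (c - 1)) * indicator {0<..} (t - qf Si d v)" for v t
    have qfst[measurable]: "(\<lambda>x. qf Si d (fst x)) \<in> borel_measurable (leb {..<d} \<Otimes>\<^sub>M lborel)"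
      by (rule measurable_compose[OF measurable_fst qf_measurable])
    have gm: "case_prod g \<in> borel_measurable (leb {..<d} \<Otimes>\<^sub>M lborel)"
      unfolding g_def split_def using sv by measurable
    have fin: "f (\<lambda>j\<in>{..<d}. (\<lambda>j\<in>{..<d}. sqrt t * w j) j / sqrt t) = f w" if "w \<in> space (leb {..<d})" "t > 0" for t w
    proof -
      have "(\<lambda>j\<in>{..<d}. (\<lambda>j\<in>{..<d}. sqrt t * w j) j / sqrt t) = w"
        using that by (auto simp: fun_eq_iff space_PiM PiE_iff extensional_def)
      then show ?thesis by simp
    qed
    have "(\<integral>\<^sup>+h. f (\<lambda>j\<in>{..<d}. (\<Sum>i<b. h i * Z i j) / sqrt (\<Sum>i<b. (h i)\<^sup>2)) \<partial>stdg {..<b}) =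
      (\<integral>\<^sup>+h. \<Phi> (\<lambda>j\<in>{..<d}. \<Sum>i<b. h i * Z i j) (\<Sum>i<b. (h i)\<^sup>2) \<partial>leb {..<b})"
    proof -
      have hm: "(\<lambda>h. \<lambda>j\<in>{..<d}. (\<Sum>i<b. h i * Z i j) / sqrt (\<Sum>i<b. (h i)\<^sup>2)) \<in> leb {..<b} \<rightarrow>\<^sub>M leb {..<d}"
        by (rule measurable_restrict) simp
      have 0: "(\<lambda>j\<in>{..<d}. (\<lambda>j\<in>{..<d}. \<Sum>i<b. h i * Z i j) j / s) = (\<lambda>j\<in>{..<d}. (\<Sum>i<b. h i * Z i j) / s)" for h s
        by (auto simp: fun_eq_iff)
      show ?thesis
        unfolding stdg_density[OF finite_lessThan] \<Phi>_def 0
        by (subst nn_integral_density) (auto simp: c0_def mult.commute intro!: measurable_compose[OF hm f])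
    qed
    also have "\<dots> = ennreal C * (\<integral>\<^sup>+v. (\<integral>\<^sup>+s. \<Phi> v (qf Si d v + s) * ennreal (s ^ (c - 1)) * indicator {0<..} s \<partial>lborel) \<partial>leb {..<d})"
      by (rule C(2)[OF \<Phi>m])
    also have "(\<integral>\<^sup>+v. (\<integral>\<^sup>+s. \<Phi> v (qf Si d v + s) * ennreal (s ^ (c - 1)) * indicator {0<..} s \<partial>lborel) \<partial>leb {..<d}) =
       (\<integral>\<^sup>+v. (\<integral>\<^sup>+t. g v t \<partial>lborel) \<partial>leb {..<d})"
    proof (rule nn_integral_cong)
      fix v assume v: "v \<in> space (leb {..<d})"
      have gv: "g v \<in> borel_measurable lborel" using measurable_Pair2[OF gm v] by simp
      have "(\<integral>\<^sup>+t. g v t \<partial>lborel) = ennreal \<bar>1\<bar> * (\<integral>\<^sup>+s. g v (qf Si d v + 1 * s) \<partial>lborel)"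
        using gv by (intro nn_integral_real_affine) auto
      then show "(\<integral>\<^sup>+s. \<Phi> v (qf Si d v + s) * ennreal (s ^ (c - 1)) * indicator {0<..} s \<partial>lborel) = (\<integral>\<^sup>+t. g v t \<partial>lborel)"
        by (simp add: g_def)
    qed
    also have "\<dots> = (\<integral>\<^sup>+t. (\<integral>\<^sup>+v. g v t \<partial>leb {..<d}) \<partial>lborel)"
      by (rule P.Fubini'[symmetric, OF gm])
    also have "\<dots> = (\<integral>\<^sup>+t. (ennreal (sqrt t ^ d * (c0 * exp (- t / 2)) * t ^ (c - 1)) * indicator {0<..} t) * (\<integral>\<^sup>+w. f w * u w \<partial>leb {..<d}) \<partial>lborel)"
    proof (rule nn_integral_cong)
      fix t :: real
      have gt: "(\<lambda>v. g v t) \<in> borel_measurable (leb {..<d})" using measurable_Pair1[OF gm, of t] by simp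
      show "(\<integral>\<^sup>+v. g v t \<partial>leb {..<d}) =
        (ennreal (sqrt t ^ d * (c0 * exp (- t / 2)) * t ^ (c - 1)) * indicator {0<..} t) * (\<integral>\<^sup>+w. f w * u w \<partial>leb {..<d})"
      proof (cases "t > 0")
        case False
        then have "g v t = 0" for v using qf_nonneg[of v] by (auto simp: g_def split: split_indicator)
        then show ?thesis using False by simp
      next
        case True
        have "(\<integral>\<^sup>+v. g v t \<partial>leb {..<d}) = ennreal (sqrt t ^ card {..<d}) * (\<integral>\<^sup>+w. g (\<lambda>j\<in>{..<d}. sqrt t * w j) t \<partial>leb {..<d})"
          using True by (intro leb_scale[OF _ gt]) auto
        also have "(\<integral>\<^sup>+w. g (\<lambda>j\<in>{..<d}. sqrt t * w j) t \<partial>leb {..<d}) =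
          (\<integral>\<^sup>+w. ennreal (c0 * exp (- t / 2) * t ^ (c - 1)) * (f w * u w) \<partial>leb {..<d})"
        proof (rule nn_integral_cong)
          fix w assume w: "w \<in> space (leb {..<d})"
          have q: "qf Si d (\<lambda>j\<in>{..<d}. sqrt t * w j) = t * qf Si d w" using True by (simp add: qf_scale)
          have e: "t - t * qf Si d w = t * (1 - qf Si d w)" by (simp add: algebra_simps)
          have i: "indicator {0<..} (t - t * qf Si d w) = (indicator {..<1} (qf Si d w) :: ennreal)"
            using True by (auto simp: e zero_less_mult_iff split: split_indicator)
          show "g (\<lambda>j\<in>{..<d}. sqrt t * w j) t = ennreal (c0 * exp (- t / 2) * t ^ (c - 1)) * (f w * u w)"
          proof (cases "qf Si d w < 1")
            case q1: True
            then show ?thesis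
              unfolding g_def \<Phi>_def q fin[OF w True] i unfolding e u_def power_mult_distrib
              using True c0 by (simp add: ennreal_mult' mult_ac)
          qed (simp add: g_def q i u_def)
        qed
        also have "\<dots> = ennreal (c0 * exp (- t / 2) * t ^ (c - 1)) * (\<integral>\<^sup>+w. f w * u w \<partial>leb {..<d})"
          by (rule nn_integral_cmult) measurable
        finally show ?thesis using True c0 by (simp add: ennreal_mult' mult_ac)
      qed
    qed
    also have "\<dots> = D * (\<integral>\<^sup>+w. f w * u w \<partial>leb {..<d})"
      unfolding D_def by (rule nn_integral_multc) measurable
    finally show "(\<integral>\<^sup>+h. f (\<lambda>j\<in>{..<d}. (\<Sum>i<b. h i * Z i j) / sqrt (\<Sum>i<b. (h i)\<^sup>2)) \<partial>stdg {..<b}) =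
      ennreal C * D * (\<integral>\<^sup>+w. f w * (ennreal ((1 - qf Si d w) ^ (c - 1)) * indicator {..<1} (qf Si d w)) \<partial>leb {..<d})"
      unfolding u_def mult.assoc .
  qed
qed

end

section \<open>Concentration of Gaussian matrices\<close>

abbreviation stdmat :: "nat \<Rightarrow> nat \<Rightarrow> (nat \<Rightarrow> nat \<Rightarrow> real) measure" where
  "stdmat b d \<equiv> PiM {..<b} (\<lambda>_. stdg {..<d})"

lemma prob_space_stdmat [simp, intro]: "prob_space (stdmat b d)"
  by (intro prob_space_PiM) auto

lemma stdmat_entry_measurable:
  "i < b \<Longrightarrow> j < d \<Longrightarrow> (\<lambda>Z. Z i j) \<in> borel_measurable (stdmat b d)"
  using measurable_component2[of i "{..<b}" j "{..<d}" "\<lambda>_. std_normal_distribution"] by simp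

text \<open>Transposed, so that nonvanishing says directly that no nontrivial combination of the
  first n points has its first n coordinates zero, as in
  \<open>lead_det_nonzero_inj\<close>.\<close>

definition lead_det :: "nat \<Rightarrow> (nat \<Rightarrow> nat \<Rightarrow> real) \<Rightarrow> real" where
  "lead_det n Z = Determinant.det (Matrix.mat n n (\<lambda>(j, i). Z i j))"

lemma permutes_atLeast0_less:
  fixes n :: nat assumes "p permutes {0..<n}" "i < n" shows "p i < n"
  using permutes_in_image[OF assms(1), of i] assms(2) by simp

lemma lead_det_expand: "lead_det n Z = (\<Sum>p\<in>{p. p permutes {0..<n}}. signof p * (\<Prod>i\<in>{0..<n}. Z (p i) i))"
proof -
  have "lead_det n Z = (\<Sum>p\<in>{p. p permutes {0..<n}}. signof p *
    (\<Prod>i\<in>{0..<n}. Matrix.mat n n (\<lambda>(j, i). Z i j) $$ (i, p i)))"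
    unfolding lead_det_def by (subst Determinant.det_def'[of _ n]) auto
  also have "\<dots> = (\<Sum>p\<in>{p. p permutes {0..<n}}. signof p * (\<Prod>i\<in>{0..<n}. Z (p i) i))"
    by (intro sum.cong refl arg_cong2[where f="(*)"] prod.cong) (simp add: permutes_atLeast0_less)
  finally show ?thesis .
qed

lemma lead_det_measurable:
  assumes "\<And>i j. i < n \<Longrightarrow> j < n \<Longrightarrow> (\<lambda>x. f x i j) \<in> borel_measurable M"
  shows "(\<lambda>x. lead_det n (f x)) \<in> borel_measurable M"
  unfolding lead_det_expand
proof (intro borel_measurable_sum borel_measurable_times borel_measurable_const borel_measurable_prod assms)
  fix p i assume "p \<in> {p. p permutes {0..<n}}" "i \<in> {0..<n}"
  then show "p i < n" "i < n" using permutes_atLeast0_less by auto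
qed

text \<open>In the expansion along the last row no cofactor contains the corner entry, and the
  cofactor of the corner is the next smaller leading minor. So the determinant is affine in y with
  that minor as slope.\<close>

lemma lead_det_Suc_corner:
  "lead_det (Suc n) (\<lambda>i j. if i = n \<and> j = n then y else Z i j) =
    y * lead_det n Z + lead_det (Suc n) (\<lambda>i j. if i = n \<and> j = n then 0 else Z i j)"
proof -
  define A where "A y = Matrix.mat (Suc n) (Suc n) (\<lambda>(j, i). if i = n \<and> j = n then y else Z i j)" for y
  have A: "A y \<in> carrier_mat (Suc n) (Suc n)" for y by (simp add: A_def)
  have del: "mat_delete (A y) n j = mat_delete (A 0) n j" for j y
    by (rule eq_matI) (auto simp: mat_delete_def A_def)
  have corner: "mat_delete (A y) n n = Matrix.mat n n (\<lambda>(j, i). Z i j)" for y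
    by (rule eq_matI) (auto simp: mat_delete_def A_def)
  have A_eq: "lead_det (Suc n) (\<lambda>i j. if i = n \<and> j = n then y else Z i j) = Determinant.det (A y)" for y
    by (simp add: lead_det_def A_def)
  have "Determinant.det (A y) = y * lead_det n Z + (\<Sum>j<n. A 0 $$ (n, j) * cofactor (A 0) n j)" for y
  proof -
    have "Determinant.det (A y) = (\<Sum>j<Suc n. A y $$ (n, j) * cofactor (A y) n j)"
      by (rule laplace_expansion_row[OF A]) simp
    also have "\<dots> = (\<Sum>j<n. A y $$ (n, j) * cofactor (A y) n j) + A y $$ (n, n) * cofactor (A y) n n"
      by simp
    also have "A y $$ (n, n) = y" by (simp add: A_def)
    also have "cofactor (A y) n n = lead_det n Z" by (simp add: cofactor_def corner lead_det_def)
    also have "(\<Sum>j<n. A y $$ (n, j) * cofactor (A y) n j) = (\<Sum>j<n. A 0 $$ (n, j) * cofactor (A 0) n j)"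
    proof (rule sum.cong[OF refl])
      fix j assume "j \<in> {..<n}"
      then have "A y $$ (n, j) = A 0 $$ (n, j)" by (simp add: A_def)
      moreover have "cofactor (A y) n j = cofactor (A 0) n j" by (simp add: cofactor_def del[of y])
      ultimately show "A y $$ (n, j) * cofactor (A y) n j = A 0 $$ (n, j) * cofactor (A 0) n j" by simp
    qed
    finally show ?thesis by simp
  qed
  from this[of y] this[of 0] show ?thesis by (simp add: A_eq)
qed

lemma AE_std_normal_neq: "AE y in std_normal_distribution. y \<noteq> (c::real)"
  using AE_lborel_singleton[of c] by (subst AE_density) auto

text \<open>Given all other entries, the determinant of size n + 1 is y D + r in the corner entry y,
  with D the minor of size n. If D is nonzero, a single value of y is excluded. The flat index set
  allows one entry to be integrated alone.\<close>

lemma AE_lead_det_nonzero_flat: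
  assumes "n \<le> d" "n \<le> b"
  shows "AE w in stdg ({..<b} \<times> {..<d}). lead_det n (\<lambda>i j. w (i, j)) \<noteq> 0"
  using assms
proof (induction n)
  case 0
  then show ?case by (simp add: lead_det_def)
next
  case (Suc n)
  interpret N: product_sigma_finite "\<lambda>_::nat\<times>nat. std_normal_distribution"
    unfolding product_sigma_finite_def by (intro allI prob_space_imp_sigma_finite) simp
  define K where "K = {..<b} \<times> {..<d} - {(n, n)}"
  have K: "insert (n, n) K = {..<b} \<times> {..<d}" "finite K" "(n, n) \<notin> K" using Suc.prems by (auto simp: K_def)
  have em: "(\<lambda>w. w (i, j)) \<in> borel_measurable (stdg (insert (n, n) K))" if "i < Suc n" "j < Suc n" for i j
  proof -
    have "(i, j) \<in> insert (n, n) K" unfolding K(1) using that Suc.prems by auto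
    from measurable_component_singleton[OF this, of "\<lambda>_. std_normal_distribution"] show ?thesis by simp
  qed
  have m1[measurable]: "(\<lambda>w. lead_det (Suc n) (\<lambda>i j. w (i, j))) \<in> borel_measurable (stdg (insert (n, n) K))"
    by (rule lead_det_measurable) (rule em)
  have m2[measurable]: "(\<lambda>w. lead_det n (\<lambda>i j. w (i, j))) \<in> borel_measurable (stdg (insert (n, n) K))"
    by (rule lead_det_measurable) (rule em; simp)
  define S where "S = {w \<in> space (stdg (insert (n, n) K)). lead_det (Suc n) (\<lambda>i j. w (i, j)) = 0 \<and> lead_det n (\<lambda>i j. w (i, j)) \<noteq> 0}"
  have Sm[measurable]: "S \<in> sets (stdg (insert (n, n) K))" unfolding S_def by measurable
  have "emeasure (stdg (insert (n, n) K)) S = (\<integral>\<^sup>+w. indicator S w \<partial>stdg (insert (n, n) K))" by simp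
  also have "\<dots> = (\<integral>\<^sup>+x. (\<integral>\<^sup>+y. indicator S (x((n, n) := y)) \<partial>std_normal_distribution) \<partial>stdg K)"
    by (rule N.product_nn_integral_insert[OF K(2,3), of "indicator S"]) (rule borel_measurable_indicator[OF Sm])
  also have "\<dots> = (\<integral>\<^sup>+x. 0 \<partial>stdg K)"
  proof (rule nn_integral_cong)
    fix x :: "nat \<times> nat \<Rightarrow> real"
    have e1: "(\<lambda>i j. (x((n, n) := y)) (i, j)) = (\<lambda>i j. if i = n \<and> j = n then y else x (i, j))" for y
      by (intro ext) simp
    define D where "D = lead_det n (\<lambda>i j. x (i, j))"
    define r where "r = lead_det (Suc n) (\<lambda>i j. if i = n \<and> j = n then 0 else x (i, j))"
    have e2: "lead_det n (\<lambda>i j. if i = n \<and> j = n then y else x (i, j)) = D" for y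
      unfolding lead_det_def D_def by (rule arg_cong[where f=Determinant.det], rule eq_matI) simp_all
    have e3: "lead_det (Suc n) (\<lambda>i j. if i = n \<and> j = n then y else x (i, j)) = y * D + r" for y
      unfolding D_def r_def by (rule lead_det_Suc_corner)
    have "AE y in std_normal_distribution. indicator S (x((n, n) := y)) = (0::ennreal)"
      using AE_std_normal_neq[of "- r / D"]
    proof eventually_elim
      case (elim y)
      have "x((n, n) := y) \<notin> S"
      proof
        assume "x((n, n) := y) \<in> S"
        then have "y * D + r = 0" "D \<noteq> 0" unfolding S_def mem_Collect_eq e1 e2 e3 by auto
        then have "y * D = - r" by linarith
        with \<open>D \<noteq> 0\<close> have "y = - r / D" by (metis nonzero_mult_div_cancel_right)
        with elim show False ..
      qed
      then show ?case by simp
    qed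
    then show "(\<integral>\<^sup>+y. indicator S (x((n, n) := y)) \<partial>std_normal_distribution) = 0"
      by (subst nn_integral_cong_AE[where v = "\<lambda>_. 0"]) auto
  qed
  finally have "emeasure (stdg (insert (n, n) K)) S = 0" by simp
  then have "AE w in stdg (insert (n, n) K). w \<notin> S"
    by (intro AE_not_in) (auto simp: null_sets_def)
  moreover have "AE w in stdg (insert (n, n) K). lead_det n (\<lambda>i j. w (i, j)) \<noteq> 0"
    unfolding K(1) using Suc by simp
  ultimately have "AE w in stdg (insert (n, n) K). lead_det (Suc n) (\<lambda>i j. w (i, j)) \<noteq> 0"
    using AE_space by eventually_elim (auto simp: S_def)
  then show ?case unfolding K(1) .
qed

lemma AE_lead_det_nonzero:
  assumes "d \<le> b"
  shows "AE Z in stdmat b d. lead_det d Z \<noteq> 0"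
proof -
  have m: "(\<lambda>w. \<lambda>i\<in>{..<b}. \<lambda>j\<in>{..<d}. w (i, j)) \<in> stdg ({..<b} \<times> {..<d}) \<rightarrow>\<^sub>M stdmat b d"
    by (intro measurable_restrict measurable_component_singleton) auto
  have dm[measurable]: "lead_det d \<in> borel_measurable (stdmat b d)"
    using assms by (intro lead_det_measurable stdmat_entry_measurable) auto
  have S: "{Z \<in> space (stdmat b d). lead_det d Z \<noteq> 0} \<in> sets (stdmat b d)" by measurable
  have e: "lead_det d (\<lambda>i\<in>{..<b}. \<lambda>j\<in>{..<d}. w (i, j)) = lead_det d (\<lambda>i j. w (i, j))" for w
    unfolding lead_det_def using assms by (intro arg_cong[where f=Determinant.det] eq_matI) auto
  have "AE Z in distr (stdg ({..<b} \<times> {..<d})) (stdmat b d) (\<lambda>w. \<lambda>i\<in>{..<b}. \<lambda>j\<in>{..<d}. w (i, j)). lead_det d Z \<noteq> 0"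
    unfolding AE_distr_iff[OF m S] e using AE_lead_det_nonzero_flat[of d d b] assms by simp
  then show ?thesis by (subst (asm) distr_PiM_swap(1)) auto
qed

lemma lead_det_nonzero_inj:
  assumes D: "lead_det d Z \<noteq> 0" and z: "\<And>j. j < d \<Longrightarrow> (\<Sum>i<d. Z i j * v i) = 0" and i: "i < d"
  shows "v i = 0"
proof (rule ccontr)
  assume vi: "v i \<noteq> 0"
  define A where "A = Matrix.mat d d (\<lambda>(j, i). Z i j)"
  have A: "A \<in> carrier_mat d d" by (simp add: A_def)
  have "A *\<^sub>v Matrix.vec d v = 0\<^sub>v d"
    by (rule eq_vecI) (auto simp: A_def scalar_prod_def atLeast0LessThan z)
  moreover have "Matrix.vec d v \<noteq> 0\<^sub>v d" using vi i by (metis index_vec index_zero_vec(1))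
  ultimately have "Determinant.det A = 0"
    using det_0_iff_vec_prod_zero_field[OF A] by (metis vec_carrier)
  with D show False by (simp add: lead_det_def A_def)
qed

section \<open>Exponential moments and tails of quadratic forms in Gaussian data\<close>

lemma emeasure_le_nn_integral:
  assumes "S \<in> sets M" "\<And>x. x \<in> S \<Longrightarrow> 1 \<le> g x"
  shows "emeasure M S \<le> (\<integral>\<^sup>+x. g x \<partial>M)"
proof -
  have "emeasure M S = (\<integral>\<^sup>+x. indicator S x \<partial>M)" using assms by simp
  also have "\<dots> \<le> (\<integral>\<^sup>+x. g x \<partial>M)" using assms by (intro nn_integral_mono) (auto split: split_indicator)
  finally show ?thesis .
qed

lemma stdg_exp_square_linear:
  assumes I: "finite I" and t: "t * (\<Sum>j\<in>I. (y j)\<^sup>2) < 1/2"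
  shows "(\<integral>\<^sup>+z. ennreal (exp (t * (\<Sum>j\<in>I. y j * z j)\<^sup>2)) \<partial>stdg I) = ennreal (1 / sqrt (1 - 2 * (t * (\<Sum>j\<in>I. (y j)\<^sup>2))))"
proof -
  define s where "s = (\<Sum>j\<in>I. (y j)\<^sup>2)"
  have s: "s \<ge> 0" by (simp add: s_def sum_nonneg)
  have "(\<integral>\<^sup>+z. ennreal (exp (t * (\<Sum>j\<in>I. y j * z j)\<^sup>2)) \<partial>stdg I) =
    (\<integral>\<^sup>+x. ennreal (exp (t * x\<^sup>2)) \<partial>distr (stdg I) borel (\<lambda>z. \<Sum>j\<in>I. y j * z j))"
    by (subst nn_integral_distr) auto
  also have "\<dots> = (\<integral>\<^sup>+x. ennreal (exp (t * x\<^sup>2)) \<partial>distr std_normal_distribution borel (\<lambda>x. sqrt s * x))"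
    unfolding distr_linear_comb_std_normal[OF I] s_def ..
  also have "\<dots> = (\<integral>\<^sup>+x. ennreal (exp ((t * s) * x\<^sup>2)) \<partial>std_normal_distribution)"
    using s by (subst nn_integral_distr) (auto simp: power_mult_distrib mult_ac)
  also have "\<dots> = ennreal (1 / sqrt (1 - 2 * (t * s)))"
    using t by (intro nn_integral_exp_square_std_normal) (simp add: s_def)
  finally show ?thesis by (simp add: s_def)
qed

lemma stdmat_exp_sum_squares:
  assumes t: "t * (\<Sum>j<d. (y j)\<^sup>2) < 1/2"
  shows "(\<integral>\<^sup>+Z. ennreal (exp (t * (\<Sum>i<b. (\<Sum>j<d. y j * Z i j)\<^sup>2))) \<partial>stdmat b d) =
    ennreal ((1 / sqrt (1 - 2 * (t * (\<Sum>j<d. (y j)\<^sup>2)))) ^ b)"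
proof -
  interpret N: product_sigma_finite "\<lambda>_::nat. stdg {..<d}"
    unfolding product_sigma_finite_def by (intro allI prob_space_imp_sigma_finite) simp
  have "(\<integral>\<^sup>+Z. ennreal (exp (t * (\<Sum>i<b. (\<Sum>j<d. y j * Z i j)\<^sup>2))) \<partial>stdmat b d) =
    (\<integral>\<^sup>+Z. (\<Prod>i<b. ennreal (exp (t * (\<Sum>j<d. y j * Z i j)\<^sup>2))) \<partial>stdmat b d)"
    by (simp add: sum_distrib_left exp_sum prod_ennreal)
  also have "\<dots> = (\<Prod>i<b. \<integral>\<^sup>+z. ennreal (exp (t * (\<Sum>j<d. y j * z j)\<^sup>2)) \<partial>stdg {..<d})"
    by (intro N.product_nn_integral_prod) auto
  also have "\<dots> = ennreal ((1 / sqrt (1 - 2 * (t * (\<Sum>j<d. (y j)\<^sup>2)))) ^ b)"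
    using t by (subst stdg_exp_square_linear) (auto simp: ennreal_power)
  finally show ?thesis .
qed

lemma inv_sqrt_power_le_exp:
  fixes x :: real assumes "0 \<le> x" "x \<le> 1/2"
  shows "(1 / sqrt (1 - x)) ^ b \<le> exp (b * (x + 2 * x\<^sup>2) / 2)"
proof -
  have "1 / sqrt (1 - x) = exp (- ln (1 - x) / 2)"
  proof -
    have "exp (ln (1 - x) / 2) = exp (ln (sqrt (1 - x)))" using assms by (subst ln_sqrt) auto
    also have "\<dots> = sqrt (1 - x)" using assms by (intro exp_ln) auto
    finally have "exp (- (ln (1 - x) / 2)) = 1 / sqrt (1 - x)" by (simp add: exp_minus inverse_eq_divide)
    then show ?thesis by simp
  qed
  also have "\<dots> \<le> exp ((x + 2 * x\<^sup>2) / 2)"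
    using ln_one_minus_pos_lower_bound[of x] assms by simp
  finally have "(1 / sqrt (1 - x)) ^ b \<le> exp ((x + 2 * x\<^sup>2) / 2) ^ b"
    using assms by (intro power_mono) auto
  also have "\<dots> = exp (b * (x + 2 * x\<^sup>2) / 2)" by (simp add: exp_of_nat_mult[symmetric])
  finally show ?thesis .
qed

lemma inv_sqrt_plus_power_le_exp:
  fixes x :: real assumes "0 \<le> x" "x \<le> 1"
  shows "(1 / sqrt (1 + x)) ^ b \<le> exp (b * (- x + x\<^sup>2) / 2)"
proof -
  have "1 / sqrt (1 + x) = exp (- ln (1 + x) / 2)"
  proof -
    have "exp (ln (1 + x) / 2) = exp (ln (sqrt (1 + x)))" using assms by (subst ln_sqrt) auto
    also have "\<dots> = sqrt (1 + x)" using assms by (intro exp_ln) auto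
    finally have "exp (- (ln (1 + x) / 2)) = 1 / sqrt (1 + x)" by (simp add: exp_minus inverse_eq_divide)
    then show ?thesis by simp
  qed
  also have "\<dots> \<le> exp ((- x + x\<^sup>2) / 2)"
    using ln_one_plus_pos_lower_bound[of x] assms by simp
  finally have "(1 / sqrt (1 + x)) ^ b \<le> exp ((- x + x\<^sup>2) / 2) ^ b"
    using assms by (intro power_mono) auto
  also have "\<dots> = exp (b * (- x + x\<^sup>2) / 2)" by (simp add: exp_of_nat_mult[symmetric])
  finally show ?thesis .
qed

text \<open>With the rows of \<open>Z\<close> as data points, \<open>dev_form b d Z y = y\<^sup>T E y\<close> and below \<open>dev_vec b d Z w = E w\<close> for the
  deviation \<open>E = Z\<^sup>T Z / b - I\<close>.\<close>

definition dev_form :: "nat \<Rightarrow> nat \<Rightarrow> (nat \<Rightarrow> nat \<Rightarrow> real) \<Rightarrow> (nat \<Rightarrow> real) \<Rightarrow> real" where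
  "dev_form b d Z y = (\<Sum>i<b. (\<Sum>j<d. y j * Z i j)\<^sup>2) / b - (\<Sum>j<d. (y j)\<^sup>2)"

lemma dev_form_measurable [measurable]: "(\<lambda>Z. dev_form b d Z y) \<in> borel_measurable (stdmat b d)"
  unfolding dev_form_def
  by (intro borel_measurable_diff borel_measurable_divide borel_measurable_sum borel_measurable_power
    borel_measurable_times borel_measurable_const stdmat_entry_measurable) auto

text \<open>The sum of squares is |y|^2 times a chi-square variable with b degrees of freedom. A
  Chernoff bound with one fixed t, used with both signs, covers the two tails.\<close>

lemma dev_form_tail:
  fixes y :: "nat \<Rightarrow> real"
  assumes eta: "0 < \<eta>" "\<eta> \<le> 1" and b: "b > 0"
  shows "emeasure (stdmat b d) {Z \<in> space (stdmat b d). \<bar>dev_form b d Z y\<bar> > \<eta> * (\<Sum>j<d. (y j)\<^sup>2)} \<le> ennreal (2 * exp (- (b * \<eta>\<^sup>2 / 16)))"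
proof -
  define s where "s = (\<Sum>j<d. (y j)\<^sup>2)"
  define X where "X Z = (\<Sum>i<b. (\<Sum>j<d. y j * Z i j)\<^sup>2)" for Z
  have dev_form: "dev_form b d Z y = X Z / b - s" for Z by (simp add: dev_form_def X_def s_def)
  have Xm[measurable]: "X \<in> borel_measurable (stdmat b d)"
    unfolding X_def[abs_def]
    by (intro borel_measurable_sum borel_measurable_power
      borel_measurable_times borel_measurable_const stdmat_entry_measurable) auto
  show ?thesis
  proof (cases "s = 0")
    case True
    then have "y j = 0" if "j < d" for j using that by (simp add: s_def sum_nonneg_eq_0_iff)
    then have "X Z = 0" for Z by (simp add: X_def)
    then have "{Z \<in> space (stdmat b d). \<bar>dev_form b d Z y\<bar> > \<eta> * s} = {}" by (auto simp: dev_form True)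
    then show ?thesis by (simp only: s_def[symmetric] emeasure_empty zero_le)
  next
    case False
    then have s: "s > 0" using sum_nonneg[of "{..<d}" "\<lambda>j. (y j)\<^sup>2"] by (simp add: s_def)
    define U where "U = {Z \<in> space (stdmat b d). X Z \<ge> b * s * (1 + \<eta>)}"
    define V where "V = {Z \<in> space (stdmat b d). X Z \<le> b * s * (1 - \<eta>)}"
    have UV: "U \<in> sets (stdmat b d)" "V \<in> sets (stdmat b d)" unfolding U_def V_def by measurable
    \<comment> \<open>Then 2 t s = \<eta> / 4 lies in the range of the second order bounds for the
      logarithm. The linear terms in \<eta> cancel; the upper tail leaves exactly - b \<eta>^2 / 16
      in the exponent and the lower tail something smaller.\<close>
    define t where "t = \<eta> / (8 * s)"
    have ts: "t * s = \<eta> / 8" using s by (simp add: t_def)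
    have t: "t > 0" using s eta by (simp add: t_def)
    have U: "emeasure (stdmat b d) U \<le> ennreal (exp (- (b * \<eta>\<^sup>2 / 16)))"
    proof -
      have "emeasure (stdmat b d) U \<le> (\<integral>\<^sup>+Z. ennreal (exp (- (t * (b * s * (1 + \<eta>))))) * ennreal (exp (t * X Z)) \<partial>stdmat b d)"
      proof (rule emeasure_le_nn_integral[OF UV(1)])
        fix Z assume "Z \<in> U"
        then have "t * (b * s * (1 + \<eta>)) \<le> t * X Z" using t by (simp add: U_def)
        then show "1 \<le> ennreal (exp (- (t * (b * s * (1 + \<eta>))))) * ennreal (exp (t * X Z))"
          by (simp add: ennreal_mult'[symmetric] mult_exp_exp)
      qed
      also have "\<dots> = ennreal (exp (- (t * (b * s * (1 + \<eta>))))) * ennreal ((1 / sqrt (1 - 2 * (t * s))) ^ b)"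
        unfolding X_def s_def
        using eta ts by (subst nn_integral_cmult, simp add: X_def[symmetric], subst stdmat_exp_sum_squares) (auto simp: s_def)
      also have "\<dots> \<le> ennreal (exp (- (t * (b * s * (1 + \<eta>))))) * ennreal (exp (b * (\<eta> / 4 + 2 * (\<eta> / 4)\<^sup>2) / 2))"
        using inv_sqrt_power_le_exp[of "\<eta> / 4" b] eta
        by (intro mult_left_mono ennreal_leI) (auto simp: ts)
      also have "\<dots> = ennreal (exp (- (t * s * b * (1 + \<eta>)) + b * (\<eta> / 4 + 2 * (\<eta> / 4)\<^sup>2) / 2))"
        by (simp add: ennreal_mult'[symmetric] mult_exp_exp mult_ac)
      also have "- (t * s * b * (1 + \<eta>)) + b * (\<eta> / 4 + 2 * (\<eta> / 4)\<^sup>2) / 2 = - (b * \<eta>\<^sup>2 / 16)"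
        unfolding ts by (simp add: power2_eq_square field_simps)
      finally show ?thesis .
    qed
    have V: "emeasure (stdmat b d) V \<le> ennreal (exp (- (b * \<eta>\<^sup>2 / 16)))"
    proof -
      have "emeasure (stdmat b d) V \<le> (\<integral>\<^sup>+Z. ennreal (exp (t * (b * s * (1 - \<eta>)))) * ennreal (exp ((- t) * X Z)) \<partial>stdmat b d)"
      proof (rule emeasure_le_nn_integral[OF UV(2)])
        fix Z assume "Z \<in> V"
        then have "t * X Z \<le> t * (b * s * (1 - \<eta>))" using t by (simp add: V_def)
        then show "1 \<le> ennreal (exp (t * (b * s * (1 - \<eta>)))) * ennreal (exp ((- t) * X Z))"
          by (simp add: ennreal_mult'[symmetric] mult_exp_exp)
      qed
      also have "\<dots> = ennreal (exp (t * (b * s * (1 - \<eta>)))) * ennreal ((1 / sqrt (1 - 2 * ((- t) * s))) ^ b)"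
        unfolding X_def s_def
        using eta ts by (subst nn_integral_cmult, simp add: X_def[symmetric], subst stdmat_exp_sum_squares) (auto simp: s_def)
      also have "\<dots> \<le> ennreal (exp (t * (b * s * (1 - \<eta>)))) * ennreal (exp (b * (- (\<eta> / 4) + (\<eta> / 4)\<^sup>2) / 2))"
        using inv_sqrt_plus_power_le_exp[of "\<eta> / 4" b] eta
        by (intro mult_left_mono ennreal_leI) (auto simp: ts)
      also have "\<dots> = ennreal (exp (t * s * b * (1 - \<eta>) + b * (- (\<eta> / 4) + (\<eta> / 4)\<^sup>2) / 2))"
        by (simp add: ennreal_mult'[symmetric] mult_exp_exp mult_ac)
      also have "\<dots> \<le> ennreal (exp (- (b * \<eta>\<^sup>2 / 16)))"
        unfolding ts using mult_nonneg_nonneg[of \<eta> "\<eta> * b"] eta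
        by (intro ennreal_leI) (simp add: power2_eq_square field_simps)
      finally show ?thesis .
    qed
    have "{Z \<in> space (stdmat b d). \<bar>dev_form b d Z y\<bar> > \<eta> * s} \<subseteq> U \<union> V"
      using b by (auto simp: U_def V_def dev_form abs_less_iff abs_if field_simps split: if_splits)
    then have "emeasure (stdmat b d) {Z \<in> space (stdmat b d). \<bar>dev_form b d Z y\<bar> > \<eta> * s} \<le> emeasure (stdmat b d) (U \<union> V)"
      using UV by (intro emeasure_mono) auto
    also have "\<dots> \<le> emeasure (stdmat b d) U + emeasure (stdmat b d) V"
      using UV by (intro emeasure_subadditive)
    also have "\<dots> \<le> ennreal (exp (- (b * \<eta>\<^sup>2 / 16))) + ennreal (exp (- (b * \<eta>\<^sup>2 / 16)))"
      using U V by (rule add_mono)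
    also have "\<dots> = ennreal (2 * exp (- (b * \<eta>\<^sup>2 / 16)))" by (simp add: ennreal_plus[symmetric] del: ennreal_plus)
    finally show ?thesis by (simp add: s_def)
  qed
qed

text \<open>The same chi-square moment at t = 1 / b. It stays bounded as long as |y|^2 is of order
  sqrt b, and controls the weight in \<open>excess_mass\<close>.\<close>

lemma dev_form_exp_moment:
  fixes y :: "nat \<Rightarrow> real" and b d :: nat
  defines "s \<equiv> \<Sum>j<d. (y j)\<^sup>2"
  assumes b: "b > 0" and s: "4 * s \<le> b"
  shows "(\<integral>\<^sup>+Z. ennreal (exp (dev_form b d Z y)) \<partial>stdmat b d) \<le> ennreal (exp (4 * s\<^sup>2 / b))"
proof -
  define X where "X Z = (\<Sum>i<b. (\<Sum>j<d. y j * Z i j)\<^sup>2)" for Z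
  have dev_form: "dev_form b d Z y = X Z / b - s" for Z by (simp add: dev_form_def X_def s_def)
  have Xm[measurable]: "X \<in> borel_measurable (stdmat b d)"
    unfolding X_def[abs_def]
    by (intro borel_measurable_sum borel_measurable_power
      borel_measurable_times borel_measurable_const stdmat_entry_measurable) auto
  have s0: "s \<ge> 0" by (simp add: s_def sum_nonneg)
  have "(\<integral>\<^sup>+Z. ennreal (exp (dev_form b d Z y)) \<partial>stdmat b d) = (\<integral>\<^sup>+Z. ennreal (exp (- s)) * ennreal (exp ((1 / b) * X Z)) \<partial>stdmat b d)"
    by (intro nn_integral_cong) (simp add: dev_form ennreal_mult'[symmetric] mult_exp_exp)
  also have "\<dots> = ennreal (exp (- s)) * (\<integral>\<^sup>+Z. ennreal (exp ((1 / b) * X Z)) \<partial>stdmat b d)"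
    by (rule nn_integral_cmult) simp
  also have "(\<integral>\<^sup>+Z. ennreal (exp ((1 / b) * X Z)) \<partial>stdmat b d) = ennreal ((1 / sqrt (1 - 2 * ((1 / b) * s))) ^ b)"
    unfolding X_def s_def using s b by (intro stdmat_exp_sum_squares) (auto simp: s_def field_simps)
  also have "ennreal (exp (- s)) * \<dots> \<le> ennreal (exp (- s)) * ennreal (exp (b * ((2 * s / b) + 2 * (2 * s / b)\<^sup>2) / 2))"
    using inv_sqrt_power_le_exp[of "2 * s / b" b] s s0 b
    by (intro mult_left_mono ennreal_leI) (auto simp: field_simps)
  also have "\<dots> = ennreal (exp (- s + b * ((2 * s / b) + 2 * (2 * s / b)\<^sup>2) / 2))"
    by (simp add: ennreal_mult'[symmetric] mult_exp_exp)
  also have "- s + b * ((2 * s / b) + 2 * (2 * s / b)\<^sup>2) / 2 = 4 * s\<^sup>2 / b"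
    using b by (simp add: power2_eq_square field_simps)
  finally show ?thesis .
qed

text \<open>If |w|^2 exceeds d L, some coordinate has square above L. This union bound is cruder
  than chi-square concentration, but L is logarithmic anyway.\<close>

lemma stdg_norm_tail:
  fixes L :: real and d :: nat
  shows "emeasure (stdg {..<d}) {w \<in> space (stdg {..<d}). (\<Sum>j<d. (w j)\<^sup>2) > d * L} \<le> ennreal (2 * d * exp (- L / 4))"
proof -
  define S where "S j = {w \<in> space (stdg {..<d}). (w j)\<^sup>2 > L}" for j :: nat
  have Sm: "S j \<in> sets (stdg {..<d})" if "j < d" for j
  proof -
    have [measurable]: "(\<lambda>w. w j) \<in> borel_measurable (stdg {..<d})"
      using measurable_component_singleton[of j "{..<d}" "\<lambda>_. std_normal_distribution"] that by simp
    show ?thesis unfolding S_def by measurable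
  qed
  have S: "emeasure (stdg {..<d}) (S j) \<le> ennreal (2 * exp (- L / 4))" if j: "j < d" for j
  proof -
    define y where "y k = (if k = j then 1 else 0::real)" for k
    have y1: "(\<Sum>k<d. y k * w k) = w j" for w :: "nat \<Rightarrow> real"
      using j by (simp add: y_def if_distrib[of "\<lambda>x. x * _"] cong: if_cong)
    have y2: "(\<Sum>k<d. (y k)\<^sup>2) = 1"
      using j by (simp add: y_def if_distrib[of "\<lambda>x. x\<^sup>2"] cong: if_cong)
    have [measurable]: "(\<lambda>w. w j) \<in> borel_measurable (stdg {..<d})"
      using measurable_component_singleton[of j "{..<d}" "\<lambda>_. std_normal_distribution"] j by simp
    have "emeasure (stdg {..<d}) (S j) \<le> (\<integral>\<^sup>+w. ennreal (exp (- L / 4)) * ennreal (exp ((1/4) * (w j)\<^sup>2)) \<partial>stdg {..<d})"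
    proof (rule emeasure_le_nn_integral[OF Sm[OF j]])
      fix w assume "w \<in> S j"
      then show "1 \<le> ennreal (exp (- L / 4)) * ennreal (exp ((1/4) * (w j)\<^sup>2))"
        by (auto simp: S_def ennreal_mult'[symmetric] mult_exp_exp)
    qed
    also have "\<dots> = ennreal (exp (- L / 4)) * (\<integral>\<^sup>+w. ennreal (exp ((1/4) * (w j)\<^sup>2)) \<partial>stdg {..<d})"
      by (rule nn_integral_cmult) simp
    also have "(\<integral>\<^sup>+w. ennreal (exp ((1/4) * (w j)\<^sup>2)) \<partial>stdg {..<d}) = ennreal (1 / sqrt (1 - 2 * ((1/4) * 1)))"
      using stdg_exp_square_linear[of "{..<d}" "1/4" y] unfolding y1 y2 by simp
    also have "ennreal (exp (- L / 4)) * \<dots> \<le> ennreal (exp (- L / 4)) * ennreal 2"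
    proof (intro mult_left_mono ennreal_leI)
      have "sqrt (1/4) \<le> sqrt (1/2 :: real)" by (intro real_sqrt_le_mono) simp
      then have "1/2 \<le> sqrt (1/2 :: real)" by (simp add: real_sqrt_divide)
      then show "1 / sqrt (1 - 2 * ((1/4) * 1)) \<le> (2::real)" by (simp add: field_simps)
    qed simp
    also have "ennreal (exp (- L / 4)) * ennreal 2 = ennreal (2 * exp (- L / 4))"
      by (subst ennreal_mult'[symmetric]) (simp_all add: mult.commute)
    finally show ?thesis .
  qed
  have "{w \<in> space (stdg {..<d}). (\<Sum>j<d. (w j)\<^sup>2) > d * L} \<subseteq> (\<Union>j\<in>{..<d}. S j)"
  proof
    fix w assume w: "w \<in> {w \<in> space (stdg {..<d}). (\<Sum>j<d. (w j)\<^sup>2) > d * L}"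
    show "w \<in> (\<Union>j\<in>{..<d}. S j)"
    proof (rule ccontr)
      assume "w \<notin> (\<Union>j\<in>{..<d}. S j)"
      then have "(w j)\<^sup>2 \<le> L" if "j < d" for j using w that by (force simp: S_def)
      then have "(\<Sum>j<d. (w j)\<^sup>2) \<le> of_nat (card {..<d}) * L" by (intro sum_bounded_above) auto
      then show False using w by simp
    qed
  qed
  then have "emeasure (stdg {..<d}) {w \<in> space (stdg {..<d}). (\<Sum>j<d. (w j)\<^sup>2) > d * L} \<le> emeasure (stdg {..<d}) (\<Union>j\<in>{..<d}. S j)"
    using Sm by (intro emeasure_mono) auto
  also have "\<dots> \<le> (\<Sum>j\<in>{..<d}. emeasure (stdg {..<d}) (S j))"
    using Sm by (intro emeasure_subadditive_finite) auto
  also have "\<dots> \<le> (\<Sum>j\<in>{..<d}. ennreal (2 * exp (- L / 4)))"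
    using S by (intro sum_mono) auto
  also have "\<dots> = ennreal (2 * d * exp (- L / 4))"
    by (simp add: ennreal_of_nat_eq_real_of_nat ennreal_mult'[symmetric] mult_ac)
  finally show ?thesis .
qed

section \<open>Projected sphere density against Gaussian density\<close>

definition sqn :: "nat \<Rightarrow> (nat \<Rightarrow> real) \<Rightarrow> real" where
  "sqn d w = (\<Sum>j<d. (w j)\<^sup>2)"

definition dev_vec :: "nat \<Rightarrow> nat \<Rightarrow> (nat \<Rightarrow> nat \<Rightarrow> real) \<Rightarrow> (nat \<Rightarrow> real) \<Rightarrow> nat \<Rightarrow> real" where
  "dev_vec b d Z w j = (\<Sum>i<b. Z i j * (\<Sum>k<d. w k * Z i k)) / b - w j"

lemma sqn_nonneg [simp]: "sqn d w \<ge> 0"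
  by (simp add: sqn_def sum_nonneg)

lemma bilinear_sum: "(\<Sum>j<d. x j * dev_vec b d Z w j) = (\<Sum>i<b. (\<Sum>j<d. x j * Z i j) * (\<Sum>k<d. w k * Z i k)) / b - (\<Sum>j<d. x j * w j)"
proof -
  have "(\<Sum>j<d. x j * (\<Sum>i<b. Z i j * (\<Sum>k<d. w k * Z i k))) = (\<Sum>j<d. \<Sum>i<b. x j * Z i j * (\<Sum>k<d. w k * Z i k))"
    by (simp add: sum_distrib_left mult.assoc)
  also have "\<dots> = (\<Sum>i<b. \<Sum>j<d. x j * Z i j * (\<Sum>k<d. w k * Z i k))" by (rule sum.swap)
  also have "\<dots> = (\<Sum>i<b. (\<Sum>j<d. x j * Z i j) * (\<Sum>k<d. w k * Z i k))" by (simp add: sum_distrib_right)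
  finally show ?thesis
    by (simp add: dev_vec_def right_diff_distrib sum_subtractf sum_divide_distrib[symmetric])
qed

lemma dev_form_bilinear: "dev_form b d Z w = (\<Sum>j<d. w j * dev_vec b d Z w j)"
  unfolding bilinear_sum by (simp add: dev_form_def power2_eq_square)

lemma dev_form_add_diff:
  "dev_form b d Z (\<lambda>j. x j + y j) - dev_form b d Z (\<lambda>j. x j - y j) = 4 * (\<Sum>j<d. x j * dev_vec b d Z y j)"
proof -
  have i: "(\<Sum>j<d. (x j + y j) * Z i j)\<^sup>2 - (\<Sum>j<d. (x j - y j) * Z i j)\<^sup>2 =
    4 * ((\<Sum>j<d. x j * Z i j) * (\<Sum>k<d. y k * Z i k))" for i
    by (simp add: distrib_right left_diff_distrib sum.distrib sum_subtractf) (simp add: power2_eq_square algebra_simps)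
  have h1: "(\<Sum>i<b. (\<Sum>j<d. (x j + y j) * Z i j)\<^sup>2) - (\<Sum>i<b. (\<Sum>j<d. (x j - y j) * Z i j)\<^sup>2) =
    4 * (\<Sum>i<b. (\<Sum>j<d. x j * Z i j) * (\<Sum>k<d. y k * Z i k))"
    unfolding sum_subtractf[symmetric] i by (rule sum_distrib_left[symmetric])
  have h2: "(\<Sum>j<d. (x j + y j)\<^sup>2) - (\<Sum>j<d. (x j - y j)\<^sup>2) = 4 * (\<Sum>j<d. x j * y j)"
    unfolding sum_subtractf[symmetric] sum_distrib_left
    by (intro sum.cong refl) (simp add: power2_eq_square algebra_simps)
  have "(\<Sum>i<b. (\<Sum>j<d. (x j + y j) * Z i j)\<^sup>2) / b - (\<Sum>i<b. (\<Sum>j<d. (x j - y j) * Z i j)\<^sup>2) / b =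
    4 * (\<Sum>i<b. (\<Sum>j<d. x j * Z i j) * (\<Sum>k<d. y k * Z i k)) / b"
    unfolding diff_divide_distrib[symmetric] h1 ..
  then show ?thesis
    unfolding bilinear_sum dev_form_def right_diff_distrib times_divide_eq_right using h2 by linarith
qed

lemma sqn_add_diff: "sqn d (\<lambda>j. x j + y j) + sqn d (\<lambda>j. x j - y j) = 2 * sqn d x + 2 * sqn d y"
  unfolding sqn_def sum.distrib[symmetric] sum_distrib_left
  by (intro sum.cong refl) (simp add: power2_eq_square algebra_simps)

text \<open>Polarisation writes 4 x^T E y as the difference of the form at x + y and x - y; the
  parallelogram law adds up the two bounds.\<close>

lemma bilinear_bound:
  assumes 1: "\<bar>dev_form b d Z (\<lambda>j. x j + y j)\<bar> \<le> \<eta> * sqn d (\<lambda>j. x j + y j)"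
    and 2: "\<bar>dev_form b d Z (\<lambda>j. x j - y j)\<bar> \<le> \<eta> * sqn d (\<lambda>j. x j - y j)"
  shows "\<bar>\<Sum>j<d. x j * dev_vec b d Z y j\<bar> \<le> \<eta> * (sqn d x + sqn d y) / 2"
proof -
  have "\<bar>4 * (\<Sum>j<d. x j * dev_vec b d Z y j)\<bar> \<le> \<eta> * (sqn d (\<lambda>j. x j + y j) + sqn d (\<lambda>j. x j - y j))"
    unfolding dev_form_add_diff[symmetric] distrib_left using 1 2 by linarith
  then show ?thesis unfolding sqn_add_diff by (simp add: algebra_simps)
qed

definition unitv :: "nat \<Rightarrow> nat \<Rightarrow> real" where "unitv k j = (if j = k then 1 else 0)"

lemma sum_unitv: "k < d \<Longrightarrow> (\<Sum>j<d. unitv k j * f j) = f k"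
  by (simp add: unitv_def if_distrib[of "\<lambda>x. x * _"] cong: if_cong)

lemma sqn_unitv: "k < d \<Longrightarrow> sqn d (\<lambda>j. a * unitv k j) = a\<^sup>2"
  by (simp add: sqn_def unitv_def if_distrib[of "\<lambda>x. (a * x)\<^sup>2"] cong: if_cong)

text \<open>Each coordinate of E w is a value of the bilinear form at a unit vector and w. The unit
  vector is rescaled to the length of w, which balances the two norms in
  \<open>bilinear_bound\<close> and gives \<eta> |w| per coordinate.\<close>

lemma dev_vec_small:
  assumes eta: "\<eta> > 0" and w: "\<And>k s. k < d \<Longrightarrow> s \<in> {1, -1} \<Longrightarrow>
      \<bar>dev_form b d Z (\<lambda>j. sqrt (sqn d w) * unitv k j + s * w j)\<bar> \<le> \<eta> * sqn d (\<lambda>j. sqrt (sqn d w) * unitv k j + s * w j)"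
  shows "(\<Sum>j<d. (dev_vec b d Z w j)\<^sup>2) \<le> d * \<eta>\<^sup>2 * sqn d w"
proof -
  define a where "a = sqrt (sqn d w)"
  have a2: "a\<^sup>2 = sqn d w" by (simp add: a_def)
  have a0: "a \<ge> 0" by (simp add: a_def)
  have "(dev_vec b d Z w k)\<^sup>2 \<le> \<eta>\<^sup>2 * sqn d w" if k: "k < d" for k
  proof (cases "a = 0")
    case True
    then have "w j = 0" if "j < d" for j using a2 that by (simp add: sqn_def sum_nonneg_eq_0_iff)
    then have "dev_vec b d Z w k = 0" using k by (simp add: dev_vec_def)
    then show ?thesis by simp
  next
    case False
    have "\<bar>\<Sum>j<d. (a * unitv k j) * dev_vec b d Z w j\<bar> \<le> \<eta> * (sqn d (\<lambda>j. a * unitv k j) + sqn d w) / 2"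
      using w[OF k, of 1] w[OF k, of "-1"] by (intro bilinear_bound) (auto simp: a_def)
    also have "(\<Sum>j<d. (a * unitv k j) * dev_vec b d Z w j) = a * dev_vec b d Z w k"
      using sum_unitv[OF k, of "dev_vec b d Z w"] by (simp add: mult.assoc sum_distrib_left[symmetric])
    finally have "a * \<bar>dev_vec b d Z w k\<bar> \<le> a * (\<eta> * a)"
      using a0 by (simp add: sqn_unitv[OF k] a2[symmetric] abs_mult power2_eq_square mult_ac)
    then have "\<bar>dev_vec b d Z w k\<bar> \<le> \<eta> * a" using False a0 by simp
    then have "\<bar>dev_vec b d Z w k\<bar>\<^sup>2 \<le> (\<eta> * a)\<^sup>2" by (intro power_mono) auto
    then show ?thesis by (simp add: power_mult_distrib a2)
  qed
  then have "(\<Sum>j<d. (dev_vec b d Z w j)\<^sup>2) \<le> of_nat (card {..<d}) * (\<eta>\<^sup>2 * sqn d w)"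
    by (intro sum_bounded_above) auto
  then show ?thesis by (simp add: mult.assoc)
qed

text \<open>Polarisation bounds every entry of E by \<eta>, so the form is at most \<eta> (\<Sum>
  |u_j|)^2 \<le> \<eta> d |u|^2 in modulus. This is the estimate valid for all u at once; it is
  needed only to constant accuracy, which makes the factor d affordable.\<close>

lemma dev_form_lower_of_entries:
  assumes eta: "\<eta> > 0" and w: "\<And>j k s. j < d \<Longrightarrow> k < d \<Longrightarrow> s \<in> {1, -1} \<Longrightarrow>
      \<bar>dev_form b d Z (\<lambda>l. unitv j l + s * unitv k l)\<bar> \<le> \<eta> * sqn d (\<lambda>l. unitv j l + s * unitv k l)"
  shows "dev_form b d Z u \<ge> - (\<eta> * d * sqn d u)"
proof -
  have ent: "\<bar>dev_vec b d Z (unitv k) j\<bar> \<le> \<eta>" if jk: "j < d" "k < d" for j k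
  proof -
    have "\<bar>\<Sum>l<d. unitv j l * dev_vec b d Z (unitv k) l\<bar> \<le> \<eta> * (sqn d (unitv j) + sqn d (unitv k)) / 2"
      using w[OF jk, of 1] w[OF jk, of "-1"] by (intro bilinear_bound) auto
    moreover have "sqn d (unitv k) = 1" if "k < d" for k using sqn_unitv[OF that, of 1] by simp
    ultimately show ?thesis using jk by (simp add: sum_unitv)
  qed
  have lin: "dev_vec b d Z u j = (\<Sum>k<d. u k * dev_vec b d Z (unitv k) j)" if j: "j < d" for j
  proof -
    have "(\<Sum>k<d. u k * dev_vec b d Z (unitv k) j) = (\<Sum>k<d. u k * ((\<Sum>i<b. Z i j * Z i k) / b - unitv k j))"
      by (intro sum.cong refl) (simp add: dev_vec_def sum_unitv)
    also have "\<dots> = (\<Sum>k<d. \<Sum>i<b. Z i j * (u k * Z i k)) / b - (\<Sum>k<d. u k * unitv k j)"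
      by (simp add: right_diff_distrib sum_subtractf sum_divide_distrib sum_distrib_left mult_ac)
    also have "(\<Sum>k<d. \<Sum>i<b. Z i j * (u k * Z i k)) = (\<Sum>i<b. Z i j * (\<Sum>k<d. u k * Z i k))"
      unfolding sum_distrib_left by (rule sum.swap)
    also have "(\<Sum>k<d. u k * unitv k j) = u j"
      using sum_unitv[OF j, of u] by (simp add: unitv_def mult.commute eq_commute)
    finally show ?thesis by (simp add: dev_vec_def)
  qed
  have "- dev_form b d Z u \<le> \<bar>\<Sum>j<d. u j * dev_vec b d Z u j\<bar>" unfolding dev_form_bilinear by simp
  also have "(\<Sum>j<d. u j * dev_vec b d Z u j) = (\<Sum>j<d. \<Sum>k<d. u j * (u k * dev_vec b d Z (unitv k) j))"
    by (intro sum.cong refl) (simp add: lin sum_distrib_left)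
  also have "\<bar>\<dots>\<bar> \<le> (\<Sum>j<d. \<Sum>k<d. \<bar>u j * (u k * dev_vec b d Z (unitv k) j)\<bar>)"
    by (intro order_trans[OF sum_abs] sum_mono sum_abs)
  also have "\<dots> \<le> (\<Sum>j<d. \<Sum>k<d. \<bar>u j\<bar> * \<bar>u k\<bar> * \<eta>)"
    using ent by (intro sum_mono) (auto simp: abs_mult mult.assoc intro!: mult_left_mono)
  also have "\<dots> = \<eta> * (\<Sum>j<d. \<bar>u j\<bar>)\<^sup>2"
    by (simp add: power2_eq_square sum_product sum_distrib_left mult_ac)
  also have "(\<Sum>j<d. \<bar>u j\<bar>)\<^sup>2 \<le> (\<Sum>j<d. \<bar>u j\<bar>\<^sup>2) * of_nat (card {..<d})"
    by (rule sum_squared_le_sum_of_squares)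
  finally show ?thesis using eta by (simp add: sqn_def mult_ac)
qed

text \<open>With \<open>y = b S\<^sup>-\<^sup>1 w\<close> and \<open>r = y - w\<close>, the equation \<open>(I + E) y = w\<close> gives
  \<open>b w\<^sup>T S\<^sup>-\<^sup>1 w = |w|\<^sup>2 - w\<^sup>T E w + \<rho>\<close> with \<open>\<rho> = |r|\<^sup>2 + r\<^sup>T E r = - r\<^sup>T E w\<close>.\<close>

lemma inverse_quadratic_form_bounds:
  fixes Z Si :: "nat \<Rightarrow> nat \<Rightarrow> real"
  assumes b: "b > 0"
    and Si: "\<And>j l. j < d \<Longrightarrow> l < d \<Longrightarrow> (\<Sum>k<d. (\<Sum>i<b. Z i j * Z i k) * Si k l) = (if j = l then 1 else 0)"
    and op: "\<And>u. dev_form b d Z u \<ge> - (1/2 * sqn d u)"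
  shows "b * qf Si d w \<ge> sqn d w - dev_form b d Z w"
    and "b * qf Si d w \<le> sqn d w - dev_form b d Z w + 2 * (\<Sum>j<d. (dev_vec b d Z w j)\<^sup>2)"
proof -
  define y where "y j = b * (\<Sum>k<d. Si j k * w k)" for j
  have Sy: "(\<Sum>k<d. (\<Sum>i<b. Z i j * Z i k) * y k) = b * w j" if j: "j < d" for j
  proof -
    have "(\<Sum>k<d. (\<Sum>i<b. Z i j * Z i k) * y k) = (\<Sum>k<d. b * ((\<Sum>i<b. Z i j * Z i k) * (\<Sum>l<d. Si k l * w l)))"
      unfolding y_def by (intro sum.cong refl mult.left_commute)
    also have "\<dots> = b * (\<Sum>k<d. (\<Sum>i<b. Z i j * Z i k) * (\<Sum>l<d. Si k l * w l))"
      by (rule sum_distrib_left[symmetric])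
    also have "(\<Sum>k<d. (\<Sum>i<b. Z i j * Z i k) * (\<Sum>l<d. Si k l * w l)) = w j"
      by (rule linear_inverse_apply[where F = "\<lambda>j k. \<Sum>i<b. Z i j * Z i k", OF Si j])
    finally show ?thesis .
  qed
  have vy: "dev_vec b d Z y j = w j - y j" if j: "j < d" for j
  proof -
    have "(\<Sum>i<b. Z i j * (\<Sum>k<d. y k * Z i k)) = (\<Sum>i<b. \<Sum>k<d. Z i j * Z i k * y k)"
      by (simp add: sum_distrib_left mult_ac)
    also have "\<dots> = (\<Sum>k<d. \<Sum>i<b. Z i j * Z i k * y k)" by (rule sum.swap)
    also have "\<dots> = b * w j" using Sy[OF j] by (simp add: sum_distrib_right)
    finally show ?thesis using b by (simp add: dev_vec_def)
  qed
  define r where "r j = y j - w j" for j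
  have add: "dev_vec b d Z y j = dev_vec b d Z w j + dev_vec b d Z r j" if "j < d" for j
    by (simp add: dev_vec_def r_def left_diff_distrib right_diff_distrib sum_subtractf diff_divide_distrib)
  have rE: "dev_vec b d Z r j = - r j - dev_vec b d Z w j" if "j < d" for j
    using vy[OF that] add[OF that] by (simp add: r_def)
  define \<rho> where "\<rho> = sqn d r + dev_form b d Z r"
  have rho1: "\<rho> = - (\<Sum>j<d. r j * dev_vec b d Z w j)"
    unfolding \<rho>_def dev_form_bilinear sqn_def sum.distrib[symmetric] sum_negf[symmetric]
    by (intro sum.cong refl) (simp add: rE power2_eq_square algebra_simps)
  have sym: "(\<Sum>j<d. w j * dev_vec b d Z r j) = (\<Sum>j<d. r j * dev_vec b d Z w j)"
    unfolding bilinear_sum by (simp add: mult.commute)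
  have theta: "b * qf Si d w = (\<Sum>j<d. w j * y j)"
  proof -
    have "(\<Sum>j<d. w j * y j) = (\<Sum>j<d. b * (w j * (\<Sum>k<d. Si j k * w k)))"
      unfolding y_def by (intro sum.cong refl mult.left_commute)
    then show ?thesis unfolding qf_def by (simp only: sum_distrib_left[symmetric])
  qed
  also have "\<dots> = (\<Sum>j<d. (w j)\<^sup>2 - w j * dev_vec b d Z w j - w j * dev_vec b d Z r j)"
    by (intro sum.cong refl) (simp add: rE, simp add: r_def power2_eq_square algebra_simps)
  also have "\<dots> = sqn d w - dev_form b d Z w + \<rho>"
    unfolding rho1 sym[symmetric] dev_form_bilinear sqn_def by (simp add: sum_subtractf)
  finally have eq: "b * qf Si d w = sqn d w - dev_form b d Z w + \<rho>" .
  have rho0: "\<rho> \<ge> sqn d r / 2" using op[of r] by (simp add: \<rho>_def)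
  then have "\<rho> \<ge> 0" using sqn_nonneg[of d r] by linarith
  with eq show "b * qf Si d w \<ge> sqn d w - dev_form b d Z w" by simp
  \<comment> \<open>Young's inequality. The summand |r|^2 / 4 is at most \<rho> / 2, because E \<ge>
    - I / 2 gives \<rho> \<ge> |r|^2 / 2, and is absorbed on the left.\<close>
  have "\<rho> \<le> (\<Sum>j<d. (r j)\<^sup>2 / 4 + (dev_vec b d Z w j)\<^sup>2)"
    unfolding rho1 sum_negf[symmetric]
  proof (rule sum_mono)
    fix j
    have "0 \<le> (r j / 2 + dev_vec b d Z w j)\<^sup>2" by simp
    then show "- (r j * dev_vec b d Z w j) \<le> (r j)\<^sup>2 / 4 + (dev_vec b d Z w j)\<^sup>2"
      by (simp add: power2_eq_square algebra_simps)
  qed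
  also have "\<dots> = sqn d r / 4 + (\<Sum>j<d. (dev_vec b d Z w j)\<^sup>2)"
    by (simp add: sum.distrib sqn_def sum_divide_distrib)
  finally have "\<rho> \<le> 2 * (\<Sum>j<d. (dev_vec b d Z w j)\<^sup>2)" using rho0 by simp
  with eq show "b * qf Si d w \<le> sqn d w - dev_form b d Z w + 2 * (\<Sum>j<d. (dev_vec b d Z w j)\<^sup>2)" by simp
qed

text \<open>On a kernel vector v of Z^T Z the deviation acts as E v = - v, so the form is -|v|^2
  there, which contradicts the lower bound -|v|^2 / 2 unless v = 0.\<close>

lemma gram_inverse_exists:
  fixes Z :: "nat \<Rightarrow> nat \<Rightarrow> real"
  assumes b: "b > 0" and op: "\<And>u. dev_form b d Z u \<ge> - (1/2 * sqn d u)"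
  obtains Si where "\<And>j l. j < d \<Longrightarrow> l < d \<Longrightarrow> (\<Sum>k<d. (\<Sum>i<b. Z i j * Z i k) * Si k l) = (if j = l then 1 else 0)"
proof (rule two_sided_inverse_exists[of d "\<lambda>j k. \<Sum>i<b. Z i j * Z i k"])
  fix v :: "nat \<Rightarrow> real" and j
  assume z: "\<And>j. j < d \<Longrightarrow> (\<Sum>k<d. (\<Sum>i<b. Z i j * Z i k) * v k) = 0" and j: "j < d"
  have "dev_vec b d Z v j = - v j" if j: "j < d" for j
  proof -
    have "(\<Sum>i<b. Z i j * (\<Sum>k<d. v k * Z i k)) = (\<Sum>i<b. \<Sum>k<d. Z i j * Z i k * v k)"
      by (simp add: sum_distrib_left mult_ac)
    also have "\<dots> = (\<Sum>k<d. \<Sum>i<b. Z i j * Z i k * v k)" by (rule sum.swap)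
    also have "\<dots> = 0" using z[OF j] by (simp add: sum_distrib_right)
    finally show ?thesis by (simp add: dev_vec_def)
  qed
  then have "dev_form b d Z v = - sqn d v"
    unfolding dev_form_bilinear sqn_def sum_negf[symmetric] by (intro sum.cong refl) (simp add: power2_eq_square)
  then have "sqn d v = 0" using op[of v] sqn_nonneg[of d v] by simp
  then show "v j = 0" using j by (simp add: sqn_def sum_nonneg_eq_0_iff)
qed (use that in blast)

text \<open>Here \<open>u\<close> is the density of the projected sphere at \<open>w\<close>, without its normalising constant.\<close>

lemma density_ratio_bounds:
  fixes Z Si :: "nat \<Rightarrow> nat \<Rightarrow> real" and L :: real
  assumes d: "d \<ge> 1" and L: "L \<ge> 2" and c: "c \<ge> 1" and bc: "b = d + 2 * c" and bL: "real b \<ge> 4 * (real d)\<^sup>2 * L ^ 3"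
    and Si: "\<And>j l. j < d \<Longrightarrow> l < d \<Longrightarrow> (\<Sum>k<d. (\<Sum>i<b. Z i j * Z i k) * Si k l) = (if j = l then 1 else 0)"
    and op: "\<And>u. dev_form b d Z u \<ge> - (1/2 * sqn d u)"
    and q0: "qf Si d w \<ge> 0" and w: "sqn d w \<le> d * L"
  defines "u \<equiv> (1 - qf Si d w) ^ (c - 1) * (if qf Si d w < 1 then 1 else 0)"
  shows "u \<le> exp (- sqn d w / 2) * exp (1/2 + max 0 (dev_form b d Z w) / 2)" (is ?A)
    and "\<bar>dev_form b d Z w\<bar> \<le> 1 \<Longrightarrow> (\<Sum>j<d. (dev_vec b d Z w j)\<^sup>2) \<le> 1 \<Longrightarrow> exp (- sqn d w / 2) \<le> exp (5/2) * u" (is "_ \<Longrightarrow> _ \<Longrightarrow> ?B")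
    and "u \<ge> 0"
proof -
  define q where "q = qf Si d w"
  define m where "m = c - 1"
  have m: "real m = (real b - real d) / 2 - 1" using c bc by (simp add: m_def)
  have m2: "2 * real m \<le> b"
  proof -
    have "2 * m \<le> b" using bc c by (simp add: m_def)
    then show ?thesis by (metis of_nat_le_iff of_nat_mult of_nat_numeral)
  qed
  have dL: "real d * L \<ge> 2" using d L mult_mono[of 1 "real d" 2 L] by simp
  have b0: "real b > 0" using bc c by simp
  have bL2: "real b \<ge> 8 * (real d * L)\<^sup>2"
  proof -
    have "4 * (real d)\<^sup>2 * L ^ 3 = 4 * (real d * L)\<^sup>2 * L" by (simp add: power2_eq_square power3_eq_cube)
    moreover have "4 * (real d * L)\<^sup>2 * L \<ge> 4 * (real d * L)\<^sup>2 * 2" using L by (intro mult_left_mono) auto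
    ultimately show ?thesis using bL by linarith
  qed
  have b0': "b > 0" using b0 by simp
  have lo: "b * q \<ge> sqn d w - dev_form b d Z w"
    unfolding q_def by (rule inverse_quadratic_form_bounds(1)[where Z = Z, OF b0']) (rule Si, assumption+, rule op)
  have hi: "b * q \<le> sqn d w - dev_form b d Z w + 2 * (\<Sum>j<d. (dev_vec b d Z w j)\<^sup>2)"
    unfolding q_def by (rule inverse_quadratic_form_bounds(2)[where Z = Z, OF b0']) (rule Si, assumption+, rule op)
  show u0: "u \<ge> 0" by (simp add: u_def)
  show ?A
  proof (cases "q < 1")
    case True
    have "1 - q \<le> exp (- q)" using exp_ge_add_one_self[of "- q"] by simp
    then have "(1 - q) ^ m \<le> exp (- q) ^ m" using True by (intro power_mono) auto
    also have "\<dots> = exp (- (m * q))" by (simp add: exp_of_nat_mult[symmetric])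
    \<comment> \<open>The ratio m / b falls short of 1/2 by (d + 2) / (2 b), which on |w|^2 \<le> d
      L costs at most 1/2 in the exponent. As m / b \<le> 1/2, a positive value of the form costs at
      most half of itself and a negative one nothing.\<close>
    also have "\<dots> \<le> exp (- sqn d w / 2 + (1/2 + max 0 (dev_form b d Z w) / 2))"
    proof -
      have mb: "real m / b = 1/2 - (d + 2) / (2 * b)" using b0 by (simp add: m field_simps)
      have mb1: "0 \<le> real m / b" by simp
      have mb2: "real m / b \<le> 1/2" using m2 b0 by (subst pos_divide_le_eq) auto
      have "(real m / b) * (sqn d w - dev_form b d Z w) \<le> (real m / b) * (b * q)"
        by (rule mult_left_mono[OF lo mb1])
      also have "\<dots> = m * q" using b0 by simp
      finally have 1: "m * q \<ge> (real m / b) * sqn d w - (real m / b) * dev_form b d Z w" by (simp add: right_diff_distrib)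
      have "(real m / b) * dev_form b d Z w \<le> (real m / b) * max 0 (dev_form b d Z w)" by (rule mult_left_mono[OF _ mb1]) simp
      also have "\<dots> \<le> (1/2) * max 0 (dev_form b d Z w)" by (rule mult_right_mono[OF mb2]) simp
      finally have 2: "(real m / b) * dev_form b d Z w \<le> max 0 (dev_form b d Z w) / 2" by simp
      have 3: "(real m / b) * sqn d w = sqn d w / 2 - ((d + 2) / (2 * b)) * sqn d w"
        unfolding mb left_diff_distrib by (rule arg_cong2[where f = "(-)"]) simp_all
      have 4: "((d + 2) / (2 * b)) * sqn d w \<le> 1/2"
      proof -
        have "(real d + 2) * sqn d w \<le> (real d + 2) * (d * L)" using w by (intro mult_left_mono) auto
        also have "\<dots> \<le> (2 * (d * L)) * (d * L)"
        proof (rule mult_right_mono)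
          have "real d * 2 \<le> real d * L" using L by (intro mult_left_mono) auto
          then show "real d + 2 \<le> 2 * (d * L)" using dL by simp
        qed (use dL in simp)
        also have "\<dots> \<le> b" using bL2 zero_le_power2[of "real d * L"] unfolding power2_eq_square by linarith
        finally have 5: "(real d + 2) * sqn d w \<le> b" .
        have "((d + 2) / (2 * b)) * sqn d w = ((real d + 2) * sqn d w) / (2 * b)" by simp
        also have "\<dots> \<le> b / (2 * b)" by (rule divide_right_mono[OF 5]) simp
        also have "\<dots> = 1/2" using b0 by simp
        finally show ?thesis .
      qed
      show ?thesis unfolding exp_le_cancel_iff using 1 2 3 4 by linarith
    qed
    finally show ?thesis using True by (simp add: u_def q_def m_def mult_exp_exp)
  qed (simp add: u_def q_def)
  assume nice: "\<bar>dev_form b d Z w\<bar> \<le> 1" "(\<Sum>j<d. (dev_vec b d Z w j)\<^sup>2) \<le> 1"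
  have bq: "b * q \<le> sqn d w + 3" using hi nice by linarith
  have bq3: "b * q \<le> 5/2 * (d * L)" using bq w dL by linarith
  have bqn: "b * q \<ge> 0" using q0 b0 by (simp add: q_def)
  have bqq: "(b * q)\<^sup>2 \<le> b"
  proof -
    have "(b * q)\<^sup>2 \<le> (5/2 * (d * L))\<^sup>2" using bq3 bqn by (intro power_mono) auto
    also have "\<dots> = 25/4 * (d * L)\<^sup>2" by (simp only: power_mult_distrib) (simp add: power2_eq_square)
    also have "\<dots> \<le> b" using bL2 zero_le_power2[of "real d * L"] by linarith
    finally show ?thesis .
  qed
  have q2: "q \<le> 1/2"
  proof -
    have "2 * (b * q) \<le> 5 * (d * L)" using bq3 by simp
    also have "\<dots> \<le> 8 * (d * L) * (d * L)"
    proof -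
      have "(d * L) * 1 \<le> (d * L) * (d * L)" using dL by (intro mult_left_mono) auto
      then show ?thesis using dL by simp
    qed
    also have "\<dots> \<le> b" using bL2 by (simp add: power2_eq_square mult.assoc)
    finally show ?thesis using b0 by (simp add: field_simps)
  qed
  \<comment> \<open>The constant 5/2 arises from m q \<le> b q / 2 \<le> |w|^2 / 2 + 3/2, where 3 =
    1 + 2 is the form plus twice |E w|^2, and from the second order term 2 m q^2 \<le> (b q)^2 / b
    \<le> 1.\<close>
  have "exp (- q - 2 * q\<^sup>2) \<le> 1 - q"
    using ln_one_minus_pos_lower_bound[of q] q0 q2 by (subst ln_ge_iff[symmetric]) (auto simp: q_def)
  then have "exp (- q - 2 * q\<^sup>2) ^ m \<le> (1 - q) ^ m" by (intro power_mono) auto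
  then have "exp (m * (- q - 2 * q\<^sup>2)) \<le> u" using q2 by (simp add: u_def q_def m_def exp_of_nat_mult)
  moreover have "- sqn d w / 2 - 5/2 \<le> m * (- q - 2 * q\<^sup>2)"
  proof -
    have mb: "real m \<le> b / 2" using m2 by simp
    have "m * q \<le> (b / 2) * q" using mb q0 by (intro mult_right_mono) (auto simp: q_def)
    moreover have "m * (2 * q\<^sup>2) \<le> (b / 2) * (2 * q\<^sup>2)" using mb by (intro mult_right_mono) auto
    moreover have "(b / 2) * (2 * q\<^sup>2) = (b * q)\<^sup>2 / b" using b0 by (simp add: power2_eq_square)
    moreover have "(b * q)\<^sup>2 / b \<le> 1" using bqq b0 by simp
    moreover have "b * q / 2 \<le> sqn d w / 2 + 3/2" using bq by simp
    ultimately show ?thesis by (simp add: algebra_simps)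
  qed
  ultimately have "exp (- sqn d w / 2 - 5/2) \<le> u" by (meson exp_le_cancel_iff order_trans)
  then have "exp (5/2) * exp (- sqn d w / 2 - 5/2) \<le> exp (5/2) * u" by (intro mult_left_mono) auto
  then show ?B by (simp add: mult_exp_exp)
qed

text \<open>The densities are a u and b v with unknown constants a and b. Integrating v \<le>
  \<kappa> u over a set that carries at least half of M2 gives a \<le> 2 \<kappa> b; the opposite
  pointwise inequality then compares the measures on G.\<close>

lemma density_compare:
  fixes u v :: "'a \<Rightarrow> ennreal" and a b :: ennreal and \<kappa> :: real
  assumes u[measurable]: "u \<in> borel_measurable N" and v[measurable]: "v \<in> borel_measurable N"
    and 1: "\<And>f. f \<in> borel_measurable N \<Longrightarrow> (\<integral>\<^sup>+x. f x \<partial>M1) = a * (\<integral>\<^sup>+x. f x * u x \<partial>N)" "prob_space M1" "sets M1 = sets N"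
    and 2: "\<And>f. f \<in> borel_measurable N \<Longrightarrow> (\<integral>\<^sup>+x. f x \<partial>M2) = b * (\<integral>\<^sup>+x. f x * v x \<partial>N)" "prob_space M2" "sets M2 = sets N"
    and G[measurable]: "G \<in> sets N" and k: "\<kappa> \<ge> 0"
    and vu: "\<And>x. x \<in> G \<Longrightarrow> v x \<le> ennreal \<kappa> * u x"
    and half: "emeasure M2 G \<ge> ennreal (1/2)"
  shows "a \<le> ennreal (2 * \<kappa>) * b"
    and "\<And>A \<kappa>'. A \<in> sets N \<Longrightarrow> \<kappa>' \<ge> 0 \<Longrightarrow> (\<And>x. x \<in> G \<Longrightarrow> u x \<le> ennreal \<kappa>' * v x) \<Longrightarrow>
      emeasure M1 (A \<inter> G) \<le> ennreal (2 * \<kappa> * \<kappa>') * emeasure M2 A"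
proof -
  interpret M1: prob_space M1 by fact
  interpret M2: prob_space M2 by fact
  define I where "I = (\<integral>\<^sup>+x. indicator G x * v x \<partial>N)"
  have e1: "emeasure M1 B = a * (\<integral>\<^sup>+x. indicator B x * u x \<partial>N)" if "B \<in> sets N" for B
    using 1(1)[of "indicator B"] that 1(3) by simp
  have e2: "emeasure M2 B = b * (\<integral>\<^sup>+x. indicator B x * v x \<partial>N)" if "B \<in> sets N" for B
    using 2(1)[of "indicator B"] that 2(3) by simp
  have bI: "b * I \<ge> ennreal (1/2)" "b * I \<le> 1"
    using half e2[OF G] M2.emeasure_le_1[of G] by (auto simp: I_def)
  have I0: "I \<noteq> 0" using bI(1) by (auto simp: ennreal_le_iff2)
  have It: "I \<noteq> \<top>"
  proof
    assume t: "I = \<top>"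
    then have "b = 0" using bI(2) by (auto simp: ennreal_mult_top top_unique split: if_splits)
    with bI(1) show False by (auto simp: ennreal_le_iff2)
  qed
  have "a * I \<le> a * (\<integral>\<^sup>+x. ennreal \<kappa> * (indicator G x * u x) \<partial>N)"
    unfolding I_def using vu by (intro mult_left_mono nn_integral_mono) (auto split: split_indicator)
  also have "\<dots> = ennreal \<kappa> * emeasure M1 G"
    by (subst nn_integral_cmult) (auto simp: e1 mult_ac)
  also have "\<dots> \<le> ennreal \<kappa> * 1" by (intro mult_left_mono M1.emeasure_le_1) simp
  also have "\<dots> = ennreal (2 * \<kappa>) * ennreal (1/2)" using k by (subst ennreal_mult'[symmetric]) auto
  also have "\<dots> \<le> ennreal (2 * \<kappa>) * (b * I)" using bI(1) by (intro mult_left_mono) auto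
  finally have "I * a \<le> I * (ennreal (2 * \<kappa>) * b)" by (simp add: mult_ac)
  then show ab: "a \<le> ennreal (2 * \<kappa>) * b" using I0 It by (simp add: ennreal_mult_le_mult_iff)
  fix A \<kappa>' assume A[measurable]: "A \<in> sets N" and k': "(\<kappa>'::real) \<ge> 0" and uv: "\<And>x. x \<in> G \<Longrightarrow> u x \<le> ennreal \<kappa>' * v x"
  have "emeasure M1 (A \<inter> G) = a * (\<integral>\<^sup>+x. indicator (A \<inter> G) x * u x \<partial>N)" by (rule e1) simp
  also have "\<dots> \<le> a * (\<integral>\<^sup>+x. ennreal \<kappa>' * (indicator A x * v x) \<partial>N)"
    using uv by (intro mult_left_mono nn_integral_mono) (auto split: split_indicator)
  also have "\<dots> = ennreal \<kappa>' * (a * (\<integral>\<^sup>+x. indicator A x * v x \<partial>N))"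
    by (subst nn_integral_cmult) (auto simp: mult_ac)
  also have "\<dots> \<le> ennreal \<kappa>' * (ennreal (2 * \<kappa>) * b * (\<integral>\<^sup>+x. indicator A x * v x \<partial>N))"
    by (intro mult_left_mono mult_right_mono ab) auto
  also have "\<dots> = ennreal (2 * \<kappa> * \<kappa>') * emeasure M2 A"
    using k k' by (simp add: e2[OF A] ennreal_mult' mult_ac)
  finally show "emeasure M1 (A \<inter> G) \<le> ennreal (2 * \<kappa> * \<kappa>') * emeasure M2 A" .
qed

section \<open>Typical data\<close>

definition sphere_proj :: "nat \<Rightarrow> nat \<Rightarrow> (nat \<Rightarrow> nat \<Rightarrow> real) \<Rightarrow> (nat \<Rightarrow> real) \<Rightarrow> nat \<Rightarrow> real" where
  "sphere_proj b d Z h = (\<lambda>j\<in>{..<d}. (\<Sum>i<b. h i * Z i j) / sqrt (\<Sum>i<b. (h i)\<^sup>2))"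

definition sphere_law :: "nat \<Rightarrow> nat \<Rightarrow> (nat \<Rightarrow> nat \<Rightarrow> real) \<Rightarrow> (nat \<Rightarrow> real) measure" where
  "sphere_law b d Z = distr (stdg {..<b}) (leb {..<d}) (sphere_proj b d Z)"

lemma sets_stdg: "sets (stdg I) = sets (leb I)"
  by (intro sets_PiM_cong) auto

lemma space_stdg: "space (stdg I) = space (leb I)"
  by (rule sets_eq_imp_space_eq[OF sets_stdg])

lemma coord_measurable: "j < d \<Longrightarrow> (\<lambda>w. w j) \<in> borel_measurable (stdg {..<d})"
  using measurable_component_singleton[of j "{..<d}" "\<lambda>_. std_normal_distribution"] by simp

lemma sphere_proj_measurable_pair: "(\<lambda>(Z, h). sphere_proj b d Z h) \<in> stdmat b d \<Otimes>\<^sub>M stdg {..<b} \<rightarrow>\<^sub>M leb {..<d}"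
proof -
  have e: "(\<lambda>x. fst x i j) \<in> borel_measurable (stdmat b d \<Otimes>\<^sub>M stdg {..<b})" if "i < b" "j < d" for i j
    by (rule measurable_compose[OF measurable_fst stdmat_entry_measurable[OF that]])
  have h: "(\<lambda>x. snd x i) \<in> borel_measurable (stdmat b d \<Otimes>\<^sub>M stdg {..<b})" if "i < b" for i
    by (rule measurable_compose[OF measurable_snd coord_measurable[OF that]])
  show ?thesis unfolding sphere_proj_def split_def
  proof (rule measurable_restrict)
    fix j assume j: "j \<in> {..<d}"
    have 1: "(\<lambda>x. \<Sum>i<b. snd x i * fst x i j) \<in> borel_measurable (stdmat b d \<Otimes>\<^sub>M stdg {..<b})"
      using j by (intro borel_measurable_sum borel_measurable_times e h) auto
    have 2: "(\<lambda>x. \<Sum>i<b. (snd x i)\<^sup>2) \<in> borel_measurable (stdmat b d \<Otimes>\<^sub>M stdg {..<b})"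
      by (intro borel_measurable_sum borel_measurable_power h) auto
    show "(\<lambda>x. (\<Sum>i<b. snd x i * fst x i j) / sqrt (\<Sum>i<b. (snd x i)\<^sup>2)) \<in> stdmat b d \<Otimes>\<^sub>M stdg {..<b} \<rightarrow>\<^sub>M lborel"
      using borel_measurable_divide[OF 1 measurable_compose[OF 2 borel_measurable_sqrt]] by simp
  qed
qed

lemma sphere_proj_measurable: "sphere_proj b d Z \<in> stdg {..<b} \<rightarrow>\<^sub>M leb {..<d}"
  unfolding sphere_proj_def[abs_def]
proof (rule measurable_restrict)
  fix j
  have 1: "(\<lambda>h. \<Sum>i<b. h i * Z i j) \<in> borel_measurable (stdg {..<b})"
    by (intro borel_measurable_sum borel_measurable_times borel_measurable_const coord_measurable) auto
  have 2: "(\<lambda>h. \<Sum>i<b. (h i)\<^sup>2) \<in> borel_measurable (stdg {..<b})"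
    by (intro borel_measurable_sum borel_measurable_power coord_measurable) auto
  show "(\<lambda>h. (\<Sum>i<b. h i * Z i j) / sqrt (\<Sum>i<b. (h i)\<^sup>2)) \<in> stdg {..<b} \<rightarrow>\<^sub>M lborel"
    using borel_measurable_divide[OF 1 measurable_compose[OF 2 borel_measurable_sqrt]] by simp
qed

lemma prob_space_sphere_law: "prob_space (sphere_law b d Z)"
  unfolding sphere_law_def by (intro prob_space.prob_space_distr sphere_proj_measurable) auto

text \<open>For a fixed direction h and random data, the projection is a unit combination of
  Gaussian vectors. This is how the mass of the sphere law outside a ball is computed on
  average.\<close>

lemma sphere_proj_Z_distr:
  assumes h: "(\<Sum>i<b. (h i)\<^sup>2) \<noteq> 0"
  shows "distr (stdmat b d) (stdg {..<d}) (\<lambda>Z. sphere_proj b d Z h) = stdg {..<d}"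
proof -
  define a where "a i = h i / sqrt (\<Sum>i<b. (h i)\<^sup>2)" for i
  have n: "(\<Sum>i<b. (h i)\<^sup>2) \<ge> 0" by (intro sum_nonneg) simp
  have "(\<Sum>i\<in>{..<b}. (a i)\<^sup>2) = 1"
    using h n by (simp add: a_def power_divide sum_divide_distrib[symmetric])
  moreover have "(\<lambda>Z. sphere_proj b d Z h) = (\<lambda>X. \<lambda>j\<in>{..<d}. \<Sum>i\<in>{..<b}. a i * X i j)"
    by (auto simp: sphere_proj_def a_def fun_eq_iff sum_divide_distrib)
  ultimately show ?thesis using unit_comb_stdg[of "{..<b}" a "{..<d}"] by simp
qed

text \<open>The negation of the two conditions under which the lower density bound in
  \<open>density_ratio_bounds\<close> holds.\<close>

definition bad_point :: "nat \<Rightarrow> nat \<Rightarrow> (nat \<Rightarrow> nat \<Rightarrow> real) \<Rightarrow> (nat \<Rightarrow> real) \<Rightarrow> bool" where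
  "bad_point b d Z w \<longleftrightarrow> \<not> (\<bar>dev_form b d Z w\<bar> \<le> 1 \<and> (\<Sum>j<d. (dev_vec b d Z w j)\<^sup>2) \<le> 1)"

lemma pair_measurables:
  shows dev_form_pair: "(\<lambda>x. dev_form b d (fst x) (snd x)) \<in> borel_measurable (stdmat b d \<Otimes>\<^sub>M stdg {..<d})"
    and dev_vec_pair: "(\<lambda>x. \<Sum>j<d. (dev_vec b d (fst x) (snd x) j)\<^sup>2) \<in> borel_measurable (stdmat b d \<Otimes>\<^sub>M stdg {..<d})"
    and sqn_pair: "(\<lambda>x. sqn d (snd x)) \<in> borel_measurable (stdmat b d \<Otimes>\<^sub>M stdg {..<d})"
proof -
  have e: "(\<lambda>x. fst x i j) \<in> borel_measurable (stdmat b d \<Otimes>\<^sub>M stdg {..<d})" if "i < b" "j < d" for i j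
    by (rule measurable_compose[OF measurable_fst stdmat_entry_measurable[OF that]])
  have h: "(\<lambda>x. snd x i) \<in> borel_measurable (stdmat b d \<Otimes>\<^sub>M stdg {..<d})" if "i < d" for i
    by (rule measurable_compose[OF measurable_snd coord_measurable[OF that]])
  show "(\<lambda>x. dev_form b d (fst x) (snd x)) \<in> borel_measurable (stdmat b d \<Otimes>\<^sub>M stdg {..<d})"
    unfolding dev_form_def
    by (intro borel_measurable_sum borel_measurable_times borel_measurable_power borel_measurable_divide
       borel_measurable_diff borel_measurable_const e h) auto
  show "(\<lambda>x. \<Sum>j<d. (dev_vec b d (fst x) (snd x) j)\<^sup>2) \<in> borel_measurable (stdmat b d \<Otimes>\<^sub>M stdg {..<d})"
    unfolding dev_vec_def
    by (intro borel_measurable_sum borel_measurable_times borel_measurable_power borel_measurable_divide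
       borel_measurable_diff borel_measurable_const e h) auto
  show "(\<lambda>x. sqn d (snd x)) \<in> borel_measurable (stdmat b d \<Otimes>\<^sub>M stdg {..<d})"
    unfolding sqn_def by (intro borel_measurable_sum borel_measurable_power h) auto
qed

lemma bad_point_pair: "Measurable.pred (stdmat b d \<Otimes>\<^sub>M stdg {..<d}) (\<lambda>x. bad_point b d (fst x) (snd x))"
  unfolding bad_point_def using dev_form_pair[of b d] dev_vec_pair[of b d] by measurable

lemma sqn_measurable [measurable]: "sqn d \<in> borel_measurable (stdg {..<d})"
  unfolding sqn_def[abs_def] by (intro borel_measurable_sum borel_measurable_power coord_measurable) simp

lemma bad_point_measurable_Z: "w \<in> space (stdg {..<d}) \<Longrightarrow> Measurable.pred (stdmat b d) (\<lambda>Z. bad_point b d Z w)"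
  by (drule measurable_compose[OF measurable_Pair2' bad_point_pair[of b d]]) (simp only: fst_conv snd_conv)

lemma bad_point_measurable_w: "Z \<in> space (stdmat b d) \<Longrightarrow> Measurable.pred (stdg {..<d}) (\<lambda>w. bad_point b d Z w)"
  by (drule measurable_compose[OF measurable_Pair1' bad_point_pair[of b d]]) (simp only: fst_conv snd_conv)

section \<open>Block parameters and the probability of exceptional points and data\<close>

locale gaussian_block =
  fixes d c b :: nat and L :: real
  assumes d: "d \<ge> 1" and L: "L \<ge> 2" and c: "c \<ge> 1" and bc: "b = d + 2 * c" and bL: "real b \<ge> 4 * (real d)\<^sup>2 * L ^ 3"
begin

lemma dL_ge: "real d * L \<ge> 2" using d L mult_mono[of 1 "real d" 2 L] by simp

text \<open>The accuracy 1 / (d L) keeps the form at most 1 on |w|^2 \<le> d L, and the lower bound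
  on b is chosen to turn the exponent b \<eta>^2 / 16 into at least L / 4.\<close>

lemma dev_form_tail_L:
  "emeasure (stdmat b d) {Z \<in> space (stdmat b d). \<bar>dev_form b d Z y\<bar> > 1 / (d * L) * sqn d y} \<le> ennreal (2 * exp (- L / 4))"
proof -
  have b0: "b > 0" using bc c by simp
  have "emeasure (stdmat b d) {Z \<in> space (stdmat b d). \<bar>dev_form b d Z y\<bar> > 1 / (d * L) * sqn d y} \<le> ennreal (2 * exp (- (b * (1 / (d * L))\<^sup>2 / 16)))"
    unfolding sqn_def using dL_ge b0 by (intro dev_form_tail) (auto simp: field_simps)
  also have "\<dots> \<le> ennreal (2 * exp (- L / 4))"
  proof -
    have "L / 4 = (4 * (real d)\<^sup>2 * L ^ 3) * (1 / (d * L))\<^sup>2 / 16"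
      using d L by (simp add: power2_eq_square power3_eq_cube field_simps)
    also have "\<dots> \<le> b * (1 / (d * L))\<^sup>2 / 16" using bL by (intro divide_right_mono mult_right_mono) auto
    finally show ?thesis by (intro ennreal_leI) simp
  qed
  finally show ?thesis .
qed

lemma dev_form_tail_sets: "{Z \<in> space (stdmat b d). \<bar>dev_form b d Z y\<bar> > s} \<in> sets (stdmat b d)"
  by measurable

text \<open>Here w is fixed and the data are random, so a union bound over 2 d + 1 directions
  suffices: w itself for the form, and the unit vectors scaled to length |w| plus and minus w for E
  w.\<close>

lemma bad_point_prob:
  assumes w: "w \<in> space (stdg {..<d})" "sqn d w \<le> d * L"
  shows "emeasure (stdmat b d) {Z \<in> space (stdmat b d). bad_point b d Z w} \<le> ennreal ((2 + 4 * d) * exp (- L / 4))"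
proof -
  define T where "T y = {Z \<in> space (stdmat b d). \<bar>dev_form b d Z y\<bar> > 1 / (d * L) * sqn d y}" for y
  define yk where "yk p = (\<lambda>j. sqrt (sqn d w) * unitv (fst p) j + snd p * w j)" for p :: "nat \<times> real"
  define P where "P = {..<d} \<times> {1, -1::real}"
  have P: "finite P" "card P = 2 * d" by (auto simp: P_def card_cartesian_product)
  have Tm: "T y \<in> sets (stdmat b d)" for y unfolding T_def by (rule dev_form_tail_sets)
  have TL: "emeasure (stdmat b d) (T y) \<le> ennreal (2 * exp (- L / 4))" for y unfolding T_def by (rule dev_form_tail_L)
  have "{Z \<in> space (stdmat b d). bad_point b d Z w} \<subseteq> T w \<union> (\<Union>p\<in>P. T (yk p))"
  proof
    fix Z assume Z: "Z \<in> {Z \<in> space (stdmat b d). bad_point b d Z w}"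
    show "Z \<in> T w \<union> (\<Union>p\<in>P. T (yk p))"
    proof (rule ccontr)
      assume n: "Z \<notin> T w \<union> (\<Union>p\<in>P. T (yk p))"
      have 1: "\<bar>dev_form b d Z w\<bar> \<le> 1 / (d * L) * sqn d w" using n Z by (auto simp: T_def)
      also have "\<dots> \<le> 1 / (d * L) * (d * L)" using w dL_ge by (intro mult_left_mono) auto
      also have "\<dots> = 1" using d L by simp
      finally have a: "\<bar>dev_form b d Z w\<bar> \<le> 1" .
      have "(\<Sum>j<d. (dev_vec b d Z w j)\<^sup>2) \<le> d * (1 / (d * L))\<^sup>2 * sqn d w"
      proof (rule dev_vec_small)
        show "1 / (real d * L) > 0" using dL_ge by simp
        fix k and s :: real assume "k < d" "s \<in> {1, -1}"
        then have "(k, s) \<in> P" by (simp add: P_def)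
        then have "Z \<notin> T (yk (k, s))" using n by auto
        then show "\<bar>dev_form b d Z (\<lambda>j. sqrt (sqn d w) * unitv k j + s * w j)\<bar> \<le> 1 / (real d * L) * sqn d (\<lambda>j. sqrt (sqn d w) * unitv k j + s * w j)"
          using Z by (auto simp: T_def yk_def)
      qed
      also have "\<dots> \<le> d * (1 / (d * L))\<^sup>2 * (d * L)" using w by (intro mult_left_mono) auto
      also have "\<dots> = 1 / L" using d L by (simp add: power2_eq_square field_simps)
      also have "\<dots> \<le> 1" using L by simp
      finally show False using a Z by (simp add: bad_point_def)
    qed
  qed
  then have "emeasure (stdmat b d) {Z \<in> space (stdmat b d). bad_point b d Z w} \<le> emeasure (stdmat b d) (T w \<union> (\<Union>p\<in>P. T (yk p)))"
    using Tm P by (intro emeasure_mono) auto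
  also have "\<dots> \<le> emeasure (stdmat b d) (T w) + emeasure (stdmat b d) (\<Union>p\<in>P. T (yk p))"
    using Tm P by (intro emeasure_subadditive) auto
  also have "\<dots> \<le> ennreal (2 * exp (- L / 4)) + (\<Sum>p\<in>P. emeasure (stdmat b d) (T (yk p)))"
    using Tm P by (intro add_mono emeasure_subadditive_finite) (rule TL, auto)
  also have "\<dots> \<le> ennreal (2 * exp (- L / 4)) + (\<Sum>p\<in>P. ennreal (2 * exp (- L / 4)))"
    by (intro add_mono sum_mono order_refl) (unfold T_def, rule dev_form_tail_L)
  also have "(\<Sum>p\<in>P. ennreal (2 * exp (- L / 4))) = ennreal (\<Sum>p\<in>P. 2 * exp (- L / 4))"
    by (rule sum_ennreal) simp
  also have "ennreal (2 * exp (- L / 4)) + \<dots> = ennreal (2 * exp (- L / 4) + (\<Sum>p\<in>P. 2 * exp (- L / 4)))"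
    by (intro ennreal_plus[symmetric] sum_nonneg) auto
  also have "2 * exp (- L / 4) + (\<Sum>p\<in>P. 2 * exp (- L / 4)) = (2 + 4 * d) * exp (- L / 4)"
    by (simp add: P algebra_simps)
  finally show ?thesis .
qed

text \<open>The directions e_j + e_k and e_j - e_k control all entries of E by polarisation. There
  are only about d^2 of them, so the tail bound applies to all at once.\<close>

definition well_conditioned :: "(nat \<Rightarrow> nat \<Rightarrow> real) set" where
  "well_conditioned = space (stdmat b d) - (\<Union>p\<in>{..<d} \<times> {..<d} \<times> {1, -1}.
     {Z \<in> space (stdmat b d). \<bar>dev_form b d Z (\<lambda>l. unitv (fst p) l + snd (snd p) * unitv (fst (snd p)) l)\<bar> >
        1 / (d * L) * sqn d (\<lambda>l. unitv (fst p) l + snd (snd p) * unitv (fst (snd p)) l)})"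

lemma well_conditioned_sets: "well_conditioned \<in> sets (stdmat b d)"
  unfolding well_conditioned_def by (rule sets.Diff[OF sets.top], rule sets.finite_UN) (simp, rule dev_form_tail_sets)

lemma well_conditioned_prob: "emeasure (stdmat b d) (space (stdmat b d) - well_conditioned) \<le> ennreal (4 * (real d)\<^sup>2 * exp (- L / 4))"
proof -
  define T where "T p = {Z \<in> space (stdmat b d). \<bar>dev_form b d Z (\<lambda>l. unitv (fst p) l + snd (snd p) * unitv (fst (snd p)) l)\<bar> >
        1 / (d * L) * sqn d (\<lambda>l. unitv (fst p) l + snd (snd p) * unitv (fst (snd p)) l)}" for p :: "nat \<times> nat \<times> real"
  define P where "P = {..<d} \<times> {..<d} \<times> {1, -1::real}"
  have P: "finite P" "card P = 2 * d\<^sup>2" by (auto simp: P_def card_cartesian_product power2_eq_square)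
  have Tm: "T y \<in> sets (stdmat b d)" for y unfolding T_def by (rule dev_form_tail_sets)
  have "space (stdmat b d) - well_conditioned = (\<Union>p\<in>P. T p)"
    unfolding well_conditioned_def P_def[symmetric] T_def[symmetric] by (auto simp: T_def)
  then have "emeasure (stdmat b d) (space (stdmat b d) - well_conditioned) \<le> (\<Sum>p\<in>P. emeasure (stdmat b d) (T p))"
    using emeasure_subadditive_finite[OF P(1), of T "stdmat b d"] Tm by (simp add: image_subset_iff del: split_paired_All)
  also have "\<dots> \<le> (\<Sum>p\<in>P. ennreal (2 * exp (- L / 4)))"
    by (intro sum_mono) (unfold T_def, rule dev_form_tail_L)
  also have "\<dots> = ennreal (\<Sum>p\<in>P. 2 * exp (- L / 4))"
    by (rule sum_ennreal) simp
  also have "(\<Sum>p\<in>P. 2 * exp (- L / 4)) = 4 * (real d)\<^sup>2 * exp (- L / 4)"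
    by (simp add: P)
  finally show ?thesis .
qed

lemma well_conditioned_op:
  assumes Z: "Z \<in> well_conditioned" shows "dev_form b d Z u \<ge> - (1/2 * sqn d u)"
proof -
  have "dev_form b d Z u \<ge> - (1 / (d * L) * d * sqn d u)"
  proof (rule dev_form_lower_of_entries)
    show "1 / (real d * L) > 0" using dL_ge by simp
    fix j k and s :: real assume "j < d" "k < d" "s \<in> {1, -1}"
    then have p: "(j, k, s) \<in> {..<d} \<times> {..<d} \<times> {1, -1}" by simp
    define T where "T p = {Z \<in> space (stdmat b d). \<bar>dev_form b d Z (\<lambda>l. unitv (fst p) l + snd (snd p) * unitv (fst (snd p)) l)\<bar> >
        1 / (d * L) * sqn d (\<lambda>l. unitv (fst p) l + snd (snd p) * unitv (fst (snd p)) l)}" for p :: "nat \<times> nat \<times> real"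
    have "Z \<in> space (stdmat b d) - (\<Union>p\<in>{..<d} \<times> {..<d} \<times> {1, -1}. T p)"
      using Z unfolding well_conditioned_def T_def .
    then have "Z \<in> space (stdmat b d)" "Z \<notin> T (j, k, s)" using p by blast+
    then show "\<bar>dev_form b d Z (\<lambda>l. unitv j l + s * unitv k l)\<bar> \<le> 1 / (real d * L) * sqn d (\<lambda>l. unitv j l + s * unitv k l)"
      unfolding T_def mem_Collect_eq fst_conv snd_conv not_less[symmetric] by blast
  qed
  also have "1 / (d * L) * d = 1 / L" using d by simp
  finally have "- (1 / L * sqn d u) \<le> dev_form b d Z u" .
  moreover have "1 / L * sqn d u \<le> 1/2 * sqn d u" using L by (intro mult_right_mono) auto
  ultimately show ?thesis by linarith
qed

lemma exp_quarter_le: "exp (- L / 4) \<le> exp (- L / 8)" using L by simp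

section \<open>Exceptional masses of one data cloud and their averages over the data\<close>

definition escape_mass :: "(nat \<Rightarrow> nat \<Rightarrow> real) \<Rightarrow> ennreal" where
  "escape_mass Z = (\<integral>\<^sup>+w. (if sqn d w > d * L \<or> bad_point b d Z w then 1 else 0) \<partial>stdg {..<d})"

text \<open>The weight is the factor by which the sphere density may exceed the Gaussian one at a
  bad point. Up to constants this integral therefore bounds the sphere law of the bad points inside
  the ball.\<close>

definition excess_mass :: "(nat \<Rightarrow> nat \<Rightarrow> real) \<Rightarrow> ennreal" where
  "excess_mass Z = (\<integral>\<^sup>+w. (if sqn d w \<le> d * L \<and> bad_point b d Z w then ennreal (exp (max 0 (dev_form b d Z w) / 2)) else 0) \<partial>stdg {..<d})"

definition sphere_tail :: "(nat \<Rightarrow> nat \<Rightarrow> real) \<Rightarrow> ennreal" where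
  "sphere_tail Z = (\<integral>\<^sup>+h. (if sqn d (sphere_proj b d Z h) > d * L then 1 else 0) \<partial>stdg {..<b})"

lemma integrands_measurable:
  "(\<lambda>x. if sqn d (snd x) > d * L \<or> bad_point b d (fst x) (snd x) then 1 else 0 :: ennreal) \<in> borel_measurable (stdmat b d \<Otimes>\<^sub>M stdg {..<d})"
  "(\<lambda>x. if sqn d (snd x) \<le> d * L \<and> bad_point b d (fst x) (snd x) then ennreal (exp (max 0 (dev_form b d (fst x) (snd x)) / 2)) else 0) \<in> borel_measurable (stdmat b d \<Otimes>\<^sub>M stdg {..<d})"
  "(\<lambda>x. if sqn d (sphere_proj b d (fst x) (snd x)) > d * L then 1 else 0 :: ennreal) \<in> borel_measurable (stdmat b d \<Otimes>\<^sub>M stdg {..<b})"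
proof -
  note [measurable] = bad_point_pair[of b d] dev_form_pair[of b d] sqn_pair[of d b]
  show "(\<lambda>x. if sqn d (snd x) > d * L \<or> bad_point b d (fst x) (snd x) then 1 else 0 :: ennreal) \<in> borel_measurable (stdmat b d \<Otimes>\<^sub>M stdg {..<d})"
    by measurable
  show "(\<lambda>x. if sqn d (snd x) \<le> d * L \<and> bad_point b d (fst x) (snd x) then ennreal (exp (max 0 (dev_form b d (fst x) (snd x)) / 2)) else 0) \<in> borel_measurable (stdmat b d \<Otimes>\<^sub>M stdg {..<d})"
    by measurable
  have "(\<lambda>x. sphere_proj b d (fst x) (snd x)) \<in> stdmat b d \<Otimes>\<^sub>M stdg {..<b} \<rightarrow>\<^sub>M stdg {..<d}"
    using sphere_proj_measurable_pair[of b d] measurable_cong_sets[OF refl sets_stdg] by (simp add: split_def)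
  from measurable_compose[OF this sqn_measurable]
  have [measurable]: "(\<lambda>x. sqn d (sphere_proj b d (fst x) (snd x))) \<in> borel_measurable (stdmat b d \<Otimes>\<^sub>M stdg {..<b})" .
  show "(\<lambda>x. if sqn d (sphere_proj b d (fst x) (snd x)) > d * L then 1 else 0 :: ennreal) \<in> borel_measurable (stdmat b d \<Otimes>\<^sub>M stdg {..<b})"
    by measurable
qed

lemma sigma_finite_stdg: "sigma_finite_measure (stdg I)"
  by (rule prob_space_imp_sigma_finite) simp

lemma masses_measurable: "escape_mass \<in> borel_measurable (stdmat b d)" "excess_mass \<in> borel_measurable (stdmat b d)" "sphere_tail \<in> borel_measurable (stdmat b d)"
proof -
  show "escape_mass \<in> borel_measurable (stdmat b d)" unfolding escape_mass_def[abs_def]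
    by (rule sigma_finite_measure.borel_measurable_nn_integral[OF sigma_finite_stdg])
      (use integrands_measurable(1) in \<open>simp only: split_def\<close>)
  show "excess_mass \<in> borel_measurable (stdmat b d)" unfolding excess_mass_def[abs_def]
    by (rule sigma_finite_measure.borel_measurable_nn_integral[OF sigma_finite_stdg])
      (use integrands_measurable(2) in \<open>simp only: split_def\<close>)
  show "sphere_tail \<in> borel_measurable (stdmat b d)" unfolding sphere_tail_def[abs_def]
    by (rule sigma_finite_measure.borel_measurable_nn_integral[OF sigma_finite_stdg])
      (use integrands_measurable(3) in \<open>simp only: split_def\<close>)
qed

lemma pair_stdmat_stdg: "pair_sigma_finite (stdmat b d) (stdg {..<n})"
  unfolding pair_sigma_finite_def by (intro conjI prob_space_imp_sigma_finite) (rule prob_space_stdmat, rule prob_space_stdg)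

text \<open>After Fubini the point w is fixed and the data are random, which is the situation of
  \<open>bad_point_prob\<close>.\<close>

lemma escape_mass_expect: "(\<integral>\<^sup>+Z. escape_mass Z \<partial>stdmat b d) \<le> ennreal (8 * d * exp (- L / 8))"
proof -
  interpret P: pair_sigma_finite "stdmat b d" "stdg {..<d}" by (rule pair_stdmat_stdg)
  interpret M: prob_space "stdmat b d" by simp
  interpret N: prob_space "stdg {..<d}" by simp
  have "(\<integral>\<^sup>+Z. escape_mass Z \<partial>stdmat b d) = (\<integral>\<^sup>+w. (\<integral>\<^sup>+Z. (if sqn d w > d * L \<or> bad_point b d Z w then 1 else 0) \<partial>stdmat b d) \<partial>stdg {..<d})"
    unfolding escape_mass_def using integrands_measurable(1) by (intro P.Fubini'[symmetric]) (simp add: split_def)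
  also have "\<dots> \<le> (\<integral>\<^sup>+w. indicator {w \<in> space (stdg {..<d}). sqn d w > d * L} w + ennreal ((2 + 4 * d) * exp (- L / 4)) \<partial>stdg {..<d})"
  proof (rule nn_integral_mono)
    fix w assume w: "w \<in> space (stdg {..<d})"
    show "(\<integral>\<^sup>+Z. (if sqn d w > d * L \<or> bad_point b d Z w then 1 else 0) \<partial>stdmat b d) \<le>
      indicator {w \<in> space (stdg {..<d}). sqn d w > d * L} w + ennreal ((2 + 4 * d) * exp (- L / 4))"
    proof (cases "sqn d w > d * L")
      case True
      then show ?thesis using w M.emeasure_space_1 by simp
    next
      case False
      have "(\<integral>\<^sup>+Z. (if sqn d w > d * L \<or> bad_point b d Z w then 1 else 0) \<partial>stdmat b d) =
        (\<integral>\<^sup>+Z. indicator {Z \<in> space (stdmat b d). bad_point b d Z w} Z \<partial>stdmat b d)"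
        using False by (intro nn_integral_cong) auto
      also have "\<dots> = emeasure (stdmat b d) {Z \<in> space (stdmat b d). bad_point b d Z w}"
        using bad_point_measurable_Z[OF w, of b] by (intro nn_integral_indicator) (simp add: pred_def)
      also have "\<dots> \<le> ennreal ((2 + 4 * d) * exp (- L / 4))"
        using False w by (intro bad_point_prob) auto
      finally show ?thesis using False by simp
    qed
  qed
  also have "\<dots> = emeasure (stdg {..<d}) {w \<in> space (stdg {..<d}). sqn d w > d * L} + ennreal ((2 + 4 * d) * exp (- L / 4))"
    using N.emeasure_space_1 by (subst nn_integral_add) auto
  also have "\<dots> \<le> ennreal (2 * d * exp (- L / 4)) + ennreal ((2 + 4 * d) * exp (- L / 4))"
    unfolding sqn_def by (intro add_mono stdg_norm_tail order_refl)
  also have "\<dots> = ennreal (2 * d * exp (- L / 4) + (2 + 4 * d) * exp (- L / 4))"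
    by (intro ennreal_plus[symmetric]) auto
  also have "\<dots> \<le> ennreal (8 * d * exp (- L / 8))"
  proof (rule ennreal_leI)
    have "2 * d * exp (- L / 4) + (2 + 4 * d) * exp (- L / 4) = (6 * d + 2) * exp (- L / 4)" by (simp add: algebra_simps)
    also have "\<dots> \<le> (8 * d) * exp (- L / 8)" using d exp_quarter_le by (intro mult_mono) auto
    finally show "2 * d * exp (- L / 4) + (2 + 4 * d) * exp (- L / 4) \<le> 8 * d * exp (- L / 8)" by simp
  qed
  finally show ?thesis .
qed

text \<open>Cauchy-Schwarz in additive form: on the bad set x \<le> 1 / (2 t) + t x^2 / 2, where the
  square of the weight x has a bounded mean. With t = exp (- L / 8), the square root of the scale of
  the bad probability, both terms are of order d t; hence the rate L / 8 in place of L / 4.\<close>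

lemma excess_mass_expect: "(\<integral>\<^sup>+Z. excess_mass Z \<partial>stdmat b d) \<le> ennreal (5 * d * exp (- L / 8))"
proof -
  interpret P: pair_sigma_finite "stdmat b d" "stdg {..<d}" by (rule pair_stdmat_stdg)
  interpret M: prob_space "stdmat b d" by simp
  interpret N: prob_space "stdg {..<d}" by simp
  define t where "t = exp (- L / 8)"
  have t: "t > 0" "t * t = exp (- L / 4)" by (auto simp: t_def mult_exp_exp)
  have b0: "b > 0" using bc c by simp
  have "(\<integral>\<^sup>+Z. excess_mass Z \<partial>stdmat b d) = (\<integral>\<^sup>+w. (\<integral>\<^sup>+Z. (if sqn d w \<le> d * L \<and> bad_point b d Z w then ennreal (exp (max 0 (dev_form b d Z w) / 2)) else 0) \<partial>stdmat b d) \<partial>stdg {..<d})"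
    unfolding excess_mass_def using integrands_measurable(2) by (intro P.Fubini'[symmetric]) (simp add: split_def)
  also have "\<dots> \<le> (\<integral>\<^sup>+w. ennreal (5 * d * exp (- L / 8)) \<partial>stdg {..<d})"
  proof (rule nn_integral_mono)
    fix w assume w: "w \<in> space (stdg {..<d})"
    show "(\<integral>\<^sup>+Z. (if sqn d w \<le> d * L \<and> bad_point b d Z w then ennreal (exp (max 0 (dev_form b d Z w) / 2)) else 0) \<partial>stdmat b d) \<le> ennreal (5 * d * exp (- L / 8))"
    proof (cases "sqn d w \<le> d * L")
      case False
      then show ?thesis by simp
    next
      case True
      define B where "B = {Z \<in> space (stdmat b d). bad_point b d Z w}"
      have Bm[measurable]: "B \<in> sets (stdmat b d)" unfolding B_def using bad_point_measurable_Z[OF w, of b] by (simp add: pred_def)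
      have dL2: "4 * (real d * L)\<^sup>2 \<le> b" "4 * (real d * L) \<le> b"
      proof -
        have "4 * (real d * L)\<^sup>2 * 1 \<le> 4 * (real d * L)\<^sup>2 * L" using L by (intro mult_left_mono) auto
        also have "\<dots> = 4 * (real d)\<^sup>2 * L ^ 3" by (simp add: power2_eq_square power3_eq_cube)
        also note bL
        finally show 1: "4 * (real d * L)\<^sup>2 \<le> b" by simp
        have "(real d * L) * 1 \<le> (real d * L) * (real d * L)" using dL_ge by (intro mult_left_mono) auto
        with 1 show "4 * (real d * L) \<le> b" by (simp add: power2_eq_square)
      qed
      \<comment> \<open>The bound 4 (d L)^2 \<le> b makes the exponent 4 |w|^4 / b at most 1 on the
        ball, so the moment is at most exp 1 \<le> 3.\<close>
      have mom: "(\<integral>\<^sup>+Z. ennreal (exp (dev_form b d Z w)) \<partial>stdmat b d) \<le> ennreal 3"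
      proof -
        have "(\<integral>\<^sup>+Z. ennreal (exp (dev_form b d Z w)) \<partial>stdmat b d) \<le> ennreal (exp (4 * (sqn d w)\<^sup>2 / b))"
          using True dL2(2) b0 unfolding sqn_def by (intro dev_form_exp_moment) auto
        also have "\<dots> \<le> ennreal (exp 1)"
        proof (intro ennreal_leI)
          have "4 * (sqn d w)\<^sup>2 \<le> 4 * (real d * L)\<^sup>2" using True by (intro mult_left_mono power_mono) auto
          also note dL2(1)
          finally show "exp (4 * (sqn d w)\<^sup>2 / b) \<le> exp 1" using b0 by simp
        qed
        also have "\<dots> \<le> ennreal 3" using exp_le by (intro ennreal_leI) simp
        finally show ?thesis .
      qed
      have "(\<integral>\<^sup>+Z. (if sqn d w \<le> d * L \<and> bad_point b d Z w then ennreal (exp (max 0 (dev_form b d Z w) / 2)) else 0) \<partial>stdmat b d) \<le>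
        (\<integral>\<^sup>+Z. ennreal (1 / (2 * t)) * indicator B Z + ennreal (t / 2) * (1 + ennreal (exp (dev_form b d Z w))) \<partial>stdmat b d)"
      proof (rule nn_integral_mono)
        fix Z assume Z: "Z \<in> space (stdmat b d)"
        define x where "x = exp (max 0 (dev_form b d Z w) / 2)"
        have xx: "x * x \<le> 1 + exp (dev_form b d Z w)" by (auto simp: x_def mult_exp_exp max_def)
        have "0 \<le> (1 - t * x)\<^sup>2" by simp
        then have "2 * t * x \<le> 1 + t * t * (x * x)" by (simp add: power2_eq_square algebra_simps)
        then have "x \<le> 1 / (2 * t) + t / 2 * (x * x)" using t(1) by (simp add: field_simps)
        also have "\<dots> \<le> 1 / (2 * t) + t / 2 * (1 + exp (dev_form b d Z w))"
          using xx t(1) by (intro add_mono mult_left_mono) auto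
        finally have "ennreal x \<le> ennreal (1 / (2 * t) + t / 2 * (1 + exp (dev_form b d Z w)))" by (rule ennreal_leI)
        also have "\<dots> = ennreal (1 / (2 * t)) + ennreal (t / 2) * (1 + ennreal (exp (dev_form b d Z w)))"
        proof -
          have "ennreal (1 / (2 * t) + t / 2 * (1 + exp (dev_form b d Z w))) = ennreal (1 / (2 * t)) + ennreal (t / 2 * (1 + exp (dev_form b d Z w)))"
            using t(1) by (intro ennreal_plus) (auto intro!: mult_nonneg_nonneg add_nonneg_nonneg)
          also have "ennreal (t / 2 * (1 + exp (dev_form b d Z w))) = ennreal (t / 2) * ennreal (1 + exp (dev_form b d Z w))"
            using t(1) by (intro ennreal_mult') simp
          also have "ennreal (1 + exp (dev_form b d Z w)) = 1 + ennreal (exp (dev_form b d Z w))"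
            using ennreal_plus[of 1 "exp (dev_form b d Z w)"] by simp
          finally show ?thesis .
        qed
        finally have "ennreal x \<le> ennreal (1 / (2 * t)) + ennreal (t / 2) * (1 + ennreal (exp (dev_form b d Z w)))" .
        then show "(if sqn d w \<le> d * L \<and> bad_point b d Z w then ennreal (exp (max 0 (dev_form b d Z w) / 2)) else 0) \<le>
           ennreal (1 / (2 * t)) * indicator B Z + ennreal (t / 2) * (1 + ennreal (exp (dev_form b d Z w)))"
          using Z by (auto simp: B_def x_def)
      qed
      also have "\<dots> = ennreal (1 / (2 * t)) * emeasure (stdmat b d) B + ennreal (t / 2) * (1 + (\<integral>\<^sup>+Z. ennreal (exp (dev_form b d Z w)) \<partial>stdmat b d))"
        using M.emeasure_space_1 by (simp add: nn_integral_add nn_integral_cmult)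
      also have "\<dots> \<le> ennreal (1 / (2 * t)) * ennreal ((2 + 4 * d) * exp (- L / 4)) + ennreal (t / 2) * (1 + ennreal 3)"
        using mom bad_point_prob[OF w True] by (intro add_mono mult_left_mono) (auto simp: B_def)
      also have "\<dots> = ennreal ((1 + 2 * d) * t + 2 * t)"
      proof -
        have "ennreal (1 / (2 * t)) * ennreal ((2 + 4 * d) * exp (- L / 4)) = ennreal ((1 + 2 * d) * t)"
        proof -
          have "ennreal (1 / (2 * t)) * ennreal ((2 + 4 * d) * exp (- L / 4)) = ennreal (1 / (2 * t) * ((2 + 4 * d) * (t * t)))"
            unfolding t(2) using t(1) by (intro ennreal_mult'[symmetric]) simp
          also have "1 / (2 * t) * ((2 + 4 * d) * (t * t)) = (1 + 2 * d) * t" using t(1) by (simp add: field_simps)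
          finally show ?thesis .
        qed
        moreover have "ennreal (t / 2) * (1 + ennreal 3) = ennreal (2 * t)"
        proof -
          have "1 + ennreal 3 = ennreal 4" using ennreal_plus[of 1 3] by simp
          then show ?thesis using t(1) by (simp only:) (subst ennreal_mult'[symmetric], auto)
        qed
        ultimately show ?thesis using t(1) by (simp add: ennreal_plus)
      qed
      also have "\<dots> \<le> ennreal (5 * d * exp (- L / 8))"
      proof (rule ennreal_leI)
        have "(1 + 2 * d) * t + 2 * t = (2 * d + 3) * t" by (simp add: algebra_simps)
        also have "\<dots> \<le> (5 * d) * t" using d t(1) by (intro mult_right_mono) auto
        finally show "(1 + 2 * d) * t + 2 * t \<le> 5 * d * exp (- L / 8)" by (simp add: t_def)
      qed
      finally show ?thesis .
    qed
  qed
  also have "\<dots> = ennreal (5 * d * exp (- L / 8))" using N.emeasure_space_1 by simp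
  finally show ?thesis .
qed

lemma sphere_tail_expect: "(\<integral>\<^sup>+Z. sphere_tail Z \<partial>stdmat b d) \<le> ennreal (2 * d * exp (- L / 8))"
proof -
  interpret P: pair_sigma_finite "stdmat b d" "stdg {..<b}" by (rule pair_stdmat_stdg)
  interpret N: prob_space "stdg {..<b}" by simp
  have "(\<integral>\<^sup>+Z. sphere_tail Z \<partial>stdmat b d) = (\<integral>\<^sup>+h. (\<integral>\<^sup>+Z. (if sqn d (sphere_proj b d Z h) > d * L then 1 else 0) \<partial>stdmat b d) \<partial>stdg {..<b})"
    unfolding sphere_tail_def using integrands_measurable(3) by (intro P.Fubini'[symmetric]) (simp add: split_def)
  also have "\<dots> \<le> (\<integral>\<^sup>+h. ennreal (2 * d * exp (- L / 8)) \<partial>stdg {..<b})"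
  proof (rule nn_integral_mono)
    fix h assume h: "h \<in> space (stdg {..<b})"
    show "(\<integral>\<^sup>+Z. (if sqn d (sphere_proj b d Z h) > d * L then 1 else 0) \<partial>stdmat b d) \<le> ennreal (2 * d * exp (- L / 8))"
    proof (cases "(\<Sum>i<b. (h i)\<^sup>2) = 0")
      case True
      \<comment> \<open>For h = 0 the convention x / 0 = 0 puts the projection at the origin, which
        is not in the tail.\<close>
      then have "sqn d (sphere_proj b d Z h) = 0" for Z by (simp add: sphere_proj_def sqn_def)
      then show ?thesis using dL_ge by simp
    next
      case False
      have m: "(\<lambda>Z. sphere_proj b d Z h) \<in> stdmat b d \<rightarrow>\<^sub>M stdg {..<d}"
        using measurable_compose[OF measurable_Pair2'[OF h] sphere_proj_measurable_pair[of b d]] measurable_cong_sets[OF refl sets_stdg] by simp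
      have "(\<integral>\<^sup>+Z. (if sqn d (sphere_proj b d Z h) > d * L then 1 else 0) \<partial>stdmat b d) =
        (\<integral>\<^sup>+w. (if sqn d w > d * L then 1 else 0) \<partial>distr (stdmat b d) (stdg {..<d}) (\<lambda>Z. sphere_proj b d Z h))"
        using m by (subst nn_integral_distr) auto
      also have "\<dots> = (\<integral>\<^sup>+w. indicator {w \<in> space (stdg {..<d}). sqn d w > d * L} w \<partial>stdg {..<d})"
        unfolding sphere_proj_Z_distr[OF False] by (intro nn_integral_cong) auto
      also have "\<dots> = emeasure (stdg {..<d}) {w \<in> space (stdg {..<d}). (\<Sum>j<d. (w j)\<^sup>2) > d * L}"
        by (subst nn_integral_indicator) (auto simp: sqn_def)
      also have "\<dots> \<le> ennreal (2 * d * exp (- L / 4))" by (rule stdg_norm_tail)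
      also have "\<dots> \<le> ennreal (2 * d * exp (- L / 8))" using exp_quarter_le by (intro ennreal_leI mult_left_mono) auto
      finally show ?thesis .
    qed
  qed
  also have "\<dots> = ennreal (2 * d * exp (- L / 8))" using N.emeasure_space_1 by simp
  finally show ?thesis .
qed

lemma nn_integral_Markov:
  assumes F: "F \<in> borel_measurable M" and e: "(\<integral>\<^sup>+x. F x \<partial>M) \<le> ennreal e" and t: "\<tau> > 0"
  shows "emeasure M {x \<in> space M. F x > ennreal \<tau>} \<le> ennreal (e / \<tau>)"
proof -
  have "emeasure M {x \<in> space M. F x > ennreal \<tau>} \<le> (\<integral>\<^sup>+x. ennreal (1 / \<tau>) * F x \<partial>M)"
  proof (rule emeasure_le_nn_integral)
    show "{x \<in> space M. F x > ennreal \<tau>} \<in> sets M" using F by measurable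
    fix x assume "x \<in> {x \<in> space M. F x > ennreal \<tau>}"
    then have "ennreal (1 / \<tau>) * ennreal \<tau> \<le> ennreal (1 / \<tau>) * F x" by (intro mult_left_mono) auto
    moreover have "ennreal (1 / \<tau>) * ennreal \<tau> = 1" using t by (subst ennreal_mult'[symmetric]) auto
    ultimately show "1 \<le> ennreal (1 / \<tau>) * F x" by simp
  qed
  also have "\<dots> = ennreal (1 / \<tau>) * (\<integral>\<^sup>+x. F x \<partial>M)" using F by (rule nn_integral_cmult)
  also have "\<dots> \<le> ennreal (1 / \<tau>) * ennreal e" using e by (intro mult_left_mono) auto
  also have "\<dots> = ennreal (e / \<tau>)" using t by (subst ennreal_mult'[symmetric]) auto
  finally show ?thesis .
qed

definition good_cloud :: "real \<Rightarrow> (nat \<Rightarrow> nat \<Rightarrow> real) set" where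
  "good_cloud \<tau> = {Z \<in> well_conditioned. lead_det d Z \<noteq> 0 \<and> escape_mass Z \<le> ennreal \<tau> \<and> excess_mass Z \<le> ennreal \<tau> \<and> sphere_tail Z \<le> ennreal \<tau>}"

lemma good_cloud_sets: "good_cloud \<tau> \<in> sets (stdmat b d)"
proof -
  have dm: "lead_det d \<in> borel_measurable (stdmat b d)"
    using bc by (intro lead_det_measurable stdmat_entry_measurable) auto
  have "good_cloud \<tau> = well_conditioned \<inter> {Z \<in> space (stdmat b d). lead_det d Z \<noteq> 0 \<and> escape_mass Z \<le> ennreal \<tau> \<and> excess_mass Z \<le> ennreal \<tau> \<and> sphere_tail Z \<le> ennreal \<tau>}"
    using sets.sets_into_space[OF well_conditioned_sets] by (auto simp: good_cloud_def)
  also have "\<dots> \<in> sets (stdmat b d)"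
    using well_conditioned_sets dm masses_measurable by measurable
  finally show ?thesis .
qed

lemma good_cloud_prob:
  assumes t: "\<tau> > 0" "\<tau> \<le> 1"
  shows "emeasure (stdmat b d) (space (stdmat b d) - good_cloud \<tau>) \<le> ennreal (19 * (real d)\<^sup>2 * exp (- L / 8) / \<tau>)"
proof -
  define e where "e = exp (- L / 8)"
  define A where "A = space (stdmat b d) - well_conditioned"
  define B where "B = {Z \<in> space (stdmat b d). lead_det d Z = 0}"
  define C where "C F = {Z \<in> space (stdmat b d). F Z > ennreal \<tau>}" for F
  have dm[measurable]: "lead_det d \<in> borel_measurable (stdmat b d)"
    using bc by (intro lead_det_measurable stdmat_entry_measurable) auto
  note [measurable] = masses_measurable well_conditioned_sets
  have sets: "A \<in> sets (stdmat b d)" "B \<in> sets (stdmat b d)" "C escape_mass \<in> sets (stdmat b d)" "C excess_mass \<in> sets (stdmat b d)" "C sphere_tail \<in> sets (stdmat b d)"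
    unfolding A_def B_def C_def by measurable
  have B0: "emeasure (stdmat b d) B = 0"
    using AE_lead_det_nonzero[of d b] bc AE_iff_measurable[of B "stdmat b d" "\<lambda>Z. lead_det d Z \<noteq> 0"] sets(2) by (simp add: B_def)
  have "space (stdmat b d) - good_cloud \<tau> \<subseteq> A \<union> (B \<union> (C escape_mass \<union> (C excess_mass \<union> C sphere_tail)))"
    by (auto simp: good_cloud_def A_def B_def C_def not_le)
  then have "emeasure (stdmat b d) (space (stdmat b d) - good_cloud \<tau>) \<le> emeasure (stdmat b d) (A \<union> (B \<union> (C escape_mass \<union> (C excess_mass \<union> C sphere_tail))))"
    using sets by (intro emeasure_mono) auto
  also have "\<dots> \<le> emeasure (stdmat b d) A + (emeasure (stdmat b d) B + (emeasure (stdmat b d) (C escape_mass) + (emeasure (stdmat b d) (C excess_mass) + emeasure (stdmat b d) (C sphere_tail))))"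
    using sets by (intro order_trans[OF emeasure_subadditive] add_mono order_refl) auto
  also have "\<dots> \<le> ennreal (4 * (real d)\<^sup>2 * exp (- L / 4)) + (0 + (ennreal (8 * d * exp (- L / 8) / \<tau>) + (ennreal (5 * d * exp (- L / 8) / \<tau>) + ennreal (2 * d * exp (- L / 8) / \<tau>))))"
    unfolding A_def C_def
    by (intro add_mono well_conditioned_prob nn_integral_Markov escape_mass_expect excess_mass_expect sphere_tail_expect masses_measurable t) (simp add: B0)
  also have "\<dots> = ennreal (4 * (real d)\<^sup>2 * exp (- L / 4) + (8 * d * e / \<tau> + (5 * d * e / \<tau> + 2 * d * e / \<tau>)))"
  proof -
    have g: "ennreal a + (0 + (ennreal x + (ennreal y + ennreal z))) = ennreal (a + (x + (y + z)))"
      if "0 \<le> a" "0 \<le> x" "0 \<le> y" "0 \<le> z" for a x y z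
      using that by (simp add: ennreal_plus)
    show ?thesis unfolding e_def using t by (intro g) auto
  qed
  \<comment> \<open>The 4 comes from conditioning and 15 = 8 + 5 + 2 from Markov's inequality for
    the three masses; singular leading minors have probability 0.\<close>
  also have "\<dots> \<le> ennreal (19 * (real d)\<^sup>2 * exp (- L / 8) / \<tau>)"
  proof (rule ennreal_leI)
    have "exp (- L / 4) \<le> e / \<tau>"
    proof -
      have "exp (- L / 4) \<le> e" unfolding e_def by (rule exp_quarter_le)
      also have "\<dots> \<le> e / \<tau>" using t by (simp add: e_def le_divide_eq)
      finally show ?thesis .
    qed
    then have "4 * (real d)\<^sup>2 * exp (- L / 4) \<le> 4 * (real d)\<^sup>2 * (e / \<tau>)" by (intro mult_left_mono) auto
    moreover have "15 * d * (e / \<tau>) \<le> 15 * (real d)\<^sup>2 * (e / \<tau>)"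
      using d t by (intro mult_right_mono) (auto simp: e_def power2_eq_square)
    moreover have "8 * d * e / \<tau> + (5 * d * e / \<tau> + 2 * d * e / \<tau>) = 15 * d * (e / \<tau>)" using t by (simp add: field_simps)
    ultimately show "4 * (real d)\<^sup>2 * exp (- L / 4) + (8 * d * e / \<tau> + (5 * d * e / \<tau> + 2 * d * e / \<tau>)) \<le> 19 * (real d)\<^sup>2 * exp (- L / 8) / \<tau>"
      by (simp add: e_def)
  qed
  finally show ?thesis .
qed

end

section \<open>Comparison of the sphere law and of shifted Gaussians with the standard
  Gaussian\<close>

context gaussian_block
begin

lemma b_pos: "b > 0" using bc c by simp

lemma nn_integral_sphere_law:
  assumes f: "f \<in> borel_measurable (leb {..<d})"
  shows "(\<integral>\<^sup>+w. f w \<partial>sphere_law b d Z) = (\<integral>\<^sup>+h. f (sphere_proj b d Z h) \<partial>stdg {..<b})"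
  unfolding sphere_law_def using f by (intro nn_integral_distr sphere_proj_measurable) simp

lemma nn_integral_stdg:
  assumes f: "f \<in> borel_measurable (leb {..<d})"
  shows "(\<integral>\<^sup>+w. f w \<partial>stdg {..<d}) = ennreal ((1 / sqrt (2 * pi)) ^ d) * (\<integral>\<^sup>+w. f w * ennreal (exp (- sqn d w / 2)) \<partial>leb {..<d})"
proof -
  define c0 where "c0 = (1 / sqrt (2 * pi)) ^ d"
  have c0: "c0 \<ge> 0" by (simp add: c0_def)
  have m: "(\<lambda>w. exp (- sqn d w / 2)) \<in> borel_measurable (leb {..<d})" unfolding sqn_def by measurable
  have "(\<integral>\<^sup>+w. f w \<partial>stdg {..<d}) = (\<integral>\<^sup>+w. ennreal (c0 * exp (- sqn d w / 2)) * f w \<partial>leb {..<d})"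
    unfolding stdg_density[OF finite_lessThan] sqn_def c0_def using f by (subst nn_integral_density) auto
  also have "\<dots> = (\<integral>\<^sup>+w. ennreal c0 * (f w * ennreal (exp (- sqn d w / 2))) \<partial>leb {..<d})"
    using c0 by (intro nn_integral_cong) (simp add: ennreal_mult' mult_ac)
  also have "\<dots> = ennreal c0 * (\<integral>\<^sup>+w. f w * ennreal (exp (- sqn d w / 2)) \<partial>leb {..<d})"
    using f m by (intro nn_integral_cmult) auto
  finally show ?thesis unfolding c0_def .
qed

lemma exp_bounds: "exp 1 \<le> (3::real)" "2 * exp 3 \<le> (41::real)" "2 * exp 4 \<le> (110::real)" "2 * exp 2 \<le> (15::real)"
proof -
  have e: "exp 1 \<le> (272/100::real)" using e_less_272 by simp
  show "exp 1 \<le> (3::real)" using e by simp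
  have p: "exp (real n) \<le> (272/100) ^ n" for n
    using power_mono[OF e, of n] by (simp add: exp_of_nat_mult[symmetric])
  show "2 * exp 3 \<le> (41::real)" using p[of 3] by (simp add: eval_nat_numeral)
  show "2 * exp 4 \<le> (110::real)" using p[of 4] by (simp add: eval_nat_numeral)
  show "2 * exp 2 \<le> (15::real)" using p[of 2] by (simp add: eval_nat_numeral)
qed

text \<open>On the good set the two densities agree up to constants, and its complement is small
  under both laws: under the Gaussian by \<open>escape_mass\<close>, under the sphere law by
  \<open>sphere_tail\<close> outside the ball and by \<open>excess_mass\<close> at the bad points
  inside it. The factor 2 exp 4 rounds up 2 exp (5/2) exp 1.\<close>

lemma sphere_law_close:
  assumes Z: "Z \<in> good_cloud \<tau>" and t: "\<tau> > 0" "\<tau> \<le> 1/100" and A[measurable]: "A \<in> sets (leb {..<d})"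
  shows "emeasure (sphere_law b d Z) A \<le> ennreal (2 * exp 4) * emeasure (stdg {..<d}) A + ennreal (42 * \<tau>)"
    and "emeasure (stdg {..<d}) A \<le> ennreal (2 * exp 4) * emeasure (sphere_law b d Z) A + ennreal (42 * \<tau>)"
proof -
  have Zop: "Z \<in> well_conditioned" and Zd: "lead_det d Z \<noteq> 0" and ZF: "escape_mass Z \<le> ennreal \<tau>" "excess_mass Z \<le> ennreal \<tau>" "sphere_tail Z \<le> ennreal \<tau>"
    using Z by (auto simp: good_cloud_def)
  have Zsp: "Z \<in> space (stdmat b d)" using Zop by (simp add: well_conditioned_def)
  have op: "\<And>u. dev_form b d Z u \<ge> - (1/2 * sqn d u)" by (rule well_conditioned_op[OF Zop])
  obtain H where H: "\<And>j l. j < d \<Longrightarrow> l < d \<Longrightarrow> (\<Sum>k<d. (\<Sum>i<b. Z i j * Z i k) * H k l) = (if j = l then 1 else 0)"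
  proof (rule gram_inverse_exists[OF b_pos op])
    fix H assume H: "\<And>j l. j < d \<Longrightarrow> l < d \<Longrightarrow> (\<Sum>k<d. (\<Sum>i<b. Z i j * Z i k) * H k l) = (if j = l then 1 else 0)"
    show thesis by (rule that[of H]) (rule H)
  qed
  have lead: "v i = 0" if "\<And>j. j < d \<Longrightarrow> (\<Sum>i<d. Z i j * v i) = 0" "i < d" for v i
    using that by (rule lead_det_nonzero_inj[OF Zd])
  have q0: "qf H d w \<ge> 0" for w
  proof (rule qf_nonneg[where Z = Z, OF c bc])
    show "\<And>j l. j < d \<Longrightarrow> l < d \<Longrightarrow> (\<Sum>k<d. (\<Sum>i<b. Z i j * Z i k) * H k l) = (if j = l then 1 else 0)" by (rule H)
    show "\<And>v i. (\<And>j. j < d \<Longrightarrow> (\<Sum>i<d. Z i j * v i) = 0) \<Longrightarrow> i < d \<Longrightarrow> v i = 0" by (rule lead)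
  qed
  define ur where "ur w = (1 - qf H d w) ^ (c - 1) * (if qf H d w < 1 then 1 else 0)" for w
  define vr where "vr w = exp (- sqn d w / 2)" for w
  obtain K where K: "\<And>f. f \<in> borel_measurable (leb {..<d}) \<Longrightarrow>
    (\<integral>\<^sup>+h. f (\<lambda>j\<in>{..<d}. (\<Sum>i<b. h i * Z i j) / sqrt (\<Sum>i<b. (h i)\<^sup>2)) \<partial>stdg {..<b}) =
    K * (\<integral>\<^sup>+w. f w * (ennreal ((1 - qf H d w) ^ (c - 1)) * indicator {..<1} (qf H d w)) \<partial>leb {..<d})"
  proof (rule sphere_projection_density[where Z = Z, OF c bc])
    show "\<And>j l. j < d \<Longrightarrow> l < d \<Longrightarrow> (\<Sum>k<d. (\<Sum>i<b. Z i j * Z i k) * H k l) = (if j = l then 1 else 0)" by (rule H)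
    show "\<And>v i. (\<And>j. j < d \<Longrightarrow> (\<Sum>i<d. Z i j * v i) = 0) \<Longrightarrow> i < d \<Longrightarrow> v i = 0" by (rule lead)
  qed blast
  have uind: "ennreal ((1 - qf H d w) ^ (c - 1)) * indicator {..<1} (qf H d w) = ennreal (ur w)" for w
    by (auto simp: ur_def split: split_indicator)
  have um[measurable]: "ur \<in> borel_measurable (leb {..<d})" unfolding ur_def[abs_def] by measurable
  have vm[measurable]: "vr \<in> borel_measurable (leb {..<d})" unfolding vr_def[abs_def] by measurable
  have M1: "(\<integral>\<^sup>+w. f w \<partial>sphere_law b d Z) = K * (\<integral>\<^sup>+w. f w * ennreal (ur w) \<partial>leb {..<d})" if f: "f \<in> borel_measurable (leb {..<d})" for f
    using K[OF f] unfolding nn_integral_sphere_law[OF f] sphere_proj_def uind .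
  define c0 where "c0 = ennreal ((1 / sqrt (2 * pi)) ^ d)"
  have M2: "(\<integral>\<^sup>+w. f w \<partial>stdg {..<d}) = c0 * (\<integral>\<^sup>+w. f w * ennreal (vr w) \<partial>leb {..<d})" if f: "f \<in> borel_measurable (leb {..<d})" for f
    using nn_integral_stdg[OF f] unfolding vr_def c0_def .
  have sPZ: "sets (sphere_law b d Z) = sets (leb {..<d})" by (simp add: sphere_law_def)
  interpret P1: prob_space "sphere_law b d Z" by (rule prob_space_sphere_law)
  interpret P2: prob_space "stdg {..<d}" by simp
  have ratio1: "ur w \<le> vr w * exp (1/2 + max 0 (dev_form b d Z w) / 2)" if "sqn d w \<le> d * L" for w
    unfolding ur_def vr_def
    by (rule density_ratio_bounds(1)[where Z = Z and Si = H, OF d L c bc bL]) (rule H, assumption+, rule op, rule q0, rule that)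
  have ratio2: "vr w \<le> exp (5/2) * ur w" if "sqn d w \<le> d * L" "\<bar>dev_form b d Z w\<bar> \<le> 1" "(\<Sum>j<d. (dev_vec b d Z w j)\<^sup>2) \<le> 1" for w
    unfolding ur_def vr_def
    by (rule density_ratio_bounds(2)[where Z = Z and Si = H, OF d L c bc bL]) (rule H, assumption+, rule op, rule q0, rule that(1), rule that(2), rule that(3))
  have bEm[measurable]: "Measurable.pred (leb {..<d}) (\<lambda>w. bad_point b d Z w)"
    using bad_point_measurable_w[OF Zsp] by (simp add: pred_def sets_stdg space_stdg)
  have qEm[measurable]: "(\<lambda>w. dev_form b d Z w) \<in> borel_measurable (leb {..<d})"
    unfolding dev_form_def by measurable
  define G where "G = {w \<in> space (leb {..<d}). sqn d w \<le> d * L \<and> \<not> bad_point b d Z w}"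
  define B where "B = {w \<in> space (leb {..<d}). sqn d w \<le> d * L \<and> bad_point b d Z w}"
  define E where "E = {w \<in> space (leb {..<d}). sqn d w > d * L}"
  have Gm[measurable]: "G \<in> sets (leb {..<d})" and Bm[measurable]: "B \<in> sets (leb {..<d})" and Em[measurable]: "E \<in> sets (leb {..<d})"
    unfolding G_def B_def E_def by measurable
  have vuG: "ennreal (vr w) \<le> ennreal (exp (5/2)) * ennreal (ur w)" if "w \<in> G" for w
  proof -
    have "vr w \<le> exp (5/2) * ur w" using that by (intro ratio2) (auto simp: G_def bad_point_def)
    then show ?thesis by (simp add: ennreal_mult'[symmetric] ennreal_leI)
  qed
  have uvG: "ennreal (ur w) \<le> ennreal (exp 1) * ennreal (vr w)" if w: "w \<in> G" for w
  proof -
    have q1: "\<bar>dev_form b d Z w\<bar> \<le> 1" and s: "sqn d w \<le> d * L" using w by (auto simp: G_def bad_point_def)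
    have "ur w \<le> vr w * exp (1/2 + max 0 (dev_form b d Z w) / 2)" by (rule ratio1[OF s])
    also have "\<dots> \<le> vr w * exp 1" using q1 by (intro mult_left_mono) (auto simp: vr_def)
    finally show ?thesis by (simp add: ennreal_mult'[symmetric] ennreal_leI mult.commute)
  qed
  have comp: "space (leb {..<d}) - G = E \<union> B" by (auto simp: G_def B_def E_def)
  have EB2: "emeasure (stdg {..<d}) (E \<union> B) \<le> ennreal \<tau>"
  proof -
    have "emeasure (stdg {..<d}) (E \<union> B) = (\<integral>\<^sup>+w. indicator (E \<union> B) w \<partial>stdg {..<d})"
      using sets_stdg[of "{..<d}"] by (intro nn_integral_indicator[symmetric]) auto
    also have "\<dots> = escape_mass Z" unfolding escape_mass_def
      by (intro nn_integral_cong) (auto simp: E_def B_def space_stdg split: split_indicator)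
    finally show ?thesis using ZF by simp
  qed
  have half_of: "emeasure M G \<ge> ennreal (1/2)" if "prob_space M" "sets M = sets (leb {..<d})" "emeasure M (E \<union> B) \<le> ennreal (1/2)" for M
  proof -
    interpret M: prob_space M by fact
    have sp: "space M = space (leb {..<d})" by (rule sets_eq_imp_space_eq[OF that(2)])
    have "M.prob (E \<union> B) \<le> 1/2" using that(3) unfolding M.emeasure_eq_measure by (subst (asm) ennreal_le_iff) auto
    moreover have "M.prob G = 1 - M.prob (E \<union> B)"
      using M.prob_compl[of G] Gm that(2) sp comp by simp
    ultimately have "M.prob G \<ge> 1/2" by simp
    then show ?thesis unfolding M.emeasure_eq_measure by (rule ennreal_leI)
  qed
  have half2: "emeasure (stdg {..<d}) G \<ge> ennreal (1/2)"
  proof (rule half_of[OF _ sets_stdg])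
    show "emeasure (stdg {..<d}) (E \<union> B) \<le> ennreal (1/2)"
      using EB2 t by (elim order_trans) (intro ennreal_leI, simp)
  qed simp
  note dc1 = density_compare[where u = "\<lambda>w. ennreal (ur w)" and v = "\<lambda>w. ennreal (vr w)" and \<kappa> = "exp (5/2)" and G = G,
      OF _ _ M1 prob_space_sphere_law sPZ M2 _ sets_stdg Gm _ vuG half2]
  have Kc0: "K \<le> ennreal (2 * exp (5/2)) * c0" by (rule dc1(1)) auto
  \<comment> \<open>Two factors meet: the normalising constant K is at most 2 exp (5/2) times the
    Gaussian one, and the upper density bound leaves exp (1/2) besides the weight. Their product 2
    exp 3 is at most 41.\<close>
  have B1: "emeasure (sphere_law b d Z) B \<le> ennreal (41 * \<tau>)"
  proof -
    define g where "g w = (if sqn d w \<le> d * L \<and> bad_point b d Z w then ennreal (exp (max 0 (dev_form b d Z w) / 2)) else 0)" for w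
    have gm: "g \<in> borel_measurable (leb {..<d})" unfolding g_def[abs_def] by measurable
    have "emeasure (sphere_law b d Z) B = (\<integral>\<^sup>+w. indicator B w \<partial>sphere_law b d Z)" using Bm by (simp add: sPZ)
    also have "\<dots> = K * (\<integral>\<^sup>+w. indicator B w * ennreal (ur w) \<partial>leb {..<d})" by (rule M1) simp
    also have "\<dots> \<le> K * (\<integral>\<^sup>+w. ennreal (exp (1/2)) * (g w * ennreal (vr w)) \<partial>leb {..<d})"
    proof (intro mult_left_mono nn_integral_mono)
      fix w
      show "indicator B w * ennreal (ur w) \<le> ennreal (exp (1/2)) * (g w * ennreal (vr w))"
      proof (cases "w \<in> B")
        case True
        then have s: "sqn d w \<le> d * L" "bad_point b d Z w" by (auto simp: B_def)
        have "ur w \<le> exp (1/2) * (exp (max 0 (dev_form b d Z w) / 2) * vr w)"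
          using ratio1[OF s(1)] by (simp add: exp_add mult_ac)
        then show ?thesis using True s
          by (simp add: g_def ennreal_mult'[symmetric] ennreal_leI vr_def)
      qed simp
    qed simp
    also have "\<dots> = K * (ennreal (exp (1/2)) * (\<integral>\<^sup>+w. g w * ennreal (vr w) \<partial>leb {..<d}))"
      using gm by (subst nn_integral_cmult) auto
    also have "\<dots> \<le> (ennreal (2 * exp (5/2)) * c0) * (ennreal (exp (1/2)) * (\<integral>\<^sup>+w. g w * ennreal (vr w) \<partial>leb {..<d}))"
      by (intro mult_right_mono Kc0) simp
    also have "\<dots> = ennreal (2 * exp (5/2)) * ennreal (exp (1/2)) * (\<integral>\<^sup>+w. g w \<partial>stdg {..<d})"
      unfolding M2[OF gm] by (simp add: mult_ac)
    also have "(\<integral>\<^sup>+w. g w \<partial>stdg {..<d}) = excess_mass Z" unfolding excess_mass_def g_def ..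
    also have "ennreal (2 * exp (5/2)) * ennreal (exp (1/2)) = ennreal (2 * exp 3)"
      by (subst ennreal_mult'[symmetric]) (simp_all add: mult_exp_exp)
    also have "ennreal (2 * exp 3) * excess_mass Z \<le> ennreal 41 * ennreal \<tau>"
      by (intro mult_mono ennreal_leI exp_bounds ZF) auto
    also have "\<dots> = ennreal (41 * \<tau>)" by (rule ennreal_mult'[symmetric]) simp
    finally show ?thesis .
  qed
  have E1: "emeasure (sphere_law b d Z) E \<le> ennreal \<tau>"
  proof -
    have "emeasure (sphere_law b d Z) E = (\<integral>\<^sup>+w. indicator E w \<partial>sphere_law b d Z)" using Em by (simp add: sPZ)
    also have "\<dots> = (\<integral>\<^sup>+h. indicator E (sphere_proj b d Z h) \<partial>stdg {..<b})" by (rule nn_integral_sphere_law) simp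
    also have "\<dots> = sphere_tail Z" unfolding sphere_tail_def
      using measurable_space[OF sphere_proj_measurable] by (intro nn_integral_cong) (auto simp: E_def split: split_indicator)
    finally show ?thesis using ZF by simp
  qed
  have EB1: "emeasure (sphere_law b d Z) (E \<union> B) \<le> ennreal (42 * \<tau>)"
  proof -
    have "emeasure (sphere_law b d Z) (E \<union> B) \<le> emeasure (sphere_law b d Z) E + emeasure (sphere_law b d Z) B"
      using Em Bm sPZ by (intro emeasure_subadditive) auto
    also have "\<dots> \<le> ennreal \<tau> + ennreal (41 * \<tau>)" by (intro add_mono E1 B1)
    also have "\<dots> = ennreal (42 * \<tau>)" using t by (subst ennreal_plus[symmetric]) auto
    finally show ?thesis .
  qed
  \<comment> \<open>Here \<tau> \<le> 1/100 enters: the exceptional mass 42 \<tau> stays below one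
    half.\<close>
  have half1: "emeasure (sphere_law b d Z) G \<ge> ennreal (1/2)"
  proof (rule half_of[OF prob_space_sphere_law sPZ])
    show "emeasure (sphere_law b d Z) (E \<union> B) \<le> ennreal (1/2)"
      using EB1 t by (elim order_trans) (intro ennreal_leI, simp)
  qed
  note dc2 = density_compare[where u = "\<lambda>w. ennreal (vr w)" and v = "\<lambda>w. ennreal (ur w)" and \<kappa> = "exp 1" and G = G,
      OF _ _ M2 _ sets_stdg M1 prob_space_sphere_law sPZ Gm _ uvG half1]
  have le: "2 * exp (5/2) * exp 1 \<le> 2 * exp (4::real)" "2 * exp 1 * exp (5/2) \<le> 2 * exp (4::real)"
    by (simp_all add: mult_exp_exp)
  have split: "emeasure M A \<le> emeasure M (A \<inter> G) + emeasure M (E \<union> B)" if "sets M = sets (leb {..<d})" for M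
  proof -
    have "emeasure M A \<le> emeasure M ((A \<inter> G) \<union> (E \<union> B))"
      using sets.sets_into_space[OF A] comp that Em Bm Gm A by (intro emeasure_mono) auto
    also have "\<dots> \<le> emeasure M (A \<inter> G) + emeasure M (E \<union> B)"
      using that Em Bm Gm A by (intro emeasure_subadditive) auto
    finally show ?thesis .
  qed
  have "emeasure (sphere_law b d Z) (A \<inter> G) \<le> ennreal (2 * exp (5/2) * exp 1) * emeasure (stdg {..<d}) A"
    by (rule dc1(2)) (auto intro: uvG)
  also have "\<dots> \<le> ennreal (2 * exp 4) * emeasure (stdg {..<d}) A"
    by (intro mult_right_mono ennreal_leI le) simp
  finally show "emeasure (sphere_law b d Z) A \<le> ennreal (2 * exp 4) * emeasure (stdg {..<d}) A + ennreal (42 * \<tau>)"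
    using split[OF sPZ] EB1 by (meson add_mono order_trans)
  have "emeasure (stdg {..<d}) (A \<inter> G) \<le> ennreal (2 * exp 1 * exp (5/2)) * emeasure (sphere_law b d Z) A"
    by (rule dc2(2)) (auto intro: vuG)
  also have "\<dots> \<le> ennreal (2 * exp 4) * emeasure (sphere_law b d Z) A"
    by (intro mult_right_mono ennreal_leI le) simp
  finally have "emeasure (stdg {..<d}) A \<le> ennreal (2 * exp 4) * emeasure (sphere_law b d Z) A + ennreal \<tau>"
    using split[OF sets_stdg] EB2 by (meson add_mono order_trans)
  also have "\<dots> \<le> ennreal (2 * exp 4) * emeasure (sphere_law b d Z) A + ennreal (42 * \<tau>)"
    using t by (intro add_left_mono ennreal_leI) simp
  finally show "emeasure (stdg {..<d}) A \<le> ennreal (2 * exp 4) * emeasure (sphere_law b d Z) A + ennreal (42 * \<tau>)" .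
qed

text \<open>A shift by \<nu> changes the exponent by w \<cdot> \<nu> - |\<nu>|^2 / 2. On |w|^2 \<le>
  d L the assumed size of \<nu> gives |w \<cdot> \<nu>| \<le> 1/2 by Cauchy-Schwarz, so the density
  ratio is between exp (-1) and exp 1. It accounts for the fluctuation of the block mean.\<close>

lemma shift_close:
  assumes nu: "sqn d \<nu> \<le> 1 / (4 * (d * L))" and t: "2 * d * exp (- L / 16) \<le> \<tau>" "\<tau> \<le> 1/2" and A[measurable]: "A \<in> sets (leb {..<d})"
  defines "S \<equiv> distr (stdg {..<d}) (leb {..<d}) (\<lambda>w. \<lambda>j\<in>{..<d}. w j + \<nu> j)"
  shows "emeasure S A \<le> ennreal (2 * exp 2) * emeasure (stdg {..<d}) A + ennreal \<tau>"
    and "emeasure (stdg {..<d}) A \<le> ennreal (2 * exp 2) * emeasure S A + ennreal \<tau>"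
proof -
  have sm: "(\<lambda>w. \<lambda>j\<in>{..<d}. w j + \<nu> j) \<in> stdg {..<d} \<rightarrow>\<^sub>M leb {..<d}"
    by (rule measurable_restrict) (simp add: coord_measurable)
  have sm': "(\<lambda>w. \<lambda>j\<in>{..<d}. w j + \<nu> j) \<in> leb {..<d} \<rightarrow>\<^sub>M leb {..<d}"
    by measurable
  define u where "u w = exp (- sqn d (\<lambda>j. w j - \<nu> j) / 2)" for w
  define v where "v w = exp (- sqn d w / 2)" for w
  have um[measurable]: "u \<in> borel_measurable (leb {..<d})" unfolding u_def[abs_def] sqn_def by measurable
  have vm[measurable]: "v \<in> borel_measurable (leb {..<d})" unfolding v_def[abs_def] by measurable
  define c0 where "c0 = ennreal ((1 / sqrt (2 * pi)) ^ d)"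
  have M2: "(\<integral>\<^sup>+w. f w \<partial>stdg {..<d}) = c0 * (\<integral>\<^sup>+w. f w * ennreal (v w) \<partial>leb {..<d})" if f: "f \<in> borel_measurable (leb {..<d})" for f
    using nn_integral_stdg[OF f] unfolding v_def c0_def .
  have M1: "(\<integral>\<^sup>+w. f w \<partial>S) = c0 * (\<integral>\<^sup>+w. f w * ennreal (u w) \<partial>leb {..<d})" if f[measurable]: "f \<in> borel_measurable (leb {..<d})" for f
  proof -
    have fm: "(\<lambda>w. f (\<lambda>j\<in>{..<d}. w j + \<nu> j)) \<in> borel_measurable (leb {..<d})" by (rule measurable_compose[OF sm' f])
    have "(\<integral>\<^sup>+w. f w \<partial>S) = (\<integral>\<^sup>+w. f (\<lambda>j\<in>{..<d}. w j + \<nu> j) \<partial>stdg {..<d})"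
      unfolding S_def using f by (intro nn_integral_distr sm) auto
    also have "\<dots> = c0 * (\<integral>\<^sup>+w. f (\<lambda>j\<in>{..<d}. w j + \<nu> j) * ennreal (v w) \<partial>leb {..<d})" by (rule M2[OF fm])
    also have "(\<integral>\<^sup>+w. f (\<lambda>j\<in>{..<d}. w j + \<nu> j) * ennreal (v w) \<partial>leb {..<d}) =
      (\<integral>\<^sup>+w. (\<lambda>w. f w * ennreal (u w)) (\<lambda>j\<in>{..<d}. w j + \<nu> j) \<partial>leb {..<d})"
      by (intro nn_integral_cong) (simp add: u_def v_def sqn_def)
    also have "\<dots> = (\<integral>\<^sup>+w. f w * ennreal (u w) \<partial>leb {..<d})"
      by (rule leb_translate) auto
    finally show ?thesis .
  qed
  have sS: "sets S = sets (leb {..<d})" by (simp add: S_def)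
  have pS: "prob_space S" unfolding S_def by (intro prob_space.prob_space_distr sm) simp
  define G where "G = {w \<in> space (leb {..<d}). sqn d w \<le> d * L}"
  define E where "E = {w \<in> space (leb {..<d}). sqn d w > d * L}"
  have Gm[measurable]: "G \<in> sets (leb {..<d})" and Em[measurable]: "E \<in> sets (leb {..<d})" unfolding G_def E_def by measurable
  have dLp: "real d * L \<ge> 2" by (rule dL_ge)
  have ratio: "\<bar>(sqn d (\<lambda>j. w j - \<nu> j) - sqn d w) / 2\<bar> \<le> 1" if w: "sqn d w \<le> d * L" for w
  proof -
    have eq: "sqn d (\<lambda>j. w j - \<nu> j) = sqn d w - 2 * (\<Sum>j<d. w j * \<nu> j) + sqn d \<nu>"
      by (simp add: sqn_def power2_diff sum.distrib sum_subtractf sum_distrib_left mult_ac)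
    have ab: "\<bar>\<Sum>j<d. w j * \<nu> j\<bar> \<le> 1/2"
    proof -
      have "(\<Sum>j<d. w j * \<nu> j)\<^sup>2 \<le> sqn d w * sqn d \<nu>" unfolding sqn_def by (rule Cauchy_Schwarz_ineq_sum)
      also have "\<dots> \<le> (d * L) * (1 / (4 * (d * L)))" using w nu dLp by (intro mult_mono) auto
      also have "\<dots> = (1/2)\<^sup>2" using d L by (simp add: power2_eq_square)
      finally show ?thesis by (intro power2_le_imp_le[of "\<bar>\<Sum>j<d. w j * \<nu> j\<bar>"]) auto
    qed
    have le: "sqn d \<nu> \<le> 1"
    proof -
      have "1 / (4 * (d * L)) \<le> 1" using dLp by simp
      then show ?thesis using nu by linarith
    qed
    have "\<bar>sqn d (\<lambda>j. w j - \<nu> j) - sqn d w\<bar> \<le> 2"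
      using abs_le_D1[OF ab] abs_le_D2[OF ab] le sqn_nonneg[of d \<nu>]
      unfolding eq by (intro abs_leI) linarith+
    then show ?thesis by simp
  qed
  have uvG: "ennreal (u w) \<le> ennreal (exp 1) * ennreal (v w)" "ennreal (v w) \<le> ennreal (exp 1) * ennreal (u w)" if "w \<in> G" for w
  proof -
    have r: "\<bar>(sqn d (\<lambda>j. w j - \<nu> j) - sqn d w) / 2\<bar> \<le> 1" using that by (intro ratio) (simp add: G_def)
    then have "u w \<le> exp 1 * v w" "v w \<le> exp 1 * u w"
      unfolding u_def v_def mult_exp_exp by (auto simp: abs_le_iff field_simps)
    then show "ennreal (u w) \<le> ennreal (exp 1) * ennreal (v w)" "ennreal (v w) \<le> ennreal (exp 1) * ennreal (u w)"
      by (auto simp: ennreal_mult'[symmetric] intro: ennreal_leI)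
  qed
  have comp: "space (leb {..<d}) - G = E" by (auto simp: G_def E_def)
  have E2: "emeasure (stdg {..<d}) E \<le> ennreal \<tau>"
  proof -
    have "emeasure (stdg {..<d}) E \<le> ennreal (2 * d * exp (- L / 4))"
      using stdg_norm_tail[of d L] by (simp add: E_def sqn_def space_stdg)
    also have "\<dots> \<le> ennreal (2 * d * exp (- L / 16))" using L by (intro ennreal_leI mult_left_mono) auto
    also have "\<dots> \<le> ennreal \<tau>" using t by (intro ennreal_leI)
    finally show ?thesis .
  qed
  have E1: "emeasure S E \<le> ennreal \<tau>"
  proof -
    \<comment> \<open>Since |w + \<nu>|^2 \<le> 2 |w|^2 + 2 |\<nu>|^2, leaving the ball after the
      shift forces |w|^2 > d L / 4 before it. The tail at L / 4 is the origin of exp (- L /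
      16).\<close>
    define E' where "E' = {w \<in> space (stdg {..<d}). (\<Sum>j<d. (w j)\<^sup>2) > d * (L / 4)}"
    have E'm: "E' \<in> sets (stdg {..<d})" unfolding E'_def sqn_def[symmetric] by measurable
    have "emeasure S E = emeasure (stdg {..<d}) ((\<lambda>w. \<lambda>j\<in>{..<d}. w j + \<nu> j) -` E \<inter> space (stdg {..<d}))"
      unfolding S_def by (rule emeasure_distr[OF sm Em])
    also have "\<dots> \<le> emeasure (stdg {..<d}) E'"
    proof (intro emeasure_mono E'm subsetI)
      fix w assume w: "w \<in> (\<lambda>w. \<lambda>j\<in>{..<d}. w j + \<nu> j) -` E \<inter> space (stdg {..<d})"
      then have "sqn d (\<lambda>j. w j + \<nu> j) > d * L" by (auto simp: E_def sqn_def)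
      also have "sqn d (\<lambda>j. w j + \<nu> j) \<le> 2 * sqn d w + 2 * sqn d \<nu>"
        using sqn_add_diff[of d w \<nu>] sqn_nonneg[of d "\<lambda>j. w j - \<nu> j"] by linarith
      finally have "2 * sqn d w > d * L - 2 * sqn d \<nu>" by linarith
      moreover have "2 * sqn d \<nu> \<le> d * L / 2"
      proof -
        have "1 / (4 * (d * L)) \<le> 1/4" using dLp by (simp add: field_simps)
        then show ?thesis using nu dLp by linarith
      qed
      ultimately have "sqn d w > d * (L / 4)" by simp
      then show "w \<in> E'" using w by (simp add: E'_def sqn_def)
    qed
    also have "\<dots> \<le> ennreal (2 * d * exp (- (L / 4) / 4))" unfolding E'_def by (rule stdg_norm_tail)
    also have "\<dots> \<le> ennreal \<tau>" using t by (intro ennreal_leI) simp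
    finally show ?thesis .
  qed
  have half: "emeasure M G \<ge> ennreal (1/2)" if "prob_space M" "sets M = sets (leb {..<d})" "emeasure M E \<le> ennreal \<tau>" for M
  proof -
    interpret M: prob_space M by fact
    have sp: "space M = space (leb {..<d})" by (rule sets_eq_imp_space_eq[OF that(2)])
    have "emeasure M E \<le> ennreal (1/2)" using that(3) t by (elim order_trans) (intro ennreal_leI, simp)
    then have "M.prob E \<le> 1/2" unfolding M.emeasure_eq_measure by (subst (asm) ennreal_le_iff) auto
    moreover have "M.prob G = 1 - M.prob E"
      using M.prob_compl[of G] Gm that(2) sp comp by simp
    ultimately have "M.prob G \<ge> 1/2" by simp
    then show ?thesis unfolding M.emeasure_eq_measure by (rule ennreal_leI)
  qed
  have split: "emeasure M A \<le> emeasure M (A \<inter> G) + emeasure M E" if "sets M = sets (leb {..<d})" for M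
  proof -
    have "emeasure M A \<le> emeasure M ((A \<inter> G) \<union> E)"
      using sets.sets_into_space[OF A] comp that Em Gm A by (intro emeasure_mono) auto
    also have "\<dots> \<le> emeasure M (A \<inter> G) + emeasure M E"
      using that Em Gm A by (intro emeasure_subadditive) auto
    finally show ?thesis .
  qed
  have h2: "emeasure (stdg {..<d}) G \<ge> ennreal (1/2)" by (rule half[OF _ sets_stdg E2]) simp
  have h1: "emeasure S G \<ge> ennreal (1/2)" by (rule half[OF pS sS E1])
  have e2: "2 * exp 1 * exp 1 = 2 * exp (2::real)" by (simp add: mult_exp_exp)
  note dc1 = density_compare[where u = "\<lambda>w. ennreal (u w)" and v = "\<lambda>w. ennreal (v w)" and \<kappa> = "exp 1" and G = G,
      OF _ _ M1 pS sS M2 _ sets_stdg Gm _ uvG(2) h2]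
  note dc2 = density_compare[where u = "\<lambda>w. ennreal (v w)" and v = "\<lambda>w. ennreal (u w)" and \<kappa> = "exp 1" and G = G,
      OF _ _ M2 _ sets_stdg M1 pS sS Gm _ uvG(1) h1]
  have "emeasure S (A \<inter> G) \<le> ennreal (2 * exp 1 * exp 1) * emeasure (stdg {..<d}) A"
    by (rule dc1(2)) (auto intro: uvG)
  then show "emeasure S A \<le> ennreal (2 * exp 2) * emeasure (stdg {..<d}) A + ennreal \<tau>"
    using split[OF sS] E1 unfolding e2 by (meson add_mono order_trans)
  have "emeasure (stdg {..<d}) (A \<inter> G) \<le> ennreal (2 * exp 1 * exp 1) * emeasure S A"
    by (rule dc2(2)) (auto intro: uvG)
  then show "emeasure (stdg {..<d}) A \<le> ennreal (2 * exp 2) * emeasure S A + ennreal \<tau>"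
    using split[OF sets_stdg] E2 unfolding e2 by (meson add_mono order_trans)
qed

end

section \<open>The output law of one block\<close>

text \<open>Coefficients of \<open>mean + sqrt (1 - 1 / (2 b)) \<Sum>\<^sub>i (h\<^sub>i / |h|) (X\<^sub>i - X\<^sub>b\<^sub>+\<^sub>i) / sqrt 2\<close> in terms of \<open>X\<close>.\<close>

definition block_coeff :: "nat \<Rightarrow> (nat \<Rightarrow> real) \<Rightarrow> nat \<Rightarrow> real" where
  "block_coeff b h i = 1 / (2 * b) + sqrt (1 - 1 / (2 * b)) / sqrt 2 *
     (if i < b then h i else - h (i - b)) / sqrt (\<Sum>i<b. (h i)\<^sup>2)"

definition block_law :: "nat \<Rightarrow> nat \<Rightarrow> (nat \<Rightarrow> nat \<Rightarrow> real) \<Rightarrow> (nat \<Rightarrow> real) measure" where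
  "block_law b d X = distr (stdg {..<b}) (lborel_dim d) (\<lambda>h. \<lambda>j\<in>{..<d}. \<Sum>i<2 * b. block_coeff b h i * X i j)"

lemma sum_double: "(\<Sum>i<2 * b. f i) = (\<Sum>i<b. f i) + (\<Sum>i<b. f (b + i))" for f :: "nat \<Rightarrow> 'a::comm_monoid_add"
proof -
  have "(\<Sum>i<2 * b. f i) = (\<Sum>i<b. f i) + (\<Sum>i\<in>{b..<2*b}. f i)"
    by (subst sum.union_disjoint[symmetric]) (auto intro!: sum.cong)
  also have "(\<Sum>i\<in>{b..<2*b}. f i) = (\<Sum>i<b. f (b + i))"
    by (rule sum.reindex_bij_witness[of _ "\<lambda>i. b + i" "\<lambda>i. i - b"]) auto
  finally show ?thesis .
qed

text \<open>The differences enter with opposite signs and cancel in the sum. In the sum of squares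
  the mean part contributes 1 / (2 b), which is why the unit direction is shortened by sqrt (1 - 1 /
  (2 b)).\<close>

lemma block_coeff_sums:
  assumes b: "b > 0" and h: "(\<Sum>i<b. (h i)\<^sup>2) \<noteq> 0"
  shows "(\<Sum>i<2 * b. block_coeff b h i) = 1" and "(\<Sum>i<2 * b. (block_coeff b h i)\<^sup>2) = 1"
proof -
  define u where "u = 1 / (2 * real b)"
  define n where "n = (\<Sum>i<b. (h i)\<^sup>2)"
  have n0: "n > 0" using h sum_nonneg[of "{..<b}" "\<lambda>i. (h i)\<^sup>2"] by (simp add: n_def)
  define g where "g i = sqrt (1 - u) / sqrt 2 * h i / sqrt n" for i
  have 1: "block_coeff b h i = u + g i" "block_coeff b h (b + i) = u - g i" if "i < b" for i
    using that by (auto simp: block_coeff_def u_def g_def n_def)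
  have "(\<Sum>i<2 * b. block_coeff b h i) = (\<Sum>i<b. u + g i) + (\<Sum>i<b. u - g i)"
    unfolding sum_double by (intro arg_cong2[where f = "(+)"] sum.cong refl) (auto simp: 1)
  also have "\<dots> = 2 * b * u" by (simp add: sum.distrib sum_subtractf)
  finally show "(\<Sum>i<2 * b. block_coeff b h i) = 1" using b by (simp add: u_def)
  have "(\<Sum>i<2 * b. (block_coeff b h i)\<^sup>2) = (\<Sum>i<b. (u + g i)\<^sup>2) + (\<Sum>i<b. (u - g i)\<^sup>2)"
    unfolding sum_double by (intro arg_cong2[where f = "(+)"] sum.cong refl) (auto simp: 1)
  also have "\<dots> = (\<Sum>i<b. 2 * u\<^sup>2 + 2 * (g i)\<^sup>2)"
    unfolding sum.distrib[symmetric] by (intro sum.cong refl) (simp add: power2_sum power2_diff)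
  also have "\<dots> = 2 * b * u\<^sup>2 + 2 * (\<Sum>i<b. (g i)\<^sup>2)" by (simp add: sum.distrib sum_distrib_left)
  also have "(\<Sum>i<b. (g i)\<^sup>2) = 1/2 - u / 2"
  proof -
    have u1: "u \<le> 1" using b by (simp add: u_def)
    define k where "k = (1 - u) / 2 / n"
    have gk: "(g i)\<^sup>2 = k * (h i)\<^sup>2" for i
      using n0 u1 by (simp add: g_def k_def power_mult_distrib power_divide)
    have "(\<Sum>i<b. (g i)\<^sup>2) = k * n" unfolding n_def gk by (rule sum_distrib_left[symmetric])
    also have "\<dots> = (1 - u) / 2" using n0 by (simp add: k_def)
    also have "\<dots> = 1/2 - u / 2" by (rule diff_divide_distrib)
    finally show ?thesis .
  qed
  also have "2 * b * u\<^sup>2 = u" using b by (simp add: u_def power2_eq_square)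
  finally show "(\<Sum>i<2 * b. (block_coeff b h i)\<^sup>2) = 1" by simp
qed

lemma block_coeff_measurable: "(\<lambda>h. block_coeff b h i) \<in> borel_measurable (stdg {..<b})" if "i < 2 * b"
proof (cases "i < b")
  case True
  have [measurable]: "(\<lambda>h. h k) \<in> borel_measurable (stdg {..<b})" if "k < b" for k using that by (rule coord_measurable)
  have n: "(\<lambda>h. sqrt (\<Sum>i<b. (h i)\<^sup>2)) \<in> borel_measurable (stdg {..<b})"
    by (intro measurable_compose[OF _ borel_measurable_sqrt] borel_measurable_sum borel_measurable_power coord_measurable) simp
  show ?thesis unfolding block_coeff_def using True n coord_measurable[OF True]
    by (simp add: borel_measurable_divide borel_measurable_times)
next
  case False
  have n: "(\<lambda>h. sqrt (\<Sum>i<b. (h i)\<^sup>2)) \<in> borel_measurable (stdg {..<b})"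
    by (intro measurable_compose[OF _ borel_measurable_sqrt] borel_measurable_sum borel_measurable_power coord_measurable) simp
  have "i - b < b" using False that by simp
  from coord_measurable[OF this] show ?thesis unfolding block_coeff_def using False n
    by (simp add: borel_measurable_divide borel_measurable_times)
qed

lemma block_law_map_measurable_pair:
  "(\<lambda>(X, h). \<lambda>j\<in>{..<d}. \<Sum>i<2 * b. block_coeff b h i * X i j) \<in> PiM {..<2 * b} (\<lambda>_. lborel_dim d) \<Otimes>\<^sub>M stdg {..<b} \<rightarrow>\<^sub>M lborel_dim d"
  unfolding lborel_dim_eq split_def
proof (rule measurable_restrict)
  fix j assume j: "j \<in> {..<d}"
  have e: "(\<lambda>x. fst x i j) \<in> borel_measurable (PiM {..<2 * b} (\<lambda>_. leb {..<d}) \<Otimes>\<^sub>M stdg {..<b})" if i: "i < 2 * b" for i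
    using measurable_compose[OF measurable_fst measurable_component2[of i "{..<2*b}" j "{..<d}" "\<lambda>_. lborel"]] i j by simp
  have h: "(\<lambda>x. block_coeff b (snd x) i) \<in> borel_measurable (PiM {..<2 * b} (\<lambda>_. leb {..<d}) \<Otimes>\<^sub>M stdg {..<b})" if i: "i < 2 * b" for i
    by (rule measurable_compose[OF measurable_snd block_coeff_measurable[OF i]])
  have "(\<lambda>x. \<Sum>i<2 * b. block_coeff b (snd x) i * fst x i j) \<in> borel_measurable (PiM {..<2 * b} (\<lambda>_. leb {..<d}) \<Otimes>\<^sub>M stdg {..<b})"
    by (intro borel_measurable_sum borel_measurable_times e h) auto
  then show "(\<lambda>x. \<Sum>i<2 * b. block_coeff b (snd x) i * fst x i j) \<in> PiM {..<2 * b} (\<lambda>_. leb {..<d}) \<Otimes>\<^sub>M stdg {..<b} \<rightarrow>\<^sub>M lborel"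
    by simp
qed

lemma block_law_map_measurable:
  "(\<lambda>h. \<lambda>j\<in>{..<d}. \<Sum>i<2 * b. block_coeff b h i * X i j) \<in> stdg {..<b} \<rightarrow>\<^sub>M lborel_dim d"
  unfolding lborel_dim_eq
proof (rule measurable_restrict)
  fix j
  have "(\<lambda>h. \<Sum>i<2 * b. block_coeff b h i * X i j) \<in> borel_measurable (stdg {..<b})"
    by (intro borel_measurable_sum borel_measurable_times block_coeff_measurable borel_measurable_const) auto
  then show "(\<lambda>h. \<Sum>i<2 * b. block_coeff b h i * X i j) \<in> stdg {..<b} \<rightarrow>\<^sub>M lborel" by simp
qed

lemma block_law_measurable: "block_law b d \<in> PiM {..<2 * b} (\<lambda>_. lborel_dim d) \<rightarrow>\<^sub>M prob_algebra (lborel_dim d)"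
proof -
  have "(\<lambda>X. distr (stdg {..<b}) (lborel_dim d) (\<lambda>h. \<lambda>j\<in>{..<d}. \<Sum>i<2 * b. block_coeff b h i * X i j)) \<in>
    PiM {..<2 * b} (\<lambda>_. lborel_dim d) \<rightarrow>\<^sub>M prob_algebra (lborel_dim d)"
    by (rule measurable_distr_prob_space2[where M = "stdg {..<b}"])
      (use block_law_map_measurable_pair in \<open>auto intro!: measurable_const simp: space_prob_algebra\<close>)
  then show ?thesis by (simp add: block_law_def[abs_def])
qed

lemma AE_sum_squares_nonzero:
  fixes b :: nat assumes b: "b > 0"
  shows "AE h in stdg {..<b}. (\<Sum>i<b. (h i)\<^sup>2) \<noteq> 0"
proof -
  have "AE h in stdg {..<b}. h 0 \<noteq> 0"
    using b by (intro AE_PiM_component[where P = "\<lambda>x. x \<noteq> 0"] AE_std_normal_neq) auto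
  then show ?thesis
  proof eventually_elim
    case (elim h)
    have "(h 0)\<^sup>2 \<le> (\<Sum>i<b. (h i)\<^sup>2)" using b by (intro member_le_sum) auto
    then show ?case using elim by auto
  qed
qed

text \<open>On affine images of standard Gaussian data the block kernel is exact on average, because its
  coefficients satisfy \<open>\<Sum> a = \<Sum> a\<^sup>2 = 1\<close>.\<close>

lemma block_law_affine:
  assumes b: "b > 0"
  shows "emeasure (block_law b d (\<lambda>i\<in>{..<2*b}. affine_map d m a (X i))) A =
    emeasure (distr (block_law b d X) (lborel_dim d) (affine_map d m a)) A"
proof (cases "A \<in> sets (lborel_dim d)")
  case False
  then show ?thesis by (simp add: block_law_def emeasure_notin_sets)
next
  case A: True
  have am: "affine_map d m a \<in> lborel_dim d \<rightarrow>\<^sub>M lborel_dim d" by (simp add: lborel_dim_eq affine_map_measurable)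
  let ?F = "\<lambda>X h. \<lambda>j\<in>{..<d}. \<Sum>i<2 * b. block_coeff b h i * X i j"
  have "emeasure (distr (block_law b d X) (lborel_dim d) (affine_map d m a)) A =
    emeasure (distr (stdg {..<b}) (lborel_dim d) (affine_map d m a \<circ> ?F X)) A"
    unfolding block_law_def by (subst distr_distr[OF am block_law_map_measurable]) simp
  also have "\<dots> = emeasure (distr (stdg {..<b}) (lborel_dim d) (?F (\<lambda>i\<in>{..<2*b}. affine_map d m a (X i)))) A"
  proof (rule arg_cong2[where f = emeasure, OF _ refl], rule distr_cong_AE[OF refl refl])
    show "AE h in stdg {..<b}. (affine_map d m a \<circ> ?F X) h = ?F (\<lambda>i\<in>{..<2*b}. affine_map d m a (X i)) h"
      using AE_sum_squares_nonzero[OF b]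
    proof eventually_elim
      case (elim h)
      show ?case
      proof
        fix j
        show "(affine_map d m a \<circ> ?F X) h j = ?F (\<lambda>i\<in>{..<2*b}. affine_map d m a (X i)) h j"
        proof (cases "j < d")
          case True
          have "?F (\<lambda>i\<in>{..<2*b}. affine_map d m a (X i)) h j = (\<Sum>i<2 * b. block_coeff b h i * (m j + (\<Sum>k<d. a j k * X i k)))"
            using True by (simp add: affine_map_def)
          also have "\<dots> = (\<Sum>i<2 * b. block_coeff b h i) * m j + (\<Sum>i<2 * b. \<Sum>k<d. a j k * (block_coeff b h i * X i k))"
            by (simp add: distrib_left sum.distrib sum_distrib_right sum_distrib_left mult_ac)
          also have "(\<Sum>i<2 * b. \<Sum>k<d. a j k * (block_coeff b h i * X i k)) = (\<Sum>k<d. \<Sum>i<2 * b. a j k * (block_coeff b h i * X i k))"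
            by (rule sum.swap)
          also have "\<dots> = (\<Sum>k<d. a j k * (\<Sum>i<2 * b. block_coeff b h i * X i k))" by (simp add: sum_distrib_left)
          finally show ?thesis using True block_coeff_sums(1)[OF b elim] by (simp add: affine_map_def)
        qed (simp add: affine_map_def)
      qed
    qed
  qed (use am block_law_map_measurable in \<open>auto intro: measurable_comp\<close>)
  finally show ?thesis by (simp add: block_law_def)
qed

text \<open>By Fubini h may be fixed; the output is then a unit combination of independent Gaussian
  vectors. The null event h = 0 is excluded, as the squares would sum to 1 / (2 b) there.\<close>

lemma block_law_exact_std:
  assumes b: "b > 0" and A: "A \<in> sets (lborel_dim d)"
  shows "(\<integral>\<^sup>+X. emeasure (block_law b d X) A \<partial>stdmat (2 * b) d) = emeasure (stdg {..<d}) A"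
proof -
  let ?F = "\<lambda>X h. \<lambda>j\<in>{..<d}. \<Sum>i<2 * b. block_coeff b h i * X i j"
  interpret P: pair_sigma_finite "stdmat (2 * b) d" "stdg {..<b}"
    unfolding pair_sigma_finite_def by (intro conjI prob_space_imp_sigma_finite) (rule prob_space_stdmat, rule prob_space_stdg)
  have A': "A \<in> sets (stdg {..<d})" using A by (simp add: sets_stdg lborel_dim_eq)
  have ss: "sets (stdmat (2 * b) d) = sets (PiM {..<2 * b} (\<lambda>_. lborel_dim d))"
    by (intro sets_PiM_cong) (auto simp: sets_stdg lborel_dim_eq)
  have Fm: "(\<lambda>(X, h). ?F X h) \<in> stdmat (2 * b) d \<Otimes>\<^sub>M stdg {..<b} \<rightarrow>\<^sub>M lborel_dim d"
  proof -
    have "(stdmat (2 * b) d \<Otimes>\<^sub>M stdg {..<b} \<rightarrow>\<^sub>M lborel_dim d) = (PiM {..<2 * b} (\<lambda>_. lborel_dim d) \<Otimes>\<^sub>M stdg {..<b} \<rightarrow>\<^sub>M lborel_dim d)"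
      by (intro measurable_cong_sets sets_pair_measure_cong ss refl)
    then show ?thesis by (rule ssubst) (rule block_law_map_measurable_pair)
  qed
  have em: "emeasure (block_law b d X) A = (\<integral>\<^sup>+h. indicator A (?F X h) \<partial>stdg {..<b})" for X
  proof -
    have "emeasure (block_law b d X) A = (\<integral>\<^sup>+w. indicator A w \<partial>block_law b d X)" using A by (simp add: block_law_def)
    also have "\<dots> = (\<integral>\<^sup>+h. indicator A (?F X h) \<partial>stdg {..<b})"
      unfolding block_law_def using A by (intro nn_integral_distr block_law_map_measurable) simp
    finally show ?thesis .
  qed
  have Im: "(\<lambda>(X, h). indicator A (?F X h) :: ennreal) \<in> borel_measurable (stdmat (2 * b) d \<Otimes>\<^sub>M stdg {..<b})"
    using measurable_compose[OF Fm borel_measurable_indicator[OF A]] by (simp add: split_def)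
  have "(\<integral>\<^sup>+X. emeasure (block_law b d X) A \<partial>stdmat (2 * b) d) = (\<integral>\<^sup>+h. (\<integral>\<^sup>+X. indicator A (?F X h) \<partial>stdmat (2 * b) d) \<partial>stdg {..<b})"
    unfolding em by (rule P.Fubini'[symmetric, OF Im])
  also have "\<dots> = (\<integral>\<^sup>+h. emeasure (stdg {..<d}) A \<partial>stdg {..<b})"
  proof (rule nn_integral_cong_AE)
    show "AE h in stdg {..<b}. (\<integral>\<^sup>+X. indicator A (?F X h) \<partial>stdmat (2 * b) d) = emeasure (stdg {..<d}) A"
      using AE_sum_squares_nonzero[OF b] AE_space
    proof eventually_elim
      case (elim h)
      have Fh: "(\<lambda>X. ?F X h) \<in> stdmat (2 * b) d \<rightarrow>\<^sub>M stdg {..<d}"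
      proof -
        have 1: "(\<lambda>X. ?F X h) \<in> stdmat (2 * b) d \<rightarrow>\<^sub>M lborel_dim d"
          using measurable_compose[OF measurable_Pair2'[OF elim(2)] Fm] by (simp only: split_conv)
        have "(stdmat (2 * b) d \<rightarrow>\<^sub>M stdg {..<d}) = (stdmat (2 * b) d \<rightarrow>\<^sub>M lborel_dim d)"
          by (intro measurable_cong_sets refl) (simp add: sets_stdg lborel_dim_eq)
        then show ?thesis by (rule ssubst) (rule 1)
      qed
      have "(\<integral>\<^sup>+X. indicator A (?F X h) \<partial>stdmat (2 * b) d) = (\<integral>\<^sup>+w. indicator A w \<partial>distr (stdmat (2 * b) d) (stdg {..<d}) (\<lambda>X. ?F X h))"
        using A' by (intro nn_integral_distr[symmetric] Fh) simp
      also have "distr (stdmat (2 * b) d) (stdg {..<d}) (\<lambda>X. ?F X h) = stdg {..<d}"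
        using block_coeff_sums(2)[OF b elim(1)] by (intro unit_comb_stdg) auto
      finally show ?case unfolding nn_integral_indicator[OF A'] .
    qed
  qed
  also have "\<dots> = emeasure (stdg {..<d}) A"
    using prob_space.emeasure_space_1[OF prob_space_stdg[of "{..<b}"]] by simp
  finally show ?thesis .
qed

section \<open>Block mean and paired differences; typical blocks\<close>

definition half_diff :: "nat \<Rightarrow> nat \<Rightarrow> (nat \<Rightarrow> nat \<Rightarrow> real) \<Rightarrow> nat \<Rightarrow> nat \<Rightarrow> real" where
  "half_diff b d X = (\<lambda>i\<in>{..<b}. \<lambda>j\<in>{..<d}. (X i j - X (b + i) j) / sqrt 2)"

definition block_mean :: "nat \<Rightarrow> (nat \<Rightarrow> nat \<Rightarrow> real) \<Rightarrow> nat \<Rightarrow> real" where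
  "block_mean b X j = (\<Sum>i<2 * b. X i j) / (2 * b)"

lemma block_coeff_combination:
  assumes j: "j < d"
  shows "(\<Sum>i<2 * b. block_coeff b h i * X i j) = block_mean b X j + sqrt (1 - 1 / (2 * b)) * sphere_proj b d (half_diff b d X) h j"
proof -
  define u where "u = 1 / (2 * real b)"
  define g where "g i = sqrt (1 - u) / sqrt 2 * h i / sqrt (\<Sum>i<b. (h i)\<^sup>2)" for i
  have 1: "block_coeff b h i = u + g i" "block_coeff b h (b + i) = u - g i" if "i < b" for i
    using that by (auto simp: block_coeff_def u_def g_def)
  have "(\<Sum>i<2 * b. block_coeff b h i * X i j) = (\<Sum>i<b. (u + g i) * X i j) + (\<Sum>i<b. (u - g i) * X (b + i) j)"
    unfolding sum_double by (intro arg_cong2[where f = "(+)"] sum.cong refl) (auto simp: 1)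
  also have "\<dots> = u * ((\<Sum>i<b. X i j) + (\<Sum>i<b. X (b + i) j)) + (\<Sum>i<b. g i * (X i j - X (b + i) j))"
    by (simp add: distrib_right left_diff_distrib right_diff_distrib sum.distrib sum_subtractf distrib_left sum_distrib_left)
  also have "(\<Sum>i<b. X i j) + (\<Sum>i<b. X (b + i) j) = (\<Sum>i<2 * b. X i j)" by (rule sum_double[symmetric])
  also have "(\<Sum>i<b. g i * (X i j - X (b + i) j)) = sqrt (1 - u) * sphere_proj b d (half_diff b d X) h j"
    using j by (simp add: sphere_proj_def half_diff_def g_def sum_divide_distrib sum_distrib_left mult_ac)
  finally show ?thesis by (simp add: block_mean_def u_def)
qed

lemma half_diff_measurable: "half_diff b d \<in> stdmat (2 * b) d \<rightarrow>\<^sub>M stdmat b d"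
  unfolding half_diff_def[abs_def]
proof (rule measurable_restrict, rule measurable_restrict)
  fix i j assume "i \<in> {..<b}" "j \<in> {..<d}"
  then have "(\<lambda>X. X i j) \<in> borel_measurable (stdmat (2 * b) d)" "(\<lambda>X. X (b + i) j) \<in> borel_measurable (stdmat (2 * b) d)"
    by (auto intro!: stdmat_entry_measurable)
  then show "(\<lambda>X. (X i j - X (b + i) j) / sqrt 2) \<in> stdmat (2 * b) d \<rightarrow>\<^sub>M std_normal_distribution" by simp
qed

lemma half_diff_distr: "distr (stdmat (2 * b) d) (stdmat b d) (half_diff b d) = stdmat b d"
proof -
  define f where "f i X = (\<lambda>j\<in>{..<d}. (X i j - X (b + i) j) / sqrt 2)" for i and X :: "nat \<Rightarrow> nat \<Rightarrow> real"
  define G where "G i = {i, b + i}" for i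
  have df: "distr (PiM (G i) (\<lambda>_. stdg {..<d})) (stdg {..<d}) (f i) = stdg {..<d}" if i: "i < b" for i
  proof -
    define a where "a k = (if k = i then 1 else -1) / sqrt 2" for k
    have ne: "b + i \<noteq> i" using i by simp
    have "distr (PiM (G i) (\<lambda>_. stdg {..<d})) (stdg {..<d}) (\<lambda>X. \<lambda>j\<in>{..<d}. \<Sum>k\<in>G i. a k * X k j) = stdg {..<d}"
      using ne by (intro unit_comb_stdg) (auto simp: G_def a_def power_divide)
    moreover have "(\<lambda>X. \<lambda>j\<in>{..<d}. \<Sum>k\<in>G i. a k * X k j) = f i"
      using ne by (auto simp: fun_eq_iff f_def G_def a_def diff_divide_distrib)
    ultimately show ?thesis by simp
  qed
  have fm: "f i \<in> PiM (G i) (\<lambda>_. stdg {..<d}) \<rightarrow>\<^sub>M stdg {..<d}" for i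
    unfolding f_def[abs_def]
  proof (rule measurable_restrict)
    fix j assume j: "j \<in> {..<d}"
    have "(\<lambda>X. X k j) \<in> borel_measurable (PiM (G i) (\<lambda>_. stdg {..<d}))" if "k \<in> G i" for k
      using measurable_component2[OF that j, of "\<lambda>_. std_normal_distribution"] by simp
    from this[of i] this[of "b + i"]
    show "(\<lambda>X. (X i j - X (b + i) j) / sqrt 2) \<in> PiM (G i) (\<lambda>_. stdg {..<d}) \<rightarrow>\<^sub>M std_normal_distribution"
      by (simp add: G_def)
  qed
  have "half_diff b d = (\<lambda>X. \<lambda>i\<in>{..<b}. f i (restrict X (G i)))"
    by (auto simp: fun_eq_iff half_diff_def f_def G_def restrict_def)
  then have "distr (stdmat (2 * b) d) (stdmat b d) (half_diff b d) =
    distr (stdmat (2 * b) d) (stdmat b d) (\<lambda>X. \<lambda>i\<in>{..<b}. f i (restrict X (G i)))" by simp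
  also have "\<dots> = PiM {..<b} (\<lambda>i. distr (PiM (G i) (\<lambda>_. stdg {..<d})) (stdg {..<d}) (f i))"
    by (rule distr_PiM_groups[where N = "\<lambda>_. stdg {..<d}"]) (auto simp: G_def disjoint_family_on_def intro: fm[unfolded G_def])
  also have "\<dots> = stdmat b d" by (intro PiM_cong refl) (simp add: df)
  finally show ?thesis .
qed

text \<open>sqrt (2 b) times the mean is a unit combination of the points, hence standard
  Gaussian.\<close>

lemma block_mean_tail:
  fixes b d :: nat and L :: real
  assumes b: "b > 0"
  shows "emeasure (stdmat (2 * b) d) {X \<in> space (stdmat (2 * b) d). sqn d (block_mean b X) > d * L / (2 * b)} \<le> ennreal (2 * d * exp (- L / 4))"
    and "{X \<in> space (stdmat (2 * b) d). sqn d (block_mean b X) > d * L / (2 * b)} \<in> sets (stdmat (2 * b) d)"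
proof -
  define a where "a = 1 / sqrt (2 * real b)"
  have a2: "a\<^sup>2 = 1 / (2 * b)" using b by (simp add: a_def power_divide)
  let ?F = "\<lambda>X. \<lambda>j\<in>{..<d}. \<Sum>i\<in>{..<2*b}. a * X i j"
  have D: "distr (stdmat (2 * b) d) (stdg {..<d}) ?F = stdg {..<d}"
    using b by (intro unit_comb_stdg[where a = "\<lambda>_. a"]) (auto simp: a2)
  have Fm: "?F \<in> stdmat (2 * b) d \<rightarrow>\<^sub>M stdg {..<d}"
  proof (rule measurable_restrict)
    fix j assume j: "j \<in> {..<d}"
    have "(\<lambda>X. \<Sum>i\<in>{..<2*b}. a * X i j) \<in> borel_measurable (stdmat (2 * b) d)"
      using j by (intro borel_measurable_sum borel_measurable_times borel_measurable_const stdmat_entry_measurable) auto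
    then show "(\<lambda>X. \<Sum>i\<in>{..<2*b}. a * X i j) \<in> stdmat (2 * b) d \<rightarrow>\<^sub>M std_normal_distribution" by simp
  qed
  have s: "sqn d (?F X) = 2 * b * sqn d (block_mean b X)" for X
  proof -
    have k: "a * x = sqrt (2 * b) * (x / (2 * b))" for x using b by (simp add: a_def real_div_sqrt field_simps)
    have "(\<Sum>i\<in>{..<2*b}. a * X i j) = sqrt (2 * b) * block_mean b X j" for j
      unfolding block_mean_def sum_divide_distrib sum_distrib_left by (intro sum.cong refl) (simp add: k)
    then have "sqn d (?F X) = (\<Sum>j<d. (sqrt (2 * b) * block_mean b X j)\<^sup>2)" unfolding sqn_def by (intro sum.cong refl) simp
    also have "\<dots> = 2 * b * sqn d (block_mean b X)" by (simp add: power_mult_distrib sqn_def sum_distrib_left)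
    finally show ?thesis .
  qed
  define E where "E = {w \<in> space (stdg {..<d}). (\<Sum>j<d. (w j)\<^sup>2) > d * L}"
  have Em: "E \<in> sets (stdg {..<d})" unfolding E_def sqn_def[symmetric] by measurable
  have eq: "{X \<in> space (stdmat (2 * b) d). sqn d (block_mean b X) > d * L / (2 * b)} = ?F -` E \<inter> space (stdmat (2 * b) d)"
  proof -
    have "sqn d (?F X) > d * L \<longleftrightarrow> sqn d (block_mean b X) > d * L / (2 * b)" for X
      unfolding s using b by (simp add: pos_divide_less_eq mult.commute)
    then show ?thesis using measurable_space[OF Fm] by (auto simp: E_def sqn_def[symmetric])
  qed
  show "{X \<in> space (stdmat (2 * b) d). sqn d (block_mean b X) > d * L / (2 * b)} \<in> sets (stdmat (2 * b) d)"
    unfolding eq by (rule measurable_sets[OF Fm Em])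
  have "emeasure (stdmat (2 * b) d) {X \<in> space (stdmat (2 * b) d). sqn d (block_mean b X) > d * L / (2 * b)} = emeasure (stdg {..<d}) E"
    unfolding eq using emeasure_distr[OF Fm Em] D by simp
  then show "emeasure (stdmat (2 * b) d) {X \<in> space (stdmat (2 * b) d). sqn d (block_mean b X) > d * L / (2 * b)} \<le> ennreal (2 * d * exp (- L / 4))"
    using stdg_norm_tail[of d L] by (simp add: E_def)
qed

context gaussian_block
begin

definition good_block :: "real \<Rightarrow> (nat \<Rightarrow> nat \<Rightarrow> real) set" where
  "good_block \<tau> = {X \<in> space (stdmat (2 * b) d). half_diff b d X \<in> good_cloud \<tau> \<and> \<not> sqn d (block_mean b X) > d * L / (2 * b)}"

lemma good_block_sets: "good_block \<tau> \<in> sets (stdmat (2 * b) d)"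
proof -
  have "good_block \<tau> = (half_diff b d -` good_cloud \<tau> \<inter> space (stdmat (2 * b) d)) - {X \<in> space (stdmat (2 * b) d). sqn d (block_mean b X) > d * L / (2 * b)}"
    by (auto simp: good_block_def)
  also have "\<dots> \<in> sets (stdmat (2 * b) d)"
    by (intro sets.Diff measurable_sets[OF half_diff_measurable good_cloud_sets] block_mean_tail b_pos)
  finally show ?thesis .
qed

lemma good_block_prob:
  assumes t: "\<tau> > 0" "\<tau> \<le> 1"
  shows "emeasure (stdmat (2 * b) d) (space (stdmat (2 * b) d) - good_block \<tau>) \<le> ennreal (21 * (real d)\<^sup>2 * exp (- L / 8) / \<tau>)"
proof -
  define E where "E = {X \<in> space (stdmat (2 * b) d). sqn d (block_mean b X) > d * L / (2 * b)}"
  define B where "B = half_diff b d -` (space (stdmat b d) - good_cloud \<tau>) \<inter> space (stdmat (2 * b) d)"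
  have Em: "E \<in> sets (stdmat (2 * b) d)" unfolding E_def by (rule block_mean_tail(2)[OF b_pos])
  have cm: "space (stdmat b d) - good_cloud \<tau> \<in> sets (stdmat b d)" using good_cloud_sets by auto
  have Bm: "B \<in> sets (stdmat (2 * b) d)" unfolding B_def by (rule measurable_sets[OF half_diff_measurable cm])
  have "space (stdmat (2 * b) d) - good_block \<tau> \<subseteq> B \<union> E"
    using measurable_space[OF half_diff_measurable] by (auto simp: good_block_def B_def E_def)
  then have "emeasure (stdmat (2 * b) d) (space (stdmat (2 * b) d) - good_block \<tau>) \<le> emeasure (stdmat (2 * b) d) (B \<union> E)"
    using Em Bm by (intro emeasure_mono) auto
  also have "\<dots> \<le> emeasure (stdmat (2 * b) d) B + emeasure (stdmat (2 * b) d) E"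
    using Em Bm by (rule emeasure_subadditive[rotated])
  also have "emeasure (stdmat (2 * b) d) B = emeasure (stdmat b d) (space (stdmat b d) - good_cloud \<tau>)"
    unfolding B_def emeasure_distr[OF half_diff_measurable cm, symmetric] half_diff_distr ..
  also have "\<dots> + emeasure (stdmat (2 * b) d) E \<le> ennreal (19 * (real d)\<^sup>2 * exp (- L / 8) / \<tau>) + ennreal (2 * d * exp (- L / 4))"
    unfolding E_def by (intro add_mono good_cloud_prob block_mean_tail b_pos t)
  also have "\<dots> = ennreal (19 * (real d)\<^sup>2 * exp (- L / 8) / \<tau> + 2 * d * exp (- L / 4))"
    using t by (intro ennreal_plus[symmetric]) auto
  also have "\<dots> \<le> ennreal (21 * (real d)\<^sup>2 * exp (- L / 8) / \<tau>)"
  proof (rule ennreal_leI)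
    have "real d \<le> (real d)\<^sup>2" using d by (simp add: power2_eq_square)
    then have "2 * d * exp (- L / 4) \<le> 2 * (real d)\<^sup>2 * exp (- L / 8)" using exp_quarter_le by (intro mult_mono) auto
    also have "\<dots> \<le> 2 * (real d)\<^sup>2 * exp (- L / 8) / \<tau>" using t by (simp add: le_divide_eq mult_left_le)
    finally show "19 * (real d)\<^sup>2 * exp (- L / 8) / \<tau> + 2 * d * exp (- L / 4) \<le> 21 * (real d)\<^sup>2 * exp (- L / 8) / \<tau>"
      by (simp add: add_divide_distrib[symmetric])
  qed
  finally show ?thesis .
qed

text \<open>R does not depend on X, so two typical blocks can be compared through it. Pulling the
  factor s = sqrt (1 - 1 / (2 b)) out of the whole output exhibits the block law as the sphere law
  shifted by \<nu> = mean / s and then scaled, and the two comparisons of the previous part are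
  chained.\<close>

lemma block_law_close_ref:
  assumes X: "X \<in> good_block \<tau>" and t: "\<tau> > 0" "\<tau> \<le> 1/100" "2 * d * exp (- L / 16) \<le> \<tau>" and A: "A \<in> sets (leb {..<d})"
  defines "R \<equiv> distr (stdg {..<d}) (leb {..<d}) (\<lambda>w. \<lambda>j\<in>{..<d}. sqrt (1 - 1 / (2 * b)) * w j)"
  shows "emeasure (block_law b d X) A \<le> ennreal (4 * exp 6) * emeasure R A + ennreal (1000 * \<tau>)"
    and "emeasure R A \<le> ennreal (4 * exp 6) * emeasure (block_law b d X) A + ennreal (1000 * \<tau>)"
proof -
  define s where "s = sqrt (1 - 1 / real (2 * b))"
  have sd: "sqrt (1 - 1 / (2 * real b)) = s" by (simp add: s_def)
  have b1: "real b \<ge> 1" using b_pos by simp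
  have s2: "s\<^sup>2 \<ge> 1/2" "s > 0" using b1 by (auto simp: s_def field_simps)
  define \<nu> where "\<nu> j = block_mean b X j / s" for j
  have nu: "sqn d \<nu> \<le> 1 / (4 * (d * L))"
  proof -
    have "sqn d \<nu> = sqn d (block_mean b X) / s\<^sup>2" by (simp add: sqn_def \<nu>_def power_divide sum_divide_distrib)
    also have "\<dots> \<le> (d * L / (2 * b)) / (1/2)" using X s2 L by (intro frac_le) (auto simp: good_block_def)
    also have "\<dots> = d * L / b" by simp
    also have "\<dots> \<le> 1 / (4 * (d * L))"
    proof -
      have "4 * (real d * L) * (d * L) * 1 \<le> 4 * (real d * L) * (d * L) * L" using L by (intro mult_left_mono) auto
      also have "\<dots> = 4 * (real d)\<^sup>2 * L ^ 3" by (simp add: power2_eq_square power3_eq_cube)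
      also note bL
      finally show ?thesis using dL_ge d L b_pos by (simp add: field_simps)
    qed
    finally show ?thesis .
  qed
  have sc: "(\<lambda>w. \<lambda>j\<in>{..<d}. s * w j) \<in> leb {..<d} \<rightarrow>\<^sub>M leb {..<d}" by measurable
  have sh: "(\<lambda>w. \<lambda>j\<in>{..<d}. w j + \<nu> j) \<in> leb {..<d} \<rightarrow>\<^sub>M leb {..<d}" by measurable
  have id: "g \<in> stdg {..<d} \<rightarrow>\<^sub>M leb {..<d}" if "g \<in> leb {..<d} \<rightarrow>\<^sub>M leb {..<d}" for g
    using that measurable_cong_sets[OF sets_stdg[of "{..<d}"] refl] by blast
  define A1 where "A1 = (\<lambda>w. \<lambda>j\<in>{..<d}. s * w j) -` A \<inter> space (leb {..<d})"
  define A2 where "A2 = (\<lambda>w. \<lambda>j\<in>{..<d}. w j + \<nu> j) -` A1 \<inter> space (leb {..<d})"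
  have A1: "A1 \<in> sets (leb {..<d})" unfolding A1_def by (rule measurable_sets[OF sc A])
  have A2: "A2 \<in> sets (leb {..<d})" unfolding A2_def by (rule measurable_sets[OF sh A1])
  have eR: "emeasure R A = emeasure (stdg {..<d}) A1"
    unfolding R_def s_def[symmetric] A1_def by (subst emeasure_distr[OF id[OF sc] A]) (simp add: space_stdg)
  define S where "S = distr (stdg {..<d}) (leb {..<d}) (\<lambda>w. \<lambda>j\<in>{..<d}. w j + \<nu> j)"
  have eS: "emeasure S A1 = emeasure (stdg {..<d}) A2"
    unfolding S_def A2_def by (subst emeasure_distr[OF id[OF sh] A1]) (simp add: space_stdg)
  have eB: "emeasure (block_law b d X) A = emeasure (sphere_law b d (half_diff b d X)) A2"
  proof -
    have cm: "(\<lambda>w. \<lambda>j\<in>{..<d}. s * (w j + \<nu> j)) \<in> leb {..<d} \<rightarrow>\<^sub>M leb {..<d}" by measurable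
    have f: "(\<lambda>h. \<lambda>j\<in>{..<d}. \<Sum>i<2 * b. block_coeff b h i * X i j) = (\<lambda>w. \<lambda>j\<in>{..<d}. s * (w j + \<nu> j)) \<circ> sphere_proj b d (half_diff b d X)"
      using s2 by (auto simp: fun_eq_iff restrict_def block_coeff_combination sd \<nu>_def distrib_left)
    have "block_law b d X = distr (sphere_law b d (half_diff b d X)) (leb {..<d}) (\<lambda>w. \<lambda>j\<in>{..<d}. s * (w j + \<nu> j))"
      unfolding block_law_def sphere_law_def lborel_dim_eq f by (rule distr_distr[OF cm sphere_proj_measurable, symmetric])
    then have "emeasure (block_law b d X) A = emeasure (sphere_law b d (half_diff b d X)) ((\<lambda>w. \<lambda>j\<in>{..<d}. s * (w j + \<nu> j)) -` A \<inter> space (leb {..<d}))"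
      using emeasure_distr[of "\<lambda>w. \<lambda>j\<in>{..<d}. s * (w j + \<nu> j)" "sphere_law b d (half_diff b d X)" "leb {..<d}" A] A cm by (simp add: sphere_law_def)
    also have "(\<lambda>w. \<lambda>j\<in>{..<d}. s * (w j + \<nu> j)) -` A \<inter> space (leb {..<d}) = A2"
    proof -
      have "(\<lambda>j\<in>{..<d}. s * (\<lambda>j\<in>{..<d}. x j + \<nu> j) j) = (\<lambda>j\<in>{..<d}. s * (x j + \<nu> j))" for x by (rule restrict_ext) simp
      moreover have "(\<lambda>j\<in>{..<d}. x j + \<nu> j) \<in> space (leb {..<d})" for x by (simp add: space_PiM)
      ultimately show ?thesis unfolding A2_def A1_def vimage_def by simp
    qed
    finally show ?thesis .
  qed
  have Zg: "half_diff b d X \<in> good_cloud \<tau>" using X by (simp add: good_block_def)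
  have t': "\<tau> \<le> 1/2" using t by simp
  note P = sphere_law_close[OF Zg t(1,2) A2, folded eB]
  note Q = shift_close[OF nu t(3) t' A1, folded S_def, unfolded eS, folded eR]
  have c: "2 * exp 4 * (2 * exp 2) = 4 * exp (6::real)" by (simp add: mult_exp_exp)
  \<comment> \<open>The factors multiply to 2 exp 4 * 2 exp 2. The additive errors are at most 110
    \<tau> + 42 \<tau> in one direction and 15 * 42 \<tau> + \<tau> in the other; 1000 \<tau> covers
    both.\<close>
  have chain: "x \<le> ennreal (4 * exp 6) * z + ennreal (1000 * \<tau>)"
    if 1: "x \<le> ennreal p * y + ennreal \<sigma>" and 2: "y \<le> ennreal q * z + ennreal \<sigma>'" and pq: "p * q = 4 * exp 6" "p \<ge> 0" "q \<ge> 0"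
      and small: "p * \<sigma>' + \<sigma> \<le> 1000 * \<tau>" "\<sigma> \<ge> 0" "\<sigma>' \<ge> 0" for x y z p q \<sigma> \<sigma>'
  proof -
    have "x \<le> ennreal p * (ennreal q * z + ennreal \<sigma>') + ennreal \<sigma>"
      by (rule order_trans[OF 1]) (intro add_right_mono mult_left_mono 2, simp)
    also have "\<dots> = ennreal (4 * exp 6) * z + ennreal (p * \<sigma>' + \<sigma>)"
      using pq small by (simp add: distrib_left mult.assoc[symmetric] ennreal_mult'[symmetric] ennreal_plus add.assoc)
    also have "\<dots> \<le> ennreal (4 * exp 6) * z + ennreal (1000 * \<tau>)" by (intro add_left_mono ennreal_leI small)
    finally show ?thesis .
  qed
  show "emeasure (block_law b d X) A \<le> ennreal (4 * exp 6) * emeasure R A + ennreal (1000 * \<tau>)"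
  proof (rule chain[OF P(1) Q(1)])
  qed (use c t exp_bounds mult_right_mono[OF exp_bounds(3), of \<tau>] in auto)
  show "emeasure R A \<le> ennreal (4 * exp 6) * emeasure (block_law b d X) A + ennreal (1000 * \<tau>)"
  proof (rule chain[OF Q(2) P(2)])
  qed (use c t exp_bounds mult_right_mono[OF exp_bounds(4), of \<tau>] in \<open>auto simp: mult_ac\<close>)
qed

end

section \<open>Inequalities tested on a countable algebra\<close>

text \<open>Unions of atoms of \<open>B 0, \<dots>, B (n - 1)\<close> form a countable algebra. Inequalities between kernels are
  tested on it, as measurability needs countably many conditions; approximation extends them to all of \<open>sets M\<close>.\<close>

definition test_set :: "'a measure \<Rightarrow> (nat \<Rightarrow> 'a set) \<Rightarrow> nat \<Rightarrow> nat set set \<Rightarrow> 'a set" where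
  "test_set M B n T = {x \<in> space M. {i. i < n \<and> x \<in> B i} \<in> T}"

definition test_sets :: "'a measure \<Rightarrow> (nat \<Rightarrow> 'a set) \<Rightarrow> 'a set set" where
  "test_sets M B = (\<Union>n. test_set M B n ` Pow (Pow {..<n}))"

lemma countable_test_sets: "countable (test_sets M B)"
  unfolding test_sets_def
  by (intro countable_UN countable_image) (auto intro!: countable_finite)

lemma test_set_lift:
  assumes "n \<le> m" shows "test_set M B n T = test_set M B m {J. {i\<in>J. i < n} \<in> T}"
proof -
  have "{i \<in> {i. i < m \<and> x \<in> B i}. i < n} = {i. i < n \<and> x \<in> B i}" for x using assms by auto
  then show ?thesis by (simp add: test_set_def)
qed

lemma test_set_in: "test_set M B n T \<in> test_sets M B"
proof -
  have "test_set M B n T = test_set M B n (T \<inter> Pow {..<n})" by (auto simp: test_set_def)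
  then show ?thesis unfolding test_sets_def by blast
qed

lemma test_sets_Un: "X \<in> test_sets M B \<Longrightarrow> Y \<in> test_sets M B \<Longrightarrow> X \<union> Y \<in> test_sets M B"
proof -
  assume "X \<in> test_sets M B" "Y \<in> test_sets M B"
  then obtain n T m U where X: "X = test_set M B n T" and Y: "Y = test_set M B m U"
    by (auto simp: test_sets_def)
  define k where "k = max n m"
  have "X = test_set M B k {J. {i\<in>J. i < n} \<in> T}" "Y = test_set M B k {J. {i\<in>J. i < m} \<in> U}"
    unfolding X Y by (rule test_set_lift, simp add: k_def)+
  then have "X \<union> Y = test_set M B k ({J. {i\<in>J. i < n} \<in> T} \<union> {J. {i\<in>J. i < m} \<in> U})"
    unfolding test_set_def by blast
  then show ?thesis by (rule ssubst) (rule test_set_in)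
qed

lemma test_sets_compl: "X \<in> test_sets M B \<Longrightarrow> space M - X \<in> test_sets M B"
proof -
  assume "X \<in> test_sets M B"
  then obtain n T where "X = test_set M B n T" by (auto simp: test_sets_def)
  then have "space M - X = test_set M B n (- T)" by (auto simp: test_set_def)
  then show ?thesis by (rule ssubst) (rule test_set_in)
qed

lemma test_sets_empty: "{} \<in> test_sets M B"
  using test_set_in[of M B 0 "{}"] by (simp add: test_set_def)

lemma test_sets_gen: "B i \<subseteq> space M \<Longrightarrow> B i \<in> test_sets M B"
proof -
  assume "B i \<subseteq> space M"
  then have "B i = test_set M B (Suc i) {J. i \<in> J}" by (auto simp: test_set_def)
  then show ?thesis by (rule ssubst) (rule test_set_in)
qed

lemma test_sets_sets:
  assumes "\<And>i. B i \<in> sets M" shows "test_sets M B \<subseteq> sets M"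
proof
  fix X assume "X \<in> test_sets M B"
  then obtain n T where X: "X = test_set M B n T" and T: "T \<subseteq> Pow {..<n}" by (auto simp: test_sets_def)
  have fin: "finite T" using T by (rule finite_subset) simp
  have "{i. i < n \<and> x \<in> B i} = J" if "J \<in> T" "\<forall>i\<in>{..<n}. x \<in> B i \<longleftrightarrow> i \<in> J" for x J
    using T that by blast
  then have "X = (\<Union>J\<in>T. {x \<in> space M. \<forall>i\<in>{..<n}. x \<in> B i \<longleftrightarrow> i \<in> J})"
    unfolding X test_set_def by (auto intro!: bexI)
  also have "\<dots> \<in> sets M"
  proof (rule sets.finite_UN[OF fin])
    fix J
    note assms[measurable]
    show "{x \<in> space M. \<forall>i\<in>{..<n}. x \<in> B i \<longleftrightarrow> i \<in> J} \<in> sets M" by measurable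
  qed
  finally show "X \<in> sets M" .
qed

text \<open>Induction along the generation of the sigma-algebra, for both measures with the same A.
  Complements keep the symmetric difference; a countable union is cut to finitely many sets up to e
  / 2.\<close>

lemma test_sets_approx:
  assumes B: "\<And>i. B i \<in> sets M" and gen: "sets M = sigma_sets (space M) (range B)"
    and P: "prob_space P" "sets P = sets M" and Q: "prob_space Q" "sets Q = sets M"
    and S: "S \<in> sets M" and e: "(e::real) > 0"
  shows "\<exists>A\<in>test_sets M B. measure P ((S - A) \<union> (A - S)) < e \<and> measure Q ((S - A) \<union> (A - S)) < e"
  using S[unfolded gen] e
proof (induction S arbitrary: e rule: sigma_sets.induct)
  interpret P: prob_space P by fact
  interpret Q: prob_space Q by fact
  have sub: "test_sets M B \<subseteq> sets M" by (rule test_sets_sets[OF B])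
  {
    case (Basic a)
    then obtain i where "a = B i" by auto
    moreover have "B i \<subseteq> space M" using sets.sets_into_space[OF B] .
    ultimately have "a \<in> test_sets M B" using test_sets_gen by metis
    then show ?case using Basic by (intro bexI[of _ a]) auto
  next
    case Empty
    then show ?case using test_sets_empty[of M B] by (intro bexI[of _ "{}"]) auto
  next
    case (Compl a)
    then obtain A where A: "A \<in> test_sets M B" "measure P ((a - A) \<union> (A - a)) < e" "measure Q ((a - A) \<union> (A - a)) < e" by blast
    have "a \<subseteq> space M" using Compl.hyps sets.sets_into_space gen by blast
    moreover have "A \<subseteq> space M" using A(1) sub sets.sets_into_space by blast
    ultimately have "(space M - a - (space M - A)) \<union> (space M - A - (space M - a)) = (a - A) \<union> (A - a)" by blast
    then show ?case using A test_sets_compl[OF A(1)] by (intro bexI[of _ "space M - A"]) simp_all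
  next
    case (Union a)
    have am: "a i \<in> sets M" for i using Union.hyps gen by simp
    have dm: "(\<Union>i<n. a i) \<in> sets M" for n using am by auto
    have Um: "(\<Union>i. a i) \<in> sets M" using am by auto
    have lim: "(\<lambda>n. measure R ((\<Union>i. a i) - (\<Union>i<n. a i))) \<longlonglongrightarrow> 0" if "prob_space R" "sets R = sets M" for R
    proof -
      interpret R: prob_space R by fact
      have "(\<lambda>n. measure R ((\<Union>i. a i) - (\<Union>i<n. a i))) \<longlonglongrightarrow> measure R (\<Inter>n. (\<Union>i. a i) - (\<Union>i<n. a i))"
        using am that(2) by (intro R.finite_Lim_measure_decseq) (auto simp: decseq_def intro!: sets.Diff sets.countable_UN)
      also have "(\<Inter>n. (\<Union>i. a i) - (\<Union>i<n. a i)) = {}"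
      proof -
        have "x \<in> (\<Union>i<Suc k. a i)" if "x \<in> a k" for x k using that by auto
        then show ?thesis by blast
      qed
      finally show ?thesis by simp
    qed
    have "eventually (\<lambda>n. measure P ((\<Union>i. a i) - (\<Union>i<n. a i)) < e / 2) sequentially"
      using lim[OF P] Union.prems by (intro order_tendstoD(2)[of _ 0]) auto
    moreover have "eventually (\<lambda>n. measure Q ((\<Union>i. a i) - (\<Union>i<n. a i)) < e / 2) sequentially"
      using lim[OF Q] Union.prems by (intro order_tendstoD(2)[of _ 0]) auto
    ultimately have "eventually (\<lambda>n. measure P ((\<Union>i. a i) - (\<Union>i<n. a i)) < e / 2 \<and> measure Q ((\<Union>i. a i) - (\<Union>i<n. a i)) < e / 2) sequentially"
      by eventually_elim auto
    then obtain n where n: "measure P ((\<Union>i. a i) - (\<Union>i<n. a i)) < e / 2" "measure Q ((\<Union>i. a i) - (\<Union>i<n. a i)) < e / 2"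
      by (auto simp: eventually_sequentially)
    \<comment> \<open>The n errors add up to at most e / 2; the summand 1 keeps the denominator
      positive for n = 0.\<close>
    define e' where "e' = e / (2 * (real n + 1))"
    have e': "e' > 0" using Union.prems by (simp add: e'_def)
    have "\<forall>i. \<exists>A\<in>test_sets M B. measure P ((a i - A) \<union> (A - a i)) < e' \<and> measure Q ((a i - A) \<union> (A - a i)) < e'"
      using Union.IH[OF e'] by blast
    then obtain A where A: "\<And>i. A i \<in> test_sets M B" "\<And>i. measure P ((a i - A i) \<union> (A i - a i)) < e'" "\<And>i. measure Q ((a i - A i) \<union> (A i - a i)) < e'"
      by metis
    have Am: "A i \<in> sets M" for i using A(1) sub by blast
    define U where "U = (\<Union>i<n. A i)"
    have Ut: "(\<Union>i<k. A i) \<in> test_sets M B" for k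
    proof (induction k)
      case 0 then show ?case using test_sets_empty by simp
    next
      case (Suc k)
      have "(\<Union>i<Suc k. A i) = A k \<union> (\<Union>i<k. A i)" by (auto simp: less_Suc_eq)
      then show ?case using test_sets_Un[OF A(1) Suc] by simp
    qed
    have bound: "measure R (((\<Union>i. a i) - U) \<union> (U - (\<Union>i. a i))) < e"
      if R: "prob_space R" "sets R = sets M" and n: "measure R ((\<Union>i. a i) - (\<Union>i<n. a i)) < e / 2"
        and s: "\<And>i. measure R ((a i - A i) \<union> (A i - a i)) < e'" for R
    proof -
      interpret R: prob_space R by fact
      have dm': "(a i - A i) \<union> (A i - a i) \<in> sets R" for i using am Am R(2) by auto
      have "((\<Union>i. a i) - U) \<union> (U - (\<Union>i. a i)) \<subseteq> ((\<Union>i. a i) - (\<Union>i<n. a i)) \<union> (\<Union>i\<in>{..<n}. (a i - A i) \<union> (A i - a i))"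
      proof
        fix x assume x: "x \<in> ((\<Union>i. a i) - U) \<union> (U - (\<Union>i. a i))"
        show "x \<in> ((\<Union>i. a i) - (\<Union>i<n. a i)) \<union> (\<Union>i\<in>{..<n}. (a i - A i) \<union> (A i - a i))"
        proof (cases "x \<in> U")
          case True
          then obtain i where "i < n" "x \<in> A i" by (auto simp: U_def)
          then show ?thesis using x True by (intro UnI2 UN_I[of i]) auto
        next
          case False
          then have "x \<in> A i \<Longrightarrow> i < n \<Longrightarrow> False" for i by (auto simp: U_def)
          then show ?thesis using x False by fast
        qed
      qed
      then have "measure R (((\<Union>i. a i) - U) \<union> (U - (\<Union>i. a i))) \<le> measure R (((\<Union>i. a i) - (\<Union>i<n. a i)) \<union> (\<Union>i\<in>{..<n}. (a i - A i) \<union> (A i - a i)))"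
        using Um dm dm' R(2) by (intro R.finite_measure_mono) (auto intro!: sets.Un sets.Diff sets.finite_UN)
      also have "\<dots> \<le> measure R ((\<Union>i. a i) - (\<Union>i<n. a i)) + measure R (\<Union>i\<in>{..<n}. (a i - A i) \<union> (A i - a i))"
        using Um dm dm' R(2) by (intro measure_Un_le) (auto intro!: sets.Diff sets.finite_UN)
      also have "measure R (\<Union>i\<in>{..<n}. (a i - A i) \<union> (A i - a i)) \<le> (\<Sum>i\<in>{..<n}. measure R ((a i - A i) \<union> (A i - a i)))"
        using dm' by (intro measure_UNION_le) auto
      also have "\<dots> \<le> (\<Sum>i\<in>{..<n}. e')" using s by (intro sum_mono less_imp_le)
      also have "\<dots> = n * e'" by simp
      also have "n * e' \<le> e / 2" using Union.prems by (simp add: e'_def field_simps)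
      finally show ?thesis using n by simp
    qed
    show ?case
      by (intro bexI[of _ U] conjI bound[OF P n(1) A(2)] bound[OF Q n(2) A(3)]) (simp add: U_def Ut)
  }
qed

text \<open>Replacing S by an approximating test set costs e' on the left and K e' on the right,
  which is arbitrarily small in total.\<close>

lemma test_sets_ineq_extend:
  assumes B: "\<And>i. B i \<in> sets M" and gen: "sets M = sigma_sets (space M) (range B)"
    and P: "prob_space P" "sets P = sets M" and Q: "prob_space Q" "sets Q = sets M"
    and le: "\<And>A. A \<in> test_sets M B \<Longrightarrow> measure P A \<le> K * measure Q A + \<delta>" and K: "K \<ge> 0" and S: "S \<in> sets M"
  shows "measure P S \<le> K * measure Q S + \<delta>"
proof (rule field_le_epsilon)
  interpret P: prob_space P by fact
  interpret Q: prob_space Q by fact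
  fix e :: real assume e: "e > 0"
  define e' where "e' = e / (K + 1)"
  have e': "e' > 0" using e K by (simp add: e'_def)
  obtain A where A: "A \<in> test_sets M B" "measure P ((S - A) \<union> (A - S)) < e'" "measure Q ((S - A) \<union> (A - S)) < e'"
    using test_sets_approx[OF B gen P Q S e'] by blast
  have Am: "A \<in> sets M" using A(1) test_sets_sets[of B M, OF B] by blast
  have "measure P S \<le> measure P (A \<union> ((S - A) \<union> (A - S)))"
    using Am S P(2) by (intro P.finite_measure_mono) auto
  also have "\<dots> \<le> measure P A + measure P ((S - A) \<union> (A - S))"
    using Am S P(2) by (intro measure_Un_le) auto
  finally have 1: "measure P S \<le> measure P A + e'" using A(2) by simp
  have "measure Q A \<le> measure Q (S \<union> ((S - A) \<union> (A - S)))"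
    using Am S Q(2) by (intro Q.finite_measure_mono) auto
  also have "\<dots> \<le> measure Q S + measure Q ((S - A) \<union> (A - S))"
    using Am S Q(2) by (intro measure_Un_le) auto
  finally have 2: "measure Q A \<le> measure Q S + e'" using A(3) by simp
  have "K * measure Q A \<le> K * (measure Q S + e')" using 2 K by (rule mult_left_mono)
  then have "measure P S \<le> K * measure Q S + \<delta> + (K + 1) * e'" using 1 le[OF A(1)] by (simp add: algebra_simps)
  also have "(K + 1) * e' = e" using K by (simp add: e'_def)
  finally show "measure P S \<le> K * measure Q S + \<delta> + e" .
qed

text \<open>Half spaces with rational thresholds generate, since a real threshold is an intersection
  of larger rational ones. The empty set is added so that there is something to enumerate when d =
  0.\<close>

lemma lborel_dim_generator:
  obtains B where "\<And>i::nat. B i \<in> sets (lborel_dim d)" "sets (lborel_dim d) = sigma_sets (space (lborel_dim d)) (range B)"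
proof -
  define G where "G = (\<lambda>(j, q::rat). {x \<in> space (lborel_dim d). x j \<le> of_rat q}) ` ({..<d} \<times> UNIV)"
  have Gc: "countable (insert {} G)" unfolding G_def by (intro countable_insert countable_image countable_SIGMA) auto
  define B where "B = from_nat_into (insert {} G)"
  have rB: "range B = insert {} G" unfolding B_def using Gc by (intro range_from_nat_into) auto
  have sp: "space (lborel_dim d) = PiE {..<d} (\<lambda>_. UNIV)" by (simp add: lborel_dim_def space_PiM)
  have Gs: "insert {} G \<subseteq> sets (lborel_dim d)"
  proof -
    have "{x \<in> space (lborel_dim d). x j \<le> r} \<in> sets (lborel_dim d)" if "j < d" for j and r :: real
    proof -
      have "(\<lambda>x. x j) \<in> borel_measurable (lborel_dim d)"
        using that measurable_component_singleton[of j "{..<d}" "\<lambda>_. lborel"] by (simp add: lborel_dim_def)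
      then show ?thesis by measurable
    qed
    then show ?thesis by (auto simp: G_def)
  qed
  have "sets (lborel_dim d) = sigma_sets (space (lborel_dim d)) (range B)"
  proof
    show "sigma_sets (space (lborel_dim d)) (range B) \<subseteq> sets (lborel_dim d)"
      unfolding rB using Gs by (rule sets.sigma_sets_subset)
    define N where "N = sigma (space (lborel_dim d)) (insert {} G)"
    have GP: "insert {} G \<subseteq> Pow (space (lborel_dim d))" by (auto simp: G_def)
    have sN: "sets N = sigma_sets (space (lborel_dim d)) (range B)" and spN: "space N = space (lborel_dim d)"
      unfolding N_def rB using GP by (simp_all only: sets_measure_of space_measure_of)
    have comp: "(\<lambda>x. x j) \<in> borel_measurable N" if j: "j < d" for j
    proof (rule borel_measurable_iff_le[THEN iffD2], rule allI)
      fix a :: real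
      define Q where "Q = {q::rat. a < of_rat q}"
      have Qne: "Q \<noteq> {}" using of_rat_dense[of a "a + 1"] by (auto simp: Q_def)
      have "{w \<in> space N. w j \<le> a} = (\<Inter>q\<in>Q. {x \<in> space (lborel_dim d). x j \<le> of_rat q})"
      proof (intro equalityI subsetI)
        fix x assume "x \<in> {w \<in> space N. w j \<le> a}"
        then show "x \<in> (\<Inter>q\<in>Q. {x \<in> space (lborel_dim d). x j \<le> of_rat q})" by (auto simp: Q_def spN)
      next
        fix x assume x: "x \<in> (\<Inter>q\<in>Q. {x \<in> space (lborel_dim d). x j \<le> of_rat q})"
        have "x j \<le> a"
        proof (rule ccontr)
          assume "\<not> x j \<le> a"
          then obtain q where "a < of_rat q" "of_rat q < x j" using of_rat_dense[of a "x j"] by auto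
          then show False using x by (force simp: Q_def)
        qed
        then show "x \<in> {w \<in> space N. w j \<le> a}" using x Qne by (auto simp: spN)
      qed
      also have "\<dots> \<in> sets N"
      proof (rule sets.countable_INT')
        show "countable Q" by (rule countableI_type)
        show "Q \<noteq> {}" by (rule Qne)
        show "(\<lambda>q. {x \<in> space (lborel_dim d). x j \<le> of_rat q}) ` Q \<subseteq> sets N"
          unfolding sN rB using j by (auto simp: G_def intro!: sigma_sets.Basic)
      qed
      finally show "{w \<in> space N. w j \<le> a} \<in> sets N" .
    qed
    have "sets (PiM {..<d} (\<lambda>_. lborel :: real measure)) \<subseteq> sets N"
    proof (rule sets_PiM_in_sets)
      show "space N = (\<Pi>\<^sub>E i\<in>{..<d}. space lborel)" by (simp add: spN sp)
      fix j and A :: "real set" assume j: "j \<in> {..<d}" and A: "A \<in> sets lborel"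
      have "(\<lambda>x. x j) -` A \<inter> space N \<in> sets N" using comp[of j] j A by (intro measurable_sets[of _ N borel]) auto
      moreover have "(\<lambda>x. x j) -` A \<inter> space N = {x \<in> space N. x j \<in> A}" by auto
      ultimately show "{x \<in> space N. x j \<in> A} \<in> sets N" by simp
    qed
    then show "sets (lborel_dim d) \<subseteq> sigma_sets (space (lborel_dim d)) (range B)"
      unfolding sN by (simp add: lborel_dim_def)
  qed
  then show thesis using that[of B] Gs rB by blast
qed

section \<open>Private aggregation\<close>

text \<open>The changed block contributes at most 1 to the difference and the other k - 1 blocks at
  most 2 / k each, hence less than 3 in total.\<close>

lemma weight_sum_stable:
  fixes w w' :: "nat \<Rightarrow> real"
  assumes j0: "j0 < k" and w: "\<And>j. j < k \<Longrightarrow> 0 \<le> w j \<and> w j \<le> 1" and w': "\<And>j. j < k \<Longrightarrow> 0 \<le> w' j \<and> w' j \<le> 1"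
    and dw: "\<And>j. j < k \<Longrightarrow> j \<noteq> j0 \<Longrightarrow> \<bar>w j - w' j\<bar> \<le> 2 / k"
  shows "(\<Sum>j<k. w j) \<le> (\<Sum>j<k. w' j) + 3"
proof -
  have k: "real k > 0" using j0 by simp
  have "(\<Sum>j<k. w j) = w j0 + (\<Sum>j\<in>{..<k} - {j0}. w j)" using j0 by (intro sum.remove) auto
  also have "\<dots> \<le> (1 + w' j0) + (\<Sum>j\<in>{..<k} - {j0}. w' j + 2 / k)"
  proof (rule add_mono)
    show "w j0 \<le> 1 + w' j0" using w[OF j0] w'[OF j0] by simp
    show "(\<Sum>j\<in>{..<k} - {j0}. w j) \<le> (\<Sum>j\<in>{..<k} - {j0}. w' j + 2 / k)"
      by (intro sum_mono) (use dw in \<open>force simp: abs_le_iff\<close>)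
  qed
  also have "(\<Sum>j\<in>{..<k} - {j0}. w' j + 2 / k) = (\<Sum>j\<in>{..<k} - {j0}. w' j) + (real k - 1) * (2 / k)"
    using j0 by (simp add: sum.distrib of_nat_diff)
  also have "(real k - 1) * (2 / k) \<le> 2" using k by (simp add: field_simps)
  also have "1 + w' j0 + ((\<Sum>j\<in>{..<k} - {j0}. w' j) + 2) = (w' j0 + (\<Sum>j\<in>{..<k} - {j0}. w' j)) + 3" by simp
  also have "w' j0 + (\<Sum>j\<in>{..<k} - {j0}. w' j) = (\<Sum>j<k. w' j)" using j0 by (intro sum.remove[symmetric]) auto
  finally show ?thesis by simp
qed

text \<open>Averaging the closeness hypothesis over j shows that every P i of positive weight is at
  most K m + \<sigma>, with m the weighted mean itself. So no block, changed or reweighted, moves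
  the numerator by more than its change of weight times K m + \<sigma>, and the additive term does
  not grow with k.\<close>

lemma weighted_mean_stable:
  fixes w w' P P' :: "nat \<Rightarrow> real"
  assumes j0: "j0 < k" and w: "\<And>j. j < k \<Longrightarrow> 0 \<le> w j \<and> w j \<le> 1" and w': "\<And>j. j < k \<Longrightarrow> 0 \<le> w' j \<and> w' j \<le> 1"
    and dw: "\<And>j. j < k \<Longrightarrow> j \<noteq> j0 \<Longrightarrow> \<bar>w j - w' j\<bar> \<le> 2 / k"
    and PP: "\<And>j. j < k \<Longrightarrow> j \<noteq> j0 \<Longrightarrow> P' j = P j"
    and P: "\<And>j. j < k \<Longrightarrow> 0 \<le> P j" and P': "\<And>j. j < k \<Longrightarrow> 0 \<le> P' j"
    and close: "\<And>i j. i < k \<Longrightarrow> j < k \<Longrightarrow> w i > 0 \<Longrightarrow> w j > 0 \<Longrightarrow> P i \<le> K * P j + \<sigma>"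
    and K: "K \<ge> 0" and \<sigma>: "\<sigma> \<ge> 0" and e: "0 < \<epsilon>" "\<epsilon> \<le> 1" and k: "k \<ge> 48 * (1 + K) / \<epsilon>"
    and W: "(\<Sum>j<k. w j) \<ge> k / 2" and W': "(\<Sum>j<k. w' j) \<ge> k / 2"
  shows "(\<Sum>j<k. w j * P j) / (\<Sum>j<k. w j) \<le> exp (\<epsilon> / 4) * ((\<Sum>j<k. w' j * P' j) / (\<Sum>j<k. w' j)) + \<sigma>"
proof -
  define V where "V = (\<Sum>j<k. w j)"
  define V' where "V' = (\<Sum>j<k. w' j)"
  define N where "N = (\<Sum>j<k. w j * P j)"
  define N' where "N' = (\<Sum>j<k. w' j * P' j)"
  define m where "m = N / V"
  have ke: "real k * \<epsilon> \<ge> 48 * (1 + K)" using k e by (simp add: divide_le_eq)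
  moreover have "real k * \<epsilon> \<le> real k * 1" using e by (intro mult_left_mono) auto
  ultimately have k48: "real k \<ge> 48 * (1 + K)" by simp
  have V: "V \<ge> k / 2" "V > 0" using W k48 K by (auto simp: V_def)
  have V': "V' > 0" "V' \<le> V + 3"
    using W' k48 K weight_sum_stable[OF j0 w' w] dw by (auto simp: V_def V'_def abs_minus_commute)
  have N0: "N' \<ge> 0" unfolding N'_def using w' P' by (intro sum_nonneg mult_nonneg_nonneg) auto
  have m0: "m \<ge> 0" unfolding m_def N_def using w P V by (intro divide_nonneg_pos sum_nonneg mult_nonneg_nonneg) auto
  have Pm: "P i \<le> K * m + \<sigma>" if i: "i < k" "w i > 0" for i
  proof -
    have "P i * V = (\<Sum>j<k. w j * P i)" by (simp add: V_def sum_distrib_left mult.commute)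
    also have "\<dots> \<le> (\<Sum>j<k. w j * (K * P j + \<sigma>))"
    proof (rule sum_mono)
      fix j assume "j \<in> {..<k}"
      then show "w j * P i \<le> w j * (K * P j + \<sigma>)"
        using close[OF i(1) _ i(2)] w[of j] by (cases "w j > 0") (auto intro!: mult_left_mono)
    qed
    also have "\<dots> = K * N + \<sigma> * V"
      by (simp add: N_def V_def sum_distrib_left distrib_left sum.distrib mult_ac)
    finally have "P i \<le> (K * N + \<sigma> * V) / V" using V by (simp add: le_divide_eq)
    then show ?thesis using V by (simp add: m_def add_divide_distrib)
  qed
  have c0: "K * m + \<sigma> \<ge> 0" using K m0 \<sigma> by simp
  have "N - N' = (\<Sum>j<k. w j * P j - w' j * P' j)" by (simp add: N_def N'_def sum_subtractf)
  also have "\<dots> = (w j0 * P j0 - w' j0 * P' j0) + (\<Sum>j\<in>{..<k} - {j0}. w j * P j - w' j * P' j)"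
    using j0 by (intro sum.remove) auto
  also have "\<dots> \<le> (K * m + \<sigma>) + (\<Sum>j\<in>{..<k} - {j0}. 2 / k * (K * m + \<sigma>))"
  proof (intro add_mono sum_mono)
    have "w j0 * P j0 \<le> K * m + \<sigma>"
    proof (cases "w j0 > 0")
      case True
      have "w j0 * P j0 \<le> 1 * (K * m + \<sigma>)" using w[OF j0] P[OF j0] Pm[OF j0 True] by (intro mult_mono) auto
      then show ?thesis by simp
    next
      case False
      then show ?thesis using w[OF j0] c0 by simp
    qed
    moreover have "0 \<le> w' j0 * P' j0" using w'[OF j0] P'[OF j0] by simp
    ultimately show "w j0 * P j0 - w' j0 * P' j0 \<le> K * m + \<sigma>" by simp
    fix j assume "j \<in> {..<k} - {j0}"
    then have j: "j < k" "j \<noteq> j0" by auto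
    have "w j * P j - w' j * P' j = (w j - w' j) * P j" using PP[OF j] by (simp add: left_diff_distrib)
    also have "\<dots> \<le> 2 / k * (K * m + \<sigma>)"
    proof (cases "w j > 0")
      case True
      then show ?thesis using dw[OF j] P[OF j(1)] Pm[OF j(1)] by (intro mult_mono) (auto simp: abs_le_iff)
    next
      case False
      then have "(w j - w' j) * P j \<le> 0" using w[OF j(1)] w'[OF j(1)] P[OF j(1)] by (intro mult_nonpos_nonneg) auto
      moreover have "0 \<le> 2 / k * (K * m + \<sigma>)" using c0 by simp
      ultimately show ?thesis by simp
    qed
    finally show "w j * P j - w' j * P' j \<le> 2 / k * (K * m + \<sigma>)" .
  qed
  also have "\<dots> \<le> (K * m + \<sigma>) + 2 * (K * m + \<sigma>)"
  proof -
    have "(\<Sum>j\<in>{..<k} - {j0}. 2 / k * (K * m + \<sigma>)) \<le> (\<Sum>j<k. 2 / k * (K * m + \<sigma>))"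
      using c0 by (intro sum_mono2) auto
    also have "\<dots> = 2 * (K * m + \<sigma>)" using j0 by simp
    finally show ?thesis by simp
  qed
  finally have "N - N' \<le> 3 * (K * m + \<sigma>)" by simp
  moreover have "N = V * m" using V by (simp add: m_def)
  \<comment> \<open>The loss 3 K m is a multiple of the mean and is moved to the left, where it
    reduces the total weight from V to D.\<close>
  moreover define D where "D = V - 3 * K"
  moreover have "D * m = V * m - 3 * (K * m)" by (simp add: D_def left_diff_distrib)
  ultimately have 1: "D * m \<le> N' + 3 * \<sigma>" unfolding distrib_left by linarith
  have VD: "V = D + 3 * K" by (simp add: D_def)
  have k48': "48 + 48 * K \<le> real k" using k48 by (simp add: distrib_left)
  have "real k \<le> 2 * V" using V by simp
  then have D4: "real k \<le> 4 * D" using k48' K unfolding VD distrib_left by linarith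
  then have D3: "D \<ge> 12" using k48' K by linarith
  have n0: "0 \<le> N' / V'" using N0 V' by simp
  have "N' = (N' / V') * V'" using V' by simp
  also have "\<dots> \<le> (N' / V') * (exp (\<epsilon> / 4) * D)"
  proof (rule mult_left_mono[OF _ n0])
    \<comment> \<open>Origin of 48: the total weight is at least k / 2, so D is at least k / 4 and
      \<epsilon> D at least 12 (1 + K). Then replacing D by V + 3, larger by 3 K + 3, costs a factor
      at most 1 + \<epsilon> / 4.\<close>
    have "48 * (1 + K) \<le> (4 * D) * \<epsilon>" using ke mult_right_mono[OF D4, of \<epsilon>] e by linarith
    then have "48 * K + 48 \<le> 4 * (\<epsilon> * D)" by (simp add: distrib_left mult_ac)
    then have "3 * K + 3 \<le> \<epsilon> / 4 * D" by simp
    then have "V + 3 \<le> (1 + \<epsilon> / 4) * D" unfolding VD distrib_right by simp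
    also have "\<dots> \<le> exp (\<epsilon> / 4) * D" using D3 by (intro mult_right_mono exp_ge_add_one_self) auto
    finally show "V' \<le> exp (\<epsilon> / 4) * D" using V' by simp
  qed
  finally have "D * m \<le> D * (exp (\<epsilon> / 4) * (N' / V')) + 3 * \<sigma>" using 1 by (simp add: mult_ac)
  also have "3 * \<sigma> \<le> D * \<sigma>" using D3 \<sigma> by (intro mult_right_mono) auto
  finally have "D * m \<le> D * (exp (\<epsilon> / 4) * (N' / V') + \<sigma>)" by (simp add: distrib_left)
  then have "m \<le> exp (\<epsilon> / 4) * (N' / V') + \<sigma>" using D3 by (simp add: mult_le_cancel_left_pos)
  then show ?thesis by (simp add: m_def N_def V_def N'_def V'_def)
qed

definition sigmoid :: "real \<Rightarrow> real" where "sigmoid t = 1 / (1 + exp (- t))"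

lemma sigmoid_bounds: "0 < sigmoid t" "sigmoid t < 1" "sigmoid t \<le> exp t" "1 - sigmoid t \<le> exp (- t)"
proof -
  have p: "exp (- t) > 0" "exp t * exp (- t) = 1" by (auto simp: exp_minus)
  show "0 < sigmoid t" "sigmoid t < 1" using p by (auto simp: sigmoid_def add_pos_pos)
  have "1 \<le> exp t * (1 + exp (- t))" using p by (simp add: distrib_left)
  then show "sigmoid t \<le> exp t" using p by (simp add: sigmoid_def divide_le_eq add_pos_pos)
  have q: "1 + exp (- t) > 0" by (simp add: add_pos_pos)
  have "1 - sigmoid t = exp (- t) / (1 + exp (- t))" using q by (simp add: sigmoid_def diff_divide_eq_iff)
  also have "\<dots> \<le> exp (- t)" unfolding pos_divide_le_eq[OF q] by (simp add: distrib_left)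
  finally show "1 - sigmoid t \<le> exp (- t)" .
qed

lemma sigmoid_uminus: "1 - sigmoid t = sigmoid (- t)"
proof -
  have "1 + exp t > 0" "1 + exp (- t) > 0" by (simp_all add: add_pos_pos)
  then show ?thesis by (simp add: sigmoid_def exp_minus field_simps)
qed

text \<open>The logarithm of the sigmoid is increasing with slope at most 1.\<close>

lemma sigmoid_stable: "t \<le> t' + c \<Longrightarrow> 0 \<le> c \<Longrightarrow> sigmoid t \<le> exp c * sigmoid t'"
proof -
  assume "t \<le> t' + c" "0 \<le> c"
  then have "exp (- t') \<le> exp c * exp (- t)" "1 \<le> exp c" by (auto simp: mult_exp_exp)
  then have "1 + exp (- t') \<le> exp c * (1 + exp (- t))" unfolding distrib_left by linarith
  then have "exp c * (1 + exp (- t)) * sigmoid t * sigmoid t' \<ge> (1 + exp (- t')) * sigmoid t * sigmoid t'"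
    using sigmoid_bounds(1)[of t] sigmoid_bounds(1)[of t'] by (intro mult_right_mono) auto
  moreover have "(1 + exp (- t)) * sigmoid t = 1" "(1 + exp (- t')) * sigmoid t' = 1"
    by (simp_all add: sigmoid_def add_pos_pos less_imp_neq[symmetric])
  ultimately show ?thesis by (metis mult.assoc mult.commute mult_1)
qed

text \<open>The hard cut at \<open>k / 2\<close> is invisible to privacy because the sigmoid is already tiny there.\<close>

definition gate :: "real \<Rightarrow> nat \<Rightarrow> real \<Rightarrow> real" where
  "gate \<epsilon> k V = (if V \<ge> k / 2 then sigmoid (\<epsilon> / 12 * (V - 3 * k / 4)) else 0)"

lemma gate_bounds: "0 \<le> gate \<epsilon> k V" "gate \<epsilon> k V \<le> 1"
  using sigmoid_bounds(1,2)[of "\<epsilon> / 12 * (V - 3 * k / 4)"] by (auto simp: gate_def)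

lemma gate_full: "1 - gate \<epsilon> k k \<le> exp (- (\<epsilon> * k / 48))"
  using sigmoid_bounds(4)[of "\<epsilon> / 12 * (k - 3 * k / 4)"] by (simp add: gate_def field_simps)

text \<open>The slope \<epsilon> / 12 against a sensitivity of 3 makes both the gate and its
  complement stable within exp (\<epsilon> / 4); with the factor exp (\<epsilon> / 4) for the mean
  this gives exp (\<epsilon> / 2). If one of the totals is below k / 2, then both gates are at most
  \<delta>, and \<delta> absorbs the difference. The centre 3 k / 4 leaves the margin k / 4 both at
  k / 2 and at the full total k.\<close>

lemma gated_mixture_private:
  assumes e: "0 < \<epsilon>" "\<epsilon> \<le> 1" and VV: "V \<le> V' + 3" "V' \<le> V + 3"
    and m: "0 \<le> m" "m \<le> 1" and m': "0 \<le> m'" and r: "0 \<le> r" "r \<le> 1"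
    and mm: "V \<ge> real k / 2 \<Longrightarrow> V' \<ge> real k / 2 \<Longrightarrow> m \<le> exp (\<epsilon> / 4) * m' + \<sigma>"
    and small: "exp (1/4) * exp (- (\<epsilon> * k / 48)) \<le> \<delta>" "2 * \<sigma> \<le> \<delta>" and \<sigma>: "\<sigma> \<ge> 0"
  shows "gate \<epsilon> k V * m + (1 - gate \<epsilon> k V) * r \<le> exp \<epsilon> * (gate \<epsilon> k V' * m' + (1 - gate \<epsilon> k V') * r) + \<delta>"
proof -
  define p where "p = gate \<epsilon> k V"
  define p' where "p' = gate \<epsilon> k V'"
  have p: "0 \<le> p" "p \<le> 1" and p': "0 \<le> p'" "p' \<le> 1" by (simp_all add: p_def p'_def gate_bounds)
  define y where "y = p' * m' + (1 - p') * r"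
  have y0: "y \<ge> 0" using p' m' r by (simp add: y_def)
  have ey: "y \<le> exp \<epsilon> * y" using mult_right_mono[of 1 "exp \<epsilon>" y] y0 e by simp
  \<comment> \<open>The margin 3 covers a neighbour whose total is just below the cut; at slope
    \<epsilon> / 12 it contributes at most 1/4 to the exponent, whence exp (1/4).\<close>
  have gs: "gate \<epsilon> k U \<le> \<delta>" if U: "U \<le> real k / 2 + 3" for U
  proof (cases "U \<ge> real k / 2")
    case True
    have "\<epsilon> / 12 * (U - 3 * k / 4) \<le> \<epsilon> / 12 * (3 - k / 4)" using U e by (intro mult_left_mono) auto
    also have "\<dots> \<le> 1 / 4 - \<epsilon> * k / 48" using e by (simp add: field_simps)
    finally have "exp (\<epsilon> / 12 * (U - 3 * k / 4)) \<le> exp (1/4 - \<epsilon> * k / 48)" by simp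
    also have "\<dots> = exp (1/4) * exp (- (\<epsilon> * k / 48))" by (simp add: mult_exp_exp)
    finally show ?thesis using small True sigmoid_bounds(3)[of "\<epsilon> / 12 * (U - 3 * k / 4)"] by (simp add: gate_def)
  next
    case False
    then show ?thesis using small(2) \<sigma> by (simp add: gate_def)
  qed
  have "p * m + (1 - p) * r \<le> exp \<epsilon> * y + \<delta>"
  proof (cases "V \<ge> real k / 2")
    case V: True
    show ?thesis
    proof (cases "V' \<ge> real k / 2")
      case V': True
      have d: "\<epsilon> / 12 * (V - 3 * k / 4) \<le> \<epsilon> / 12 * (V' - 3 * k / 4) + \<epsilon> / 4" "\<epsilon> / 12 * (V' - 3 * k / 4) \<le> \<epsilon> / 12 * (V - 3 * k / 4) + \<epsilon> / 4"
        using mult_left_mono[OF VV(1), of "\<epsilon> / 12"] mult_left_mono[OF VV(2), of "\<epsilon> / 12"] e by (auto simp: algebra_simps)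
      have g1: "p \<le> exp (\<epsilon> / 4) * p'" unfolding p_def p'_def gate_def using V V' sigmoid_stable[OF d(1)] e by simp
      have g2: "1 - p \<le> exp (\<epsilon> / 4) * (1 - p')" unfolding p_def p'_def gate_def
        using V V' sigmoid_stable[of "- (\<epsilon> / 12 * (V - 3 * k / 4))" "- (\<epsilon> / 12 * (V' - 3 * k / 4))" "\<epsilon> / 4"] d(2) e
        by (simp add: sigmoid_uminus)
      have "p * m \<le> p * (exp (\<epsilon> / 4) * m' + \<sigma>)" using mm[OF V V'] p by (intro mult_left_mono)
      also have "\<dots> \<le> p * (exp (\<epsilon> / 4) * m') + \<sigma>" using p \<sigma> by (simp add: distrib_left mult_left_le_one_le)
      also have "p * (exp (\<epsilon> / 4) * m') \<le> (exp (\<epsilon> / 4) * p') * (exp (\<epsilon> / 4) * m')" using g1 m' by (intro mult_right_mono) auto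
      also have "\<dots> = exp (\<epsilon> / 2) * (p' * m')"
      proof -
        have "exp (\<epsilon> / 2) = exp (\<epsilon> / 4) * exp (\<epsilon> / 4)" by (simp add: mult_exp_exp)
        then show ?thesis by (simp only: mult_ac)
      qed
      finally have 1: "p * m \<le> exp (\<epsilon> / 2) * (p' * m') + \<sigma>" by simp
      have "(1 - p) * r \<le> exp (\<epsilon> / 4) * (1 - p') * r" using g2 r by (intro mult_right_mono)
      also have "\<dots> \<le> exp (\<epsilon> / 2) * (1 - p') * r" using e p' r by (intro mult_right_mono) auto
      finally have "p * m + (1 - p) * r \<le> exp (\<epsilon> / 2) * y + \<sigma>" using 1 by (simp add: y_def distrib_left mult.assoc)
      also have "exp (\<epsilon> / 2) * y \<le> exp \<epsilon> * y" using y0 e by (intro mult_right_mono) auto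
      finally show ?thesis using small(2) \<sigma> by simp
    next
      case V': False
      then have "y = r" by (simp add: y_def p'_def gate_def)
      moreover have "p \<le> \<delta>" unfolding p_def using VV V' by (intro gs) simp
      moreover have "p * m \<le> p" "(1 - p) * r \<le> r" using p m r by (auto simp: mult_left_le mult_left_le_one_le)
      ultimately show ?thesis using ey by simp
    qed
  next
    case V: False
    then have p0: "p = 0" by (simp add: p_def gate_def)
    have "p' \<le> \<delta>" unfolding p'_def using VV V by (intro gs) simp
    moreover have "p' * r \<le> p'" using p' r by (simp add: mult_left_le)
    moreover have "y \<ge> r - p' * r" using p' m' by (simp add: y_def algebra_simps)
    ultimately show ?thesis using p0 ey by simp
  qed
  then show ?thesis by (simp add: p_def p'_def y_def)
qed

section \<open>Finite mixtures of laws as Markov kernels\<close>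

definition mixture :: "nat \<Rightarrow> (nat \<Rightarrow> real) \<Rightarrow> (nat \<Rightarrow> 'a measure) \<Rightarrow> 'a measure" where
  "mixture n u Q = Giry_Monad.bind (point_measure {..<n} (\<lambda>j. ennreal (u j))) Q"

lemma mixture:
  assumes n: "n > 0" and u: "\<And>j. j < n \<Longrightarrow> 0 \<le> u j" "(\<Sum>j<n. u j) = 1"
    and Q: "\<And>j. j < n \<Longrightarrow> Q j \<in> space (prob_algebra M)"
  shows "sets (mixture n u Q) = sets M"
    and "S \<in> sets M \<Longrightarrow> emeasure (mixture n u Q) S = (\<Sum>j<n. ennreal (u j) * emeasure (Q j) S)"
    and "prob_space (mixture n u Q)"
    and "S \<in> sets M \<Longrightarrow> measure (mixture n u Q) S = (\<Sum>j<n. u j * measure (Q j) S)"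
proof -
  let ?N = "point_measure {..<n} (\<lambda>j. ennreal (u j))"
  have sp: "space ?N \<noteq> {}" using n by (auto simp: space_point_measure)
  have Qm: "Q \<in> ?N \<rightarrow>\<^sub>M subprob_algebra M"
    using Q by (auto simp: measurable_def space_point_measure sets_point_measure space_prob_algebra space_subprob_algebra
        intro: prob_space_imp_subprob_space)
  have Qp: "prob_space (Q j)" "sets (Q j) = sets M" if "j < n" for j using Q[OF that] by (auto simp: space_prob_algebra)
  show s: "sets (mixture n u Q) = sets M" unfolding mixture_def
    using sp by (intro sets_bind) (auto simp: space_point_measure Qp)
  have em: "emeasure (mixture n u Q) S = (\<Sum>j<n. ennreal (u j) * emeasure (Q j) S)" if "S \<in> sets M" for S
    unfolding mixture_def by (subst emeasure_bind[OF sp Qm that]) (rule nn_integral_point_measure_finite, simp)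
  then show "emeasure (mixture n u Q) S = (\<Sum>j<n. ennreal (u j) * emeasure (Q j) S)" if "S \<in> sets M" using that .
  have em': "emeasure (mixture n u Q) S = ennreal (\<Sum>j<n. u j * measure (Q j) S)" if S: "S \<in> sets M" for S
  proof -
    have "emeasure (mixture n u Q) S = (\<Sum>j<n. ennreal (u j * measure (Q j) S))"
      unfolding em[OF S]
    proof (rule sum.cong[OF refl])
      fix j assume "j \<in> {..<n}"
      then have j: "j < n" by simp
      interpret q: prob_space "Q j" by (rule Qp(1)[OF j])
      show "ennreal (u j) * emeasure (Q j) S = ennreal (u j * measure (Q j) S)"
        unfolding q.emeasure_eq_measure using u(1)[OF j] by (simp add: ennreal_mult)
    qed
    also have "\<dots> = ennreal (\<Sum>j<n. u j * measure (Q j) S)" using u by (intro sum_ennreal) auto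
    finally show ?thesis .
  qed
  show "prob_space (mixture n u Q)"
  proof
    have "space (mixture n u Q) = space M" using s by (rule sets_eq_imp_space_eq)
    moreover have "measure (Q j) (space M) = 1" if "j < n" for j
      using prob_space.prob_space[OF Qp(1)[OF that]] sets_eq_imp_space_eq[OF Qp(2)[OF that]] by simp
    ultimately show "emeasure (mixture n u Q) (space (mixture n u Q)) = 1" using em'[OF sets.top] u(2) by simp
  qed
  show "measure (mixture n u Q) S = (\<Sum>j<n. u j * measure (Q j) S)" if S: "S \<in> sets M"
    unfolding measure_def[of "mixture n u Q"] em'[OF S]
    using u by (intro enn2real_ennreal sum_nonneg mult_nonneg_nonneg) auto
qed

lemma mixture_kernel:
  assumes n: "n > 0" and u: "\<And>j Y. j < n \<Longrightarrow> 0 \<le> u Y j" "\<And>Y. (\<Sum>j<n. u Y j) = 1"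
    and um: "\<And>j. j < n \<Longrightarrow> (\<lambda>Y. u Y j) \<in> borel_measurable N"
    and Q: "\<And>j. j < n \<Longrightarrow> (\<lambda>Y. Q Y j) \<in> N \<rightarrow>\<^sub>M prob_algebra M"
  shows "(\<lambda>Y. mixture n (u Y) (Q Y)) \<in> N \<rightarrow>\<^sub>M prob_algebra M"
proof (rule measurable_prob_algebraI)
  have Qs: "Q Y j \<in> space (prob_algebra M)" if "Y \<in> space N" "j < n" for Y j
    using measurable_space[OF Q[OF that(2)] that(1)] .
  show p: "prob_space (mixture n (u Y) (Q Y))" if "Y \<in> space N" for Y
    by (rule mixture(3)[OF n u Qs[OF that]])
  show "(\<lambda>Y. mixture n (u Y) (Q Y)) \<in> N \<rightarrow>\<^sub>M subprob_algebra M"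
  proof (rule measurable_subprob_algebra)
    fix Y assume Y: "Y \<in> space N"
    show "subprob_space (mixture n (u Y) (Q Y))" by (rule prob_space_imp_subprob_space[OF p[OF Y]])
    show "sets (mixture n (u Y) (Q Y)) = sets M" by (rule mixture(1)[OF n u Qs[OF Y]])
  next
    fix A assume A: "A \<in> sets M"
    have "(\<lambda>Y. \<Sum>j<n. ennreal (u Y j) * emeasure (Q Y j) A) \<in> borel_measurable N"
    proof (intro borel_measurable_sum borel_measurable_times_ennreal)
      fix j assume "j \<in> {..<n}"
      then have j: "j < n" by simp
      show "(\<lambda>Y. ennreal (u Y j)) \<in> borel_measurable N" using um[OF j] by (rule measurable_compose[OF _ measurable_ennreal])
      show "(\<lambda>Y. emeasure (Q Y j) A) \<in> borel_measurable N"
        by (rule measurable_emeasure_kernel[OF measurable_prob_algebraD[OF Q[OF j]] A])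
    qed
    then show "(\<lambda>Y. emeasure (mixture n (u Y) (Q Y)) A) \<in> borel_measurable N"
      by (rule measurable_cong[THEN iffD1, rotated]) (rule mixture(2)[OF n u Qs A, symmetric])
  qed
qed

section \<open>The compatibility graph of the blocks and the weighted mean of their laws\<close>

definition compatible :: "'a set set \<Rightarrow> real \<Rightarrow> real \<Rightarrow> 'a measure \<Rightarrow> 'a measure \<Rightarrow> bool" where
  "compatible \<A> K \<sigma> P Q \<longleftrightarrow> (\<forall>A\<in>\<A>. measure P A \<le> K * measure Q A + \<sigma> \<and> measure Q A \<le> K * measure P A + \<sigma>)"

text \<open>Twice the positive part of the excess over one half, so that the weights fill [0, 1] and
  one changed neighbour moves them by at most 2 / k.\<close>

definition degree_weight :: "nat \<Rightarrow> (nat \<Rightarrow> nat \<Rightarrow> bool) \<Rightarrow> nat \<Rightarrow> real" where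
  "degree_weight k R j = max 0 (2 * real (card {i. i < k \<and> R j i}) / k - 1)"

lemma degree_weight_bounds: "0 \<le> degree_weight k R j" "degree_weight k R j \<le> 1"
proof -
  show "0 \<le> degree_weight k R j" by (simp add: degree_weight_def)
  have "card {i. i < k \<and> R j i} \<le> card {..<k}" by (rule card_mono) auto
  then have "2 * real (card {i. i < k \<and> R j i}) / k \<le> 2" by (cases "k = 0") (auto simp: divide_le_eq)
  then show "degree_weight k R j \<le> 1" by (simp add: degree_weight_def)
qed

lemma degree_weight_stable:
  assumes R: "\<And>i. i < k \<Longrightarrow> i \<noteq> j0 \<Longrightarrow> R j i = R' j i"
  shows "\<bar>degree_weight k R j - degree_weight k R' j\<bar> \<le> 2 / k"
proof -
  define a where "a R = card {i. i < k \<and> R j i}" for R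
  have le: "a R \<le> a R' + 1" if "\<And>i. i < k \<Longrightarrow> i \<noteq> j0 \<Longrightarrow> R j i = R' j i" for R R'
  proof -
    have "a R \<le> card (insert j0 {i. i < k \<and> R' j i})" unfolding a_def using that by (intro card_mono) auto
    also have "\<dots> \<le> a R' + 1" by (simp add: a_def card_insert_if)
    finally show ?thesis .
  qed
  have "real (a R) \<le> real (a R') + 1" "real (a R') \<le> real (a R) + 1"
    using le[of R R'] le[of R' R] R by fastforce+
  then have "2 * real (a R) / k \<le> (2 * real (a R') + 2) / k" "2 * real (a R') / k \<le> (2 * real (a R) + 2) / k"
    by (auto intro!: divide_right_mono)
  then show ?thesis unfolding degree_weight_def a_def[symmetric] add_divide_distrib by linarith
qed

lemma degree_weight_common:
  assumes "degree_weight k R j > 0" "degree_weight k R i > 0"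
  obtains l where "l < k" "R j l" "R i l"
proof -
  have k: "k > 0" using assms(1) by (cases "k = 0") (auto simp: degree_weight_def)
  have big: "2 * card {i. i < k \<and> R j i} > k" if "degree_weight k R j > 0" for j
  proof -
    have "2 * real (card {i. i < k \<and> R j i}) / k > 1" using that by (simp add: degree_weight_def max_def split: if_splits)
    then have "2 * real (card {i. i < k \<and> R j i}) > k" using k by (simp add: less_divide_eq)
    then show ?thesis by linarith
  qed
  have "{i. i < k \<and> R j i} \<inter> {l. l < k \<and> R i l} \<noteq> {}"
  proof
    assume "{i. i < k \<and> R j i} \<inter> {l. l < k \<and> R i l} = {}"
    then have "card ({i. i < k \<and> R j i} \<union> {l. l < k \<and> R i l}) = card {i. i < k \<and> R j i} + card {l. l < k \<and> R i l}"
      by (intro card_Un_disjoint) auto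
    moreover have "card ({i. i < k \<and> R j i} \<union> {l. l < k \<and> R i l}) \<le> card {..<k}" by (rule card_mono) auto
    ultimately show False using big[OF assms(1)] big[OF assms(2)] by simp
  qed
  then show thesis using that by blast
qed

lemma degree_weight_full:
  assumes "k > 0" "\<And>i. i < k \<Longrightarrow> R j i"
  shows "degree_weight k R j = 1"
proof -
  have "{i. i < k \<and> R j i} = {..<k}" using assms(2) by auto
  then show ?thesis using assms(1) by (simp add: degree_weight_def)
qed

text \<open>The additional index k stands for the default law, which does not depend on the
  data.\<close>

definition agg_weight :: "nat \<Rightarrow> real \<Rightarrow> (nat \<Rightarrow> nat \<Rightarrow> bool) \<Rightarrow> nat \<Rightarrow> real" where
  "agg_weight k \<epsilon> R j = (let V = (\<Sum>i<k. degree_weight k R i) in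
     if j < k then gate \<epsilon> k V * (degree_weight k R j / V) else 1 - gate \<epsilon> k V)"

definition agg :: "nat \<Rightarrow> real \<Rightarrow> (nat \<Rightarrow> nat \<Rightarrow> bool) \<Rightarrow> (nat \<Rightarrow> 'a measure) \<Rightarrow> 'a measure \<Rightarrow> 'a measure" where
  "agg k \<epsilon> R P r = mixture (Suc k) (agg_weight k \<epsilon> R) (\<lambda>j. if j < k then P j else r)"

lemma agg_weight:
  assumes k: "k > 0"
  shows "0 \<le> agg_weight k \<epsilon> R j" "(\<Sum>j<Suc k. agg_weight k \<epsilon> R j) = 1"
proof -
  define V where "V = (\<Sum>i<k. degree_weight k R i)"
  have V0: "V \<ge> 0" unfolding V_def by (intro sum_nonneg degree_weight_bounds)
  have w: "agg_weight k \<epsilon> R j = (if j < k then gate \<epsilon> k V * (degree_weight k R j / V) else 1 - gate \<epsilon> k V)" for j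
    by (simp add: agg_weight_def V_def Let_def)
  show "0 \<le> agg_weight k \<epsilon> R j"
    unfolding w using gate_bounds[of \<epsilon> k V] V0 degree_weight_bounds(1)[of k R j] by simp
  have "(\<Sum>j<Suc k. agg_weight k \<epsilon> R j) = (\<Sum>j<k. gate \<epsilon> k V * (degree_weight k R j / V)) + (1 - gate \<epsilon> k V)"
    by (simp add: w)
  also have "(\<Sum>j<k. gate \<epsilon> k V * (degree_weight k R j / V)) = gate \<epsilon> k V * (V / V)"
    by (simp add: V_def sum_distrib_left[symmetric] sum_divide_distrib[symmetric])
  \<comment> \<open>If V = 0, the gate vanishes because k > 0, so the value 0 / 0 = 0 does no harm
    and all the mass goes to the default law.\<close>
  also have "\<dots> = gate \<epsilon> k V" using k by (cases "V = 0") (auto simp: gate_def)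
  finally show "(\<Sum>j<Suc k. agg_weight k \<epsilon> R j) = 1" by simp
qed

lemma agg:
  assumes k: "k > 0" and P: "\<And>j. j < k \<Longrightarrow> P j \<in> space (prob_algebra M)" and r: "r \<in> space (prob_algebra M)"
  shows "sets (agg k \<epsilon> R P r) = sets M" "prob_space (agg k \<epsilon> R P r)"
    and "S \<in> sets M \<Longrightarrow> measure (agg k \<epsilon> R P r) S =
      gate \<epsilon> k (\<Sum>i<k. degree_weight k R i) * ((\<Sum>j<k. degree_weight k R j * measure (P j) S) / (\<Sum>i<k. degree_weight k R i))
      + (1 - gate \<epsilon> k (\<Sum>i<k. degree_weight k R i)) * measure r S"
proof -
  have Q: "(if j < k then P j else r) \<in> space (prob_algebra M)" for j using P r by simp
  note m = mixture[where u = "agg_weight k \<epsilon> R", OF zero_less_Suc agg_weight[OF k] Q]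
  show "sets (agg k \<epsilon> R P r) = sets M" unfolding agg_def by (rule m(1))
  show "prob_space (agg k \<epsilon> R P r)" unfolding agg_def by (rule m(3))
  assume S: "S \<in> sets M"
  define V where "V = (\<Sum>i<k. degree_weight k R i)"
  have "measure (agg k \<epsilon> R P r) S = (\<Sum>j<Suc k. agg_weight k \<epsilon> R j * measure (if j < k then P j else r) S)"
    unfolding agg_def by (rule m(4)[OF S])
  also have "\<dots> = (\<Sum>j<k. gate \<epsilon> k V * (degree_weight k R j * measure (P j) S / V)) + (1 - gate \<epsilon> k V) * measure r S"
    by (simp add: agg_weight_def Let_def V_def mult.assoc)
  also have "\<dots> = gate \<epsilon> k V * ((\<Sum>j<k. degree_weight k R j * measure (P j) S) / V) + (1 - gate \<epsilon> k V) * measure r S"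
    by (simp only: sum_distrib_left sum_divide_distrib)
  finally show "measure (agg k \<epsilon> R P r) S =
      gate \<epsilon> k (\<Sum>i<k. degree_weight k R i) * ((\<Sum>j<k. degree_weight k R j * measure (P j) S) / (\<Sum>i<k. degree_weight k R i))
      + (1 - gate \<epsilon> k (\<Sum>i<k. degree_weight k R i)) * measure r S" unfolding V_def .
qed

lemma agg_kernel:
  assumes k: "k > 0" and P: "\<And>j. j < k \<Longrightarrow> (\<lambda>Y. P Y j) \<in> N \<rightarrow>\<^sub>M prob_algebra M" and r: "r \<in> space (prob_algebra M)"
    and R: "\<And>i j. i < k \<Longrightarrow> j < k \<Longrightarrow> {Y \<in> space N. R Y i j} \<in> sets N"
  shows "(\<lambda>Y. agg k \<epsilon> (R Y) (P Y) r) \<in> N \<rightarrow>\<^sub>M prob_algebra M"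
proof -
  have dm: "(\<lambda>Y. degree_weight k (R Y) j) \<in> borel_measurable N" if j: "j < k" for j
  proof -
    have "real (card {i. i < k \<and> R Y j i}) = (\<Sum>i<k. indicator {Y \<in> space N. R Y j i} Y)" if "Y \<in> space N" for Y
    proof -
      have "real (card {i. i < k \<and> R Y j i}) = (\<Sum>i\<in>{i. i < k \<and> R Y j i}. 1)" by simp
      also have "\<dots> = (\<Sum>i<k. indicator {Y \<in> space N. R Y j i} Y)"
        using that by (intro sum.mono_neutral_cong_left) (auto simp: indicator_def)
      finally show ?thesis .
    qed
    moreover have "(\<lambda>Y. \<Sum>i<k. indicator {Y \<in> space N. R Y j i} Y :: real) \<in> borel_measurable N"
      using R[OF j] by (intro borel_measurable_sum borel_measurable_indicator) auto
    ultimately have [measurable]: "(\<lambda>Y. real (card {i. i < k \<and> R Y j i})) \<in> borel_measurable N"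
      by (subst measurable_cong) auto
    show ?thesis unfolding degree_weight_def by measurable
  qed
  have Vm[measurable]: "(\<lambda>Y. \<Sum>i<k. degree_weight k (R Y) i) \<in> borel_measurable N"
    by (intro borel_measurable_sum dm) simp
  have gm: "(\<lambda>Y. gate \<epsilon> k (\<Sum>i<k. degree_weight k (R Y) i)) \<in> borel_measurable N"
    unfolding gate_def sigmoid_def by measurable
  show ?thesis unfolding agg_def
  proof (rule mixture_kernel)
    show "(\<lambda>Y. if j < k then P Y j else r) \<in> N \<rightarrow>\<^sub>M prob_algebra M" for j using P r by (cases "j < k") simp_all
    show "(\<lambda>Y. agg_weight k \<epsilon> (R Y) j) \<in> borel_measurable N" for j
      using dm[of j] gm Vm by (cases "j < k") (simp_all add: agg_weight_def Let_def)
  qed (use agg_weight[OF k] in auto)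
qed

lemma compatible_measurable:
  assumes A: "countable \<A>" "\<A> \<subseteq> sets M" and P: "P \<in> N \<rightarrow>\<^sub>M prob_algebra M" and Q: "Q \<in> N \<rightarrow>\<^sub>M prob_algebra M"
  shows "{Y \<in> space N. compatible \<A> K \<sigma> (P Y) (Q Y)} \<in> sets N"
proof -
  have s: "{Y \<in> space N. measure (P Y) B \<le> K * measure (Q Y) B + \<sigma> \<and> measure (Q Y) B \<le> K * measure (P Y) B + \<sigma>} \<in> sets N"
    if B: "B \<in> \<A>" for B
  proof -
  have m: "(\<lambda>Y. measure (P Y) B) \<in> borel_measurable N" if "P \<in> N \<rightarrow>\<^sub>M prob_algebra M" for P
  proof -
    have "B \<in> sets M" using B A(2) by blast
    then have [measurable]: "(\<lambda>Y. emeasure (P Y) B) \<in> borel_measurable N"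
      by (rule measurable_emeasure_kernel[OF measurable_prob_algebraD[OF that]])
    show ?thesis unfolding measure_def by measurable
  qed
  note [measurable] = m[OF P] m[OF Q]
  show ?thesis by measurable
  qed
  have "{Y \<in> space N. compatible \<A> K \<sigma> (P Y) (Q Y)} = space N \<inter> (\<Inter>B\<in>\<A>. {Y \<in> space N.
    measure (P Y) B \<le> K * measure (Q Y) B + \<sigma> \<and> measure (Q Y) B \<le> K * measure (P Y) B + \<sigma>})"
    by (auto simp: compatible_def)
  also have "\<dots> \<in> sets N"
  proof (cases "\<A> = {}")
    case False
    then show ?thesis using A(1) s by (intro sets.Int sets.top sets.countable_INT') auto
  qed simp
  finally show ?thesis .
qed

text \<open>The hypothesis \<open>ext\<close> lifts compatibility from the test family to all
  measurable sets. Two blocks of positive weight have a common compatible block, so their laws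
  compare with factor K^2 and error K \<sigma> + \<sigma>; these are the parameters handed to
  \<open>weighted_mean_stable\<close>.\<close>

lemma agg_private:
  assumes ext: "\<And>p q S. p \<in> space (prob_algebra M) \<Longrightarrow> q \<in> space (prob_algebra M) \<Longrightarrow> compatible \<A> K \<sigma> p q \<Longrightarrow> S \<in> sets M \<Longrightarrow>
      measure p S \<le> K * measure q S + \<sigma>"
    and j0: "j0 < k" and P: "\<And>j. j < k \<Longrightarrow> P j \<in> space (prob_algebra M)" and P': "\<And>j. j < k \<Longrightarrow> P' j \<in> space (prob_algebra M)"
    and r: "r \<in> space (prob_algebra M)" and PP: "\<And>j. j < k \<Longrightarrow> j \<noteq> j0 \<Longrightarrow> P' j = P j"
    and K: "K \<ge> 0" and \<sigma>: "\<sigma> \<ge> 0" and e: "0 < \<epsilon>" "\<epsilon> \<le> 1" and k: "k \<ge> 48 * (1 + K\<^sup>2) / \<epsilon>"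
    and small: "exp (1/4) * exp (- (\<epsilon> * k / 48)) \<le> \<delta>" "2 * ((K + 1) * \<sigma>) \<le> \<delta>" and S: "S \<in> sets M"
  shows "measure (agg k \<epsilon> (\<lambda>i j. compatible \<A> K \<sigma> (P i) (P j)) P r) S
    \<le> exp \<epsilon> * measure (agg k \<epsilon> (\<lambda>i j. compatible \<A> K \<sigma> (P' i) (P' j)) P' r) S + \<delta>"
proof -
  define R where "R = (\<lambda>i j. compatible \<A> K \<sigma> (P i) (P j))"
  define R' where "R' = (\<lambda>i j. compatible \<A> K \<sigma> (P' i) (P' j))"
  define w where "w = degree_weight k R"
  define w' where "w' = degree_weight k R'"
  have k0: "k > 0" using j0 by simp
  have w01: "0 \<le> w j \<and> w j \<le> 1" and w01': "0 \<le> w' j \<and> w' j \<le> 1" for j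
    by (simp_all add: w_def w'_def degree_weight_bounds)
  have dw: "\<bar>w j - w' j\<bar> \<le> 2 / k" if "j < k" "j \<noteq> j0" for j
    unfolding w_def w'_def
  proof (rule degree_weight_stable)
    show "R j i = R' j i" if "i < k" "i \<noteq> j0" for i
      using that PP[OF \<open>j < k\<close> \<open>j \<noteq> j0\<close>] PP[OF that] by (simp add: R_def R'_def)
  qed
  then have dw': "\<bar>w' j - w j\<bar> \<le> 2 / k" if "j < k" "j \<noteq> j0" for j using that by (simp add: abs_minus_commute)
  have close: "measure (P i) S \<le> K\<^sup>2 * measure (P j) S + (K + 1) * \<sigma>" if ij: "i < k" "j < k" "w i > 0" "w j > 0" for i j
  proof -
    obtain l where l: "l < k" "R i l" "R j l" using degree_weight_common[of k R i j] ij by (auto simp: w_def)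
    have "compatible \<A> K \<sigma> (P l) (P j)" using l(3) by (auto simp: R_def compatible_def)
    then have 1: "measure (P l) S \<le> K * measure (P j) S + \<sigma>" using ext[OF P[OF l(1)] P[OF ij(2)] _ S] by simp
    have "measure (P i) S \<le> K * measure (P l) S + \<sigma>" using ext[OF P[OF ij(1)] P[OF l(1)] _ S] l(2) by (simp add: R_def)
    also have "\<dots> \<le> K * (K * measure (P j) S + \<sigma>) + \<sigma>" using 1 K by (intro add_right_mono mult_left_mono)
    finally show ?thesis by (simp add: power2_eq_square algebra_simps)
  qed
  have m1: "measure (P j) S \<le> 1" if "j < k" for j
    using P[OF that] by (auto simp: space_prob_algebra intro: prob_space.prob_le_1)
  have r1: "measure r S \<le> 1" using r by (auto simp: space_prob_algebra intro: prob_space.prob_le_1)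
  have c: "0 \<le> (K + 1) * \<sigma>" using K \<sigma> by simp
  have le1: "(\<Sum>j<k. w j * measure (P j) S) / (\<Sum>j<k. w j) \<le> 1"
  proof -
    have "(\<Sum>j<k. w j * measure (P j) S) \<le> (\<Sum>j<k. w j)" using w01 m1 by (intro sum_mono mult_left_le) auto
    moreover have "0 \<le> (\<Sum>j<k. w j)" using w01 by (intro sum_nonneg) auto
    ultimately show ?thesis by (auto simp: divide_le_eq_1)
  qed
  have nn: "0 \<le> (\<Sum>j<k. w j * measure (P j) S) / (\<Sum>j<k. w j)" "0 \<le> (\<Sum>j<k. w' j * measure (P' j) S) / (\<Sum>j<k. w' j)"
    using w01 w01' by (auto intro!: divide_nonneg_nonneg sum_nonneg mult_nonneg_nonneg)
  have "gate \<epsilon> k (\<Sum>j<k. w j) * ((\<Sum>j<k. w j * measure (P j) S) / (\<Sum>j<k. w j)) + (1 - gate \<epsilon> k (\<Sum>j<k. w j)) * measure r S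
    \<le> exp \<epsilon> * (gate \<epsilon> k (\<Sum>j<k. w' j) * ((\<Sum>j<k. w' j * measure (P' j) S) / (\<Sum>j<k. w' j)) + (1 - gate \<epsilon> k (\<Sum>j<k. w' j)) * measure r S) + \<delta>"
  proof (rule gated_mixture_private[OF e _ _ nn(1) le1 nn(2) _ r1 _ small c])
    show "(\<Sum>j<k. w j) \<le> (\<Sum>j<k. w' j) + 3" by (rule weight_sum_stable[OF j0 w01 w01' dw])
    show "(\<Sum>j<k. w' j) \<le> (\<Sum>j<k. w j) + 3" by (rule weight_sum_stable[OF j0 w01' w01 dw'])
    show "(\<Sum>j<k. w j * measure (P j) S) / (\<Sum>j<k. w j) \<le> exp (\<epsilon> / 4) * ((\<Sum>j<k. w' j * measure (P' j) S) / (\<Sum>j<k. w' j)) + (K + 1) * \<sigma>"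
      if "real k / 2 \<le> (\<Sum>j<k. w j)" "real k / 2 \<le> (\<Sum>j<k. w' j)"
      by (rule weighted_mean_stable[OF j0 w01 w01' dw _ measure_nonneg measure_nonneg close _ c e k that])
        (use PP K in auto)
  qed simp
  moreover have "measure (agg k \<epsilon> R P r) S =
      gate \<epsilon> k (\<Sum>j<k. w j) * ((\<Sum>j<k. w j * measure (P j) S) / (\<Sum>j<k. w j)) + (1 - gate \<epsilon> k (\<Sum>j<k. w j)) * measure r S"
    unfolding w_def by (rule agg(3)[where M = M]) (use k0 P r S in auto)
  moreover have "measure (agg k \<epsilon> R' P' r) S =
      gate \<epsilon> k (\<Sum>j<k. w' j) * ((\<Sum>j<k. w' j * measure (P' j) S) / (\<Sum>j<k. w' j)) + (1 - gate \<epsilon> k (\<Sum>j<k. w' j)) * measure r S"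
    unfolding w'_def by (rule agg(3)[where M = M]) (use k0 P' r S in auto)
  ultimately show ?thesis unfolding R_def R'_def by simp
qed

text \<open>All weights are 1 and their total is k, so the mean is uniform and the only error is the
  mass 1 - gate left to the default law.\<close>

lemma agg_full:
  assumes k: "k > 0" and P: "\<And>j. j < k \<Longrightarrow> P j \<in> space (prob_algebra M)" and r: "r \<in> space (prob_algebra M)"
    and R: "\<And>i j. i < k \<Longrightarrow> j < k \<Longrightarrow> R i j" and S: "S \<in> sets M"
  shows "\<bar>measure (agg k \<epsilon> R P r) S - (\<Sum>j<k. measure (P j) S) / k\<bar> \<le> exp (- (\<epsilon> * k / 48))"
proof -
  define m where "m = (\<Sum>j<k. measure (P j) S) / k"
  have w: "degree_weight k R j = 1" if "j < k" for j using degree_weight_full[of k R j] k R that by simp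
  have P1: "measure (P j) S \<le> 1" if "j < k" for j
    using P[OF that] by (auto simp: space_prob_algebra intro: prob_space.prob_le_1)
  have r1: "measure r S \<le> 1" using r by (auto simp: space_prob_algebra intro: prob_space.prob_le_1)
  have "(\<Sum>j<k. measure (P j) S) \<le> (\<Sum>j<k. 1)" using P1 by (intro sum_mono) auto
  then have m: "0 \<le> m" "m \<le> 1" using k by (auto simp: m_def divide_le_eq_1 intro!: divide_nonneg_nonneg sum_nonneg)
  have "measure (agg k \<epsilon> R P r) S = gate \<epsilon> k k * m + (1 - gate \<epsilon> k k) * measure r S"
    using agg(3)[where M = M and \<epsilon> = \<epsilon> and R = R and r = r and P = P and k = k and S = S] k P r S by (simp add: w m_def)
  then have "measure (agg k \<epsilon> R P r) S - m = (1 - gate \<epsilon> k k) * (measure r S - m)" by (simp add: algebra_simps)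
  moreover have "\<bar>measure r S - m\<bar> \<le> 1" using m r1 measure_nonneg[of r S] by linarith
  then have "\<bar>(1 - gate \<epsilon> k k) * (measure r S - m)\<bar> \<le> (1 - gate \<epsilon> k k) * 1"
    unfolding abs_mult using gate_bounds[of \<epsilon> k k] by (intro mult_mono) auto
  ultimately show ?thesis using gate_full[of \<epsilon> k] by (simp add: m_def)
qed

section \<open>The sampler\<close>

definition block_of :: "nat \<Rightarrow> (nat \<Rightarrow> 'a) \<Rightarrow> nat \<Rightarrow> nat \<Rightarrow> 'a" where
  "block_of l Y j = (\<lambda>i\<in>{..<l}. Y (j * l + i))"

lemma block_index:
  assumes "j < k" "i < l" shows "j * l + i < k * (l::nat)"
proof -
  have "j * l + i < Suc j * l" using assms(2) by simp
  also have "\<dots> \<le> k * l" using assms(1) by (intro mult_le_mono1) simp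
  finally show ?thesis .
qed

lemma block_of_measurable: "j < k \<Longrightarrow> (\<lambda>Y. block_of l Y j) \<in> PiM {..<k * l} (\<lambda>_. M) \<rightarrow>\<^sub>M PiM {..<l} (\<lambda>_. M)"
  unfolding block_of_def by (intro measurable_restrict measurable_component_singleton) (simp add: block_index)

lemma distr_block_of:
  assumes M: "prob_space M" and j: "j < k"
  shows "distr (PiM {..<k * l} (\<lambda>_. M)) (PiM {..<l} (\<lambda>_. M)) (\<lambda>Y. block_of l Y j) = PiM {..<l} (\<lambda>_. M)"
  unfolding block_of_def
  by (rule distr_PiM_reindex[of "{..<k * l}" "\<lambda>_. M" "\<lambda>i. j * l + i" "{..<l}"])
    (use M j in \<open>auto simp: inj_on_def block_index\<close>)

definition gauss_sampler :: "nat \<Rightarrow> nat \<Rightarrow> nat \<Rightarrow> real \<Rightarrow> real \<Rightarrow> real \<Rightarrow> (nat \<Rightarrow> (nat \<Rightarrow> real) set) \<Rightarrow>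
    (nat \<Rightarrow> nat \<Rightarrow> real) \<Rightarrow> (nat \<Rightarrow> real) measure" where
  "gauss_sampler d b k \<epsilon> K \<sigma> B Y = agg k \<epsilon>
     (\<lambda>i j. compatible (test_sets (lborel_dim d) B) K \<sigma> (block_law b d (block_of (2 * b) Y i)) (block_law b d (block_of (2 * b) Y j)))
     (\<lambda>j. block_law b d (block_of (2 * b) Y j)) (return (lborel_dim d) (\<lambda>i\<in>{..<d}. 0))"

lemma origin_law: "return (lborel_dim d) (\<lambda>i\<in>{..<d}. 0) \<in> space (prob_algebra (lborel_dim d))"
proof -
  have "(\<lambda>i\<in>{..<d}. 0) \<in> space (lborel_dim d)" by (simp add: lborel_dim_def space_PiM)
  then show ?thesis by (simp add: space_prob_algebra prob_space_return)
qed

lemma block_law_prob: "block_law b d X \<in> space (prob_algebra (lborel_dim d))"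
  unfolding space_prob_algebra block_law_def
  using prob_space.prob_space_distr[OF prob_space_stdg block_law_map_measurable] by simp

lemma gauss_sampler_kernel:
  assumes k: "k > 0" and B: "\<And>i. B i \<in> sets (lborel_dim d)"
  shows "gauss_sampler d b k \<epsilon> K \<sigma> B \<in> PiM {..<k * (2 * b)} (\<lambda>_. lborel_dim d) \<rightarrow>\<^sub>M prob_algebra (lborel_dim d)"
proof -
  have P: "(\<lambda>Y. block_law b d (block_of (2 * b) Y j)) \<in> PiM {..<k * (2 * b)} (\<lambda>_. lborel_dim d) \<rightarrow>\<^sub>M prob_algebra (lborel_dim d)" if "j < k" for j
    by (rule measurable_compose[OF block_of_measurable[OF that] block_law_measurable])
  have "(\<lambda>Y. gauss_sampler d b k \<epsilon> K \<sigma> B Y) \<in> PiM {..<k * (2 * b)} (\<lambda>_. lborel_dim d) \<rightarrow>\<^sub>M prob_algebra (lborel_dim d)"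
    unfolding gauss_sampler_def
  proof (rule agg_kernel[OF k P origin_law])
    fix i j assume ij: "i < k" "j < k"
    show "{Y \<in> space (PiM {..<k * (2 * b)} (\<lambda>_. lborel_dim d)). compatible (test_sets (lborel_dim d) B) K \<sigma>
        (block_law b d (block_of (2 * b) Y i)) (block_law b d (block_of (2 * b) Y j))} \<in> sets (PiM {..<k * (2 * b)} (\<lambda>_. lborel_dim d))"
      by (rule compatible_measurable[OF countable_test_sets test_sets_sets[OF B] P[OF ij(1)] P[OF ij(2)]])
  qed
  then show ?thesis by simp
qed

lemma gauss_sampler_private:
  assumes B: "\<And>i. B i \<in> sets (lborel_dim d)" and gen: "sets (lborel_dim d) = sigma_sets (space (lborel_dim d)) (range B)"
    and K: "K \<ge> 0" and \<sigma>: "\<sigma> \<ge> 0" and e: "0 < \<epsilon>" "\<epsilon> \<le> 1" and k: "k \<ge> 48 * (1 + K\<^sup>2) / \<epsilon>"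
    and small: "exp (1/4) * exp (- (\<epsilon> * k / 48)) \<le> \<delta>" "2 * ((K + 1) * \<sigma>) \<le> \<delta>"
  shows "differentially_private \<epsilon> \<delta> (lborel_dim d) (k * (2 * b)) (gauss_sampler d b k \<epsilon> K \<sigma> B)"
  unfolding differentially_private_def
proof (intro ballI impI)
  fix Y Y' :: "nat \<Rightarrow> nat \<Rightarrow> real" and S assume S: "S \<in> sets (lborel_dim d)" and nb: "neighbors (k * (2 * b)) Y Y'"
  obtain i0 where i0: "{i \<in> {..<k * (2 * b)}. Y i \<noteq> Y' i} = {i0}"
    by (rule card_1_singletonE[OF nb[unfolded neighbors_def]])
  have "i0 \<in> {i \<in> {..<k * (2 * b)}. Y i \<noteq> Y' i}" unfolding i0 by simp
  then have i0k: "i0 < k * (2 * b)" by simp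
  have eq: "Y' i = Y i" if "i < k * (2 * b)" "i \<noteq> i0" for i
  proof (rule ccontr)
    assume "Y' i \<noteq> Y i"
    then have "i \<in> {i \<in> {..<k * (2 * b)}. Y i \<noteq> Y' i}" using that(1) by simp
    then show False using that(2) unfolding i0 by simp
  qed
  \<comment> \<open>A single data point belongs to a single block, so neighbouring datasets give
    families of block laws that differ at one index only.\<close>
  define j0 where "j0 = i0 div (2 * b)"
  have b2: "2 * b > 0" using i0k by (cases "b = 0") auto
  have j0: "j0 < k" unfolding j0_def using i0k by (simp add: less_mult_imp_div_less)
  have bl: "block_of (2 * b) Y' j = block_of (2 * b) Y j" if j: "j < k" "j \<noteq> j0" for j
    unfolding block_of_def
  proof (rule restrict_ext)
    fix i assume "i \<in> {..<2 * b}"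
    then have i: "i < 2 * b" by simp
    have "(j * (2 * b) + i) div (2 * b) = j" using i b2 by simp
    then have "j * (2 * b) + i \<noteq> i0" using j(2) by (auto simp: j0_def)
    then show "Y' (j * (2 * b) + i) = Y (j * (2 * b) + i)" using eq block_index[OF j(1) i] by simp
  qed
  show "measure (gauss_sampler d b k \<epsilon> K \<sigma> B Y) S \<le> exp \<epsilon> * measure (gauss_sampler d b k \<epsilon> K \<sigma> B Y') S + \<delta>"
    unfolding gauss_sampler_def
  proof (rule agg_private[where M = "lborel_dim d" and P = "\<lambda>j. block_law b d (block_of (2 * b) Y j)" and P' = "\<lambda>j. block_law b d (block_of (2 * b) Y' j)"
        and S = S and K = K and \<sigma> = \<sigma> and \<delta> = \<delta> and \<epsilon> = \<epsilon> and k = k and ?j0.0 = j0])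
    show "measure p A \<le> K * measure q A + \<sigma>"
      if pq: "p \<in> space (prob_algebra (lborel_dim d))" "q \<in> space (prob_algebra (lborel_dim d))"
        "compatible (test_sets (lborel_dim d) B) K \<sigma> p q" and A: "A \<in> sets (lborel_dim d)" for p q A
    proof (rule test_sets_ineq_extend[OF B gen _ _ _ _ _ K A])
      show "prob_space p" "sets p = sets (lborel_dim d)" "prob_space q" "sets q = sets (lborel_dim d)"
        using pq by (auto simp: space_prob_algebra)
      show "measure p C \<le> K * measure q C + \<sigma>" if "C \<in> test_sets (lborel_dim d) B" for C
        using pq(3) that by (simp add: compatible_def)
    qed
    show "block_law b d (block_of (2 * b) Y' j) = block_law b d (block_of (2 * b) Y j)" if "j < k" "j \<noteq> j0" for j
      using bl[OF that] by simp
  qed (rule j0 block_law_prob origin_law K \<sigma> e k small S)+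
qed

context gaussian_block begin

text \<open>Passing through the common reference Gaussian squares the factor 4 exp 6 and adds its
  multiple of the error once more; this is the origin of K and \<sigma> in the sampler.\<close>

lemma good_block_compatible:
  assumes X: "X \<in> good_block \<tau>" "X' \<in> good_block \<tau>" and t: "\<tau> > 0" "\<tau> \<le> 1/100" "2 * d * exp (- L / 16) \<le> \<tau>" and A: "A \<in> sets (lborel_dim d)"
  shows "measure (block_law b d X) A \<le> 16 * exp 12 * measure (block_law b d X') A + 1000 * (4 * exp 6 + 1) * \<tau>"
proof -
  interpret P: prob_space "block_law b d X" using block_law_prob[of b d X] by (simp add: space_prob_algebra)
  interpret P': prob_space "block_law b d X'" using block_law_prob[of b d X'] by (simp add: space_prob_algebra)
  define r where "r = emeasure (distr (stdg {..<d}) (leb {..<d}) (\<lambda>w. \<lambda>j\<in>{..<d}. sqrt (1 - 1 / real (2 * b)) * w j)) A"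
  note A' = A[unfolded lborel_dim_eq]
  have "emeasure (block_law b d X) A \<le> ennreal (4 * exp 6) * r + ennreal (1000 * \<tau>)"
    unfolding r_def by (rule block_law_close_ref(1)[OF X(1) t A'])
  also have "\<dots> \<le> ennreal (4 * exp 6) * (ennreal (4 * exp 6) * emeasure (block_law b d X') A + ennreal (1000 * \<tau>)) + ennreal (1000 * \<tau>)"
    unfolding r_def by (intro add_right_mono mult_left_mono block_law_close_ref(2)[OF X(2) t A']) simp
  also have "\<dots> = ennreal (4 * exp 6 * (4 * exp 6 * P'.prob A + 1000 * \<tau>) + 1000 * \<tau>)"
    unfolding P'.emeasure_eq_measure using t(1) by (simp add: ennreal_mult ennreal_plus)
  finally have "P.prob A \<le> 4 * exp 6 * (4 * exp 6 * P'.prob A + 1000 * \<tau>) + 1000 * \<tau>"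
    unfolding P.emeasure_eq_measure using t(1) by (subst (asm) ennreal_le_iff) auto
  also have "\<dots> = 16 * (exp 6 * exp 6) * P'.prob A + 1000 * (4 * exp 6 + 1) * \<tau>" by (simp add: algebra_simps)
  also have "exp 6 * exp 6 = exp (12::real)" by (simp add: mult_exp_exp)
  finally show ?thesis .
qed

text \<open>The uniform mean of the block laws has exactly the law D on average, so no estimation
  error has to be controlled. The sampler differs from this mean by at most \<alpha> / 2 when all
  blocks are typical, and some block is untypical with probability at most \<alpha> / 2.\<close>

lemma gauss_sampler_accurate:
  assumes t: "\<tau> > 0" "\<tau> \<le> 1/100" "2 * d * exp (- L / 16) \<le> \<tau>" and k: "k > 0" and B: "\<And>i. B i \<in> sets (lborel_dim d)"
    and err: "exp (- (\<epsilon> * k / 48)) \<le> \<alpha> / 2" "k * (21 * (real d)\<^sup>2 * exp (- L / 8) / \<tau>) \<le> \<alpha> / 2"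
  shows "accurate \<alpha> (gaussians d) (k * (2 * b)) (gauss_sampler d b k \<epsilon> (16 * exp 12) (1000 * (4 * exp 6 + 1) * \<tau>) B)"
  unfolding accurate_def
proof
  fix D assume "D \<in> gaussians d"
  then obtain \<mu> \<Sigma> where D: "D = gaussian d \<mu> \<Sigma>" "\<mu> \<in> carrier_vec d" "positive_definite d \<Sigma>" by (auto simp: gaussians_def)
  obtain a where Da: "gaussian d \<mu> \<Sigma> = distr (stdg {..<d}) (lborel_dim d) (affine_map d (vec_index \<mu>) a)"
    by (rule gaussian_eq_distr[OF D(2,3)])
  define M where "M = lborel_dim d"
  define T where "T = affine_map d (vec_index \<mu>) a"
  define l where "l = 2 * b"
  define n where "n = k * l"
  define K where "K = 16 * exp (12::real)"
  define \<sigma> where "\<sigma> = 1000 * (4 * exp 6 + 1) * \<tau>"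
  define A where "A = gauss_sampler d b k \<epsilon> K \<sigma> B"
  have DT: "D = distr (stdg {..<d}) M T" unfolding D(1) Da M_def T_def ..
  have sM: "sets (stdg {..<d}) = sets M" by (simp add: sets_stdg lborel_dim_eq M_def)
  have spM: "space (stdg {..<d}) = space M" by (rule sets_eq_imp_space_eq[OF sM])
  have Tl: "T \<in> M \<rightarrow>\<^sub>M M" unfolding T_def M_def lborel_dim_eq by (rule affine_map_measurable)
  have Tm: "T \<in> stdg {..<d} \<rightarrow>\<^sub>M M" using Tl measurable_cong_sets[OF sM refl, of M] by blast
  have sD: "sets D = sets M" by (simp add: DT)
  have pD: "prob_space D" unfolding DT by (rule prob_space.prob_space_distr[OF prob_space_stdg Tm])
  have TD: "T \<in> stdg {..<d} \<rightarrow>\<^sub>M D" using Tm measurable_cong_sets[OF refl sD, of "stdg {..<d}"] by blast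
  have dD: "distr (stdg {..<d}) D T = D" unfolding DT by (rule distr_cong) auto
  interpret N: prob_space "stdmat n d" by (rule prob_space_stdmat)
  have sn: "sets (stdmat n d) = sets (PiM {..<n} (\<lambda>_. M))" by (intro sets_PiM_cong refl sM)
  have Am: "A \<in> PiM {..<n} (\<lambda>_. M) \<rightarrow>\<^sub>M prob_algebra M"
    unfolding A_def M_def n_def l_def by (rule gauss_sampler_kernel[OF k B])
  \<comment> \<open>The unknown Gaussian data are realised as affine images of standard data, so
    that typicality can be stated for the latter.\<close>
  define \<Phi> where "\<Phi> X = (\<lambda>i\<in>{..<n}. T (X i))" for X
  have \<Phi>m: "\<Phi> \<in> stdmat n d \<rightarrow>\<^sub>M PiM {..<n} (\<lambda>_. M)"
    unfolding \<Phi>_def[abs_def] by (intro measurable_restrict measurable_compose[OF _ Tm] measurable_component_singleton)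
  have PD: "PiM {..<n} (\<lambda>_. D) = distr (stdmat n d) (PiM {..<n} (\<lambda>_. M)) \<Phi>"
  proof -
    have "PiM {..<n} (\<lambda>_. D) = distr (stdmat n d) (PiM {..<n} (\<lambda>_. D)) (compose {..<n} T)"
      using distr_PiM_finite_prob_space'[of "{..<n}" "\<lambda>_. stdg {..<d}" "\<lambda>_. D" T] prob_space_stdg pD TD by (simp add: dD)
    also have "\<dots> = distr (stdmat n d) (PiM {..<n} (\<lambda>_. M)) \<Phi>"
    proof (rule distr_cong[OF refl])
      show "sets (PiM {..<n} (\<lambda>_. D)) = sets (PiM {..<n} (\<lambda>_. M))" by (intro sets_PiM_cong refl sD)
    qed (simp add: \<Phi>_def compose_def)
    finally show ?thesis .
  qed
  have out: "measure (output_dist n A D) S = (\<integral>X. measure (A (\<Phi> X)) S \<partial>stdmat n d)" if S: "S \<in> sets M" for S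
  proof -
    have mm: "(\<lambda>Y. measure (A Y) S) \<in> borel_measurable (PiM {..<n} (\<lambda>_. M))"
      by (rule measurable_compose[OF Am measurable_measure_prob_algebra[OF S]])
    have sDn: "sets (PiM {..<n} (\<lambda>_. D)) = sets (PiM {..<n} (\<lambda>_. M))" by (intro sets_PiM_cong refl sD)
    interpret Dn: prob_space "PiM {..<n} (\<lambda>_. D)" by (intro prob_space_PiM pD)
    have "A \<in> PiM {..<n} (\<lambda>_. D) \<rightarrow>\<^sub>M subprob_algebra M"
      using measurable_prob_algebraD[OF Am] measurable_cong_sets[OF sDn refl, of "subprob_algebra M"] by blast
    then have "measure (output_dist n A D) S = (\<integral>Y. measure (A Y) S \<partial>PiM {..<n} (\<lambda>_. D))"
      unfolding output_dist_def using S by (rule Dn.measure_bind)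
    also have "\<dots> = (\<integral>X. measure (A (\<Phi> X)) S \<partial>stdmat n d)"
      unfolding PD by (rule integral_distr[OF \<Phi>m mm])
    finally show ?thesis .
  qed
  have "\<bar>measure D S - measure (output_dist n A D) S\<bar> \<le> \<alpha>" if "S \<in> sets D" for S
  proof -
    have S: "S \<in> sets M" using that sD by simp
    \<comment> \<open>By equivariance, the block law of transformed data on V is the block law of
      the standard data on the preimage \<open>U V\<close>.\<close>
    define U where "U V = T -` V \<inter> space M" for V
    have Um: "U V \<in> sets M" if "V \<in> sets M" for V unfolding U_def by (rule measurable_sets[OF Tl that])
    define p where "p X j = block_law b d (block_of l X j)" for X j
    have pT: "measure (p (\<Phi> X) j) V = measure (p X j) (U V)" if j: "j < k" and V: "V \<in> sets M" for X j V
    proof -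
      have "block_of l (\<Phi> X) j = (\<lambda>i\<in>{..<l}. T (block_of l X j i))"
        unfolding block_of_def \<Phi>_def n_def using block_index[OF j] by (intro restrict_ext) auto
      then have "emeasure (p (\<Phi> X) j) V = emeasure (distr (p X j) M T) V"
        unfolding p_def l_def T_def M_def using block_law_affine[OF b_pos, of d "vec_index \<mu>" a "block_of (2 * b) X j" V] by simp
      also have "\<dots> = emeasure (p X j) (U V)"
      proof (subst emeasure_distr[OF _ V])
        show "T \<in> p X j \<rightarrow>\<^sub>M M" using Tl by (simp add: p_def block_law_def M_def cong: measurable_cong_sets)
        show "emeasure (p X j) (T -` V \<inter> space (p X j)) = emeasure (p X j) (U V)" by (simp add: U_def p_def block_law_def M_def)
      qed
      finally show ?thesis by (simp add: measure_def)
    qed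
    have bm: "(\<lambda>X. block_of l X j) \<in> stdmat n d \<rightarrow>\<^sub>M stdmat l d" if "j < k" for j
      unfolding n_def by (rule block_of_measurable[OF that])
    have pm: "(\<lambda>X. measure (block_law b d X) (U S)) \<in> borel_measurable (stdmat l d)"
    proof -
      have "(\<lambda>X. measure (block_law b d X) (U S)) \<in> borel_measurable (PiM {..<l} (\<lambda>_. M))"
        unfolding M_def l_def by (rule measurable_compose[OF block_law_measurable measurable_measure_prob_algebra]) (use Um[OF S] in \<open>simp add: M_def\<close>)
      moreover have "sets (stdmat l d) = sets (PiM {..<l} (\<lambda>_. M))" by (intro sets_PiM_cong refl sM)
      ultimately show ?thesis using measurable_cong_sets[of "stdmat l d" "PiM {..<l} (\<lambda>_. M)" borel borel] by blast
    qed
    have p1: "measure (p X j) V \<le> 1" for X j V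
      using block_law_prob[of b d "block_of l X j"] by (auto simp: p_def space_prob_algebra intro: prob_space.prob_le_1)
    have pS: "(\<integral>X. measure (p X j) (U S) \<partial>stdmat n d) = measure D S" if j: "j < k" for j
    proof -
      have "(\<integral>X. measure (p X j) (U S) \<partial>stdmat n d) = (\<integral>X. measure (block_law b d X) (U S) \<partial>distr (stdmat n d) (stdmat l d) (\<lambda>X. block_of l X j))"
        unfolding p_def by (rule integral_distr[symmetric, OF bm[OF j] pm])
      also have "distr (stdmat n d) (stdmat l d) (\<lambda>X. block_of l X j) = stdmat l d"
        unfolding n_def by (rule distr_block_of[OF prob_space_stdg j])
      also have "(\<integral>X. measure (block_law b d X) (U S) \<partial>stdmat l d) = enn2real (\<integral>\<^sup>+X. ennreal (measure (block_law b d X) (U S)) \<partial>stdmat l d)"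
        by (rule integral_eq_nn_integral[OF pm]) simp
      also have "(\<integral>\<^sup>+X. ennreal (measure (block_law b d X) (U S)) \<partial>stdmat l d) = (\<integral>\<^sup>+X. emeasure (block_law b d X) (U S) \<partial>stdmat l d)"
      proof (rule nn_integral_cong)
        fix X
        interpret q: prob_space "block_law b d X" using block_law_prob[of b d X] by (simp add: space_prob_algebra)
        show "ennreal (measure (block_law b d X) (U S)) = emeasure (block_law b d X) (U S)" by (simp add: q.emeasure_eq_measure)
      qed
      also have "\<dots> = emeasure (stdg {..<d}) (U S)"
        unfolding l_def by (rule block_law_exact_std[OF b_pos]) (use Um[OF S] in \<open>simp add: M_def\<close>)
      also have "\<dots> = emeasure D S" unfolding DT U_def spM[symmetric] by (rule emeasure_distr[symmetric, OF Tm S])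
      finally show ?thesis by (simp add: measure_def)
    qed
    \<comment> \<open>F is what the sampler does on the data, G the uniform mean of the block laws.
      Both integrate to the probabilities to be compared.\<close>
    define F where "F X = measure (A (\<Phi> X)) S" for X
    define G where "G X = (\<Sum>j<k. measure (p X j) (U S)) / k" for X
    have Fm: "F \<in> borel_measurable (stdmat n d)" unfolding F_def[abs_def]
      by (rule measurable_compose[OF \<Phi>m measurable_compose[OF Am measurable_measure_prob_algebra[OF S]]])
    have pjm: "(\<lambda>X. measure (p X j) (U S)) \<in> borel_measurable (stdmat n d)" if "j < k" for j
      unfolding p_def by (rule measurable_compose[OF bm[OF that] pm])
    have pji: "integrable (stdmat n d) (\<lambda>X. measure (p X j) (U S))" if "j < k" for j
      by (rule N.integrable_const_bound[of _ 1]) (use p1 pjm[OF that] in auto)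
    have A1: "0 \<le> F X \<and> F X \<le> 1" if "X \<in> space (stdmat n d)" for X
    proof -
      have "A (\<Phi> X) \<in> space (prob_algebra M)" using measurable_space[OF Am measurable_space[OF \<Phi>m that]] .
      then show ?thesis by (auto simp: F_def space_prob_algebra intro: prob_space.prob_le_1)
    qed
    have Fi: "integrable (stdmat n d) F"
      by (rule N.integrable_const_bound[of _ 1]) (use A1 Fm in auto)
    have Gi: "integrable (stdmat n d) G" unfolding G_def by (intro integrable_divide Bochner_Integration.integrable_sum pji) simp
    have "(\<integral>X. G X \<partial>stdmat n d) = (\<Sum>j<k. (\<integral>X. measure (p X j) (U S) \<partial>stdmat n d)) / k"
      unfolding G_def using pji by (simp add: integral_divide_zero integral_sum)
    also have "\<dots> = measure D S" using pS k by simp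
    finally have intG: "(\<integral>X. G X \<partial>stdmat n d) = measure D S" .
    have G1: "0 \<le> G X" "G X \<le> 1" for X
    proof -
      have "(\<Sum>j<k. measure (p X j) (U S)) \<le> (\<Sum>j<k. 1)" using p1 by (intro sum_mono)
      then show "G X \<le> 1" using k by (simp add: G_def divide_le_eq_1)
      show "0 \<le> G X" unfolding G_def by (intro divide_nonneg_nonneg sum_nonneg) auto
    qed
    define C where "C j = (\<lambda>X. block_of l X j) -` (space (stdmat l d) - good_block \<tau>) \<inter> space (stdmat n d)" for j
    have gm: "space (stdmat l d) - good_block \<tau> \<in> sets (stdmat l d)" using good_block_sets unfolding l_def by (intro sets.compl_sets)
    have Cm: "C j \<in> sets (stdmat n d)" if "j < k" for j unfolding C_def by (rule measurable_sets[OF bm[OF that] gm])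
    have Cp: "measure (stdmat n d) (C j) \<le> 21 * (real d)\<^sup>2 * exp (- L / 8) / \<tau>" if j: "j < k" for j
    proof -
      have "emeasure (stdmat n d) (C j) = emeasure (distr (stdmat n d) (stdmat l d) (\<lambda>X. block_of l X j)) (space (stdmat l d) - good_block \<tau>)"
        unfolding C_def by (rule emeasure_distr[symmetric, OF bm[OF j] gm])
      also have "distr (stdmat n d) (stdmat l d) (\<lambda>X. block_of l X j) = stdmat l d"
        unfolding n_def by (rule distr_block_of[OF prob_space_stdg j])
      also have "emeasure (stdmat l d) (space (stdmat l d) - good_block \<tau>) \<le> ennreal (21 * (real d)\<^sup>2 * exp (- L / 8) / \<tau>)"
        unfolding l_def by (rule good_block_prob) (use t in auto)
      finally show ?thesis unfolding N.emeasure_eq_measure using t by (subst (asm) ennreal_le_iff) auto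
    qed
    define Bad where "Bad = (\<Union>j<k. C j)"
    have Badm: "Bad \<in> sets (stdmat n d)" unfolding Bad_def using Cm by (intro sets.finite_UN) auto
    have Badp: "measure (stdmat n d) Bad \<le> \<alpha> / 2"
    proof -
      have "measure (stdmat n d) Bad \<le> (\<Sum>j<k. measure (stdmat n d) (C j))"
        unfolding Bad_def using Cm by (intro measure_UNION_le) auto
      also have "\<dots> \<le> (\<Sum>j<k. 21 * (real d)\<^sup>2 * exp (- L / 8) / \<tau>)" using Cp by (intro sum_mono) auto
      also have "\<dots> \<le> \<alpha> / 2" using err(2) by simp
      finally show ?thesis .
    qed
    have FG: "\<bar>F X - G X\<bar> \<le> \<alpha> / 2 + indicator Bad X" if X: "X \<in> space (stdmat n d)" for X
    proof (cases "X \<in> Bad")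
      case True
      have "0 \<le> \<alpha> / 2" using err(1) exp_ge_zero order_trans by blast
      then show ?thesis using A1[OF X] G1[of X] True by (simp add: abs_le_iff)
    next
      case False
      have good: "block_of l X j \<in> good_block \<tau>" if "j < k" for j
        using False X that measurable_space[OF bm[OF that] X] by (auto simp: Bad_def C_def)
      \<comment> \<open>A preimage under T need not be a test set, but for typical blocks the
        inequality holds on every measurable set, so it transfers to the transformed data.\<close>
      have cl: "measure (p (\<Phi> X) i) V \<le> K * measure (p (\<Phi> X) j) V + \<sigma>" if "i < k" "j < k" "V \<in> sets M" for i j V
        unfolding pT[OF that(1,3)] pT[OF that(2,3)] unfolding p_def K_def \<sigma>_def
        by (rule good_block_compatible[OF good[OF that(1)] good[OF that(2)] t]) (use Um[OF that(3)] in \<open>simp add: M_def\<close>)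
      have tsub: "test_sets M B \<subseteq> sets M" unfolding M_def by (rule test_sets_sets[OF B])
      have "\<bar>F X - (\<Sum>j<k. measure (p (\<Phi> X) j) S) / k\<bar> \<le> exp (- (\<epsilon> * k / 48))"
        unfolding F_def A_def gauss_sampler_def p_def l_def
      proof (rule agg_full[where M = "lborel_dim d" and P = "\<lambda>j. block_law b d (block_of (2 * b) (\<Phi> X) j)", OF k])
        show "S \<in> sets (lborel_dim d)" using S by (simp add: M_def)
        show "compatible (test_sets (lborel_dim d) B) K \<sigma> (block_law b d (block_of (2 * b) (\<Phi> X) i)) (block_law b d (block_of (2 * b) (\<Phi> X) j))"
          if "i < k" "j < k" for i j
          using cl[OF that] cl[OF that(2,1)] tsub unfolding compatible_def p_def l_def M_def by blast
      qed (rule block_law_prob origin_law)+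
      moreover have "(\<Sum>j<k. measure (p (\<Phi> X) j) S) / k = G X" unfolding G_def using pT[OF _ S] by simp
      ultimately show ?thesis using err(1) False by simp
    qed
    have ii: "integrable (stdmat n d) (\<lambda>X. \<alpha> / 2 + indicator Bad X :: real)"
      using Badm by (intro Bochner_Integration.integrable_add N.integrable_const integrable_real_indicator) (auto simp: N.emeasure_eq_measure)
    have "\<bar>(\<integral>X. F X \<partial>stdmat n d) - (\<integral>X. G X \<partial>stdmat n d)\<bar> = \<bar>\<integral>X. F X - G X \<partial>stdmat n d\<bar>"
      by (simp add: Bochner_Integration.integral_diff[OF Fi Gi])
    also have "\<dots> \<le> (\<integral>X. \<bar>F X - G X\<bar> \<partial>stdmat n d)" by (rule integral_abs_bound)
    also have "\<dots> \<le> (\<integral>X. \<alpha> / 2 + indicator Bad X \<partial>stdmat n d)"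
      by (rule integral_mono[OF _ ii FG]) (intro integrable_abs Bochner_Integration.integrable_diff Fi Gi)
    also have "\<dots> = \<alpha> / 2 + measure (stdmat n d) Bad"
      using Badm by (subst Bochner_Integration.integral_add) (auto simp: N.prob_space N.emeasure_eq_measure)
    also have "\<dots> \<le> \<alpha>" using Badp by simp
    finally show ?thesis unfolding out[OF S] intG F_def by (simp add: abs_minus_commute)
  qed
  then have "tv_dist D (output_dist n A D) \<le> \<alpha>"
    unfolding tv_dist_def by (intro cSUP_least) auto
  then show "tv_dist D (output_dist (k * (2 * b)) (gauss_sampler d b k \<epsilon> (16 * exp 12) (1000 * (4 * exp 6 + 1) * \<tau>) B) D) \<le> \<alpha>"
    unfolding n_def l_def A_def K_def \<sigma>_def .
qed

end

section \<open>Choice of the parameters\<close>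

theorem theorem6:
  shows "\<exists>(C :: real) (p :: real poly). \<forall>(d :: nat) (\<epsilon> :: real) (\<delta> :: real) (\<alpha> :: real).
    1 \<le> d \<and> \<epsilon> \<in> {0<..1} \<and> \<delta> \<in> {0<..1/2} \<and> \<alpha> \<in> {0<..1/2} \<longrightarrow>
    (\<exists>(n :: nat) A.
       real n \<le> C * ((real d)\<^sup>2 / \<epsilon> * poly p (ln (real d / (\<alpha> * \<epsilon> * \<delta>)))) \<and>
       sampler (lborel_dim d) n A \<and>
       differentially_private \<epsilon> \<delta> (lborel_dim d) n A \<and>
       accurate \<alpha> (gaussians d) n A)"
proof -
  define K where "K = 16 * exp (12::real)"
  define C1 where "C1 = 48 * (1 + K\<^sup>2)"
  \<comment> \<open>Q collects the factor between \<tau> and the additive privacy loss 2 (K + 1)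
    \<sigma>; with \<tau> = exp (- x) / Q that loss becomes exp (- x) \<le> \<delta>.\<close>
  define Q where "Q = 2 * (K + 1) * (1000 * (4 * exp 6 + 1))"
  \<comment> \<open>84 is twice 42 = 2 * 21, with 21 from the probability of an untypical block and
    2 from rounding k up; then the union bound over the blocks comes out as exp (- x) / 2.\<close>
  define H where "H = 84 * C1 * Q"
  \<comment> \<open>The union bound spends six powers of exp (- x): one on x, one on 1 / \<epsilon>,
    two on d^2, one on 1 / \<tau>, and one remains for \<alpha>. The constants are absorbed by ln
    H.\<close>
  define q where "q = 6 + ln H"
  have K1: "K \<ge> 1" unfolding K_def using one_le_exp_iff[of "12::real"] by linarith
  have C1: "C1 \<ge> 96" using one_le_power[OF K1, of 2] by (simp add: C1_def)
  have Q: "Q \<ge> 1000"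
  proof -
    have "1 * 1000 \<le> (2 * (K + 1)) * (1000 * (4 * exp 6 + 1))" using K1 by (intro mult_mono) (auto simp: add_nonneg_nonneg)
    then show ?thesis by (simp add: Q_def)
  qed
  have CQ: "1 * Q \<le> C1 * Q" using C1 Q by (intro mult_right_mono) auto
  have "H = 84 * (C1 * Q)" by (simp add: H_def)
  then have H: "H \<ge> 2 * Q" "H \<ge> 1" using CQ Q by linarith+
  have q6: "q \<ge> 6" using H by (simp add: q_def)
  show ?thesis
  \<comment> \<open>The degree 4 is one power of x from the number k of blocks and three from L^3 in
    the block size. The constant is the product of k \<le> 2 C1 x / \<epsilon> and 2 b \<le> 12 d^2
    L^3.\<close>
  proof (rule exI[of _ "24 * C1 * (16 * q) ^ 3"], rule exI[of _ "monom 1 4"], intro allI impI)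
    fix d :: nat and \<epsilon> \<delta> \<alpha> :: real
    assume "1 \<le> d \<and> \<epsilon> \<in> {0<..1} \<and> \<delta> \<in> {0<..1/2} \<and> \<alpha> \<in> {0<..1/2}"
    then have d: "d \<ge> 1" "real d \<ge> 1" and e: "0 < \<epsilon>" "\<epsilon> \<le> 1" and dl: "0 < \<delta>" "\<delta> \<le> 1/2" and al: "0 < \<alpha>" "\<alpha> \<le> 1/2" by auto
    define x where "x = ln (real d / (\<alpha> * \<epsilon> * \<delta>))"
    have pos: "0 < \<alpha> * \<epsilon> * \<delta>" using al e dl by simp
    have ex: "exp x = real d / (\<alpha> * \<epsilon> * \<delta>)" using pos d by (simp add: x_def)
    have exx: "exp x * (\<alpha> * \<epsilon> * \<delta>) = real d"
      using ex pos nonzero_eq_divide_eq[of "\<alpha> * \<epsilon> * \<delta>" "exp x" "real d"] by auto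
    have ae: "\<alpha> * \<epsilon> \<le> 1/2" "\<alpha> * \<epsilon> > 0" using mult_mono[of \<alpha> "1/2" \<epsilon> 1] al e by auto
    have "\<alpha> * \<epsilon> * \<delta> \<le> 1/2 * (1/2)" using ae dl by (intro mult_mono) auto
    then have aed4: "\<alpha> * \<epsilon> * \<delta> \<le> 1/4" by simp
    have x4: "exp x \<ge> 4 * real d"
    proof -
      have "real d = exp x * (\<alpha> * \<epsilon> * \<delta>)" using exx by simp
      also have "\<dots> \<le> exp x * (1/4)" using aed4 by (intro mult_left_mono) auto
      finally show ?thesis by simp
    qed
    then have x1: "x \<ge> 1"
    proof -
      have "exp 1 \<le> exp x" using exp_le x4 d by linarith
      then show ?thesis by simp
    qed
    have inv: "exp (- x) \<le> y" if y: "y > 0" "\<alpha> * \<epsilon> * \<delta> \<le> y" for y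
    proof -
      have "1 \<le> exp x * (\<alpha> * \<epsilon> * \<delta>)" using exx d by simp
      also have "\<dots> \<le> exp x * y" using y by (intro mult_left_mono) auto
      finally have "exp (- x) * 1 \<le> exp (- x) * (exp x * y)" by (intro mult_left_mono) auto
      then show ?thesis by (simp add: mult.assoc[symmetric] mult_exp_exp)
    qed
    \<comment> \<open>All of \<alpha>, \<epsilon> and \<delta> lie above exp (- x), and so does 1 /
      d, so one logarithm serves for every parameter.\<close>
    have xa: "exp (- x) \<le> \<alpha>" and xe: "exp (- x) \<le> \<epsilon>" and xd: "exp (- x) \<le> \<delta>"
    proof -
      have "\<alpha> * \<epsilon> * \<delta> \<le> \<alpha> * 1 * 1" using al e dl by (intro mult_mono) auto
      then show "exp (- x) \<le> \<alpha>" using inv al by simp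
      have "\<alpha> * \<epsilon> * \<delta> \<le> 1 * \<epsilon> * 1" using al e dl by (intro mult_mono) auto
      then show "exp (- x) \<le> \<epsilon>" using inv e by simp
      have "\<alpha> * \<epsilon> * \<delta> \<le> 1 * 1 * \<delta>" using al e dl by (intro mult_mono) auto
      then show "exp (- x) \<le> \<delta>" using inv dl by simp
    qed
    have xm4: "exp (- x) \<le> 1/4" by (rule inv[OF _ aed4]) simp
    define k where "k = nat \<lceil>C1 * x / \<epsilon>\<rceil>"
    have Cx: "C1 * x \<ge> 96" using mult_mono[of 96 C1 1 x] C1 x1 by simp
    have Cxe: "C1 * x / \<epsilon> \<ge> 1"
    proof -
      have "\<epsilon> \<le> C1 * x" using Cx e by linarith
      then show ?thesis using e by (simp add: le_divide_eq)
    qed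
    have kl: "real k \<ge> C1 * x / \<epsilon>" unfolding k_def by (rule real_nat_ceiling_ge)
    have ku: "real k \<le> 2 * (C1 * x / \<epsilon>)"
    proof -
      have "real k \<le> C1 * x / \<epsilon> + 1" unfolding k_def using Cxe by linarith
      then show ?thesis using Cxe by linarith
    qed
    have k0: "k > 0" using kl Cxe by linarith
    have ka: "real k \<ge> 48 * (1 + K\<^sup>2) / \<epsilon>"
    proof -
      have "C1 / \<epsilon> \<le> C1 * x / \<epsilon>" using C1 x1 e by (intro divide_right_mono) auto
      then show ?thesis using kl unfolding C1_def by linarith
    qed
    \<comment> \<open>C1 \<ge> 96 gives twice x: one factor exp (- x) goes below \<alpha> or
      \<delta>, the other, at most 1/4, takes care of the constants.\<close>
    have ek: "exp (- (\<epsilon> * k / 48)) \<le> exp (- x) * exp (- x)"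
    proof -
      have "C1 * x \<le> \<epsilon> * k" using kl e by (simp add: divide_le_eq mult.commute)
      moreover have "96 * x \<le> C1 * x" using C1 x1 by (intro mult_right_mono) auto
      ultimately have "x + x \<le> \<epsilon> * k / 48" by simp
      then show ?thesis by (simp add: mult_exp_exp)
    qed
    have kb1: "exp (1/4) * exp (- (\<epsilon> * k / 48)) \<le> \<delta>"
    proof -
      have "exp (1/4) \<le> exp (1::real)" by simp
      then have "exp (1/4) \<le> (4::real)" using exp_le by linarith
      then have "exp (1/4) * exp (- (\<epsilon> * k / 48)) \<le> 4 * (exp (- x) * exp (- x))" using ek by (intro mult_mono) auto
      also have "\<dots> \<le> 4 * (1/4 * exp (- x))" using xm4 by (intro mult_left_mono mult_right_mono) auto
      finally show ?thesis using xd by simp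
    qed
    have kb2: "exp (- (\<epsilon> * k / 48)) \<le> \<alpha> / 2"
    proof -
      have "exp (- x) * exp (- x) \<le> 1/4 * \<alpha>" using xm4 xa by (intro mult_mono) auto
      then show ?thesis using ek al by simp
    qed
    define \<tau> where "\<tau> = exp (- x) / Q"
    have t0: "\<tau> > 0" using Q by (simp add: \<tau>_def)
    have t1: "\<tau> \<le> 1/100"
    proof -
      have "\<tau> \<le> 1 / 100" unfolding \<tau>_def using Q x1 by (intro frac_le) auto
      then show ?thesis .
    qed
    have td: "2 * ((K + 1) * (1000 * (4 * exp 6 + 1) * \<tau>)) \<le> \<delta>"
    proof -
      have "2 * ((K + 1) * (1000 * (4 * exp 6 + 1) * \<tau>)) = Q * \<tau>" by (simp only: Q_def mult_ac)
      also have "\<dots> = exp (- x)" using Q by (simp add: \<tau>_def)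
      finally show ?thesis using xd by simp
    qed
    \<comment> \<open>Then exp (- L / 16) = exp (- q x), the weakest of the tails in use, and the
      other rates L / 8 and L / 4 are dominated by it.\<close>
    define L where "L = 16 * q * x"
    have L2: "L \<ge> 2" using mult_mono[of 6 q 1 x] q6 x1 by (simp add: L_def)
    have Lx: "exp (- L / 16) \<le> exp (- x) ^ 6 / H"
    proof -
      have "ln H * 1 \<le> ln H * x" using H x1 by (intro mult_left_mono) auto
      then have "6 * x + ln H \<le> q * x" by (simp add: q_def distrib_right)
      then have "exp (- L / 16) \<le> exp (- (6 * x) - ln H)" by (simp add: L_def)
      also have "\<dots> = exp (- x) ^ 6 / H" using H by (simp add: exp_diff exp_of_nat_mult[symmetric])
      finally show ?thesis .
    qed
    define y where "y = exp (- x)"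
    have y: "0 < y" "y \<le> 1" using x1 by (auto simp: y_def)
    have yx: "y * exp x = 1" by (simp add: y_def mult_exp_exp)
    have dy: "real d * y \<le> 1"
    proof -
      have "real d * y \<le> exp x * y" using x4 d y by (intro mult_right_mono) auto
      then show ?thesis using yx by (simp add: mult.commute)
    qed
    have y6: "y ^ 6 * real d \<le> y"
    proof -
      have "y ^ 6 * real d = (real d * y) * y ^ 5" by (simp add: eval_nat_numeral)
      also have "\<dots> \<le> 1 * y ^ 5" using dy y by (intro mult_right_mono) auto
      also have "\<dots> \<le> y" using y power_le_one[of y 4] by (simp add: eval_nat_numeral mult_left_le)
      finally show ?thesis .
    qed
    have t2: "2 * d * exp (- L / 16) \<le> \<tau>"
    proof -
      have "2 * d * exp (- L / 16) \<le> 2 * d * (y ^ 6 / H)" using Lx by (intro mult_left_mono) (auto simp: y_def)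
      also have "\<dots> = (y ^ 6 * real d) * (2 / H)" by simp
      also have "\<dots> \<le> y * (2 / (2 * Q))" using y6 y H Q by (intro mult_mono divide_left_mono) auto
      finally show ?thesis by (simp add: \<tau>_def y_def)
    qed
    have ke: "k * (21 * (real d)\<^sup>2 * exp (- L / 8) / \<tau>) \<le> \<alpha> / 2"
    proof -
      have xle: "x \<le> exp x" using exp_ge_add_one_self[of x] by linarith
      have "x * y \<le> 1" using mult_right_mono[OF xle, of y] y yx by (simp add: mult.commute)
      have ye: "y / \<epsilon> \<le> 1" using xe e by (simp add: y_def)
      have "exp (- L / 8) \<le> exp (- L / 16)" using L2 by simp
      also have "\<dots> \<le> y ^ 6 / H" using Lx by (simp add: y_def)
      finally have L8: "exp (- L / 8) \<le> y ^ 6 / H" .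
      \<comment> \<open>Each large factor is paired with a power of y = exp (- x): x with y, 1 /
        \<epsilon> with y, d^2 with y^2. The remaining y^2 is divided by \<tau> = y / Q.\<close>
      have "k * (21 * (real d)\<^sup>2 * exp (- L / 8) / \<tau>) \<le> (2 * (C1 * x / \<epsilon>)) * (21 * (real d)\<^sup>2 * (y ^ 6 / H) / \<tau>)"
        using ku L8 t0 Cxe by (intro mult_mono divide_right_mono mult_left_mono) auto
      also have "\<dots> = (x * y) * (y / \<epsilon>) * (real d * y)\<^sup>2 * (42 * C1 * y\<^sup>2 / (H * \<tau>))"
        by (simp add: power2_eq_square eval_nat_numeral)
      also have "\<dots> \<le> 1 * 1 * 1 * (42 * C1 * y\<^sup>2 / (H * \<tau>))"
        using \<open>x * y \<le> 1\<close> ye dy y x1 e C1 H t0 by (intro mult_right_mono mult_mono power_le_one) auto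
      also have "\<dots> = y / 2"
        using C1 Q y by (simp add: H_def \<tau>_def y_def[symmetric] power2_eq_square)
      also have "\<dots> \<le> \<alpha> / 2" using xa by (simp add: y_def)
      finally show ?thesis .
    qed
    \<comment> \<open>Half the required block size, since b exceeds 2 c; rounding up and the summand
      d are absorbed in b \<le> 6 d^2 L^3.\<close>
    define c where "c = nat \<lceil>2 * (real d)\<^sup>2 * L ^ 3\<rceil>"
    define b where "b = d + 2 * c"
    define Z where "Z = (real d)\<^sup>2 * L ^ 3"
    have Z: "Z \<ge> 2" "Z \<ge> real d"
    proof -
      have "2 ^ 3 \<le> L ^ 3" using L2 by (intro power_mono) auto
      then have L3: "L ^ 3 \<ge> 8" by simp
      have "real d * 1 \<le> real d * real d" using d by (intro mult_left_mono) auto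
      then have d2: "real d \<le> (real d)\<^sup>2" by (simp add: power2_eq_square)
      have "(real d)\<^sup>2 * 8 \<le> Z" unfolding Z_def using L3 by (intro mult_left_mono) auto
      then show "Z \<ge> 2" "Z \<ge> real d" using d2 d by linarith+
    qed
    have cl: "real c \<ge> 2 * Z" unfolding c_def Z_def mult.assoc by (rule real_nat_ceiling_ge)
    have cu: "real c \<le> 2 * Z + 1" unfolding c_def mult.assoc Z_def[symmetric] using Z by linarith
    have rb: "real b = real d + 2 * real c" by (simp add: b_def)
    interpret gaussian_block d c b L
    proof
      show "d \<ge> 1" by fact
      show "L \<ge> 2" by fact
      show "c \<ge> 1" using cl Z by linarith
      show "b = d + 2 * c" by (fact b_def)
      show "real b \<ge> 4 * (real d)\<^sup>2 * L ^ 3" using cl rb by (simp add: Z_def)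
    qed
    obtain B where B: "\<And>i::nat. B i \<in> sets (lborel_dim d)" and gen: "sets (lborel_dim d) = sigma_sets (space (lborel_dim d)) (range B)"
    proof (rule lborel_dim_generator[of d])
      fix B assume "\<And>i::nat. B i \<in> sets (lborel_dim d)" "sets (lborel_dim d) = sigma_sets (space (lborel_dim d)) (range B)"
      then show thesis by (rule that)
    qed
    define A where "A = gauss_sampler d b k \<epsilon> K (1000 * (4 * exp 6 + 1) * \<tau>) B"
    show "\<exists>n A. real n \<le> 24 * C1 * (16 * q) ^ 3 * ((real d)\<^sup>2 / \<epsilon> * poly (monom 1 4) (ln (real d / (\<alpha> * \<epsilon> * \<delta>)))) \<and>
       sampler (lborel_dim d) n A \<and> differentially_private \<epsilon> \<delta> (lborel_dim d) n A \<and> accurate \<alpha> (gaussians d) n A"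
    proof (rule exI[of _ "k * (2 * b)"], rule exI[of _ A], intro conjI)
      show "sampler (lborel_dim d) (k * (2 * b)) A"
        unfolding sampler_def A_def by (rule gauss_sampler_kernel[OF k0 B])
      show "differentially_private \<epsilon> \<delta> (lborel_dim d) (k * (2 * b)) A"
        unfolding A_def using K1 t0 by (intro gauss_sampler_private[OF B gen _ _ e ka kb1 td]) (auto intro!: mult_nonneg_nonneg add_nonneg_nonneg)
      show "accurate \<alpha> (gaussians d) (k * (2 * b)) A"
        unfolding A_def K_def by (rule gauss_sampler_accurate[OF t0 t1 t2 k0 B kb2 ke])
      have bZ: "2 * real b \<le> 12 * Z" using rb cu Z by linarith
      have "real (k * (2 * b)) = real k * (2 * real b)" by simp
      also have "\<dots> \<le> (2 * (C1 * x / \<epsilon>)) * (12 * Z)"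
        by (rule mult_mono[OF ku bZ]) (use Cxe in auto)
      also have "\<dots> = 24 * C1 * (16 * q) ^ 3 * ((real d)\<^sup>2 / \<epsilon> * x ^ 4)"
        by (simp add: Z_def L_def power_mult_distrib eval_nat_numeral)
      finally show "real (k * (2 * b)) \<le> 24 * C1 * (16 * q) ^ 3 * ((real d)\<^sup>2 / \<epsilon> * poly (monom 1 4) (ln (real d / (\<alpha> * \<epsilon> * \<delta>))))"
        by (simp add: poly_monom x_def)
    qed
  qed
qed

end
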